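(* Let $G$ be a Lie group with Lie algebra $\mathfrak g$ equipped with a bi-invariant nondegenerate quadratic form $(\cdot,\cdot)_{\mathfrak g}$, and let $M$ be a $\mathfrak g$-manifold with infinitesimal action $\rho_M:\mathfrak g\to\mathcal X(M)$, equipped with an arbitrary bivector field $\pi\in\mathcal X^2(M)$. Consider the vector bundle $T^*M\oplus\mathfrak g\to M$ (with $\mathfrak g$ the trivial bundle), the bundle map $r:T^*M\oplus\mathfrak g\to TM$, $r(\alpha,v)=\pi^\sharp(\alpha)+\rho_M(v)$, and the bracket $[\cdot,\cdot]$ on its sections $\Omega^1(M)\oplus C^\infty(M,\mathfrak g)$ defined in the context. The following are equivalent: (i) $(M,\pi)$ is a quasi-Poisson $\mathfrak g$-manifold; (ii) $r:\Omega^1(M)\oplus C^\infty(M,\mathfrak g)\to\mathcal X(M)$ preserves brackets; (iii) the bracket $[\cdot,\cdot]$ on $\Omega^1(M)\oplus C^\infty(M,\mathfrak g)$ satisfies the Jacobi identity; (iv) $(T^*M\oplus\mathfrak g,r,[\cdot,\cdot])$ is a Lie algebroid over $M$.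
   Context: Conventions. $\mathfrak g$ is identified with the right-invariant vector fields on $G$ (so the bracket of $\mathfrak g$ is that of right-invariant vector fields). A $\mathfrak g$-manifold is a manifold $M$ with a Lie algebra homomorphism $\rho_M:\mathfrak g\to\mathcal X(M)$; the same symbol denotes the induced bundle map $M\times\mathfrak g\to TM$ and the induced maps of exterior algebras; $\rho_M^*:T^*M\to\mathfrak g^*$ is the dual. For $u\in\mathfrak g$, $u^\vee\in\mathfrak g^*$ is its dual via $(\cdot,\cdot)_{\mathfrak g}$. The trivector $\chi_G\in\Lambda^3\mathfrak g$ is defined by $\chi_G(u^\vee,v^\vee,w^\vee)=\tfrac12(u,[v,w])_{\mathfrak g}$. For a bivector field $\pi$: $\pi^\sharp:T^*M\to TM$, $\beta(\pi^\sharp(\alpha))=\pi(\alpha,\beta)$; $\chi_\pi=[\pi,\pi]\in\mathcal X^3(M)$ (Schouten bracket), i.e. with $\{f,g\}=\pi(df,dg)$, $\tfrac12\chi_\pi(df,dg,dh)=\{f,\{g,h\}\}+\{g,\{h,f\}\}+\{h,\{f,g\}\}$. The bracket on 1-forms induced by $\pi$ is $[\alpha,\beta]=\mathcal L_{\pi^\sharp(\alpha)}\beta-\mathcal L_{\pi^\sharp(\beta)}\alpha-d\,\pi(\alpha,\beta)$. Contractions: $i_{\alpha\wedge\beta}\chi=\chi(\alpha,\beta,\cdot)$. A quasi-Poisson $\mathfrak g$-manifold is a $\mathfrak g$-manifold $M$ with a $\mathfrak g$-invariant bivector field $\pi$ satisfying $\chi_\pi=\rho_M(\chi_G)$. The bracket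 on $\Gamma(T^*M\oplus\mathfrak g)=\Omega^1(M)\oplus C^\infty(M,\mathfrak g)$ is the skew-symmetric bracket given, for $\alpha,\beta\in\Omega^1(M)$ and $v,v'\in\mathfrak g$ (viewed as constant sections), by $[(\alpha,0),(\beta,0)]=([\alpha,\beta],\tfrac12 i_{\rho_M^*(\alpha\wedge\beta)}(\chi_G))$, $[(0,v),(0,v')]=(0,[v,v'])$, $[(0,v),(\alpha,0)]=(\mathcal L_{\rho_M(v)}(\alpha),0)$, and extended to general sections by the Leibniz identity $[\xi,f\xi']=f[\xi,\xi']+\mathcal L_{r(\xi)}(f)\,\xi'$, $f\in C^\infty(M)$. A Lie algebroid is a vector bundle $A\to M$ with a Lie bracket on $\Gamma(A)$ and a bundle map (anchor) $\rho:A\to TM$ satisfying $[\xi,f\xi']=f[\xi,\xi']+\mathcal L_{\rho(\xi)}(f)\xi'$. *)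

theory Defs
  imports "HOL-Analysis.Analysis" "HOL-Library.Function_Algebras"
begin

section \<open>Pointwise vector space structure on functions\<close>

instantiation "fun" :: (type, scaleR) scaleR
begin
definition scaleR_fun :: "real \<Rightarrow> ('a \<Rightarrow> 'b) \<Rightarrow> 'a \<Rightarrow> 'b"
  where "scaleR_fun c f = (\<lambda>x. c *\<^sub>R f x)"
instance ..
end

instance "fun" :: (type, real_vector) real_vector
  by standard (simp_all add: scaleR_fun_def fun_eq_iff scaleR_add_right scaleR_add_left)

definition linear_on :: "'v::real_vector set \<Rightarrow> ('v \<Rightarrow> 'w::real_vector) \<Rightarrow> bool"
  where "linear_on V f \<longleftrightarrow>
    (\<forall>x\<in>V. \<forall>y\<in>V. f (x + y) = f x + f y) \<and> (\<forall>c. \<forall>x\<in>V. f (c *\<^sub>R x) = c *\<^sub>R f x)"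

text \<open>
  Vector spaces are subspaces \<open>V\<close> of ambient types. Functionals, multilinear forms and brackets
  are total functions, made unique by requiring the value 0 outside their domain.
\<close>

definition dual :: "'v::real_vector set \<Rightarrow> ('v \<Rightarrow> real) set"
  where "dual V = {a. linear_on V a \<and> (\<forall>x. x \<notin> V \<longrightarrow> a x = 0)}"

text \<open>The vector of \<open>V\<close> (finite dimensional) that corresponds to an element of the bidual.\<close>

definition bidual_elem :: "'v::real_vector set \<Rightarrow> (('v \<Rightarrow> real) \<Rightarrow> real) \<Rightarrow> 'v"
  where "bidual_elem V F = (THE x. x \<in> V \<and> (\<forall>b\<in>dual V. b x = F b))"

text \<open>
  Elements of the second and third exterior power of \<open>V\<close>, as alternating multilinear forms
  on the dual of \<open>V\<close>.
\<close>

definition ext_power2 :: "'v::real_vector set \<Rightarrow> (('v \<Rightarrow> real) \<Rightarrow> ('v \<Rightarrow> real) \<Rightarrow> real) set"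
  where "ext_power2 V = {P.
    (\<forall>a\<in>dual V. linear_on (dual V) (P a) \<and> linear_on (dual V) (\<lambda>b. P b a) \<and> P a a = 0) \<and>
    (\<forall>a b. a \<notin> dual V \<or> b \<notin> dual V \<longrightarrow> P a b = 0)}"

definition ext_power3 ::
    "'v::real_vector set \<Rightarrow> (('v \<Rightarrow> real) \<Rightarrow> ('v \<Rightarrow> real) \<Rightarrow> ('v \<Rightarrow> real) \<Rightarrow> real) set"
  where "ext_power3 V = {P.
    (\<forall>a\<in>dual V. \<forall>b\<in>dual V.
       linear_on (dual V) (\<lambda>c. P c a b) \<and> linear_on (dual V) (\<lambda>c. P a c b) \<and>
       linear_on (dual V) (\<lambda>c. P a b c) \<and>
       P a a b = 0 \<and> P a b b = 0 \<and> P a b a = 0) \<and>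
    (\<forall>a b c. a \<notin> dual V \<or> b \<notin> dual V \<or> c \<notin> dual V \<longrightarrow> P a b c = 0)}"


section \<open>Smooth manifolds\<close>

primrec C_k_on :: "nat \<Rightarrow> 'e::real_normed_vector set \<Rightarrow> ('e \<Rightarrow> 'f::real_normed_vector) \<Rightarrow> bool"
  where
    "C_k_on 0 S f \<longleftrightarrow> continuous_on S f"
  | "C_k_on (Suc k) S f \<longleftrightarrow> (\<forall>x\<in>S. f differentiable (at x)) \<and>
       (\<forall>v. C_k_on k S (\<lambda>x. frechet_derivative f (at x) v))"

text \<open>For open \<open>S\<close>.\<close>

definition smooth_on :: "'e::real_normed_vector set \<Rightarrow> ('e \<Rightarrow> 'f::real_normed_vector) \<Rightarrow> bool"
  where "smooth_on S f \<longleftrightarrow> (\<forall>k. C_k_on k S f)"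

text \<open>A chart is a pair \<open>(U, \<phi>)\<close>; only the values of \<open>\<phi>\<close> on \<open>U\<close> matter.\<close>

type_synonym ('m, 'e) atlas = "('m set \<times> ('m \<Rightarrow> 'e)) set"

text \<open>
  The manifold is the whole (Hausdorff, second countable) type \<open>'m\<close>. The model space \<open>'e\<close> is an
  arbitrary finite dimensional inner product space; the class \<open>real_inner\<close> is used rather than
  \<open>euclidean_space\<close> because the latter excludes dimension 0.
\<close>

definition smooth_manifold ::
    "('m::{t2_space,second_countable_topology}, 'e::real_inner) atlas \<Rightarrow> bool"
  where "smooth_manifold A \<longleftrightarrow>
    (\<exists>b::'e set. finite b \<and> span b = UNIV) \<and>
    \<Union>(fst ` A) = UNIV \<and>
    (\<forall>(U, \<phi>)\<in>A. open U \<and> open (\<phi> ` U) \<and> homeomorphism U (\<phi> ` U) \<phi> (inv_into U \<phi>)) \<and>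
    (\<forall>(U, \<phi>)\<in>A. \<forall>(V, \<psi>)\<in>A. smooth_on (\<phi> ` (U \<inter> V)) (\<psi> \<circ> inv_into U \<phi>))"

definition smooth_fun_on :: "('m, 'e::real_inner) atlas \<Rightarrow> 'm set \<Rightarrow> ('m \<Rightarrow> real) \<Rightarrow> bool"
  where "smooth_fun_on A W f \<longleftrightarrow>
    (\<forall>(U, \<phi>)\<in>A. smooth_on (\<phi> ` (U \<inter> W)) (f \<circ> inv_into U \<phi>))"

definition smooth_funs :: "('m, 'e::real_inner) atlas \<Rightarrow> ('m \<Rightarrow> real) set"
  where "smooth_funs A = {f. smooth_fun_on A UNIV f}"

definition smooth_map :: "('m::topological_space, 'e::real_inner) atlas \<Rightarrow>
    ('n::topological_space, 'f::real_inner) atlas \<Rightarrow> ('m \<Rightarrow> 'n) \<Rightarrow> bool"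
  where "smooth_map A B F \<longleftrightarrow> continuous_on UNIV F \<and>
    (\<forall>(U, \<phi>)\<in>A. \<forall>(V, \<psi>)\<in>B. smooth_on (\<phi> ` (U \<inter> F -` V)) (\<psi> \<circ> F \<circ> inv_into U \<phi>))"

definition prod_atlas :: "('m, 'e) atlas \<Rightarrow> ('n, 'f) atlas \<Rightarrow> ('m \<times> 'n, 'e \<times> 'f) atlas"
  where "prod_atlas A B = (\<lambda>((U, \<phi>), (V, \<psi>)). (U \<times> V, map_prod \<phi> \<psi>)) ` (A \<times> B)"


section \<open>Vector fields, forms and multivector fields\<close>

type_synonym 'm tvec = "('m \<Rightarrow> real) \<Rightarrow> real"
type_synonym 'm covec = "'m tvec \<Rightarrow> real"
type_synonym 'm vfield = "'m \<Rightarrow> 'm tvec"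
type_synonym 'm form = "'m \<Rightarrow> 'm covec"
type_synonym 'm bivec = "'m \<Rightarrow> 'm covec \<Rightarrow> 'm covec \<Rightarrow> real"
type_synonym 'm trivec = "'m \<Rightarrow> 'm covec \<Rightarrow> 'm covec \<Rightarrow> 'm covec \<Rightarrow> real"

text \<open>Tangent vectors at \<open>p\<close> are the derivations at \<open>p\<close> of the algebra of smooth functions.\<close>

definition tangent :: "('m, 'e::real_inner) atlas \<Rightarrow> 'm \<Rightarrow> 'm tvec set"
  where "tangent A p = {D. linear_on (smooth_funs A) D \<and>
    (\<forall>f\<in>smooth_funs A. \<forall>g\<in>smooth_funs A. D (\<lambda>q. f q * g q) = D f * g p + f p * D g) \<and>
    (\<forall>f. f \<notin> smooth_funs A \<longrightarrow> D f = 0)}"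

definition vector_fields :: "('m, 'e::real_inner) atlas \<Rightarrow> 'm vfield set"
  where "vector_fields A = {X. (\<forall>p. X p \<in> tangent A p) \<and>
    (\<forall>f\<in>smooth_funs A. (\<lambda>p. X p f) \<in> smooth_funs A)}"

definition vf_bracket :: "'m vfield \<Rightarrow> 'm vfield \<Rightarrow> 'm vfield"
  where "vf_bracket X Y = (\<lambda>p f. X p (\<lambda>q. Y q f) - Y p (\<lambda>q. X q f))"

text \<open>For a diffeomorphism \<open>F\<close>.\<close>

definition pushforward :: "('m \<Rightarrow> 'm) \<Rightarrow> 'm vfield \<Rightarrow> 'm vfield"
  where "pushforward F X = (\<lambda>q f. X (the_inv F q) (f \<circ> F))"

abbreviation cotangent :: "('m, 'e::real_inner) atlas \<Rightarrow> 'm \<Rightarrow> 'm covec set"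
  where "cotangent A p \<equiv> dual (tangent A p)"

definition one_forms :: "('m, 'e::real_inner) atlas \<Rightarrow> 'm form set"
  where "one_forms A = {\<alpha>. (\<forall>p. \<alpha> p \<in> cotangent A p) \<and>
    (\<forall>X\<in>vector_fields A. (\<lambda>p. \<alpha> p (X p)) \<in> smooth_funs A)}"

definition extd :: "('m, 'e::real_inner) atlas \<Rightarrow> ('m \<Rightarrow> real) \<Rightarrow> 'm form"
  where "extd A f = (\<lambda>p D. if D \<in> tangent A p then D f else 0)"

definition bivector_fields :: "('m, 'e::real_inner) atlas \<Rightarrow> 'm bivec set"
  where "bivector_fields A = {\<pi>. (\<forall>p. \<pi> p \<in> ext_power2 (tangent A p)) \<and>
    (\<forall>\<alpha>\<in>one_forms A. \<forall>\<beta>\<in>one_forms A. (\<lambda>p. \<pi> p (\<alpha> p) (\<beta> p)) \<in> smooth_funs A)}"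

definition trivector_fields :: "('m, 'e::real_inner) atlas \<Rightarrow> 'm trivec set"
  where "trivector_fields A = {\<tau>. (\<forall>p. \<tau> p \<in> ext_power3 (tangent A p)) \<and>
    (\<forall>\<alpha>\<in>one_forms A. \<forall>\<beta>\<in>one_forms A. \<forall>\<gamma>\<in>one_forms A.
       (\<lambda>p. \<tau> p (\<alpha> p) (\<beta> p) (\<gamma> p)) \<in> smooth_funs A)}"

text \<open>The Lie derivatives are given by the Leibniz rule:
  \<open>(L\<^sub>X \<alpha>)(Y) = X (\<alpha>(Y)) - \<alpha>([X, Y])\<close> and
  \<open>(L\<^sub>X \<pi>)(\<alpha>, \<beta>) = X (\<pi>(\<alpha>, \<beta>)) - \<pi>(L\<^sub>X \<alpha>, \<beta>) - \<pi>(\<alpha>, L\<^sub>X \<beta>)\<close>.\<close>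

definition lie_form :: "('m, 'e::real_inner) atlas \<Rightarrow> 'm vfield \<Rightarrow> 'm form \<Rightarrow> 'm form"
  where "lie_form A X \<alpha> = (THE \<omega>. \<omega> \<in> one_forms A \<and>
    (\<forall>Y\<in>vector_fields A. \<forall>p.
       \<omega> p (Y p) = X p (\<lambda>q. \<alpha> q (Y q)) - \<alpha> p (vf_bracket X Y p)))"

definition lie_bivec :: "('m, 'e::real_inner) atlas \<Rightarrow> 'm vfield \<Rightarrow> 'm bivec \<Rightarrow>
    'm form \<Rightarrow> 'm form \<Rightarrow> 'm \<Rightarrow> real"
  where "lie_bivec A X \<pi> \<alpha> \<beta> = (\<lambda>p. X p (\<lambda>q. \<pi> q (\<alpha> q) (\<beta> q))
    - \<pi> p (lie_form A X \<alpha> p) (\<beta> p) - \<pi> p (\<alpha> p) (lie_form A X \<beta> p))"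

text \<open>\<open>\<beta> (sharp A \<pi> p \<alpha>) = \<pi>(\<alpha>, \<beta>)\<close> for all covectors \<open>\<beta>\<close> at \<open>p\<close>.\<close>

definition sharp :: "('m, 'e::real_inner) atlas \<Rightarrow> 'm bivec \<Rightarrow> 'm \<Rightarrow> 'm covec \<Rightarrow> 'm tvec"
  where "sharp A \<pi> p a = bidual_elem (tangent A p) (\<pi> p a)"

definition form_bracket :: "('m, 'e::real_inner) atlas \<Rightarrow> 'm bivec \<Rightarrow> 'm form \<Rightarrow> 'm form \<Rightarrow> 'm form"
  where "form_bracket A \<pi> \<alpha> \<beta> =
    lie_form A (\<lambda>p. sharp A \<pi> p (\<alpha> p)) \<beta> - lie_form A (\<lambda>p. sharp A \<pi> p (\<beta> p)) \<alpha>
    - extd A (\<lambda>p. \<pi> p (\<alpha> p) (\<beta> p))"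

definition fun_bracket ::
    "('m, 'e::real_inner) atlas \<Rightarrow> 'm bivec \<Rightarrow> ('m \<Rightarrow> real) \<Rightarrow> ('m \<Rightarrow> real) \<Rightarrow> 'm \<Rightarrow> real"
  where "fun_bracket A \<pi> f g = (\<lambda>p. \<pi> p (extd A f p) (extd A g p))"

text \<open>The Schouten square \<open>[\<pi>, \<pi>]\<close>, in the normalisation where it is twice the Jacobiator.\<close>

definition schouten_square :: "('m, 'e::real_inner) atlas \<Rightarrow> 'm bivec \<Rightarrow> 'm trivec"
  where "schouten_square A \<pi> = (THE \<tau>. \<tau> \<in> trivector_fields A \<and>
    (\<forall>f\<in>smooth_funs A. \<forall>g\<in>smooth_funs A. \<forall>h\<in>smooth_funs A. \<forall>p.
       1/2 * \<tau> p (extd A f p) (extd A g p) (extd A h p) =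
         fun_bracket A \<pi> f (fun_bracket A \<pi> g h) p + fun_bracket A \<pi> g (fun_bracket A \<pi> h f) p
         + fun_bracket A \<pi> h (fun_bracket A \<pi> f g) p))"


section \<open>Lie groups with a bi-invariant form\<close>

definition lie_group :: "('g::{t2_space,second_countable_topology}, 'd::real_inner) atlas \<Rightarrow>
    ('g \<Rightarrow> 'g \<Rightarrow> 'g) \<Rightarrow> 'g \<Rightarrow> ('g \<Rightarrow> 'g) \<Rightarrow> bool"
  where "lie_group A m e i \<longleftrightarrow> smooth_manifold A \<and> group m e i \<and>
    smooth_map (prod_atlas A A) A (\<lambda>(x, y). m x y) \<and> smooth_map A A i"

text \<open>The right-invariant vector fields.\<close>

definition lie_algebra :: "('g, 'd::real_inner) atlas \<Rightarrow> ('g \<Rightarrow> 'g \<Rightarrow> 'g) \<Rightarrow> 'g vfield set"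
  where "lie_algebra A m = {X \<in> vector_fields A. \<forall>h. pushforward (\<lambda>x. m x h) X = X}"

text \<open>
  A bilinear form on the right-invariant vector fields is the same as a right-invariant field of
  bilinear forms on \<open>G\<close>. The last clause is invariance under left translations, which act on
  the right-invariant vector fields (this is the adjoint action).
\<close>

definition biinvariant_form ::
    "('g, 'd::real_inner) atlas \<Rightarrow> ('g \<Rightarrow> 'g \<Rightarrow> 'g) \<Rightarrow> ('g vfield \<Rightarrow> 'g vfield \<Rightarrow> real) \<Rightarrow> bool"
  where "biinvariant_form A m B \<longleftrightarrow>
    (\<forall>u\<in>lie_algebra A m. linear_on (lie_algebra A m) (B u)) \<and>
    (\<forall>u\<in>lie_algebra A m. \<forall>v\<in>lie_algebra A m. B u v = B v u) \<and>
    (\<forall>u\<in>lie_algebra A m. (\<forall>v\<in>lie_algebra A m. B u v = 0) \<longrightarrow> u = 0) \<and>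
    (\<forall>h. \<forall>u\<in>lie_algebra A m. \<forall>v\<in>lie_algebra A m.
       B (pushforward (m h) u) (pushforward (m h) v) = B u v)"

text \<open>From here on \<open>\<gg>\<close> is a Lie algebra of vector fields on \<open>G\<close>, with bracket \<open>vf_bracket\<close>.\<close>

definition flat :: "'g vfield set \<Rightarrow> ('g vfield \<Rightarrow> 'g vfield \<Rightarrow> real) \<Rightarrow> 'g vfield \<Rightarrow> ('g vfield \<Rightarrow> real)"
  where "flat \<gg> B u = (\<lambda>v. if v \<in> \<gg> then B u v else 0)"

definition chi_G :: "'g vfield set \<Rightarrow> ('g vfield \<Rightarrow> 'g vfield \<Rightarrow> real) \<Rightarrow>
    ('g vfield \<Rightarrow> real) \<Rightarrow> ('g vfield \<Rightarrow> real) \<Rightarrow> ('g vfield \<Rightarrow> real) \<Rightarrow> real"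
  where "chi_G \<gg> B = (THE \<tau>. \<tau> \<in> ext_power3 \<gg> \<and>
    (\<forall>u\<in>\<gg>. \<forall>v\<in>\<gg>. \<forall>w\<in>\<gg>. \<tau> (flat \<gg> B u) (flat \<gg> B v) (flat \<gg> B w) = 1/2 * B u (vf_bracket v w)))"


section \<open>Quasi-Poisson manifolds\<close>

definition g_manifold :: "('m::{t2_space,second_countable_topology}, 'e::real_inner) atlas \<Rightarrow>
    'g vfield set \<Rightarrow> ('g vfield \<Rightarrow> 'm vfield) \<Rightarrow> bool"
  where "g_manifold A \<gg> \<rho> \<longleftrightarrow> smooth_manifold A \<and> linear_on \<gg> \<rho> \<and> \<rho> ` \<gg> \<subseteq> vector_fields A \<and>
    (\<forall>u\<in>\<gg>. \<forall>v\<in>\<gg>. \<rho> (vf_bracket u v) = vf_bracket (\<rho> u) (\<rho> v))"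

text \<open>The dual \<open>\<rho>\<^sup>*\<close> of the action map, at the point \<open>p\<close>.\<close>

definition coaction ::
    "'g vfield set \<Rightarrow> ('g vfield \<Rightarrow> 'm vfield) \<Rightarrow> 'm \<Rightarrow> 'm covec \<Rightarrow> ('g vfield \<Rightarrow> real)"
  where "coaction \<gg> \<rho> p a = (\<lambda>v. if v \<in> \<gg> then a (\<rho> v p) else 0)"

text \<open>The trivector field \<open>\<rho>(\<tau>)\<close> induced by an element of the third exterior power of \<open>\<gg>\<close>.\<close>

definition push_trivector :: "('m, 'e::real_inner) atlas \<Rightarrow> 'g vfield set \<Rightarrow> ('g vfield \<Rightarrow> 'm vfield) \<Rightarrow>
    (('g vfield \<Rightarrow> real) \<Rightarrow> ('g vfield \<Rightarrow> real) \<Rightarrow> ('g vfield \<Rightarrow> real) \<Rightarrow> real) \<Rightarrow> 'm trivec"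
  where "push_trivector A \<gg> \<rho> \<tau> = (\<lambda>p a b c.
    if a \<in> cotangent A p \<and> b \<in> cotangent A p \<and> c \<in> cotangent A p
    then \<tau> (coaction \<gg> \<rho> p a) (coaction \<gg> \<rho> p b) (coaction \<gg> \<rho> p c) else 0)"

definition quasi_poisson :: "('m::{t2_space,second_countable_topology}, 'e::real_inner) atlas \<Rightarrow>
    'g vfield set \<Rightarrow> ('g vfield \<Rightarrow> 'g vfield \<Rightarrow> real) \<Rightarrow> ('g vfield \<Rightarrow> 'm vfield) \<Rightarrow> 'm bivec \<Rightarrow> bool"
  where "quasi_poisson A \<gg> B \<rho> \<pi> \<longleftrightarrow> g_manifold A \<gg> \<rho> \<and> \<pi> \<in> bivector_fields A \<and>
    (\<forall>v\<in>\<gg>. \<forall>\<alpha>\<in>one_forms A. \<forall>\<beta>\<in>one_forms A. \<forall>p. lie_bivec A (\<rho> v) \<pi> \<alpha> \<beta> p = 0) \<and>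
    schouten_square A \<pi> = push_trivector A \<gg> \<rho> (chi_G \<gg> B)"


section \<open>Lie algebroids\<close>

text \<open>
  A family of vector spaces \<open>E p\<close> together with \<open>k\<close> sections in \<open>\<Gamma>\<close> which are a basis of every
  fibre over the open set \<open>U\<close>.
\<close>

definition local_frame ::
    "('m::topological_space \<Rightarrow> 'v::real_vector set) \<Rightarrow> ('m \<Rightarrow> 'v) set \<Rightarrow> nat \<Rightarrow> 'm set \<Rightarrow> (nat \<Rightarrow> 'm \<Rightarrow> 'v) \<Rightarrow> bool"
  where "local_frame E \<Gamma> k U e \<longleftrightarrow> open U \<and> (\<forall>j<k. e j \<in> \<Gamma>) \<and>
    (\<forall>q\<in>U. inj_on (\<lambda>j. e j q) {..<k} \<and> independent ((\<lambda>j. e j q) ` {..<k}) \<and>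
            span ((\<lambda>j. e j q) ` {..<k}) = E q)"

text \<open>
  A vector bundle of rank \<open>k\<close> is given by its fibres \<open>E p\<close> and its set \<open>\<Gamma>\<close> of smooth global
  sections, which is determined by a collection of local frames (local trivialisations) covering
  \<open>M\<close>: a section is smooth iff its coefficients in each of these frames are. Since the frames
  consist of members of \<open>\<Gamma>\<close>, the transition matrices between them are smooth.
\<close>

definition vector_bundle :: "('m::topological_space, 'e::real_inner) atlas \<Rightarrow>
    ('m \<Rightarrow> 'v::real_vector set) \<Rightarrow> ('m \<Rightarrow> 'v) set \<Rightarrow> bool"
  where "vector_bundle A E \<Gamma> \<longleftrightarrow> (\<forall>p. subspace (E p)) \<and>
    (\<exists>k F. (\<forall>(U, e)\<in>F. local_frame E \<Gamma> k U e) \<and> \<Union>(fst ` F) = UNIV \<and>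
      \<Gamma> = {s. (\<forall>p. s p \<in> E p) \<and>
        (\<forall>(U, e)\<in>F. \<exists>c. (\<forall>j<k. smooth_fun_on A U (c j)) \<and>
          (\<forall>q\<in>U. s q = (\<Sum>j<k. c j q *\<^sub>R e j q)))})"

definition jacobi_on :: "'v::real_vector set \<Rightarrow> ('v \<Rightarrow> 'v \<Rightarrow> 'v) \<Rightarrow> bool"
  where "jacobi_on V br \<longleftrightarrow> (\<forall>x\<in>V. \<forall>y\<in>V. \<forall>z\<in>V.
    br x (br y z) + br y (br z x) + br z (br x y) = 0)"

definition lie_bracket_on :: "'v::real_vector set \<Rightarrow> ('v \<Rightarrow> 'v \<Rightarrow> 'v) \<Rightarrow> bool"
  where "lie_bracket_on V br \<longleftrightarrow>
    (\<forall>x\<in>V. br x ` V \<subseteq> V \<and> linear_on V (br x)) \<and>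
    (\<forall>x\<in>V. \<forall>y\<in>V. br x y = - br y x) \<and> jacobi_on V br"

definition leibniz_on :: "('m, 'e::real_inner) atlas \<Rightarrow> ('m \<Rightarrow> 'v::real_vector) set \<Rightarrow>
    ('m \<Rightarrow> 'v \<Rightarrow> 'm tvec) \<Rightarrow> (('m \<Rightarrow> 'v) \<Rightarrow> ('m \<Rightarrow> 'v) \<Rightarrow> 'm \<Rightarrow> 'v) \<Rightarrow> bool"
  where "leibniz_on A \<Gamma> r br \<longleftrightarrow> (\<forall>\<xi>\<in>\<Gamma>. \<forall>\<eta>\<in>\<Gamma>. \<forall>f\<in>smooth_funs A.
    br \<xi> (\<lambda>p. f p *\<^sub>R \<eta> p) = (\<lambda>p. f p *\<^sub>R br \<xi> \<eta> p + r p (\<xi> p) f *\<^sub>R \<eta> p))"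

definition bundle_map_to_tangent :: "('m, 'e::real_inner) atlas \<Rightarrow>
    ('m \<Rightarrow> 'v::real_vector set) \<Rightarrow> ('m \<Rightarrow> 'v) set \<Rightarrow> ('m \<Rightarrow> 'v \<Rightarrow> 'm tvec) \<Rightarrow> bool"
  where "bundle_map_to_tangent A E \<Gamma> r \<longleftrightarrow>
    (\<forall>p. linear_on (E p) (r p) \<and> r p ` E p \<subseteq> tangent A p) \<and>
    (\<forall>\<xi>\<in>\<Gamma>. (\<lambda>p. r p (\<xi> p)) \<in> vector_fields A)"

definition lie_algebroid :: "('m::topological_space, 'e::real_inner) atlas \<Rightarrow>
    ('m \<Rightarrow> 'v::real_vector set) \<Rightarrow> ('m \<Rightarrow> 'v) set \<Rightarrow>
    ('m \<Rightarrow> 'v \<Rightarrow> 'm tvec) \<Rightarrow> (('m \<Rightarrow> 'v) \<Rightarrow> ('m \<Rightarrow> 'v) \<Rightarrow> 'm \<Rightarrow> 'v) \<Rightarrow> bool"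
  where "lie_algebroid A E \<Gamma> r br \<longleftrightarrow> vector_bundle A E \<Gamma> \<and> lie_bracket_on \<Gamma> br \<and>
    bundle_map_to_tangent A E \<Gamma> r \<and> leibniz_on A \<Gamma> r br"


section \<open>The bundle \<open>T\<^sup>*M \<oplus> \<gg>\<close>\<close>

definition fibre :: "('m, 'e::real_inner) atlas \<Rightarrow> 'g vfield set \<Rightarrow> 'm \<Rightarrow> ('m covec \<times> 'g vfield) set"
  where "fibre A \<gg> p = cotangent A p \<times> \<gg>"

definition smooth_g_funs :: "('m, 'e::real_inner) atlas \<Rightarrow> 'g vfield set \<Rightarrow> ('m \<Rightarrow> 'g vfield) set"
  where "smooth_g_funs A \<gg> = {s. (\<forall>p. s p \<in> \<gg>) \<and> (\<forall>c\<in>dual \<gg>. (\<lambda>p. c (s p)) \<in> smooth_funs A)}"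

definition sections ::
    "('m, 'e::real_inner) atlas \<Rightarrow> 'g vfield set \<Rightarrow> ('m \<Rightarrow> 'm covec \<times> 'g vfield) set"
  where "sections A \<gg> = {\<xi>. (\<lambda>p. fst (\<xi> p)) \<in> one_forms A \<and> (\<lambda>p. snd (\<xi> p)) \<in> smooth_g_funs A \<gg>}"

definition anchor :: "('m, 'e::real_inner) atlas \<Rightarrow> ('g vfield \<Rightarrow> 'm vfield) \<Rightarrow> 'm bivec \<Rightarrow>
    'm \<Rightarrow> 'm covec \<times> 'g vfield \<Rightarrow> 'm tvec"
  where "anchor A \<rho> \<pi> p = (\<lambda>(a, v). sharp A \<pi> p a + \<rho> v p)"

text \<open>
  The bracket is prescribed on one-forms and on constant \<open>\<gg>\<close>-valued functions, and extended by
  the Leibniz identity and skew-symmetry. As \<open>bidual_elem \<gg>\<close> is applied to the functional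
  \<open>\<chi>\<^sub>G(\<rho>\<^sup>*\<alpha>, \<rho>\<^sup>*\<beta>, -)\<close>, it yields the contraction of \<open>\<chi>\<^sub>G\<close> with \<open>\<rho>\<^sup>*(\<alpha> \<and> \<beta>)\<close>.
\<close>

definition is_section_bracket :: "('m, 'e::real_inner) atlas \<Rightarrow> 'g vfield set \<Rightarrow>
    ('g vfield \<Rightarrow> 'g vfield \<Rightarrow> real) \<Rightarrow> ('g vfield \<Rightarrow> 'm vfield) \<Rightarrow> 'm bivec \<Rightarrow>
    (('m \<Rightarrow> 'm covec \<times> 'g vfield) \<Rightarrow> ('m \<Rightarrow> 'm covec \<times> 'g vfield) \<Rightarrow> 'm \<Rightarrow> 'm covec \<times> 'g vfield) \<Rightarrow> bool"
  where "is_section_bracket A \<gg> B \<rho> \<pi> br \<longleftrightarrow>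
    (\<forall>\<xi>\<in>sections A \<gg>. br \<xi> ` sections A \<gg> \<subseteq> sections A \<gg> \<and> linear_on (sections A \<gg>) (br \<xi>)) \<and>
    (\<forall>\<xi>\<in>sections A \<gg>. \<forall>\<eta>\<in>sections A \<gg>. br \<xi> \<eta> = - br \<eta> \<xi>) \<and>
    (\<forall>\<alpha>\<in>one_forms A. \<forall>\<beta>\<in>one_forms A.
       br (\<lambda>p. (\<alpha> p, 0)) (\<lambda>p. (\<beta> p, 0)) =
         (\<lambda>p. (form_bracket A \<pi> \<alpha> \<beta> p,
              (1/2) *\<^sub>R bidual_elem \<gg> (chi_G \<gg> B (coaction \<gg> \<rho> p (\<alpha> p)) (coaction \<gg> \<rho> p (\<beta> p)))))) \<and>
    (\<forall>v\<in>\<gg>. \<forall>w\<in>\<gg>. br (\<lambda>p. (0, v)) (\<lambda>p. (0, w)) = (\<lambda>p. (0, vf_bracket v w))) \<and>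
    (\<forall>v\<in>\<gg>. \<forall>\<alpha>\<in>one_forms A.
       br (\<lambda>p. (0, v)) (\<lambda>p. (\<alpha> p, 0)) = (\<lambda>p. (lie_form A (\<rho> v) \<alpha> p, 0))) \<and>
    leibniz_on A (sections A \<gg>) (anchor A \<rho> \<pi>) br \<and>
    (\<forall>\<xi> \<eta>. \<xi> \<notin> sections A \<gg> \<or> \<eta> \<notin> sections A \<gg> \<longrightarrow> br \<xi> \<eta> = 0)"

definition section_bracket :: "('m, 'e::real_inner) atlas \<Rightarrow> 'g vfield set \<Rightarrow>
    ('g vfield \<Rightarrow> 'g vfield \<Rightarrow> real) \<Rightarrow> ('g vfield \<Rightarrow> 'm vfield) \<Rightarrow> 'm bivec \<Rightarrow>
    ('m \<Rightarrow> 'm covec \<times> 'g vfield) \<Rightarrow> ('m \<Rightarrow> 'm covec \<times> 'g vfield) \<Rightarrow> 'm \<Rightarrow> 'm covec \<times> 'g vfield"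
  where "section_bracket A \<gg> B \<rho> \<pi> = (THE br. is_section_bracket A \<gg> B \<rho> \<pi> br)"

text \<open>The anchor, on sections, intertwines the bracket with that of vector fields.\<close>

definition anchor_preserves_brackets :: "('m, 'e::real_inner) atlas \<Rightarrow> 'g vfield set \<Rightarrow>
    ('g vfield \<Rightarrow> 'g vfield \<Rightarrow> real) \<Rightarrow> ('g vfield \<Rightarrow> 'm vfield) \<Rightarrow> 'm bivec \<Rightarrow> bool"
  where "anchor_preserves_brackets A \<gg> B \<rho> \<pi> \<longleftrightarrow>
    (\<forall>\<xi>\<in>sections A \<gg>. \<forall>\<eta>\<in>sections A \<gg>.
      (\<lambda>p. anchor A \<rho> \<pi> p (section_bracket A \<gg> B \<rho> \<pi> \<xi> \<eta> p)) =
        vf_bracket (\<lambda>p. anchor A \<rho> \<pi> p (\<xi> p)) (\<lambda>p. anchor A \<rho> \<pi> p (\<eta> p)))"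

end

theory Submission
  imports Defs
begin

text \<open>All brackets are computed on the generators \<open>(df, 0)\<close> and \<open>(0, v)\<close>, \<open>v\<close> constant. The anchor
  defect \<open>\<Delta>(\<xi>, \<eta>) = r [\<xi>, \<eta>] - [r \<xi>, r \<eta>]\<close> is \<open>C\<^sup>\<infinity>\<close>-bilinear; on \<open>((0, v), (df, 0))\<close> it measures
  the failure of \<open>v\<close> to preserve \<open>\<pi>\<close>, and on \<open>((df, 0), (dg, 0))\<close> the difference of \<open>\<chi>\<^sub>\<pi>\<close> and
  \<open>\<rho>(\<chi>\<^sub>G)\<close>, up to a factor. The Jacobiator satisfies
  \<open>Jac(\<xi>, \<eta>, f \<zeta>) = f Jac(\<xi>, \<eta>, \<zeta>) - (\<Delta>(\<xi>, \<eta>) f) \<zeta>\<close>, so the Jacobi identity forces \<open>\<Delta> = 0\<close>;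
  conversely, if \<open>\<Delta> = 0\<close> then the Jacobiator is tensorial and need only vanish on generators, where this
  follows from invariance, \<open>\<chi>\<^sub>\<pi> = \<rho>(\<chi>\<^sub>G)\<close> and the ad-invariance of the quadratic form. The latter comes
  from differentiating the Ad-invariance, since left- and right-invariant fields commute.\<close>

section \<open>Calculus in finite dimension\<close>

text \<open>Lie derivatives, the Schouten square, \<open>chi_G\<close> and the bracket on sections
  are all given by definite descriptions, so each needs an explicit candidate and a uniqueness proof
  before anything can be computed. Tangent vectors are derivations of global smooth functions, and
  forms are tested on global vector fields; a coordinate computation therefore has to be cut off by
  a bump function, and Hadamard's lemma is what identifies derivations with partial derivatives. The
  model space is only known to be a finite dimensional inner product space, so calculus is done with
  directional derivatives expanded in an orthonormal basis. The generators \<open>(df, 0)\<close>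
  suffice among forms because every covector at a point is the value there of some
  \<open>df\<close>. The factor 1/2 in the bracket of two forms fits the normalisation of
  \<open>\<chi>\<^sub>\<pi>\<close> as twice the Jacobiator: the \<gg>-part of
  \<open>[df, dg]\<close> contributes half of \<open>\<rho>(\<chi>\<^sub>G)(df, dg, dh)\<close> to
  the anchor, against exactly one Jacobiator.\<close>

lemma frechet_derivative_cong_open:
  assumes "open S" "x \<in> S" "\<And>y. y \<in> S \<Longrightarrow> f y = g y"
  shows "frechet_derivative f (at x) = frechet_derivative g (at x)"
    and "f differentiable (at x) \<longleftrightarrow> g differentiable (at x)"
proof -
  \<comment> \<open>The chosen derivative depends only on the set of all derivatives at
    \<open>x\<close>, so it is this equivalence that has to be shown.\<close>
  have "(f has_derivative f') (at x) \<longleftrightarrow> (g has_derivative f') (at x)" for f'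
    using has_derivative_transform_within_open[of f f' x UNIV S g]
      has_derivative_transform_within_open[of g f' x UNIV S f] assms by auto
  then show "frechet_derivative f (at x) = frechet_derivative g (at x)"
    "f differentiable (at x) \<longleftrightarrow> g differentiable (at x)"
    by (auto simp: frechet_derivative_def differentiable_def)
qed

text \<open>Openness of \<open>S\<close> matters: \<open>frechet_derivative\<close> looks at a full
  neighbourhood of each point, and agreement on \<open>S\<close> must cover one.\<close>

lemma C_k_on_cong:
  assumes "open S" "\<And>x. x \<in> S \<Longrightarrow> f x = g x" "C_k_on k S f"
  shows "C_k_on k S g"
  using assms(2,3)
proof (induction k arbitrary: f g)
  case 0
  then show ?case by (metis C_k_on.simps(1) continuous_on_cong)
next
  case (Suc k)
  have "C_k_on k S (\<lambda>x. frechet_derivative g (at x) v)" for v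
    using Suc.IH[of "\<lambda>x. frechet_derivative f (at x) v" "\<lambda>x. frechet_derivative g (at x) v"] Suc.prems
      frechet_derivative_cong_open(1)[OF assms(1), of _ f g] by (metis C_k_on.simps(2))
  then show ?case
    using Suc.prems frechet_derivative_cong_open(2)[OF assms(1), of _ f g] by (metis C_k_on.simps(2))
qed

lemma C_k_on_subset: "C_k_on k S f \<Longrightarrow> T \<subseteq> S \<Longrightarrow> C_k_on k T f"
  by (induction k arbitrary: f) (auto intro: continuous_on_subset)

lemma C_k_on_local:
  assumes "\<And>x. x \<in> S \<Longrightarrow> \<exists>T. open T \<and> x \<in> T \<and> C_k_on k T f"
  shows "C_k_on k S f"
  using assms
proof (induction k arbitrary: f)
  case 0
  then show ?case
    by (metis C_k_on.simps(1) continuous_at_imp_continuous_on continuous_on_eq_continuous_at)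
next
  case (Suc k)
  have "C_k_on k S (\<lambda>x. frechet_derivative f (at x) v)" for v
    by (rule Suc.IH) (metis C_k_on.simps(2) Suc.prems)
  then show ?case using Suc.prems by (metis C_k_on.simps(2))
qed

lemma C_k_on_Suc_imp: "C_k_on (Suc k) S f \<Longrightarrow> C_k_on k S f"
proof (induction k arbitrary: f)
  case 0
  then show ?case
    by (auto intro!: continuous_at_imp_continuous_on differentiable_imp_continuous_within)
next
  case (Suc k)
  then show ?case by (metis C_k_on.simps(2))
qed

text \<open>Closure under sums, products and composition goes through this rule: it is enough to
  exhibit some derivative whose values in each fixed direction are \<open>C_k_on k\<close>;
  uniqueness of derivatives identifies it with the chosen one.\<close>

lemma C_k_on_SucI:
  assumes "open S" "\<And>x. x \<in> S \<Longrightarrow> (f has_derivative f' x) (at x)"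
    and "\<And>v. C_k_on k S (\<lambda>x. f' x v)"
  shows "C_k_on (Suc k) S f"
proof -
  have "frechet_derivative f (at x) = f' x" if "x \<in> S" for x
    using assms(2)[OF that] frechet_derivative_at by metis
  then have "C_k_on k S (\<lambda>x. frechet_derivative f (at x) v)" for v
    using C_k_on_cong[OF assms(1) _ assms(3)[of v], of "\<lambda>x. frechet_derivative f (at x) v"] by simp
  then show ?thesis using assms(2) differentiable_def by fastforce
qed

lemma C_k_on_SucD:
  assumes "C_k_on (Suc k) S f" "x \<in> S"
  shows "(f has_derivative frechet_derivative f (at x)) (at x)"
  using assms frechet_derivative_works by auto

lemma C_k_on_const: "open S \<Longrightarrow> C_k_on k S (\<lambda>x. c)"
  by (induction k arbitrary: c) auto

lemma C_k_on_ident: "open S \<Longrightarrow> C_k_on k S (\<lambda>x. x)"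
  by (cases k) (auto intro!: C_k_on_const simp: frechet_derivative_ident)

lemma C_k_on_bounded_linear:
  assumes "bounded_linear L" "open S" "C_k_on k S f"
  shows "C_k_on k S (\<lambda>x. L (f x))"
  using assms(3)
proof (induction k arbitrary: f)
  case 0
  then show ?case using assms(1) by (auto intro: bounded_linear.continuous_on)
next
  case (Suc k)
  show ?case
    by (rule C_k_on_SucI[OF assms(2), of _ "\<lambda>x v. L (frechet_derivative f (at x) v)"])
      (use Suc in \<open>auto intro!: bounded_linear.has_derivative[OF assms(1)] simp: frechet_derivative_works[symmetric]\<close>)
qed

lemma C_k_on_add:
  assumes "open S" "C_k_on k S f" "C_k_on k S g"
  shows "C_k_on k S (\<lambda>x. f x + g x)"
  using assms(2,3)
proof (induction k arbitrary: f g)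
  case 0
  then show ?case by (auto intro: continuous_on_add)
next
  case (Suc k)
  show ?case
    by (rule C_k_on_SucI[OF assms(1), of _ "\<lambda>x v. frechet_derivative f (at x) v + frechet_derivative g (at x) v"])
      (use Suc in \<open>auto intro!: has_derivative_add simp: frechet_derivative_works[symmetric]\<close>)
qed

lemma C_k_on_sum:
  assumes "open S" "\<And>i. i \<in> I \<Longrightarrow> C_k_on k S (f i)"
  shows "C_k_on k S (\<lambda>x. \<Sum>i\<in>I. f i x)"
  using assms(2)
  by (induction I rule: infinite_finite_induct) (auto intro: C_k_on_add C_k_on_const assms(1))

lemma C_k_on_scaleR:
  fixes f :: "'e::real_normed_vector \<Rightarrow> real"
  assumes "open S" "C_k_on k S f" "C_k_on k S g"
  shows "C_k_on k S (\<lambda>x. f x *\<^sub>R g x)"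
  using assms(2,3)
proof (induction k arbitrary: f g)
  case 0
  then show ?case by (auto intro: continuous_on_scaleR)
next
  case (Suc k)
  \<comment> \<open>The product rule contains \<open>f\<close> and \<open>g\<close>
    undifferentiated, so their regularity one order lower is needed as well.\<close>
  have *: "C_k_on k S f" "C_k_on k S g" using Suc.prems C_k_on_Suc_imp by auto
  show ?case
    by (rule C_k_on_SucI[OF assms(1), of _ "\<lambda>x v. f x *\<^sub>R frechet_derivative g (at x) v + frechet_derivative f (at x) v *\<^sub>R g x"])
      (use Suc * in \<open>auto intro!: has_derivative_scaleR C_k_on_add assms(1) simp: frechet_derivative_works[symmetric]\<close>)
qed

lemma C_k_on_mult:
  fixes f g :: "'e::real_normed_vector \<Rightarrow> real"
  assumes "open S" "C_k_on k S f" "C_k_on k S g"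
  shows "C_k_on k S (\<lambda>x. f x * g x)"
  using C_k_on_scaleR[OF assms] by simp

section \<open>Orthonormal bases of the model space and the chain rule\<close>

definition onb :: "'e::real_inner set \<Rightarrow> bool"
  where "onb b \<longleftrightarrow> finite b \<and> (\<forall>u\<in>b. \<forall>v\<in>b. u \<bullet> v = (if u = v then 1 else 0)) \<and>
    (\<forall>x. x = (\<Sum>u\<in>b. (x \<bullet> u) *\<^sub>R u))"

text \<open>Gram-Schmidt supplies an orthogonal spanning set, whose nonzero members are normalised.
  The expansion clause of \<open>onb\<close> then follows by pairing a linear combination with each
  basis vector.\<close>

lemma onb_exists:
  fixes b :: "'e::real_inner set"
  assumes "finite b" "span b = UNIV"
  obtains c :: "'e set" where "onb c"
proof -
  obtain C :: "'e set" where C: "finite C" "card C \<le> card b" "span C = UNIV" "pairwise orthogonal C"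
    using basis_orthogonal[OF assms(1)] unfolding assms(2) by auto
  \<comment> \<open>The vector 0 may belong to an orthogonal set and has to be removed before
    dividing by the norm.\<close>
  define c where "c = (\<lambda>x. x /\<^sub>R norm x) ` (C - {0})"
  have fin: "finite c" using C by (simp add: c_def)
  have orth: "u \<bullet> v = (if u = v then 1 else 0)" if uv: "u \<in> c" "v \<in> c" for u v
  proof -
    obtain x y where xy: "u = x /\<^sub>R norm x" "v = y /\<^sub>R norm y" "x \<in> C - {0}" "y \<in> C - {0}"
      using uv unfolding c_def by (elim imageE) metis
    have 1: "u \<bullet> u = 1" unfolding xy(1) using xy(3) by (simp add: dot_square_norm power2_eq_square)
    show ?thesis
    proof (cases "x = y")
      case True
      then have "u = v" using xy(1,2) by metis
      then show ?thesis using 1 by metis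
    next
      case False
      then have 0: "x \<bullet> y = 0" using xy C(4) by (auto simp: pairwise_def orthogonal_def)
      then have "u \<bullet> v = 0" unfolding xy(1,2) by simp
      then show ?thesis using 1 by metis
    qed
  qed
  have "x \<in> span c" for x :: 'e
  proof -
    have "C \<subseteq> span c"
    proof
      fix x assume x: "x \<in> C"
      show "x \<in> span c"
      proof (cases "x = 0")
        case False
        then have "x /\<^sub>R norm x \<in> c" unfolding c_def using x by (intro image_eqI[of _ _ x]) simp_all
        then have "x /\<^sub>R norm x \<in> span c" by (rule span_base)
        then have "norm x *\<^sub>R (x /\<^sub>R norm x) \<in> span c" by (rule span_scale)
        then show ?thesis using False by simp
      qed (simp add: span_zero)
    qed
    then have "span C \<subseteq> span c" by (simp add: span_minimal)
    then show ?thesis using C(3) by auto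
  qed
  then have *: "x \<in> span c" for x :: 'e .
  have "x = (\<Sum>u\<in>c. (x \<bullet> u) *\<^sub>R u)" for x :: 'e
  proof -
    from * obtain q where q: "x = (\<Sum>u\<in>c. q u *\<^sub>R u)" unfolding span_finite[OF fin] by blast
    have "x \<bullet> v = q v" if "v \<in> c" for v
    proof -
      have "x \<bullet> v = (\<Sum>u\<in>c. q u * (u \<bullet> v))" by (simp add: q inner_sum_left)
      also have "\<dots> = (\<Sum>u\<in>c. if u = v then q u else 0)"
        using orth that by (intro sum.cong) auto
      also have "\<dots> = q v" using that fin by simp
      finally show ?thesis .
    qed
    then have e: "(\<Sum>u\<in>c. (x \<bullet> u) *\<^sub>R u) = (\<Sum>u\<in>c. q u *\<^sub>R u)" by (intro sum.cong) auto
    show ?thesis unfolding e by (rule q)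
  qed
  then have "onb c" unfolding onb_def using fin orth by blast
  then show ?thesis by (rule that)
qed

lemma onbD1: "onb b \<Longrightarrow> finite b"
  by (simp add: onb_def)

lemma onbD2: "onb b \<Longrightarrow> x = (\<Sum>u\<in>b. (x \<bullet> u) *\<^sub>R u)"
  unfolding onb_def by (elim conjE) (erule spec)

lemma onbD3: "onb b \<Longrightarrow> u \<in> b \<Longrightarrow> v \<in> b \<Longrightarrow> u \<bullet> v = (if u = v then 1 else 0)"
  by (simp add: onb_def)

lemma linear_onb:
  assumes "onb b" "linear L"
  shows "L v = (\<Sum>u\<in>b. (v \<bullet> u) *\<^sub>R L u)"
proof -
  have "L v = L (\<Sum>u\<in>b. (v \<bullet> u) *\<^sub>R u)" by (rule arg_cong[OF onbD2[OF assms(1)]])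
  then show ?thesis by (simp only: linear_sum[OF assms(2)] linear_scale[OF assms(2)])
qed

text \<open>The chain rule applies the derivative of \<open>g\<close> to the moving vector
  \<open>f'(x) v\<close>, whereas \<open>C_k_on\<close> controls derivatives in fixed directions
  only. Expanding that vector in the basis \<open>b\<close> turns the derivative into a finite sum
  of products, to which the induction hypothesis applies.\<close>

lemma C_k_on_compose:
  fixes f :: "'e::real_normed_vector \<Rightarrow> 'f::real_inner"
  assumes "onb (b::'f set)" "open S" "open T" "f ` S \<subseteq> T" "C_k_on k S f" "C_k_on k T g"
  shows "C_k_on k S (\<lambda>x. g (f x))"
  using assms(5,6)
proof (induction k arbitrary: g)
  case 0
  then show ?case using assms(4) by (auto intro: continuous_on_compose2)
next
  case (Suc k)
  let ?f' = "\<lambda>x v. frechet_derivative f (at x) v" and ?g' = "\<lambda>y v. frechet_derivative g (at y) v"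
  show ?case
  proof (rule C_k_on_SucI[OF assms(2), of _ "\<lambda>x v. \<Sum>u\<in>b. (?f' x v \<bullet> u) *\<^sub>R ?g' (f x) u"])
    fix x assume x: "x \<in> S"
    have f: "(f has_derivative ?f' x) (at x)" using C_k_on_SucD[OF Suc.prems(1) x] .
    have g: "(g has_derivative ?g' (f x)) (at (f x))" using C_k_on_SucD[OF Suc.prems(2)] x assms(4) by auto
    have "?g' (f x) w = (\<Sum>u\<in>b. (w \<bullet> u) *\<^sub>R ?g' (f x) u)" for w
      by (rule linear_onb[OF assms(1) has_derivative_linear[OF g]])
    then have "(\<lambda>v. \<Sum>u\<in>b. (?f' x v \<bullet> u) *\<^sub>R ?g' (f x) u) = ?g' (f x) \<circ> ?f' x"
      unfolding o_def fun_eq_iff by metis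
    then show "((\<lambda>x. g (f x)) has_derivative (\<lambda>v. \<Sum>u\<in>b. (?f' x v \<bullet> u) *\<^sub>R ?g' (f x) u)) (at x)"
      using diff_chain_at[OF f g] by (simp add: o_def)
  next
    fix v
    show "C_k_on k S (\<lambda>x. \<Sum>u\<in>b. (?f' x v \<bullet> u) *\<^sub>R ?g' (f x) u)"
    proof (rule C_k_on_sum[OF assms(2)], rule C_k_on_scaleR[OF assms(2)])
      fix u
      have "C_k_on k S (\<lambda>x. ?f' x v)" "C_k_on k T (\<lambda>y. ?g' y u)" using Suc.prems by auto
      then show "C_k_on k S (\<lambda>x. ?f' x v \<bullet> u)" "C_k_on k S (\<lambda>x. ?g' (f x) u)"
        using C_k_on_bounded_linear[OF bounded_linear_inner_left assms(2)] Suc.IH[OF C_k_on_Suc_imp[OF Suc.prems(1)]]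
        by blast+
    qed
  qed
qed

lemma smooth_onI: "(\<And>k. C_k_on k S f) \<Longrightarrow> smooth_on S f" by (simp add: smooth_on_def)

lemma smooth_on_cong: "smooth_on S f \<Longrightarrow> open S \<Longrightarrow> (\<And>x. x \<in> S \<Longrightarrow> f x = g x) \<Longrightarrow> smooth_on S g"
  using C_k_on_cong unfolding smooth_on_def by blast

lemma smooth_on_subset: "smooth_on S f \<Longrightarrow> T \<subseteq> S \<Longrightarrow> smooth_on T f"
  using C_k_on_subset unfolding smooth_on_def by blast

lemma smooth_on_local:
  "(\<And>x. x \<in> S \<Longrightarrow> \<exists>T. open T \<and> x \<in> T \<and> smooth_on T f) \<Longrightarrow> smooth_on S f"
  using C_k_on_local unfolding smooth_on_def by meson

lemma smooth_on_const: "open S \<Longrightarrow> smooth_on S (\<lambda>x. c)"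
  by (simp add: smooth_on_def C_k_on_const)

lemma smooth_on_ident: "open S \<Longrightarrow> smooth_on S (\<lambda>x. x)"
  by (simp add: smooth_on_def C_k_on_ident)

lemma smooth_on_bounded_linear: "bounded_linear L \<Longrightarrow> open S \<Longrightarrow> smooth_on S f \<Longrightarrow> smooth_on S (\<lambda>x. L (f x))"
  by (simp add: smooth_on_def C_k_on_bounded_linear)

lemma smooth_on_add: "open S \<Longrightarrow> smooth_on S f \<Longrightarrow> smooth_on S g \<Longrightarrow> smooth_on S (\<lambda>x. f x + g x)"
  by (simp add: smooth_on_def C_k_on_add)

lemma smooth_on_sum: "open S \<Longrightarrow> (\<And>i. i \<in> I \<Longrightarrow> smooth_on S (f i)) \<Longrightarrow> smooth_on S (\<lambda>x. \<Sum>i\<in>I. f i x)"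
  by (simp add: smooth_on_def C_k_on_sum)

lemma smooth_on_scaleR:
  fixes f :: "'e::real_normed_vector \<Rightarrow> real"
  shows "open S \<Longrightarrow> smooth_on S f \<Longrightarrow> smooth_on S g \<Longrightarrow> smooth_on S (\<lambda>x. f x *\<^sub>R g x)"
  by (simp add: smooth_on_def C_k_on_scaleR)

lemma smooth_on_mult:
  fixes f g :: "'e::real_normed_vector \<Rightarrow> real"
  shows "open S \<Longrightarrow> smooth_on S f \<Longrightarrow> smooth_on S g \<Longrightarrow> smooth_on S (\<lambda>x. f x * g x)"
  by (simp add: smooth_on_def C_k_on_mult)

lemma smooth_on_diff:
  assumes "open S" "smooth_on S f" "smooth_on S g"
  shows "smooth_on S (\<lambda>x. f x - g x)"
  using smooth_on_add[OF assms(1,2) smooth_on_bounded_linear[OF bounded_linear_minus[OF bounded_linear_ident] assms(1,3)]]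
  by simp

lemma smooth_on_Pair:
  assumes "open S" "smooth_on S f" "smooth_on S g"
  shows "smooth_on S (\<lambda>x. (f x, g x))"
proof -
  have l: "bounded_linear (\<lambda>y. (y, 0))" "bounded_linear (\<lambda>y. (0, y))"
    by (simp_all add: bounded_linear_Pair bounded_linear_ident bounded_linear_zero)
  show ?thesis
    using smooth_on_add[OF assms(1) smooth_on_bounded_linear[OF l(1) assms(1,2)] smooth_on_bounded_linear[OF l(2) assms(1,3)]]
    by simp
qed

lemma smooth_on_compose:
  fixes f :: "'e::real_normed_vector \<Rightarrow> 'f::real_inner"
  assumes "onb (b::'f set)" "open S" "open T" "f ` S \<subseteq> T" "smooth_on S f" "smooth_on T g"
  shows "smooth_on S (\<lambda>x. g (f x))"
  using assms(5,6) C_k_on_compose[OF assms(1-4)] unfolding smooth_on_def by blast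

lemma smooth_on_has_derivative:
  assumes "smooth_on S f" "x \<in> S"
  shows "(f has_derivative frechet_derivative f (at x)) (at x)"
  using assms C_k_on_SucD[of 0 S f x] by (auto simp: smooth_on_def)

lemma smooth_on_derivative:
  assumes "smooth_on S f"
  shows "smooth_on S (\<lambda>x. frechet_derivative f (at x) v)"
  using assms unfolding smooth_on_def by (metis C_k_on.simps(2))

lemma smooth_on_imp_continuous_on: "smooth_on S f \<Longrightarrow> continuous_on S f"
  unfolding smooth_on_def using C_k_on.simps(1) by blast

text \<open>The functions \<open>t\<^sup>-\<^sup>n exp (-1/t)\<close> on the positive half line, closed under differentiation
  up to linear combinations.\<close>

definition flat_exp :: "nat \<Rightarrow> real \<Rightarrow> real"
  where "flat_exp n t = (if t > 0 then (1/t) ^ n * exp (- (1/t)) else 0)"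

text \<open>Substituting \<open>x = 1/t\<close> reduces the limit from the right to that of
  \<open>x ^ n / exp x\<close> at infinity; on the left the function is 0.\<close>

lemma flat_exp_tendsto_0: "(flat_exp n \<longlongrightarrow> 0) (at 0)"
proof -
  have "((\<lambda>x::real. x ^ n / exp x) \<longlongrightarrow> 0) at_top" by (rule tendsto_power_div_exp_0)
  then have "((\<lambda>t::real. (inverse t) ^ n / exp (inverse t)) \<longlongrightarrow> 0) (at_right 0)"
    using filterlim_inverse_at_top_right by (rule filterlim_compose)
  then have "(flat_exp n \<longlongrightarrow> 0) (at_right 0)"
    by (rule Lim_transform_eventually)
      (auto simp: eventually_at_right[of 0 1] flat_exp_def exp_minus field_simps intro!: exI[of _ 1])
  moreover have "(flat_exp n \<longlongrightarrow> 0) (at_left 0)"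
    by (rule Lim_transform_eventually[OF tendsto_const])
      (auto simp: eventually_at_left[of "-1" 0] flat_exp_def intro!: exI[of _ "-1"])
  ultimately show ?thesis by (simp add: filterlim_split_at)
qed

lemma has_derivative_flat_exp:
  "(flat_exp n has_real_derivative (flat_exp (n + 2) t - n * flat_exp (n + 1) t)) (at t)"
proof -
  consider "t > 0" | "t < 0" | "t = 0" by linarith
  then show ?thesis
  proof cases
    case 1
    have "((\<lambda>t::real. (1/t) ^ n * exp (- (1/t))) has_real_derivative
        (flat_exp (n + 2) t - n * flat_exp (n + 1) t)) (at t)"
    proof (cases n)
      case (Suc k)
      have "((\<lambda>t::real. (1/t) ^ Suc k) has_real_derivative - (real (Suc k) * (1/t) ^ (k + 2))) (at t)"
      proof -
        have "((\<lambda>t::real. 1 / t) has_real_derivative - ((1/t)^2)) (at t)"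
          using 1 by (auto intro!: derivative_eq_intros simp: field_simps power2_eq_square)
        from DERIV_power[OF this, of "Suc k"] show ?thesis by (simp add: power_add power2_eq_square mult_ac)
      qed
      moreover have "((\<lambda>t::real. exp (- (1/t))) has_real_derivative (1/t)^2 * exp (- (1/t))) (at t)"
        using 1 by (auto intro!: derivative_eq_intros simp: field_simps power2_eq_square)
      ultimately show ?thesis
        using 1 by (auto dest: DERIV_mult simp: Suc flat_exp_def power_add algebra_simps power2_eq_square)
    qed (use 1 in \<open>auto intro!: derivative_eq_intros simp: flat_exp_def field_simps power2_eq_square\<close>)
    then show ?thesis
      by (rule has_field_derivative_transform_within_open[of _ _ _ "{0<..}"]) (use 1 in \<open>auto simp: flat_exp_def\<close>)
  next
    case 2
    have "((\<lambda>t::real. 0) has_real_derivative (flat_exp (n + 2) t - n * flat_exp (n + 1) t)) (at t)"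
      using 2 by (simp add: flat_exp_def)
    then show ?thesis
      by (rule has_field_derivative_transform_within_open[of _ _ _ "{..<0}"]) (use 2 in \<open>auto simp: flat_exp_def\<close>)
  next
    case 3
    \<comment> \<open>For \<open>h > 0\<close> the difference quotient is
      \<open>flat_exp (Suc n) h\<close>, and for \<open>h < 0\<close> both vanish, so the limit
      already computed applies.\<close>
    have "((\<lambda>h. (flat_exp n (0 + h) - flat_exp n 0) / h) \<longlongrightarrow> 0) (at 0)"
      by (rule Lim_transform_eventually[OF flat_exp_tendsto_0[of "Suc n"]])
        (auto simp: flat_exp_def eventually_at intro!: exI[of _ 1])
    then show ?thesis using 3 by (simp add: DERIV_def flat_exp_def)
  qed
qed

lemma smooth_on_flat_exp: "smooth_on UNIV (flat_exp n)"
proof (rule smooth_onI)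
  fix k show "C_k_on k UNIV (flat_exp n)"
  proof (induction k arbitrary: n)
    case 0
    have "isCont (flat_exp n) t" for t using has_derivative_flat_exp DERIV_isCont by blast
    then show ?case by (simp add: continuous_at_imp_continuous_on)
  next
    case (Suc k)
    have *: "C_k_on k UNIV (\<lambda>x. v * (flat_exp (n + 2) x + (- real n) * flat_exp (n + 1) x))" for v
      by (intro C_k_on_mult C_k_on_add C_k_on_const Suc.IH open_UNIV)
    show ?case
      by (rule C_k_on_SucI[of _ _ "\<lambda>x v. v * (flat_exp (n + 2) x + (- real n) * flat_exp (n + 1) x)"])
        (use * has_derivative_flat_exp[of n] in \<open>auto simp: has_field_derivative_def mult.commute[of _ "_ - _"]\<close>)
  qed
qed

lemma smooth_on_norm_square: "open S \<Longrightarrow> onb (b :: 'e::real_inner set) \<Longrightarrow> smooth_on S (\<lambda>x::'e. (norm (x - a))\<^sup>2)"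
proof -
  assume S: "open S" and b: "onb b"
  have "(norm (x - a))\<^sup>2 = (\<Sum>u\<in>b. ((x - a) \<bullet> u) * ((x - a) \<bullet> u))" for x
  proof -
    have "(norm (x - a))\<^sup>2 = (x - a) \<bullet> (\<Sum>u\<in>b. ((x - a) \<bullet> u) *\<^sub>R u)"
      using onbD2[OF b, of "x - a"] by (simp add: dot_square_norm)
    then show ?thesis by (simp add: inner_sum_right)
  qed
  moreover have "smooth_on S (\<lambda>x. \<Sum>u\<in>b. ((x - a) \<bullet> u) * ((x - a) \<bullet> u))"
    by (intro smooth_on_sum smooth_on_mult S smooth_on_bounded_linear[OF bounded_linear_inner_left] smooth_on_diff
        smooth_on_ident smooth_on_const)
  ultimately show ?thesis by simp
qed

lemma flat_exp_mono: "0 < s \<Longrightarrow> s \<le> t \<Longrightarrow> flat_exp 0 s \<le> flat_exp 0 t"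
  by (auto simp: flat_exp_def field_simps)

lemma onb_real: "onb {1::real}"
  unfolding onb_def by auto

text \<open>The plateau comes from composing \<open>flat_exp 0\<close> with a function that is itself flat on the ball.\<close>

lemma bump_exists:
  fixes a :: "'e::real_inner"
  assumes "onb (b :: 'e set)" "r > 0"
  obtains h :: "'e \<Rightarrow> real" where "smooth_on UNIV h" "\<And>x. dist a x \<le> r \<Longrightarrow> h x = 1" "\<And>x. dist a x \<ge> 2 * r \<Longrightarrow> h x = 0"
proof -
  let ?f = "flat_exp 0"
  have pos: "?f t > 0" if "t > 0" for t using that by (simp add: flat_exp_def)
  \<comment> \<open>With this \<open>c\<close> the product \<open>c * flat_exp 0 (s - r^2)\<close>
    reaches 1 once the squared distance \<open>s\<close> is at least \<open>2 r^2\<close>, which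
    \<open>dist a x \<ge> 2 * r\<close> guarantees; the outer \<open>flat_exp 0\<close> then
    vanishes. The factor \<open>1 / flat_exp 0 1\<close> in \<open>h\<close> gives the plateau
    height 1.\<close>
  define c where "c = 1 / ?f (r\<^sup>2)"
  have c: "c > 0" using pos assms(2) by (simp add: c_def)
  define h where "h x = (1 / ?f 1) * ?f (1 - c * ?f ((norm (x - a))\<^sup>2 - r\<^sup>2))" for x
  have "smooth_on UNIV h"
  proof -
    have *: "smooth_on UNIV (\<lambda>x. ?f (g x))" if "smooth_on UNIV g" for g :: "'e \<Rightarrow> real"
      using smooth_on_compose[OF onb_real, of UNIV UNIV g ?f] that smooth_on_flat_exp by auto
    show ?thesis unfolding h_def
      by (intro smooth_on_mult smooth_on_const * smooth_on_diff smooth_on_norm_square[OF _ assms(1)] open_UNIV)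
  qed
  moreover have "h x = 1" if "dist a x \<le> r" for x
  proof -
    have "(norm (x - a))\<^sup>2 \<le> r\<^sup>2" using that by (intro power_mono) (auto simp: dist_norm norm_minus_commute)
    then have "?f ((norm (x - a))\<^sup>2 - r\<^sup>2) = 0" by (simp add: flat_exp_def)
    then show ?thesis by (simp add: h_def flat_exp_def)
  qed
  moreover have "h x = 0" if "dist a x \<ge> 2 * r" for x
  proof -
    have "(norm (x - a))\<^sup>2 \<ge> (2 * r)\<^sup>2" using that assms(2) by (intro power_mono) (auto simp: dist_norm norm_minus_commute)
    moreover have "(2 * r)\<^sup>2 \<ge> 2 * r\<^sup>2" by (simp add: power_mult_distrib)
    ultimately have "(norm (x - a))\<^sup>2 - r\<^sup>2 \<ge> r\<^sup>2" by linarith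
    then have "?f ((norm (x - a))\<^sup>2 - r\<^sup>2) \<ge> ?f (r\<^sup>2)" using assms(2) by (intro flat_exp_mono) auto
    then have "c * ?f ((norm (x - a))\<^sup>2 - r\<^sup>2) \<ge> 1" using c pos assms(2) by (simp add: c_def field_simps)
    then show ?thesis by (simp add: h_def flat_exp_def)
  qed
  ultimately show ?thesis using that by blast
qed

section \<open>Compact balls, differentiation under the integral, Hadamard's lemma\<close>

lemma compact_cball_onb:
  assumes "onb (b :: 'e::real_inner set)"
  shows "compact (cball (a::'e) r)"
proof -
  \<comment> \<open>Combinations with coefficients in \<open>[-r, r]\<close> form a compact set, by
    induction on the basis: each new vector adds one interval factor, and the combination map is
    continuous. The ball around 0 lies in this set since
    \<open>\<bar>x \<bullet> u\<bar> \<le> norm x\<close>.\<close>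
  have K: "compact ((\<lambda>c. \<Sum>u\<in>b'. c u *\<^sub>R u) ` {c. \<forall>u\<in>b'. \<bar>c u\<bar> \<le> r})" (is "compact (?K b')")
    if "finite b'" for b' :: "'e set"
    using that
  proof (induction b')
    case empty
    then show ?case by (cases "{c::'e\<Rightarrow>real. True} = {}") (auto simp: image_constant_conv)
  next
    case (insert v b')
    have "?K (insert v b') = (\<lambda>(t, y). t *\<^sub>R v + y) ` ({-r..r} \<times> ?K b')" (is "_ = ?R")
    proof
      show "?K (insert v b') \<subseteq> ?R"
      proof clarify
        fix c assume c: "\<forall>u\<in>insert v b'. \<bar>c u\<bar> \<le> r"
        then show "(\<Sum>u\<in>insert v b'. c u *\<^sub>R u) \<in> ?R"
          using insert(1,2) by (intro image_eqI[of _ _ "(c v, \<Sum>u\<in>b'. c u *\<^sub>R u)"]) (auto simp: abs_le_iff)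
      qed
      show "?R \<subseteq> ?K (insert v b')"
      proof clarify
        fix t c assume t: "t \<in> {-r..r}" and c: "\<forall>u\<in>b'. \<bar>c u\<bar> \<le> r"
        have "t *\<^sub>R v + (\<Sum>u\<in>b'. c u *\<^sub>R u) = (\<Sum>u\<in>insert v b'. (c(v := t)) u *\<^sub>R u)"
          using insert(1,2) by (auto intro!: sum.cong)
        then show "t *\<^sub>R v + (\<Sum>u\<in>b'. c u *\<^sub>R u) \<in> ?K (insert v b')"
          using t c by (intro image_eqI[of _ _ "c(v := t)"]) (auto simp: abs_le_iff)
      qed
    qed
    moreover have "compact ?R"
      unfolding split_beta
      by (intro compact_continuous_image compact_Times continuous_intros compact_Icc insert.IH)
    ultimately show ?case by simp
  qed
  have "cball 0 r \<subseteq> ?K b"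
  proof
    fix x :: 'e assume x: "x \<in> cball 0 r"
    have "\<bar>x \<bullet> u\<bar> \<le> r" if "u \<in> b" for u
    proof -
      have "norm u = 1" using onbD3[OF assms that that] by (simp add: norm_eq_sqrt_inner)
      then show ?thesis using Cauchy_Schwarz_ineq2[of x u] x by auto
    qed
    then show "x \<in> ?K b" using onbD2[OF assms, of x] by (intro image_eqI[of x _ "\<lambda>u. x \<bullet> u"]) auto
  qed
  then have "compact (cball (0::'e) r)"
    using compact_Int_closed[OF K[OF onbD1[OF assms]] closed_cball, of 0 r] by (simp add: Int_absorb1)
  then have "compact ((+) a ` cball 0 r)" by (rule compact_translation)
  then show ?thesis by (simp add: image_add_cball)
qed

text \<open>A mean value estimate for \<open>F (t, y) - F (t, x)\<close>, uniform in
  \<open>t\<close> because \<open>[0, 1]\<close> is compact, is integrated over \<open>t\<close>.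
  The open set \<open>W\<close> is there because derivatives of \<open>F\<close> are taken in the
  product space, also over the end points of the interval.\<close>

lemma has_derivative_integral_param:
  fixes F :: "real \<times> 'e::real_inner \<Rightarrow> real"
  assumes b: "onb (b::'e set)" and W: "open W" and S: "open S" and sub: "{0..1} \<times> S \<subseteq> W"
    and F: "C_k_on (Suc 0) W F" and x: "x \<in> S"
  shows "((\<lambda>x. integral {0..1} (\<lambda>t. F (t, x))) has_derivative
    (\<lambda>v. integral {0..1} (\<lambda>t. frechet_derivative F (at (t, x)) (0, v)))) (at x)"
proof -
  let ?D = "\<lambda>t x v. frechet_derivative F (at (t, x)) (0, v)"
  have dF: "(F has_derivative frechet_derivative F (at (t, y))) (at (t, y))" if "t \<in> {0..1}" "y \<in> S" for t y
    by (rule C_k_on_SucD[OF F]) (rule subsetD[OF sub], use that in simp)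
  have d: "((\<lambda>y. F (t, y)) has_derivative ?D t y) (at y)" if "t \<in> {0..1}" "y \<in> S" for t y
  proof -
    have "((\<lambda>y. (t, y)) has_derivative (\<lambda>v. (0, v))) (at y)" by (auto intro!: derivative_eq_intros)
    from diff_chain_at[OF this dF[OF that]] show ?thesis by (simp add: o_def)
  qed
  have lin: "?D t y v = (\<Sum>u\<in>b. (v \<bullet> u) *\<^sub>R ?D t y u)" if "t \<in> {0..1}" "y \<in> S" for t y v
    using linear_onb[OF b has_derivative_linear[OF d[OF that]]] .
  have cF: "continuous_on W F" using C_k_on_Suc_imp[OF F] by simp
  have c1: "continuous_on {0..1} (\<lambda>t. F (t, y))" if "y \<in> S" for y
    by (rule continuous_on_compose2[OF cF]) (use sub that in \<open>auto intro!: continuous_intros\<close>)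
  have cD: "continuous_on W (\<lambda>z. frechet_derivative F (at z) (0, v))" for v using F by simp
  have c2: "continuous_on {0..1} (\<lambda>t. ?D t y v)" if "y \<in> S" for y v
    by (rule continuous_on_compose2[OF cD]) (use sub that in \<open>auto intro!: continuous_intros\<close>)
  have c3: "continuous_on (S \<times> {0..1}) (\<lambda>(y, t). ?D t y v)" for v
    unfolding split_beta by (rule continuous_on_compose2[OF cD]) (use sub in \<open>auto intro!: continuous_intros\<close>)
  show ?thesis
    unfolding has_derivative_at_alt
  proof (intro conjI allI impI)
    \<comment> \<open>Only the finitely many integrals over basis directions are involved, which
      makes the candidate derivative bounded linear.\<close>
    have eq: "(\<lambda>v. integral {0..1} (\<lambda>t. ?D t x v)) = (\<lambda>v. \<Sum>u\<in>b. (v \<bullet> u) *\<^sub>R integral {0..1} (\<lambda>t. ?D t x u))"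
    proof (rule ext)
      fix v
      have "integral {0..1} (\<lambda>t. ?D t x v) = integral {0..1} (\<lambda>t. \<Sum>u\<in>b. (v \<bullet> u) *\<^sub>R ?D t x u)"
        by (rule integral_cong) (rule lin[OF _ x])
      also have "\<dots> = (\<Sum>u\<in>b. integral {0..1} (\<lambda>t. (v \<bullet> u) *\<^sub>R ?D t x u))"
        by (rule integral_sum[OF onbD1[OF b]]) (intro integrable_continuous_real continuous_intros c2[OF x])
      finally show "integral {0..1} (\<lambda>t. ?D t x v) = (\<Sum>u\<in>b. (v \<bullet> u) *\<^sub>R integral {0..1} (\<lambda>t. ?D t x u))"
        by simp
    qed
    show "bounded_linear (\<lambda>v. integral {0..1} (\<lambda>t. ?D t x v))" unfolding eq
      by (intro bounded_linear_sum bounded_linear_scaleR_const bounded_linear_inner_left)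
  next
    fix \<epsilon> :: real assume e: "\<epsilon> > 0"
    \<comment> \<open>Each of the \<open>card b\<close> directional derivatives may vary by
      \<open>e'\<close>, so the operator norm varies by at most \<open>card b * e'\<close>; adding 1
      keeps the denominator positive when \<open>b\<close> is empty.\<close>
    define e' where "e' = \<epsilon> / (card b + 1)"
    have e': "e' > 0" using e by (simp add: e'_def)
    \<comment> \<open>Tube lemma: the directional derivatives are close on one neighbourhood of
      \<open>x\<close> for all \<open>t\<close> at once.\<close>
    have "\<exists>X. x \<in> X \<and> open X \<and> (\<forall>y\<in>X \<inter> S. \<forall>t\<in>{0..1}. dist (?D t y u) (?D t x u) \<le> e')" for u
    proof -
      obtain X where "x \<in> X" "open X" "\<forall>y\<in>X \<inter> S. \<forall>t\<in>{0..1}. dist (?D t y u) (?D t x u) \<le> e'"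
        using continuous_on_prod_compactE[OF c3[of u] compact_Icc x e'] by auto
      then show ?thesis by blast
    qed
    then obtain X where X: "x \<in> X u" "open (X u)" "y \<in> X u \<Longrightarrow> y \<in> S \<Longrightarrow> t \<in> {0..1} \<Longrightarrow> dist (?D t y u) (?D t x u) \<le> e'"
      for u y t by (metis IntI)
    have "open (S \<inter> (\<Inter>u\<in>b. X u))" "x \<in> S \<inter> (\<Inter>u\<in>b. X u)"
      using X(1,2) S x onbD1[OF b] by auto
    then obtain d where d0: "d > 0" and dsub: "ball x d \<subseteq> S \<inter> (\<Inter>u\<in>b. X u)"
      using open_contains_ball by metis
    have est: "\<bar>F (t, y) - F (t, x) - ?D t x (y - x)\<bar> \<le> norm (y - x) * \<epsilon>"
      if t: "t \<in> {0..1}" and y: "y \<in> ball x d" for t y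
    proof -
      have "norm (F (t, y) - F (t, x) - ?D t x (y - x)) \<le> norm (y - x) * \<epsilon>"
      proof (rule differentiable_bound_linearization[where S = "ball x d" and f' = "\<lambda>z v. ?D t z v"])
        show "x + s *\<^sub>R (y - x) \<in> ball x d" if "s \<in> {0..1}" for s
        proof -
          have "norm (s *\<^sub>R (y - x)) \<le> 1 * norm (y - x)" unfolding norm_scaleR using that by (intro mult_right_mono) auto
          then show ?thesis using y by (simp add: dist_norm norm_minus_commute)
        qed
        show "((\<lambda>y. F (t, y)) has_derivative ?D t z) (at z within ball x d)" if "z \<in> ball x d" for z
          using d[OF t, of z] that dsub has_derivative_at_withinI by blast
        show "x \<in> ball x d" using d0 by simp
        show "onorm ((\<lambda>v. ?D t z v) - (\<lambda>v. ?D t x v)) \<le> \<epsilon>" if z: "z \<in> ball x d" for z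
        proof (rule onorm_bound[OF less_imp_le[OF e]])
          fix v :: 'e
          have zS: "z \<in> S" using z dsub by auto
          have "norm (((\<lambda>v. ?D t z v) - (\<lambda>v. ?D t x v)) v) = \<bar>\<Sum>u\<in>b. (v \<bullet> u) * (?D t z u - ?D t x u)\<bar>"
            by (simp add: lin[OF t zS, of v] lin[OF t x, of v] sum_subtractf[symmetric] algebra_simps)
          also have "\<dots> \<le> (\<Sum>u\<in>b. norm v * e')"
          proof (rule order_trans[OF sum_abs sum_mono])
            fix u assume u: "u \<in> b"
            have "norm u = 1" using onbD3[OF b u u] by (simp add: norm_eq_sqrt_inner)
            then have "\<bar>v \<bullet> u\<bar> \<le> norm v" using Cauchy_Schwarz_ineq2[of v u] by simp
            moreover have "z \<in> X u" using subsetD[OF dsub z] u by blast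
            then have "\<bar>?D t z u - ?D t x u\<bar> \<le> e'" using X(3)[OF _ zS t] by (simp add: dist_real_def)
            ultimately show "\<bar>(v \<bullet> u) * (?D t z u - ?D t x u)\<bar> \<le> norm v * e'"
              unfolding abs_mult by (intro mult_mono) auto
          qed
          also have "\<dots> = (card b * e') * norm v" by simp
          also have "\<dots> \<le> \<epsilon> * norm v"
            using e by (intro mult_right_mono) (simp_all add: e'_def field_simps)
          finally show "norm (((\<lambda>v. ?D t z v) - (\<lambda>v. ?D t x v)) v) \<le> \<epsilon> * norm v" .
        qed
      qed
      then show ?thesis by simp
    qed
    show "\<exists>d>0. \<forall>y. norm (y - x) < d \<longrightarrow> norm (integral {0..1} (\<lambda>t. F (t, y)) - integral {0..1} (\<lambda>t. F (t, x))
        - integral {0..1} (\<lambda>t. ?D t x (y - x))) \<le> \<epsilon> * norm (y - x)"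
    proof (intro exI[of _ d] conjI allI impI d0)
      fix y assume "norm (y - x) < d"
      then have y: "y \<in> ball x d" by (simp add: dist_norm norm_minus_commute)
      then have yS: "y \<in> S" using dsub by auto
      have i: "(\<lambda>t. F (t, y)) integrable_on {0..1}" "(\<lambda>t. F (t, x)) integrable_on {0..1}" "(\<lambda>t. ?D t x (y - x)) integrable_on {0..1}"
        using c1[OF yS] c1[OF x] c2[OF x] by (auto intro: integrable_continuous_real)
      have "integral {0..1} (\<lambda>t. F (t, y)) - integral {0..1} (\<lambda>t. F (t, x)) - integral {0..1} (\<lambda>t. ?D t x (y - x))
          = integral {0..1} (\<lambda>t. F (t, y) - F (t, x) - ?D t x (y - x))"
        by (simp add: integral_diff i integrable_diff)
      also have "norm \<dots> \<le> integral {0..1} (\<lambda>t::real. norm (y - x) * \<epsilon>)"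
        by (rule integral_norm_bound_integral) (use i est[OF _ y] in \<open>auto intro!: integrable_diff\<close>)
      finally show "norm (integral {0..1} (\<lambda>t. F (t, y)) - integral {0..1} (\<lambda>t. F (t, x))
        - integral {0..1} (\<lambda>t. ?D t x (y - x))) \<le> \<epsilon> * norm (y - x)" by (simp add: mult.commute)
    qed
  qed
qed

text \<open>Differentiating in \<open>x\<close> reproduces an integral of the same kind, with
  \<open>F\<close> replaced by its derivative in direction \<open>(0, v)\<close>; hence the
  induction over arbitrary \<open>F\<close>.\<close>

lemma C_k_on_integral:
  fixes F :: "real \<times> 'e::real_inner \<Rightarrow> real"
  assumes b: "onb (b::'e set)" and W: "open W" and S: "open S" and sub: "{0..1} \<times> S \<subseteq> W"
    and F: "C_k_on k W F"
  shows "C_k_on k S (\<lambda>x. integral {0..1} (\<lambda>t. F (t, x)))"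
  using F
proof (induction k arbitrary: F)
  case 0
  have "continuous_on (S \<times> cbox 0 1) (\<lambda>(x, t). F (t, x))"
    unfolding split_beta by (rule continuous_on_compose2[OF 0[simplified]]) (use sub in \<open>auto intro!: continuous_intros\<close>)
  from integral_continuous_on_param[OF this] show ?case by simp
next
  case (Suc k)
  have "C_k_on (Suc j) S f \<Longrightarrow> C_k_on (Suc 0) S f" for j S and f :: "real \<times> 'e \<Rightarrow> real"
  proof (induction j)
    case (Suc j)
    show ?case by (rule Suc.IH[OF C_k_on_Suc_imp[OF Suc.prems]])
  qed
  then have F1: "C_k_on (Suc 0) W F" using Suc.prems by blast
  show ?case
    by (rule C_k_on_SucI[OF S has_derivative_integral_param[OF b W S sub F1] Suc.IH]) (use Suc.prems in auto)
qed

text \<open>Fundamental theorem of calculus along the segment from \<open>a\<close> to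
  \<open>x\<close>. Expanding the direction \<open>x - a\<close> in the basis leaves the factors
  \<open>g u x\<close>, the averages over the segment of the derivative of \<open>f\<close> in
  direction \<open>u\<close>.\<close>

lemma hadamard:
  fixes f :: "'e::real_inner \<Rightarrow> real"
  assumes b: "onb (b::'e set)" and f: "smooth_on (ball a r) f"
  obtains g :: "'e \<Rightarrow> 'e \<Rightarrow> real" where "\<And>u. smooth_on (ball a r) (g u)"
    and "\<And>x. x \<in> ball a r \<Longrightarrow> f x = f a + (\<Sum>u\<in>b. ((x - a) \<bullet> u) * g u x)"
    and "\<And>u. g u a = frechet_derivative f (at a) u"
proof -
  let ?f' = "\<lambda>y u. frechet_derivative f (at y) u"
  define h where "h = (\<lambda>(t, x). a + t *\<^sub>R (x - a))"
  have hs: "smooth_on S h" if "open S" for S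
    unfolding h_def split_beta using that
    by (intro smooth_on_add smooth_on_const smooth_on_scaleR smooth_on_diff
        smooth_on_bounded_linear[OF bounded_linear_fst] smooth_on_bounded_linear[OF bounded_linear_snd] smooth_on_ident)
  \<comment> \<open>The preimage of the ball is an open neighbourhood of
    \<open>{0..1} \<times> ball a r\<close> on which the integrand is smooth, as
    \<open>C_k_on_integral\<close> requires.\<close>
  define W where "W = h -` ball a r"
  have W: "open W"
    unfolding W_def using smooth_on_imp_continuous_on[OF hs[OF open_UNIV]] by (simp add: open_vimage)
  have hb: "h (t, x) \<in> ball a r" if "t \<in> {0..1}" "x \<in> ball a r" for t x
  proof -
    have "norm (t *\<^sub>R (x - a)) \<le> 1 * norm (x - a)" unfolding norm_scaleR using that by (intro mult_right_mono) auto
    then show ?thesis using that by (simp add: h_def dist_norm norm_minus_commute)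
  qed
  then have sub: "{0..1} \<times> ball a r \<subseteq> W" by (auto simp: W_def)
  define g where "g u x = integral {0..1} (\<lambda>t. ?f' (h (t, x)) u)" for u x
  have "smooth_on (ball a r) (g u)" for u
  proof -
    have "smooth_on W (\<lambda>z. ?f' (h z) u)"
      by (rule smooth_on_compose[OF b W _ _ hs[OF W] smooth_on_derivative[OF f]]) (auto simp: W_def)
    then show ?thesis
      unfolding g_def smooth_on_def using C_k_on_integral[OF b W open_ball sub, of _ "\<lambda>z. ?f' (h z) u"] by simp
  qed
  moreover have "f x = f a + (\<Sum>u\<in>b. ((x - a) \<bullet> u) * g u x)" if x: "x \<in> ball a r" for x
  proof -
    have c: "continuous_on {0..1} (\<lambda>t. ?f' (h (t, x)) u)" for u
      by (rule continuous_on_compose2[OF smooth_on_imp_continuous_on[OF smooth_on_derivative[OF f]]])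
        (use hb x in \<open>auto simp: h_def intro!: continuous_intros\<close>)
    have d: "((\<lambda>t. f (h (t, x))) has_vector_derivative ?f' (h (t, x)) (x - a)) (at t within {0..1})"
      if t: "t \<in> {0..1}" for t
    proof -
      have "((\<lambda>t. h (t, x)) has_derivative (\<lambda>s. s *\<^sub>R (x - a))) (at t)"
        by (auto simp: h_def intro!: derivative_eq_intros)
      from diff_chain_at[OF this smooth_on_has_derivative[OF f hb[OF t x]]]
      have "((\<lambda>t. f (h (t, x))) has_derivative (\<lambda>s. ?f' (h (t, x)) (s *\<^sub>R (x - a)))) (at t)"
        by (simp add: o_def)
      moreover have "?f' (h (t, x)) (s *\<^sub>R (x - a)) = s *\<^sub>R ?f' (h (t, x)) (x - a)" for s
        using linear_scale[OF has_derivative_linear[OF smooth_on_has_derivative[OF f hb[OF t x]]]] .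
      ultimately show ?thesis
        unfolding has_vector_derivative_def by (simp add: has_derivative_at_withinI)
    qed
    have "f x - f a = integral {0..1} (\<lambda>t. ?f' (h (t, x)) (x - a))"
      using integral_unique[OF fundamental_theorem_of_calculus[OF _ d]] by (simp add: h_def)
    also have "\<dots> = integral {0..1} (\<lambda>t. \<Sum>u\<in>b. ((x - a) \<bullet> u) *\<^sub>R ?f' (h (t, x)) u)"
      using linear_onb[OF b has_derivative_linear[OF smooth_on_has_derivative[OF f hb[OF _ x]]]]
      by (intro integral_cong) metis
    also have "\<dots> = (\<Sum>u\<in>b. integral {0..1} (\<lambda>t. ((x - a) \<bullet> u) *\<^sub>R ?f' (h (t, x)) u))"
      by (rule integral_sum[OF onbD1[OF b]]) (intro integrable_continuous_real continuous_intros c)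
    finally show ?thesis by (simp add: g_def)
  qed
  moreover have "g u a = ?f' a u" for u by (simp add: g_def h_def)
  ultimately show ?thesis using that by blast
qed

section \<open>Symmetry of second derivatives\<close>

lemma second_difference:
  fixes f :: "'e::real_normed_vector \<Rightarrow> real"
  assumes f: "C_k_on 2 S f" and s: "s > 0"
    and sub: "\<And>p q. p \<in> {0..s} \<Longrightarrow> q \<in> {0..s} \<Longrightarrow> x + p *\<^sub>R v + q *\<^sub>R w \<in> S"
  obtains p q where "p \<in> {0..s}" "q \<in> {0..s}"
    "f (x + s *\<^sub>R v + s *\<^sub>R w) - f (x + s *\<^sub>R v) - f (x + s *\<^sub>R w) + f x
      = s\<^sup>2 * frechet_derivative (\<lambda>y. frechet_derivative f (at y) v) (at (x + p *\<^sub>R v + q *\<^sub>R w)) w"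
proof -
  let ?fv = "\<lambda>y. frechet_derivative f (at y) v"
  have C1: "C_k_on (Suc 0) S f" "C_k_on (Suc 0) S ?fv"
    using f C_k_on_Suc_imp[of 1 S f] by (simp_all add: numeral_2_eq_2)
  have line: "((\<lambda>p. g (y + p *\<^sub>R u)) has_real_derivative frechet_derivative g (at (y + p *\<^sub>R u)) u) (at p)"
    if "C_k_on (Suc 0) S g" "y + p *\<^sub>R u \<in> S" for g y u p
  proof -
    note d = C_k_on_SucD[OF that]
    have "((\<lambda>p. y + p *\<^sub>R u) has_derivative (\<lambda>h. h *\<^sub>R u)) (at p)" by (auto intro!: derivative_eq_intros)
    from diff_chain_at[OF this d] have "((\<lambda>p. g (y + p *\<^sub>R u)) has_derivative (\<lambda>h. frechet_derivative g (at (y + p *\<^sub>R u)) (h *\<^sub>R u))) (at p)"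
      by (simp add: o_def)
    then show ?thesis
      unfolding has_field_derivative_def linear_scale[OF has_derivative_linear[OF d]] by (simp add: mult_commute_abs)
  qed
  \<comment> \<open>\<open>\<phi>\<close> is the increment in direction \<open>w\<close> as a
    function of the displacement along \<open>v\<close>. The mean value theorem for
    \<open>\<phi>\<close>, and then for the difference of derivatives it produces, gives a mixed
    derivative at one intermediate point.\<close>
  define \<phi> where "\<phi> p = f (x + s *\<^sub>R w + p *\<^sub>R v) - f (x + p *\<^sub>R v)" for p
  have "(\<phi> has_real_derivative ?fv (x + s *\<^sub>R w + p *\<^sub>R v) - ?fv (x + p *\<^sub>R v)) (at p)" if "0 \<le> p" "p \<le> s" for p
    unfolding \<phi>_def
    by (intro DERIV_diff line C1) (use sub[of p s] sub[of p 0] that s in \<open>auto simp: algebra_simps\<close>)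
  from MVT2[OF s this] obtain p where p: "0 < p" "p < s"
    "\<phi> s - \<phi> 0 = s * (?fv (x + s *\<^sub>R w + p *\<^sub>R v) - ?fv (x + p *\<^sub>R v))" by auto
  have "((\<lambda>q. ?fv (x + p *\<^sub>R v + q *\<^sub>R w)) has_real_derivative frechet_derivative ?fv (at (x + p *\<^sub>R v + q *\<^sub>R w)) w) (at q)"
    if "0 \<le> q" "q \<le> s" for q
    by (intro line C1) (use sub[of p q] p that in auto)
  from MVT2[OF s this] obtain q where q: "0 < q" "q < s"
    "?fv (x + p *\<^sub>R v + s *\<^sub>R w) - ?fv (x + p *\<^sub>R v) = s * frechet_derivative ?fv (at (x + p *\<^sub>R v + q *\<^sub>R w)) w" by auto
  show ?thesis
    by (rule that[of p q]) (use p q in \<open>auto simp: \<phi>_def algebra_simps power2_eq_square\<close>)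
qed

text \<open>The second difference is symmetric in \<open>v\<close> and \<open>w\<close>. By
  \<open>second_difference\<close> the two mixed derivatives therefore take a common value at points
  arbitrarily close to \<open>x\<close>, and continuity excludes a gap between them at
  \<open>x\<close>.\<close>

lemma mixed_partials_commute:
  fixes f :: "'e::real_normed_vector \<Rightarrow> real"
  assumes "open S" and f: "smooth_on S f" and x: "x \<in> S"
  shows "frechet_derivative (\<lambda>y. frechet_derivative f (at y) v) (at x) w
    = frechet_derivative (\<lambda>y. frechet_derivative f (at y) w) (at x) v"
proof (rule ccontr)
  let ?A = "\<lambda>x. frechet_derivative (\<lambda>y. frechet_derivative f (at y) v) (at x) w"
  let ?B = "\<lambda>x. frechet_derivative (\<lambda>y. frechet_derivative f (at y) w) (at x) v"
  assume ne: "?A x \<noteq> ?B x"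
  define e where "e = \<bar>?A x - ?B x\<bar> / 2"
  have e: "e > 0" using ne by (simp add: e_def)
  have "continuous_on S ?A" "continuous_on S ?B"
    by (intro smooth_on_imp_continuous_on smooth_on_derivative f)+
  then have "isCont ?A x" "isCont ?B x" using assms continuous_on_eq_continuous_at by blast+
  then obtain d1 d2 where d: "d1 > 0" "\<And>y. dist y x < d1 \<Longrightarrow> dist (?A y) (?A x) < e"
    "d2 > 0" "\<And>y. dist y x < d2 \<Longrightarrow> dist (?B y) (?B x) < e"
    using e unfolding continuous_at_eps_delta by (metis dist_commute)
  obtain d3 where d3: "d3 > 0" "ball x d3 \<subseteq> S" using assms open_contains_ball by metis
  define \<delta> where "\<delta> = min d1 (min d2 d3)"
  have \<delta>: "\<delta> > 0" using d d3 by (simp add: \<delta>_def)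
  \<comment> \<open>With this step size all points \<open>x + p v + q w\<close> with
    \<open>p, q \<le> s\<close> stay within \<open>\<delta> / 2\<close> of \<open>x\<close>; the
    summand 1 covers \<open>v = w = 0\<close>.\<close>
  define s where "s = \<delta> / (2 * (norm v + norm w + 1))"
  have pos: "norm v + norm w + 1 > 0" by (simp add: add_nonneg_pos)
  have half_of: "\<delta> / (2 * c) * c = \<delta> / 2" if "c > 0" for c using that by simp
  have s: "s > 0" using \<delta> pos by (simp add: s_def)
  have close: "dist (x + p *\<^sub>R v + q *\<^sub>R w) x < \<delta>" if "p \<in> {0..s}" "q \<in> {0..s}" for p q
  proof -
    have "dist (x + p *\<^sub>R v + q *\<^sub>R w) x \<le> norm (p *\<^sub>R v) + norm (q *\<^sub>R w)"
      using norm_triangle_ineq[of "p *\<^sub>R v" "q *\<^sub>R w"] by (simp add: dist_norm add.assoc)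
    also have "\<dots> \<le> s * norm v + s * norm w" using that by (intro add_mono) (auto intro!: mult_right_mono)
    also have "\<dots> \<le> s * (norm v + norm w + 1)" using s by (simp add: algebra_simps)
    also have "\<dots> = \<delta> / 2" using half_of[OF pos] by (simp only: s_def)
    finally show ?thesis using \<delta> by simp
  qed
  have C2: "C_k_on 2 S f" using f by (simp add: smooth_on_def)
  have in1: "x + p *\<^sub>R v + q *\<^sub>R w \<in> S" if "p \<in> {0..s}" "q \<in> {0..s}" for p q
    using close[OF that] d3 by (auto simp: \<delta>_def dist_commute)
  then have in2: "x + p *\<^sub>R w + q *\<^sub>R v \<in> S" if "p \<in> {0..s}" "q \<in> {0..s}" for p q
    using that by (metis add.assoc add.commute)
  obtain p q where pq: "p \<in> {0..s}" "q \<in> {0..s}"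
    "f (x + s *\<^sub>R v + s *\<^sub>R w) - f (x + s *\<^sub>R v) - f (x + s *\<^sub>R w) + f x = s\<^sup>2 * ?A (x + p *\<^sub>R v + q *\<^sub>R w)"
    using second_difference[OF C2 s in1] by blast
  obtain p' q' where pq': "p' \<in> {0..s}" "q' \<in> {0..s}"
    "f (x + s *\<^sub>R w + s *\<^sub>R v) - f (x + s *\<^sub>R w) - f (x + s *\<^sub>R v) + f x = s\<^sup>2 * ?B (x + p' *\<^sub>R w + q' *\<^sub>R v)"
    using second_difference[OF C2 s in2] by blast
  have "s\<^sup>2 * ?A (x + p *\<^sub>R v + q *\<^sub>R w) = s\<^sup>2 * ?B (x + q' *\<^sub>R v + p' *\<^sub>R w)"
    using pq(3) pq'(3) by (simp add: algebra_simps)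
  then have eq: "?A (x + p *\<^sub>R v + q *\<^sub>R w) = ?B (x + q' *\<^sub>R v + p' *\<^sub>R w)" using s by simp
  have "dist (?A (x + p *\<^sub>R v + q *\<^sub>R w)) (?A x) < e" "dist (?B (x + q' *\<^sub>R v + p' *\<^sub>R w)) (?B x) < e"
    using d(2,4) close[OF pq(1,2)] close[OF pq'(2,1)] by (auto simp: \<delta>_def)
  then have "\<bar>?A x - ?B x\<bar> < 2 * e" using eq by (auto simp: dist_real_def abs_if split: if_splits)
  then show False by (simp add: e_def)
qed

lemma sum_fun_apply: "(\<Sum>i\<in>I. f i) x = (\<Sum>i\<in>I. f i x)"
  by (induction I rule: infinite_finite_induct) auto

lemma scaleR_fun_apply [simp]: "(c *\<^sub>R f) x = c *\<^sub>R f x"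
  by (simp add: scaleR_fun_def)

section \<open>Tangent vectors, frames and vector fields\<close>

text \<open>The orthonormal basis \<open>bs\<close> of the model space is a parameter: it indexes
  all local coordinates and frames, and its cardinality is the dimension.\<close>

locale manifold =
  fixes A :: "('m::{t2_space,second_countable_topology}, 'e::real_inner) atlas" and bs :: "'e set"
  assumes mfd: "smooth_manifold A" and bs: "onb bs"
begin

abbreviation "C \<equiv> smooth_funs A"
abbreviation "T \<equiv> tangent A"
abbreviation "VF \<equiv> vector_fields A"
abbreviation "OF1 \<equiv> one_forms A"

lemma chart_open:
  assumes "(U, \<phi>) \<in> A"
  shows "open U" "open (\<phi> ` U)" "homeomorphism U (\<phi> ` U) \<phi> (inv_into U \<phi>)"
  using mfd assms unfolding smooth_manifold_def by blast+

lemma chart_inv: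
  assumes "(U, \<phi>) \<in> A"
  shows "q \<in> U \<Longrightarrow> inv_into U \<phi> (\<phi> q) = q" "x \<in> \<phi> ` U \<Longrightarrow> inv_into U \<phi> x \<in> U"
    "x \<in> \<phi> ` U \<Longrightarrow> \<phi> (inv_into U \<phi> x) = x"
    and "continuous_on U \<phi>" "continuous_on (\<phi> ` U) (inv_into U \<phi>)"
  using chart_open(3)[OF assms] unfolding homeomorphism_def by (auto simp: f_inv_into_f inv_into_into)

lemma chart_image_open:
  assumes "(U, \<phi>) \<in> A" "open W"
  shows "open (\<phi> ` (U \<inter> W))"
proof -
  have "\<phi> ` (U \<inter> W) = \<phi> ` U \<inter> inv_into U \<phi> -` W" using chart_inv[OF assms(1)] by force
  then show ?thesis
    using continuous_on_open_vimage[OF chart_open(2)[OF assms(1)], of "inv_into U \<phi>"] chart_inv(5)[OF assms(1)] assms(2)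
    by (metis Int_commute)
qed

lemma chart_preimage_open:
  assumes "(U, \<phi>) \<in> A" "open S"
  shows "open {q \<in> U. \<phi> q \<in> S}"
proof -
  have "{q \<in> U. \<phi> q \<in> S} = \<phi> -` S \<inter> U" by auto
  then show ?thesis
    using continuous_on_open_vimage[OF chart_open(1)[OF assms(1)], of \<phi>] chart_inv(4)[OF assms(1)] assms(2) by simp
qed

lemma chart_exists: obtains U \<phi> where "(U, \<phi>) \<in> A" "p \<in> U"
proof -
  have "p \<in> \<Union>(fst ` A)" using mfd unfolding smooth_manifold_def by simp
  then obtain c where "c \<in> A" "p \<in> fst c" by auto
  then show ?thesis using that[of "fst c" "snd c"] by simp
qed

lemma transition_smooth: "(U, \<phi>) \<in> A \<Longrightarrow> (V, \<psi>) \<in> A \<Longrightarrow> smooth_on (\<phi> ` (U \<inter> V)) (\<psi> \<circ> inv_into U \<phi>)"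
  using mfd unfolding smooth_manifold_def by auto

lemma smooth_fun_onD:
  assumes "smooth_fun_on A W f" "(U, \<phi>) \<in> A" "V \<subseteq> U" "V \<subseteq> W"
  shows "smooth_on (\<phi> ` V) (f \<circ> inv_into U \<phi>)"
proof (rule smooth_on_subset)
  show "smooth_on (\<phi> ` (U \<inter> W)) (f \<circ> inv_into U \<phi>)"
    using assms(1,2) unfolding smooth_fun_on_def by auto
  show "\<phi> ` V \<subseteq> \<phi> ` (U \<inter> W)" using assms(3,4) by auto
qed

lemma smooth_fun_on_chartI:
  assumes "\<And>U \<phi>. (U, \<phi>) \<in> A \<Longrightarrow> smooth_on (\<phi> ` (U \<inter> W)) (\<lambda>x. f (inv_into U \<phi> x))"
  shows "smooth_fun_on A W f"
  using assms unfolding smooth_fun_on_def o_def by auto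

lemma smooth_fun_on_chartD:
  assumes "smooth_fun_on A W f" "(U, \<phi>) \<in> A"
  shows "smooth_on (\<phi> ` (U \<inter> W)) (\<lambda>x. f (inv_into U \<phi> x))"
  using smooth_fun_onD[OF assms, of "U \<inter> W"] by (simp add: o_def)

lemma smooth_funsD: "f \<in> C \<Longrightarrow> (U, \<phi>) \<in> A \<Longrightarrow> V \<subseteq> U \<Longrightarrow> smooth_on (\<phi> ` V) (f \<circ> inv_into U \<phi>)"
  using smooth_fun_onD[of UNIV f U \<phi> V] by (simp add: smooth_funs_def)

text \<open>One chart around each point is enough, since transition maps carry smoothness from it to
  every other chart.\<close>

lemma smooth_fun_onI:
  assumes "open W" and loc: "\<And>p. p \<in> W \<Longrightarrow> \<exists>U \<phi> V. (U, \<phi>) \<in> A \<and> p \<in> V \<and> open V \<and> V \<subseteq> U \<and> smooth_on (\<phi> ` V) (f \<circ> inv_into U \<phi>)"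
  shows "smooth_fun_on A W f"
  unfolding smooth_fun_on_def
proof clarify
  fix U' \<psi> assume \<psi>: "(U', \<psi>) \<in> A"
  show "smooth_on (\<psi> ` (U' \<inter> W)) (f \<circ> inv_into U' \<psi>)"
  proof (rule smooth_on_local)
    fix y assume "y \<in> \<psi> ` (U' \<inter> W)"
    then obtain q where q: "q \<in> U'" "q \<in> W" "y = \<psi> q" by auto
    then obtain U \<phi> V where \<phi>: "(U, \<phi>) \<in> A" "q \<in> V" "open V" "V \<subseteq> U" and s: "smooth_on (\<phi> ` V) (f \<circ> inv_into U \<phi>)"
      using loc by blast
    have o: "open (\<psi> ` (U' \<inter> V))" using chart_image_open[OF \<psi> \<phi>(3)] .
    have oV: "open (\<phi> ` V)" using chart_image_open[OF \<phi>(1,3)] \<phi>(4) by (simp add: Int_absorb1)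
    have "smooth_on (\<psi> ` (U' \<inter> V)) (\<lambda>x. (f \<circ> inv_into U \<phi>) ((\<phi> \<circ> inv_into U' \<psi>) x))"
      by (rule smooth_on_compose[OF bs o oV _ smooth_on_subset[OF transition_smooth[OF \<psi> \<phi>(1)]] s])
        (use \<phi>(4) chart_inv[OF \<psi>] in auto)
    then have "smooth_on (\<psi> ` (U' \<inter> V)) (f \<circ> inv_into U' \<psi>)"
      by (rule smooth_on_cong[OF _ o]) (use \<phi>(4) chart_inv[OF \<psi>] chart_inv[OF \<phi>(1)] in auto)
    then show "\<exists>T. open T \<and> y \<in> T \<and> smooth_on T (f \<circ> inv_into U' \<psi>)" using o q \<phi>(2) by blast
  qed
qed

lemma smooth_fun_on_subset: "smooth_fun_on A W f \<Longrightarrow> V \<subseteq> W \<Longrightarrow> smooth_fun_on A V f"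
  by (rule smooth_fun_on_chartI, rule smooth_on_subset[OF smooth_fun_on_chartD]) auto

lemma smooth_fun_on_local:
  assumes "open W" "\<And>p. p \<in> W \<Longrightarrow> \<exists>V. open V \<and> p \<in> V \<and> smooth_fun_on A V f"
  shows "smooth_fun_on A W f"
proof (rule smooth_fun_onI[OF assms(1)])
  fix p assume "p \<in> W"
  then obtain V where V: "open V" "p \<in> V" "smooth_fun_on A V f" using assms(2) by blast
  obtain U \<phi> where U: "(U, \<phi>) \<in> A" "p \<in> U" by (rule chart_exists)
  then show "\<exists>U \<phi> V. (U, \<phi>) \<in> A \<and> p \<in> V \<and> open V \<and> V \<subseteq> U \<and> smooth_on (\<phi> ` V) (f \<circ> inv_into U \<phi>)"
    using smooth_fun_onD[OF V(3) U(1), of "U \<inter> V"] V chart_open(1)[OF U(1)]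
    by (intro exI[of _ U] exI[of _ \<phi>] exI[of _ "U \<inter> V"]) auto
qed

lemma smooth_fun_on_cong:
  assumes "open W" "smooth_fun_on A W f" "\<And>q. q \<in> W \<Longrightarrow> f q = g q"
  shows "smooth_fun_on A W g"
proof (rule smooth_fun_on_chartI)
  fix U \<phi> assume U: "(U, \<phi>) \<in> A"
  show "smooth_on (\<phi> ` (U \<inter> W)) (\<lambda>x. g (inv_into U \<phi> x))"
    by (rule smooth_on_cong[OF smooth_fun_on_chartD[OF assms(2) U] chart_image_open[OF U assms(1)]])
      (use chart_inv(1)[OF U] assms(3) in auto)
qed

lemma smooth_fun_on_const: "open W \<Longrightarrow> smooth_fun_on A W (\<lambda>q. c)"
  by (intro smooth_fun_on_chartI smooth_on_const chart_image_open)

lemma smooth_fun_on_add: "open W \<Longrightarrow> smooth_fun_on A W f \<Longrightarrow> smooth_fun_on A W g \<Longrightarrow> smooth_fun_on A W (\<lambda>q. f q + g q)"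
  by (rule smooth_fun_on_chartI) (intro smooth_on_add smooth_fun_on_chartD chart_image_open)

lemma smooth_fun_on_mult: "open W \<Longrightarrow> smooth_fun_on A W f \<Longrightarrow> smooth_fun_on A W g \<Longrightarrow> smooth_fun_on A W (\<lambda>q. f q * g q)"
  by (rule smooth_fun_on_chartI) (intro smooth_on_mult smooth_fun_on_chartD chart_image_open)

lemma smooth_fun_on_sum:
  "open W \<Longrightarrow> (\<And>i. i \<in> I \<Longrightarrow> smooth_fun_on A W (f i)) \<Longrightarrow> smooth_fun_on A W (\<lambda>q. \<Sum>i\<in>I. f i q)"
  by (induction I rule: infinite_finite_induct) (auto intro: smooth_fun_on_add smooth_fun_on_const)

lemma C_const [intro, simp]: "(\<lambda>q. c) \<in> C"
  by (simp add: smooth_funs_def smooth_fun_on_const)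

lemma C_add [intro]: "f \<in> C \<Longrightarrow> g \<in> C \<Longrightarrow> (\<lambda>q. f q + g q) \<in> C"
  by (simp add: smooth_funs_def smooth_fun_on_add)

lemma C_mult [intro]: "f \<in> C \<Longrightarrow> g \<in> C \<Longrightarrow> (\<lambda>q. f q * g q) \<in> C"
  by (simp add: smooth_funs_def smooth_fun_on_mult)

lemma C_sum [intro]: "(\<And>i. i \<in> I \<Longrightarrow> f i \<in> C) \<Longrightarrow> (\<lambda>q. \<Sum>i\<in>I. f i q) \<in> C"
  by (simp add: smooth_funs_def smooth_fun_on_sum)

lemma C_minus [intro]: "f \<in> C \<Longrightarrow> (\<lambda>q. - f q) \<in> C"
  using C_mult[OF C_const[of "-1"]] by simp

lemma C_diff [intro]: "f \<in> C \<Longrightarrow> g \<in> C \<Longrightarrow> (\<lambda>q. f q - g q) \<in> C"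
  using C_add[of f "\<lambda>q. - g q"] C_minus[of g] by simp

lemma C_localI: "(\<And>p. \<exists>V. open V \<and> p \<in> V \<and> smooth_fun_on A V f) \<Longrightarrow> f \<in> C"
  unfolding smooth_funs_def using smooth_fun_on_local[OF open_UNIV] by auto

lemma C_imp_smooth_fun_on: "f \<in> C \<Longrightarrow> smooth_fun_on A W f"
  unfolding smooth_funs_def using smooth_fun_on_subset by auto

section \<open>Cut-off functions and the locality of derivations\<close>

lemma extension:
  assumes U: "(U, \<phi>) \<in> A" and p: "p \<in> U" and V: "open V" "p \<in> V"
  obtains r h where "r > 0" "ball (\<phi> p) r \<subseteq> \<phi> ` (U \<inter> V)"
    "\<And>x. dist (\<phi> p) x \<le> r / 3 \<Longrightarrow> h x = 1" "\<And>x. dist (\<phi> p) x \<ge> r \<Longrightarrow> h x = (0::real)"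
    "\<And>g. smooth_on (ball (\<phi> p) r) g \<Longrightarrow> (\<lambda>q. if q \<in> U then h (\<phi> q) * g (\<phi> q) else 0) \<in> C"
proof -
  let ?a = "\<phi> p"
  obtain r where r: "r > 0" "ball ?a r \<subseteq> \<phi> ` (U \<inter> V)"
    using chart_image_open[OF U V(1)] p V(2) open_contains_ball by (metis IntI imageI)
  \<comment> \<open>A plateau of radius \<open>r / 3\<close> makes \<open>h\<close> vanish from
    \<open>2 * (r / 3)\<close> on, strictly inside the ball on which \<open>g\<close> is
    smooth.\<close>
  obtain h where h: "smooth_on UNIV h" "\<And>x. dist ?a x \<le> r / 3 \<Longrightarrow> h x = 1" "\<And>x. dist ?a x \<ge> 2 * (r / 3) \<Longrightarrow> h x = (0::real)"
    using bump_exists[OF bs, of "r / 3" ?a] r(1) by auto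
  have "(\<lambda>q. if q \<in> U then h (\<phi> q) * g (\<phi> q) else 0) \<in> C" (is "?f \<in> C") if g: "smooth_on (ball ?a r) g" for g
  proof -
    \<comment> \<open>\<open>K\<close> is compact as the continuous image of a closed ball, hence
      closed because the manifold is Hausdorff. The extended function vanishes on \<open>- K\<close>
      and is smooth on the chart ball; these two open sets cover the manifold.\<close>
    define K where "K = inv_into U \<phi> ` cball ?a (2 * (r / 3))"
    have sub: "cball ?a (2 * (r / 3)) \<subseteq> \<phi> ` U" using r by force
    have "compact K" unfolding K_def
      by (rule compact_continuous_image[OF continuous_on_subset[OF chart_inv(5)[OF U] sub] compact_cball_onb[OF bs]])
    then have "closed K" by (rule compact_imp_closed)
    have 0: "?f q = 0" if "q \<in> - K" for q
    proof (cases "q \<in> U")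
      case True
      then have "dist ?a (\<phi> q) \<ge> 2 * (r / 3)"
        using that image_eqI[of q "inv_into U \<phi>" "\<phi> q" "cball ?a (2 * (r / 3))"] chart_inv(1)[OF U True]
        unfolding K_def by (force simp: not_le[symmetric])
      then show ?thesis using h(3) by simp
    qed simp
    have K0: "smooth_fun_on A (- K) ?f"
      by (rule smooth_fun_on_cong[OF _ smooth_fun_on_const[of _ 0]]) (use \<open>closed K\<close> 0 in auto)
    let ?V = "{q \<in> U. \<phi> q \<in> ball ?a r}"
    have V': "open ?V" by (rule chart_preimage_open[OF U open_ball])
    have im: "\<phi> ` ?V = ball ?a r" using r(2) by auto
    have "smooth_on (ball ?a r) (\<lambda>x. h x * g x)"
      by (rule smooth_on_mult[OF open_ball smooth_on_subset[OF h(1)] g]) simp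
    then have s: "smooth_on (\<phi> ` ?V) (?f \<circ> inv_into U \<phi>)" unfolding im
      by (rule smooth_on_cong[OF _ open_ball]) (use r(2) chart_inv[OF U] in auto)
    have V0: "smooth_fun_on A ?V ?f"
      by (rule smooth_fun_onI[OF V'], intro exI[of _ U] exI[of _ \<phi>] exI[of _ ?V] conjI) (use U V' s in auto)
    have "K \<subseteq> ?V" unfolding K_def using sub r(1) chart_inv[OF U] by (auto simp: subset_eq)
    show ?thesis
    proof (rule C_localI)
      fix p
      have "p \<in> - K \<or> p \<in> ?V" using \<open>K \<subseteq> ?V\<close> by blast
      then show "\<exists>V. open V \<and> p \<in> V \<and> smooth_fun_on A V ?f"
      proof
        assume "p \<in> - K"
        then show ?thesis using K0 \<open>closed K\<close> by (intro exI[of _ "- K"]) auto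
      next
        assume "p \<in> ?V"
        then show ?thesis using V0 V' by (intro exI[of _ ?V] conjI)
      qed
    qed
  qed
  then show ?thesis
    by (intro that[of r h] r h) (use r(1) in simp_all)
qed

lemma bump_fun:
  assumes "open V" "p \<in> V"
  obtains \<beta> W where "\<beta> \<in> C" "open W" "p \<in> W" "\<And>q. q \<in> W \<Longrightarrow> \<beta> q = 1" "\<And>q. q \<notin> V \<Longrightarrow> \<beta> q = 0"
proof -
  obtain U \<phi> where U: "(U, \<phi>) \<in> A" "p \<in> U" by (rule chart_exists)
  obtain r and h :: "'e \<Rightarrow> real" where r: "r > 0" "ball (\<phi> p) r \<subseteq> \<phi> ` (U \<inter> V)"
    "\<And>x. dist (\<phi> p) x \<le> r / 3 \<Longrightarrow> h x = 1" "\<And>x. dist (\<phi> p) x \<ge> r \<Longrightarrow> h x = (0::real)"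
    "\<And>g. smooth_on (ball (\<phi> p) r) g \<Longrightarrow> (\<lambda>q. if q \<in> U then h (\<phi> q) * g (\<phi> q) else 0) \<in> C"
    using extension[OF U assms] by blast
  let ?\<beta> = "\<lambda>q. if q \<in> U then h (\<phi> q) * 1 else 0"
  show ?thesis
  proof (rule that)
    show "?\<beta> \<in> C" by (rule r(5)[OF smooth_on_const[OF open_ball]])
    show "open {q \<in> U. \<phi> q \<in> ball (\<phi> p) (r / 3)}" by (rule chart_preimage_open[OF U(1) open_ball])
    show "?\<beta> q = 0" if "q \<notin> V" for q
    proof (cases "q \<in> U")
      case True
      have "\<phi> q \<notin> ball (\<phi> p) r"
      proof
        assume "\<phi> q \<in> ball (\<phi> p) r"
        then obtain q' where "q' \<in> U \<inter> V" "\<phi> q = \<phi> q'" using r(2) by blast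
        then show False using chart_inv(1)[OF U(1)] True that by (metis IntD1 IntD2)
      qed
      then show ?thesis using r(4) by simp
    qed simp
  qed (use U r in auto)
qed

lemma tangentD:
  assumes "D \<in> T p"
  shows "f \<in> C \<Longrightarrow> g \<in> C \<Longrightarrow> D (\<lambda>q. f q + g q) = D f + D g"
    and "f \<in> C \<Longrightarrow> D (\<lambda>q. c * f q) = c * D f"
    and "f \<in> C \<Longrightarrow> g \<in> C \<Longrightarrow> D (\<lambda>q. f q * g q) = D f * g p + f p * D g"
    and "f \<notin> C \<Longrightarrow> D f = 0"
  using assms unfolding tangent_def linear_on_def by (auto simp: plus_fun_def scaleR_fun_def)

lemma tangentI:
  assumes "\<And>f g. f \<in> C \<Longrightarrow> g \<in> C \<Longrightarrow> D (\<lambda>q. f q + g q) = D f + D g"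
    and "\<And>f c. f \<in> C \<Longrightarrow> D (\<lambda>q. c * f q) = c * D f"
    and "\<And>f g. f \<in> C \<Longrightarrow> g \<in> C \<Longrightarrow> D (\<lambda>q. f q * g q) = D f * g p + f p * D g"
    and "\<And>f. f \<notin> C \<Longrightarrow> D f = 0"
  shows "D \<in> T p"
  using assms unfolding tangent_def linear_on_def by (auto simp: plus_fun_def scaleR_fun_def)

text \<open>The Leibniz rule for \<open>1 * 1\<close> gives \<open>D 1 = 2 * D 1\<close>.\<close>

lemma tangent_const: "D \<in> T p \<Longrightarrow> D (\<lambda>q. c) = 0"
  using tangentD(3)[of D p "\<lambda>q. 1" "\<lambda>q. 1"] tangentD(2)[of D p "\<lambda>q. 1" c] by simp

lemma tangent_minus: "D \<in> T p \<Longrightarrow> f \<in> C \<Longrightarrow> D (\<lambda>q. - f q) = - D f"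
  using tangentD(2)[of D p f "-1"] by simp

lemma tangent_diff: "D \<in> T p \<Longrightarrow> f \<in> C \<Longrightarrow> g \<in> C \<Longrightarrow> D (\<lambda>q. f q - g q) = D f - D g"
  using tangentD(1)[of D p f "\<lambda>q. - g q"] tangent_minus[of D p g] C_minus[of g] by simp

lemma tangent_sum: "D \<in> T p \<Longrightarrow> (\<And>i. i \<in> I \<Longrightarrow> f i \<in> C) \<Longrightarrow> D (\<lambda>q. \<Sum>i\<in>I. f i q) = (\<Sum>i\<in>I. D (f i))"
proof (induction I rule: infinite_finite_induct)
  case (insert x F)
  then show ?case using tangentD(1)[of D p "f x" "\<lambda>q. \<Sum>i\<in>F. f i q"] C_sum[of F f] by simp
qed (simp_all add: tangent_const)

text \<open>For a bump \<open>\<beta>\<close> vanishing outside \<open>V\<close> the product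
  \<open>\<beta> (f - g)\<close> is identically 0. By the Leibniz rule \<open>D\<close> of it is
  also \<open>D (f - g)\<close>, because \<open>\<beta> p = 1\<close> and \<open>f p = g p\<close>.
  So derivations of global functions see only germs.\<close>

lemma tangent_local:
  assumes D: "D \<in> T p" and fg: "f \<in> C" "g \<in> C" and V: "open V" "p \<in> V" "\<And>q. q \<in> V \<Longrightarrow> f q = g q"
  shows "D f = D g"
proof -
  obtain \<beta> W where \<beta>0: "\<beta> \<in> C" "open W" "p \<in> W" "\<And>q. q \<in> W \<Longrightarrow> \<beta> q = 1" "\<And>q. q \<notin> V \<Longrightarrow> \<beta> q = 0"
    using bump_fun[OF V(1,2)] by blast
  note \<beta> = \<beta>0(1,3-5)
  have "(\<lambda>q. \<beta> q * (f q - g q)) = (\<lambda>q. 0)" using V(3) \<beta>(4) by fastforce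
  then have "0 = D (\<lambda>q. \<beta> q * (f q - g q))" using tangent_const[OF D] by simp
  also have "\<dots> = D f - D g"
    using tangentD(3)[OF D \<beta>(1) C_diff[OF fg]] tangent_diff[OF D fg] \<beta>(2,3) V(2,3) by simp
  finally show ?thesis by simp
qed

text \<open>The coordinate vector at \<open>q\<close> in direction \<open>v\<close>. The value 0 on
  non-smooth functions is the convention of \<open>tangent\<close>.\<close>

definition chart_vec :: "'m set \<Rightarrow> ('m \<Rightarrow> 'e) \<Rightarrow> 'm \<Rightarrow> 'e \<Rightarrow> 'm tvec"
  where "chart_vec U \<phi> q v f = (if f \<in> C then frechet_derivative (f \<circ> inv_into U \<phi>) (at (\<phi> q)) v else 0)"

lemma chart_has_derivative:
  assumes "f \<in> C" "(U, \<phi>) \<in> A" "q \<in> U"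
  shows "((f \<circ> inv_into U \<phi>) has_derivative (\<lambda>v. chart_vec U \<phi> q v f)) (at (\<phi> q))"
  using smooth_on_has_derivative[OF smooth_funsD[OF assms(1,2) subset_refl]] assms
  by (simp add: chart_vec_def)

lemma chart_vec_eqI:
  assumes "f \<in> C" "(f \<circ> inv_into U \<phi> has_derivative f') (at (\<phi> q))"
  shows "chart_vec U \<phi> q v f = f' v"
  using assms frechet_derivative_at[OF assms(2)] by (simp add: chart_vec_def)

lemma chart_vec_tangent:
  assumes U: "(U, \<phi>) \<in> A" "q \<in> U"
  shows "chart_vec U \<phi> q v \<in> T q"
proof (rule tangentI)
  note d = chart_has_derivative[OF _ U]
  fix f g c assume f: "f \<in> C"
  show "chart_vec U \<phi> q v (\<lambda>q. c * f q) = c * chart_vec U \<phi> q v f"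
    by (rule chart_vec_eqI) (use has_derivative_mult_right[OF d[OF f], of c] f in \<open>auto simp: o_def\<close>)
  assume g: "g \<in> C"
  show "chart_vec U \<phi> q v (\<lambda>q. f q + g q) = chart_vec U \<phi> q v f + chart_vec U \<phi> q v g"
    by (rule chart_vec_eqI) (use has_derivative_add[OF d[OF f] d[OF g]] f g in \<open>auto simp: o_def\<close>)
  show "chart_vec U \<phi> q v (\<lambda>q. f q * g q) = chart_vec U \<phi> q v f * g q + f q * chart_vec U \<phi> q v g"
    by (rule chart_vec_eqI[THEN trans])
      (use has_derivative_mult[OF d[OF f] d[OF g]] f g chart_inv(1)[OF U] in \<open>auto simp: o_def add_ac\<close>)
qed (simp add: chart_vec_def)

lemma chart_vec_expand:
  assumes "(U, \<phi>) \<in> A" "q \<in> U"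
  shows "chart_vec U \<phi> q v f = (\<Sum>u\<in>bs. (v \<bullet> u) * chart_vec U \<phi> q u f)"
proof (cases "f \<in> C")
  case True
  show ?thesis using linear_onb[OF bs has_derivative_linear[OF chart_has_derivative[OF True assms]], of v] by simp
qed (simp add: chart_vec_def)

text \<open>By Hadamard's lemma, near \<open>p\<close> a smooth \<open>f\<close> is
  \<open>f p\<close> plus a sum of products \<open>X u * g u\<close> of centred coordinates with
  smooth factors. Since \<open>X u p = 0\<close>, the Leibniz rule leaves \<open>D (X u)\<close>
  times the partial derivative \<open>g u\<close> at \<open>p\<close>. Both factors are first
  extended to global functions, on which \<open>D\<close> is defined.\<close>

lemma tangent_eq_chart_vec:
  assumes D: "D \<in> T p" and U: "(U, \<phi>) \<in> A" "p \<in> U"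
  obtains v where "D = chart_vec U \<phi> p v"
proof -
  let ?a = "\<phi> p"
  obtain r and h :: "'e \<Rightarrow> real" where r0: "r > 0" "ball ?a r \<subseteq> \<phi> ` (U \<inter> UNIV)"
    "\<And>x. dist ?a x \<le> r / 3 \<Longrightarrow> h x = 1" "\<And>x. dist ?a x \<ge> r \<Longrightarrow> h x = 0"
    "\<And>g. smooth_on (ball ?a r) g \<Longrightarrow> (\<lambda>q. if q \<in> U then h (\<phi> q) * g (\<phi> q) else 0) \<in> C"
    using extension[OF U open_UNIV UNIV_I] by blast
  have r: "r > 0" "ball ?a r \<subseteq> \<phi> ` U" "\<And>x. dist ?a x \<le> r / 3 \<Longrightarrow> h x = 1" using r0(1-3) by simp_all
  note r = r r0(5)
  define ext where "ext g q = (if q \<in> U then h (\<phi> q) * g (\<phi> q) else 0)" for g q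
  have ext: "smooth_on (ball ?a r) g \<Longrightarrow> ext g \<in> C" for g using r(4) by (simp add: ext_def[abs_def])
  have ext_p: "ext g p = g ?a" for g using U(2) r(1,3) by (simp add: ext_def)
  define X where "X u = ext (\<lambda>x. (x - ?a) \<bullet> u)" for u
  have X: "X u \<in> C" for u unfolding X_def
    by (intro ext smooth_on_bounded_linear[OF bounded_linear_inner_left] smooth_on_diff smooth_on_ident smooth_on_const open_ball)
  \<comment> \<open>The components of the vector are the values of \<open>D\<close> on the cut-off,
    centred coordinate functions.\<close>
  define v where "v = (\<Sum>u\<in>bs. D (X u) *\<^sub>R u)"
  have "D f = chart_vec U \<phi> p v f" for f
  proof (cases "f \<in> C")
    case f: True
    have F: "smooth_on (ball ?a r) (f \<circ> inv_into U \<phi>)"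
      using smooth_on_subset[OF smooth_funsD[OF f U(1) subset_refl] r(2)] .
    obtain g :: "'e \<Rightarrow> 'e \<Rightarrow> real" where g: "\<And>u. smooth_on (ball ?a r) (g u)"
      "\<And>x. x \<in> ball ?a r \<Longrightarrow> (f \<circ> inv_into U \<phi>) x = (f \<circ> inv_into U \<phi>) ?a + (\<Sum>u\<in>bs. ((x - ?a) \<bullet> u) * g u x)"
      "\<And>u. g u ?a = frechet_derivative (f \<circ> inv_into U \<phi>) (at ?a) u"
      using hadamard[OF bs F] by blast
    have G: "ext (g u) \<in> C" for u by (rule ext[OF g(1)])
    let ?s = "\<lambda>q. \<Sum>u\<in>bs. X u q * ext (g u) q"
    have s: "?s \<in> C" by (intro C_sum C_mult X G)
    have "D f = D (\<lambda>q. f p + ?s q)"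
    proof (rule tangent_local[OF D f])
      show "open {q \<in> U. \<phi> q \<in> ball ?a (r / 3)}" by (rule chart_preimage_open[OF U(1) open_ball])
      show "f q = f p + ?s q" if q: "q \<in> {q \<in> U. \<phi> q \<in> ball ?a (r / 3)}" for q
      proof -
        have "X u q = (\<phi> q - ?a) \<bullet> u" "ext (g u) q = g u (\<phi> q)" for u
          using q r(3) by (auto simp: X_def ext_def)
        then show ?thesis using g(2)[of "\<phi> q"] q r(1) chart_inv(1)[OF U(1)] U(2) by simp
      qed
    qed (use U r(1) s in auto)
    also have "\<dots> = (\<Sum>u\<in>bs. D (X u) * ext (g u) p + X u p * D (ext (g u)))"
      using tangentD(1)[OF D C_const s] tangent_const[OF D] tangent_sum[OF D, of bs "\<lambda>u q. X u q * ext (g u) q"] X G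
        tangentD(3)[OF D X G] by (simp add: C_mult)
    also have "\<dots> = (\<Sum>u\<in>bs. D (X u) * chart_vec U \<phi> p u f)"
      using f by (simp add: ext_p X_def g(3) chart_vec_def)
    also have "\<dots> = chart_vec U \<phi> p v f"
      by (simp add: v_def linear_sum[OF has_derivative_linear[OF chart_has_derivative[OF f U]]]
        linear_scale[OF has_derivative_linear[OF chart_has_derivative[OF f U]]])
    finally show ?thesis .
  qed (simp add: chart_vec_def tangentD(4)[OF D])
  then show ?thesis using that by blast
qed

text \<open>Local frames made of global objects: the functions \<open>x\<close> and the fields
  \<open>E\<close> live on the whole manifold but are dual to each other, and spanning, only over
  \<open>W\<close>. This suits forms and sections that can be tested only on global vector
  fields.\<close>

definition frame_on :: "'m set \<Rightarrow> ('e \<Rightarrow> 'm \<Rightarrow> real) \<Rightarrow> ('e \<Rightarrow> 'm vfield) \<Rightarrow> bool"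
  where "frame_on W x E \<longleftrightarrow> open W \<and> (\<forall>u. x u \<in> C) \<and> (\<forall>u. E u \<in> VF) \<and>
    (\<forall>q\<in>W. \<forall>D\<in>T q. D = (\<Sum>u\<in>bs. D (x u) *\<^sub>R E u q)) \<and>
    (\<forall>q\<in>W. \<forall>u\<in>bs. \<forall>v\<in>bs. E u q (x v) = (if u = v then 1 else 0))"

lemma frame_onD:
  assumes "frame_on W x E"
  shows "open W" "x u \<in> C" "E u \<in> VF"
    "q \<in> W \<Longrightarrow> D \<in> T q \<Longrightarrow> D = (\<Sum>u\<in>bs. D (x u) *\<^sub>R E u q)"
    "q \<in> W \<Longrightarrow> u \<in> bs \<Longrightarrow> v \<in> bs \<Longrightarrow> E u q (x v) = (if u = v then 1 else 0)"
  using assms unfolding frame_on_def by blast+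

text \<open>Coordinate functions and coordinate fields are cut off by the same \<open>h\<close>, and
  \<open>W\<close> lies where \<open>h = 1\<close>. The identification with \<open>chart_vec\<close>
  is recorded for the smoothness of the adjoint action, which needs coordinate fields
  explicitly.\<close>

lemma chart_frame_exists:
  assumes U: "(U, \<phi>) \<in> A" "p \<in> U"
  shows "\<exists>W x E. p \<in> W \<and> W \<subseteq> U \<and> frame_on W x E \<and> (\<forall>q\<in>W. \<forall>u. E u q = chart_vec U \<phi> q u)"
proof -
  let ?a = "\<phi> p"
  obtain r and h :: "'e \<Rightarrow> real" where r0: "r > 0" "ball ?a r \<subseteq> \<phi> ` (U \<inter> UNIV)"
    "\<And>x. dist ?a x \<le> r / 3 \<Longrightarrow> h x = 1" "\<And>x. dist ?a x \<ge> r \<Longrightarrow> h x = 0"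
    "\<And>g. smooth_on (ball ?a r) g \<Longrightarrow> (\<lambda>q. if q \<in> U then h (\<phi> q) * g (\<phi> q) else 0) \<in> C"
    using extension[OF U open_UNIV UNIV_I] by blast
  have r: "r > 0" "ball ?a r \<subseteq> \<phi> ` U" "\<And>x. dist ?a x \<le> r / 3 \<Longrightarrow> h x = 1" using r0(1-3) by simp_all
  note r = r r0(5)
  define x where "x u q = (if q \<in> U then h (\<phi> q) * ((\<phi> q - ?a) \<bullet> u) else 0)" for u q
  define E where "E u q = (if q \<in> U then h (\<phi> q) *\<^sub>R chart_vec U \<phi> q u else 0)" for u q
  define W where "W = {q \<in> U. \<phi> q \<in> ball ?a (r / 3)}"
  have W: "open W" unfolding W_def by (rule chart_preimage_open[OF U(1) open_ball])
  have pW: "p \<in> W" using U r(1) by (simp add: W_def)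
  have x: "x u \<in> C" for u unfolding x_def[abs_def]
    by (rule r(4)) (intro smooth_on_bounded_linear[OF bounded_linear_inner_left] smooth_on_diff smooth_on_ident smooth_on_const open_ball)
  have E: "E u \<in> VF" for u
    unfolding vector_fields_def
  proof (intro CollectI conjI allI ballI)
    show "E u q \<in> T q" for q
      by (rule tangentI) (auto simp: E_def algebra_simps tangentD[OF chart_vec_tangent[OF U(1)]] split: if_splits)
    fix f assume f: "f \<in> C"
    have "(\<lambda>q. E u q f) = (\<lambda>q. if q \<in> U then h (\<phi> q) * frechet_derivative (f \<circ> inv_into U \<phi>) (at (\<phi> q)) u else 0)"
      using f by (auto simp: E_def chart_vec_def)
    also have "\<dots> \<in> C"
      by (rule r(4)) (rule smooth_on_derivative[OF smooth_on_subset[OF smooth_funsD[OF f U(1) subset_refl] r(2)]])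
    finally show "(\<lambda>q. E u q f) \<in> C" .
  qed
  have q1: "q \<in> U" "h (\<phi> q) = 1" if "q \<in> W" for q using that r(3) by (auto simp: W_def)
  have dx: "chart_vec U \<phi> q v (x u) = v \<bullet> u" if q: "q \<in> W" for q u v
  proof (rule chart_vec_eqI[OF x])
    have d: "((\<lambda>y. (y - ?a) \<bullet> u) has_derivative (\<lambda>v. v \<bullet> u)) (at (\<phi> q))"
      by (auto intro!: derivative_eq_intros)
    show "(x u \<circ> inv_into U \<phi> has_derivative (\<lambda>v. v \<bullet> u)) (at (\<phi> q))"
    proof (rule has_derivative_transform_within_open[OF d open_ball[of ?a "r / 3"]])
      show "\<phi> q \<in> ball ?a (r / 3)" using q by (simp add: W_def)
      fix y assume y: "y \<in> ball ?a (r / 3)"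
      then have "y \<in> \<phi> ` U" using r(1,2) by (auto simp: subset_eq)
      then show "(y - ?a) \<bullet> u = (x u \<circ> inv_into U \<phi>) y"
        using y r(3) chart_inv[OF U(1)] by (simp add: x_def)
    qed
  qed
  have f1: "D = (\<Sum>u\<in>bs. D (x u) *\<^sub>R E u q)" if q: "q \<in> W" and D: "D \<in> T q" for q D
  proof
    fix f
    obtain v where "D = chart_vec U \<phi> q v" using tangent_eq_chart_vec[OF D U(1) q1(1)[OF q]] .
    then show "D f = (\<Sum>u\<in>bs. D (x u) *\<^sub>R E u q) f"
      using q1[OF q] dx[OF q] chart_vec_expand[OF U(1) q1(1)[OF q], of v f] by (simp add: sum_fun_apply E_def)
  qed
  have f2: "E u q (x v) = (if u = v then 1 else 0)" if "q \<in> W" "u \<in> bs" "v \<in> bs" for q u v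
    using q1[OF that(1)] dx[OF that(1)] onbD3[OF bs that(2,3)] by (simp add: E_def)
  have "frame_on W x E"
    unfolding frame_on_def by (intro conjI ballI allI W x E f1 f2)
  moreover have "W \<subseteq> U" using q1(1) by (rule subsetI)
  moreover have "E u q = chart_vec U \<phi> q u" if "q \<in> W" for u q
    unfolding E_def if_P[OF q1(1)[OF that]] q1(2)[OF that] by (rule scaleR_one)
  ultimately show ?thesis using pW by (intro exI[of _ W] exI[of _ x] exI[of _ E] conjI ballI allI)
qed

lemma frame_on_exists: "\<exists>W x E. p \<in> W \<and> frame_on W x E"
proof -
  obtain U \<phi> where "(U, \<phi>) \<in> A" "p \<in> U" by (rule chart_exists)
  from chart_frame_exists[OF this] show ?thesis by (elim exE conjE, intro exI conjI)
qed

end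

section \<open>Duals and biduals of finite dimensional subspaces\<close>

lemma linear_onD:
  assumes "linear_on V f"
  shows "x \<in> V \<Longrightarrow> y \<in> V \<Longrightarrow> f (x + y) = f x + f y" "x \<in> V \<Longrightarrow> f (c *\<^sub>R x) = c *\<^sub>R f x"
  using assms by (auto simp: linear_on_def)

lemma linear_on_0: "linear_on V f \<Longrightarrow> 0 \<in> V \<Longrightarrow> f 0 = 0"
  using linear_onD(2)[of V f 0 0] by simp

lemma linear_on_minus: "linear_on V f \<Longrightarrow> x \<in> V \<Longrightarrow> f (- x) = - f x"
  using linear_onD(2)[of V f x "-1"] by simp

lemma linear_on_diff:
  "subspace V \<Longrightarrow> linear_on V f \<Longrightarrow> x \<in> V \<Longrightarrow> y \<in> V \<Longrightarrow> f (x - y) = f x - f y"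
  using linear_onD(1)[of V f x "- y"] linear_on_minus[of V f y] subspace_neg[of V y] by simp

lemma linear_on_sum:
  assumes "subspace V" "linear_on V f" "\<And>i. i \<in> I \<Longrightarrow> g i \<in> V"
  shows "f (\<Sum>i\<in>I. g i) = (\<Sum>i\<in>I. f (g i))"
  using assms(3)
proof (induction I rule: infinite_finite_induct)
  case (insert x F)
  then show ?case using linear_onD(1)[OF assms(2), of "g x" "sum g F"] subspace_sum[OF assms(1), of F g] by simp
qed (use linear_on_0[OF assms(2)] subspace_0[OF assms(1)] in simp_all)

lemma dual_linear: "a \<in> dual V \<Longrightarrow> linear_on V a" and dual_outside: "a \<in> dual V \<Longrightarrow> x \<notin> V \<Longrightarrow> a x = 0"
  by (auto simp: dual_def)

lemma dualI:
  assumes "\<And>x y. x \<in> V \<Longrightarrow> y \<in> V \<Longrightarrow> a (x + y) = a x + a y" "\<And>x c. x \<in> V \<Longrightarrow> a (c *\<^sub>R x) = c * a x"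
    and "\<And>x. x \<notin> V \<Longrightarrow> a x = 0"
  shows "a \<in> dual V"
  using assms by (auto simp: dual_def linear_on_def)

lemma dual_eqI: "a \<in> dual V \<Longrightarrow> b \<in> dual V \<Longrightarrow> (\<And>x. x \<in> V \<Longrightarrow> a x = b x) \<Longrightarrow> a = b"
  by (rule ext) (metis dual_outside)

lemma subspace_dual: "subspace (dual V)"
  unfolding subspace_def
proof (intro conjI ballI allI)
  show "0 \<in> dual V" by (rule dualI) simp_all
  fix a b :: "'a \<Rightarrow> real" and c :: real assume a: "a \<in> dual V"
  show "c *\<^sub>R a \<in> dual V"
    by (rule dualI) (simp_all add: linear_onD[OF dual_linear[OF a]] dual_outside[OF a] algebra_simps)
  assume b: "b \<in> dual V"
  show "a + b \<in> dual V"
    by (rule dualI) (simp_all add: linear_onD[OF dual_linear[OF a]] linear_onD[OF dual_linear[OF b]]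
        dual_outside[OF a] dual_outside[OF b] algebra_simps)
qed

text \<open>Finite dimensionality of a subspace of a possibly infinite dimensional type, in the form
  in which it is used: a finite family with coordinate functionals that reproduce every vector.
  Biorthogonality is not part of it.\<close>

definition dual_frame :: "'v::real_vector set \<Rightarrow> 'i set \<Rightarrow> ('i \<Rightarrow> 'v) \<Rightarrow> ('i \<Rightarrow> 'v \<Rightarrow> real) \<Rightarrow> bool"
  where "dual_frame V I e c \<longleftrightarrow> subspace V \<and> finite I \<and> (\<forall>i\<in>I. e i \<in> V \<and> c i \<in> dual V) \<and>
    (\<forall>x\<in>V. (\<Sum>i\<in>I. c i x *\<^sub>R e i) = x)"

lemma dual_frameD:
  assumes "dual_frame V I e c"
  shows "subspace V" "finite I" "i \<in> I \<Longrightarrow> e i \<in> V" "i \<in> I \<Longrightarrow> c i \<in> dual V"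
    "x \<in> V \<Longrightarrow> (\<Sum>i\<in>I. c i x *\<^sub>R e i) = x"
  using assms by (auto simp: dual_frame_def)

lemma dual_frame_expand_dual:
  assumes "dual_frame V I e c" "b \<in> dual V"
  shows "(\<Sum>i\<in>I. b (e i) *\<^sub>R c i) = b"
proof (rule dual_eqI[OF _ assms(2)])
  note d = dual_frameD[OF assms(1)]
  show "(\<Sum>i\<in>I. b (e i) *\<^sub>R c i) \<in> dual V"
    by (intro subspace_sum[OF subspace_dual] subspace_scale[OF subspace_dual] d(4))
  fix x assume x: "x \<in> V"
  have "b x = b (\<Sum>i\<in>I. c i x *\<^sub>R e i)" using d(5)[OF x] by simp
  also have "\<dots> = (\<Sum>i\<in>I. b (c i x *\<^sub>R e i))"
    by (rule linear_on_sum[OF d(1) dual_linear[OF assms(2)]]) (intro subspace_scale[OF d(1)] d(3))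
  also have "\<dots> = (\<Sum>i\<in>I. c i x * b (e i))"
    by (rule sum.cong) (simp_all add: linear_onD(2)[OF dual_linear[OF assms(2)]] d(3))
  finally show "(\<Sum>i\<in>I. b (e i) *\<^sub>R c i) x = b x" by (simp add: sum_fun_apply mult.commute)
qed

lemma dual_frame_separates:
  assumes "dual_frame V I e c" "x \<in> V" "y \<in> V" "\<And>b. b \<in> dual V \<Longrightarrow> b x = b y"
  shows "x = y"
proof -
  note d = dual_frameD[OF assms(1)]
  have "(\<Sum>i\<in>I. c i x *\<^sub>R e i) = (\<Sum>i\<in>I. c i y *\<^sub>R e i)"
    by (rule sum.cong) (simp_all add: assms(4)[OF d(4)])
  then show ?thesis using d(5) assms(2,3) by simp
qed

lemma bidual_elem:
  assumes fr: "dual_frame V I e c" and F: "linear_on (dual V) F"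
  shows "bidual_elem V F \<in> V" and "b \<in> dual V \<Longrightarrow> b (bidual_elem V F) = F b"
proof -
  note d = dual_frameD[OF fr]
  \<comment> \<open>Evaluating \<open>F\<close> on the coordinate functionals gives the coordinates
    of the vector that represents it.\<close>
  let ?x = "\<Sum>i\<in>I. F (c i) *\<^sub>R e i"
  have x: "?x \<in> V" by (intro subspace_sum[OF d(1)] subspace_scale[OF d(1)] d(3))
  have bx: "b ?x = F b" if b: "b \<in> dual V" for b
  proof -
    have "b ?x = (\<Sum>i\<in>I. b (F (c i) *\<^sub>R e i))"
      by (rule linear_on_sum[OF d(1) dual_linear[OF b]]) (intro subspace_scale[OF d(1)] d(3))
    also have "\<dots> = (\<Sum>i\<in>I. F (b (e i) *\<^sub>R c i))"
      by (rule sum.cong) (simp_all add: linear_onD(2)[OF dual_linear[OF b]] linear_onD(2)[OF F] d)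
    also have "\<dots> = F (\<Sum>i\<in>I. b (e i) *\<^sub>R c i)"
      by (rule linear_on_sum[OF subspace_dual F, symmetric]) (intro subspace_scale[OF subspace_dual] d(4))
    finally show ?thesis using dual_frame_expand_dual[OF fr b] by simp
  qed
  have "\<exists>!x. x \<in> V \<and> (\<forall>b\<in>dual V. b x = F b)"
  proof (rule ex1I[of _ ?x])
    fix y assume "y \<in> V \<and> (\<forall>b\<in>dual V. b y = F b)"
    then show "y = ?x" using dual_frame_separates[OF fr, of y ?x] x bx by simp
  qed (use x bx in simp)
  from theI'[OF this] show "bidual_elem V F \<in> V" "b \<in> dual V \<Longrightarrow> b (bidual_elem V F) = F b"
    unfolding bidual_elem_def by auto
qed

section \<open>Vector fields, one-forms and Lie derivatives\<close>

context manifold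
begin

lemma subspace_T: "subspace (T p)"
  unfolding subspace_def
proof (intro conjI ballI allI)
  show "0 \<in> T p" by (rule tangentI) simp_all
  fix D D' c assume D: "D \<in> T p"
  show "c *\<^sub>R D \<in> T p" by (rule tangentI) (simp_all add: tangentD[OF D] algebra_simps)
  assume D': "D' \<in> T p"
  show "D + D' \<in> T p" by (rule tangentI) (simp_all add: tangentD[OF D] tangentD[OF D'] algebra_simps)
qed

lemmas T_add = subspace_add[OF subspace_T] and T_scale = subspace_scale[OF subspace_T]
  and T_diff = subspace_diff[OF subspace_T] and T_0 = subspace_0[OF subspace_T]

lemma T_eqI: "D \<in> T p \<Longrightarrow> D' \<in> T p \<Longrightarrow> (\<And>f. f \<in> C \<Longrightarrow> D f = D' f) \<Longrightarrow> D = D'"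
  by (rule ext) (metis tangentD(4))

lemma VF_T: "X \<in> VF \<Longrightarrow> X p \<in> T p" and VF_C: "X \<in> VF \<Longrightarrow> f \<in> C \<Longrightarrow> (\<lambda>p. X p f) \<in> C"
  by (auto simp: vector_fields_def)

lemma VF_I: "(\<And>p. X p \<in> T p) \<Longrightarrow> (\<And>f. f \<in> C \<Longrightarrow> (\<lambda>p. X p f) \<in> C) \<Longrightarrow> X \<in> VF"
  by (auto simp: vector_fields_def)

lemma VF_scale: "f \<in> C \<Longrightarrow> X \<in> VF \<Longrightarrow> (\<lambda>p. f p *\<^sub>R X p) \<in> VF"
  by (rule VF_I) (auto intro: subspace_scale[OF subspace_T] VF_T VF_C C_mult)

lemma VF_add: "X \<in> VF \<Longrightarrow> Y \<in> VF \<Longrightarrow> (\<lambda>p. X p + Y p) \<in> VF"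
  by (rule VF_I) (auto intro: subspace_add[OF subspace_T] VF_T VF_C C_add)

lemma VF_0: "(\<lambda>p. 0) \<in> VF"
  by (rule VF_I) (auto intro: subspace_0[OF subspace_T])

lemma VF_sum: "(\<And>i. i \<in> I \<Longrightarrow> X i \<in> VF) \<Longrightarrow> (\<lambda>p. \<Sum>i\<in>I. X i p) \<in> VF"
  by (induction I rule: infinite_finite_induct) (auto intro: VF_add VF_0)

lemma vf_bracket_VF:
  assumes X: "X \<in> VF" and Y: "Y \<in> VF"
  shows "vf_bracket X Y \<in> VF"
proof (rule VF_I)
  note x = VF_T[OF X] VF_C[OF X] and y = VF_T[OF Y] VF_C[OF Y]
  show "vf_bracket X Y p \<in> T p" for p
    by (rule tangentI)
      (simp_all add: vf_bracket_def tangentD[OF x(1)] tangentD[OF y(1)] x(2) y(2) C_mult C_add tangent_const[OF x(1)]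
        tangent_const[OF y(1)] algebra_simps)
  fix f assume "f \<in> C"
  then show "(\<lambda>p. vf_bracket X Y p f) \<in> C"
    unfolding vf_bracket_def by (intro C_diff x(2) y(2))
qed

lemma vf_bracket_skew: "vf_bracket X Y p = - vf_bracket Y X p"
  by (rule ext) (simp add: vf_bracket_def)

lemma vf_bracket_scale:
  assumes X: "X \<in> VF" and Y: "Y \<in> VF" and f: "f \<in> C"
  shows "vf_bracket X (\<lambda>p. f p *\<^sub>R Y p) = (\<lambda>p. f p *\<^sub>R vf_bracket X Y p + X p f *\<^sub>R Y p)"
proof (intro ext)
  fix p g
  show "vf_bracket X (\<lambda>p. f p *\<^sub>R Y p) p g = (f p *\<^sub>R vf_bracket X Y p + X p f *\<^sub>R Y p) g"
  proof (cases "g \<in> C")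
    case True
    then show ?thesis
      by (simp add: vf_bracket_def tangentD(3)[OF VF_T[OF X] f VF_C[OF Y]] algebra_simps)
  next
    \<comment> \<open>All tangent vectors vanish on a non-smooth \<open>g\<close>, so the inner
      functions are constant 0.\<close>
    case False
    then show ?thesis
      by (simp add: vf_bracket_def tangentD(4)[OF VF_T[OF Y]] tangentD(4)[OF VF_T[OF X]] tangent_const[OF VF_T[OF X]] tangent_const[OF VF_T[OF Y]])
  qed
qed

lemma vf_bracket_add:
  assumes X: "X \<in> VF" and Y: "Y \<in> VF" and Z: "Z \<in> VF"
  shows "vf_bracket X (\<lambda>p. Y p + Z p) = (\<lambda>p. vf_bracket X Y p + vf_bracket X Z p)"
proof (intro ext)
  fix p g
  show "vf_bracket X (\<lambda>p. Y p + Z p) p g = (vf_bracket X Y p + vf_bracket X Z p) g"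
  proof (cases "g \<in> C")
    case True
    then show ?thesis
      by (simp add: vf_bracket_def tangentD(1)[OF VF_T[OF X] VF_C[OF Y] VF_C[OF Z]])
  next
    case False
    then show ?thesis
      by (simp add: vf_bracket_def tangentD(4)[OF VF_T[OF Y]] tangentD(4)[OF VF_T[OF X]] tangentD(4)[OF VF_T[OF Z]] tangent_const[OF VF_T[OF X]])
  qed
qed

text \<open>The components of \<open>D\<close> serve as constant coefficients in a frame of globally
  defined fields. Consequently covectors at a point can be compared through global vector
  fields.\<close>

lemma vector_through:
  assumes "D \<in> T p"
  obtains Y where "Y \<in> VF" "Y p = D"
proof -
  obtain W x E where p: "p \<in> W" and fr: "frame_on W x E" using frame_on_exists by blast
  note f = frame_onD(1)[OF fr] p frame_onD(2-)[OF fr]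
  have "(\<lambda>q. \<Sum>u\<in>bs. D (x u) *\<^sub>R E u q) \<in> VF" by (intro VF_sum VF_scale C_const f(4))
  then show ?thesis using that f(5)[OF f(2) assms] by simp
qed

lemma extd_apply: "D \<in> T p \<Longrightarrow> extd A f p D = D f"
  by (simp add: extd_def)

lemma extd_cotangent: "f \<in> C \<Longrightarrow> extd A f p \<in> cotangent A p"
proof (rule dualI)
  fix x y c assume x: "x \<in> T p"
  show "extd A f p (c *\<^sub>R x) = c * extd A f p x"
    unfolding extd_apply[OF x] extd_apply[OF T_scale[OF x]] by simp
  assume y: "y \<in> T p"
  show "extd A f p (x + y) = extd A f p x + extd A f p y"
    unfolding extd_apply[OF x] extd_apply[OF y] extd_apply[OF T_add[OF x y]] by simp
qed (simp add: extd_def)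

lemma OF1_cotangent: "\<alpha> \<in> OF1 \<Longrightarrow> \<alpha> p \<in> cotangent A p"
  by (simp add: one_forms_def)

lemma OF1_C:
  assumes "\<alpha> \<in> OF1" "X \<in> VF"
  shows "(\<lambda>p. \<alpha> p (X p)) \<in> C"
proof -
  have "\<forall>X\<in>VF. (\<lambda>p. \<alpha> p (X p)) \<in> C" using assms(1) by (simp add: one_forms_def)
  then show ?thesis using assms(2) by (rule bspec)
qed

lemma OF1_I:
  assumes "\<And>p. \<alpha> p \<in> cotangent A p" "\<And>X. X \<in> VF \<Longrightarrow> (\<lambda>p. \<alpha> p (X p)) \<in> C"
  shows "\<alpha> \<in> OF1"
  unfolding one_forms_def by (intro CollectI conjI allI ballI assms)

lemma extd_OF1:
  assumes f: "f \<in> C"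
  shows "extd A f \<in> OF1"
proof (rule OF1_I[OF extd_cotangent[OF f]])
  fix X assume X: "X \<in> VF"
  show "(\<lambda>p. extd A f p (X p)) \<in> C" unfolding extd_apply[OF VF_T[OF X]] by (rule VF_C[OF X f])
qed

lemma OF1_scale:
  assumes "f \<in> C" "\<alpha> \<in> OF1"
  shows "(\<lambda>p. f p *\<^sub>R \<alpha> p) \<in> OF1"
proof (rule OF1_I)
  show "f p *\<^sub>R \<alpha> p \<in> cotangent A p" for p by (rule subspace_scale[OF subspace_dual OF1_cotangent[OF assms(2)]])
  fix X assume X: "X \<in> VF"
  show "(\<lambda>p. (f p *\<^sub>R \<alpha> p) (X p)) \<in> C"
    unfolding scaleR_fun_apply real_scaleR_def by (rule C_mult[OF assms(1) OF1_C[OF assms(2) X]])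
qed

lemma OF1_add:
  assumes "\<alpha> \<in> OF1" "\<beta> \<in> OF1"
  shows "(\<lambda>p. \<alpha> p + \<beta> p) \<in> OF1"
proof (rule OF1_I)
  show "\<alpha> p + \<beta> p \<in> cotangent A p" for p by (rule subspace_add[OF subspace_dual OF1_cotangent[OF assms(1)] OF1_cotangent[OF assms(2)]])
  fix X assume X: "X \<in> VF"
  show "(\<lambda>p. (\<alpha> p + \<beta> p) (X p)) \<in> C"
    unfolding plus_fun_apply by (rule C_add[OF OF1_C[OF assms(1) X] OF1_C[OF assms(2) X]])
qed

lemma OF1_diff:
  assumes "\<alpha> \<in> OF1" "\<beta> \<in> OF1"
  shows "(\<lambda>p. \<alpha> p - \<beta> p) \<in> OF1"
  using OF1_add[OF assms(1) OF1_scale[OF C_const[of "-1"] assms(2)]] by (simp only: scaleR_minus1_left diff_conv_add_uminus)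

lemma OF1_0: "(\<lambda>p. 0) \<in> OF1"
proof (rule OF1_I)
  show "(\<lambda>p. 0 (X p)) \<in> C" for X unfolding zero_fun_apply by (rule C_const)
qed (rule subspace_0[OF subspace_dual])

lemma OF1_sum: "(\<And>i. i \<in> I \<Longrightarrow> \<alpha> i \<in> OF1) \<Longrightarrow> (\<lambda>p. \<Sum>i\<in>I. \<alpha> i p) \<in> OF1"
proof (induction I rule: infinite_finite_induct)
  case (insert i I)
  show ?case unfolding sum.insert[OF insert(1,2)] by (intro OF1_add insert) simp_all
qed (simp_all only: sum.infinite sum.empty not_False_eq_True OF1_0)

lemma OF1_eqI:
  assumes "\<alpha> \<in> OF1" "\<beta> \<in> OF1" "\<And>Y p. Y \<in> VF \<Longrightarrow> \<alpha> p (Y p) = \<beta> p (Y p)"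
  shows "\<alpha> = \<beta>"
proof
  fix p show "\<alpha> p = \<beta> p"
  proof (rule dual_eqI[OF OF1_cotangent[OF assms(1)] OF1_cotangent[OF assms(2)]])
    fix D assume "D \<in> T p"
    then obtain Y where "Y \<in> VF" "Y p = D" by (rule vector_through)
    then show "\<alpha> p D = \<beta> p D" using assms(3) by blast
  qed
qed

lemma extd_add: "f \<in> C \<Longrightarrow> g \<in> C \<Longrightarrow> extd A (\<lambda>q. f q + g q) p = extd A f p + extd A g p"
  by (rule ext) (simp add: extd_def tangentD(1))

lemma extd_const: "extd A (\<lambda>q. c) p = 0"
  by (rule ext) (simp add: extd_def tangent_const)

lemma extd_sum: "(\<And>i. i \<in> I \<Longrightarrow> f i \<in> C) \<Longrightarrow> extd A (\<lambda>q. \<Sum>i\<in>I. f i q) p = (\<Sum>i\<in>I. extd A (f i) p)"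
  by (rule ext) (simp add: extd_def tangent_sum sum_fun_apply)

lemma extd_mult: "f \<in> C \<Longrightarrow> g \<in> C \<Longrightarrow> extd A (\<lambda>q. f q * g q) p = f p *\<^sub>R extd A g p + g p *\<^sub>R extd A f p"
  by (rule ext) (simp add: extd_def tangentD(3) algebra_simps)

lemma extd_cmult: "f \<in> C \<Longrightarrow> extd A (\<lambda>q. c * f q) p = c *\<^sub>R extd A f p"
  by (rule ext) (simp add: extd_def tangentD(2))

lemma frame_on_dual_frame:
  assumes "frame_on W x E" "q \<in> W"
  shows "dual_frame (T q) bs (\<lambda>u. E u q) (\<lambda>u. extd A (x u) q)"
  unfolding dual_frame_def
proof (intro conjI ballI subspace_T onbD1[OF bs] VF_T[OF frame_onD(3)[OF assms(1)]] extd_cotangent frame_onD(2)[OF assms(1)])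
  fix D assume D: "D \<in> T q"
  show "(\<Sum>u\<in>bs. extd A (x u) q D *\<^sub>R E u q) = D"
    unfolding extd_apply[OF D] by (rule frame_onD(4)[OF assms D, symmetric])
qed

text \<open>A linear combination of coordinate functions with constant coefficients
  \<open>a (E u p)\<close> has differential \<open>a\<close> at \<open>p\<close>. Pointwise
  multilinear expressions can thus be tested on exact forms.\<close>

lemma covector_exact:
  assumes "a \<in> cotangent A p"
  obtains f where "f \<in> C" "extd A f p = a"
proof -
  obtain W x E where p: "p \<in> W" and fr: "frame_on W x E" using frame_on_exists by blast
  note f = frame_onD(1)[OF fr] p frame_onD(2-)[OF fr]
  let ?f = "\<lambda>q. \<Sum>u\<in>bs. a (E u p) * x u q"
  have "extd A ?f p = (\<Sum>u\<in>bs. a (E u p) *\<^sub>R extd A (x u) p)"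
    using f(3) by (simp add: extd_sum extd_cmult C_mult)
  also have "\<dots> = a" by (rule dual_frame_expand_dual[OF frame_on_dual_frame[OF fr p] assms])
  finally have "extd A ?f p = a" .
  moreover have "?f \<in> C" by (intro C_sum C_mult C_const f(3))
  ultimately show ?thesis by (intro that)
qed

text \<open>A \<open>C\<^sup>\<infinity>\<close>-linear map on vector fields is pointwise: near \<open>p\<close> expand \<open>Y\<close> in a frame, after
  multiplication by a bump function so that the expansion holds globally.\<close>

lemma tensor_form:
  assumes add: "\<And>Y Z p. Y \<in> VF \<Longrightarrow> Z \<in> VF \<Longrightarrow> F (\<lambda>p. Y p + Z p) p = F Y p + F Z p"
    and scale: "\<And>f Y p. f \<in> C \<Longrightarrow> Y \<in> VF \<Longrightarrow> F (\<lambda>p. f p *\<^sub>R Y p) p = f p * F Y p"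
    and smooth: "\<And>Y. Y \<in> VF \<Longrightarrow> F Y \<in> C"
  obtains \<omega> where "\<omega> \<in> OF1" "\<And>Y p. Y \<in> VF \<Longrightarrow> \<omega> p (Y p) = F Y p"
proof -
  have F0: "F (\<lambda>p. 0) p = 0" for p using scale[OF C_const VF_0, of 0 p] by simp
  have F_sum: "F (\<lambda>p. \<Sum>i\<in>I. Y i p) p = (\<Sum>i\<in>I. F (Y i) p)" if "\<And>i. i \<in> I \<Longrightarrow> Y i \<in> VF" for I :: "'e set" and Y p
    using that
  proof (induction I rule: infinite_finite_induct)
    case (insert i I)
    have "Y i \<in> VF" "(\<lambda>p. \<Sum>i\<in>I. Y i p) \<in> VF" using insert.prems by (auto intro: VF_sum)
    note add = add[OF this, of p]
    have "F (\<lambda>p. \<Sum>i\<in>I. Y i p) p = (\<Sum>i\<in>I. F (Y i) p)"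
      by (rule insert.IH) (simp add: insert.prems)
    with add show ?case unfolding sum.insert[OF insert(1,2)] by (simp only:)
  qed (simp_all add: F0)
  have "\<exists>x E. (\<forall>Y\<in>VF. F Y p = (\<Sum>u\<in>bs. Y p (x u) * F (E u) p)) \<and> (\<forall>u. x u \<in> C)"
    for p
  proof -
    obtain W x E where p: "p \<in> W" and fr: "frame_on W x E" using frame_on_exists by blast
    note f = frame_onD(1)[OF fr] p frame_onD(2-)[OF fr]
    obtain \<beta> V where \<beta>: "\<beta> \<in> C" "open V" "p \<in> V" "\<And>q. q \<in> V \<Longrightarrow> \<beta> q = 1" "\<And>q. q \<notin> W \<Longrightarrow> \<beta> q = 0"
      using bump_fun[OF f(1,2)] by blast
    have "F Y p = (\<Sum>u\<in>bs. Y p (x u) * F (E u) p)" if Y: "Y \<in> VF" for Y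
    proof -
      have c: "(\<lambda>q. \<beta> q * Y q (x u)) \<in> C" for u by (intro C_mult \<beta>(1) VF_C[OF Y f(3)])
      have "(\<lambda>q. \<beta> q *\<^sub>R Y q) = (\<lambda>q. \<Sum>u\<in>bs. (\<beta> q * Y q (x u)) *\<^sub>R E u q)"
      proof
        fix q
        show "\<beta> q *\<^sub>R Y q = (\<Sum>u\<in>bs. (\<beta> q * Y q (x u)) *\<^sub>R E u q)"
        proof (cases "q \<in> W")
          case True
          have "\<beta> q *\<^sub>R Y q = \<beta> q *\<^sub>R (\<Sum>u\<in>bs. Y q (x u) *\<^sub>R E u q)"
            by (rule arg_cong[OF f(5)[OF True VF_T[OF Y]]])
          then show ?thesis by (simp only: scaleR_sum_right scaleR_scaleR)
        qed (simp add: \<beta>(5))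
      qed
      then have "F (\<lambda>q. \<beta> q *\<^sub>R Y q) p = (\<Sum>u\<in>bs. (\<beta> p * Y p (x u)) * F (E u) p)"
        using F_sum[of bs "\<lambda>u q. (\<beta> q * Y q (x u)) *\<^sub>R E u q" p] scale[OF c f(4)] VF_scale[OF c f(4)] by simp
      then show ?thesis using scale[OF \<beta>(1) Y, of p] \<beta>(3,4) by simp
    qed
    then show ?thesis using f(3) by blast
  qed
  then obtain x E where xE: "\<And>p Y. Y \<in> VF \<Longrightarrow> F Y p = (\<Sum>u\<in>bs. Y p (x p u) * F (E p u) p)" "\<And>p u. x p u \<in> C"
    by metis
  \<comment> \<open>Each point uses a frame of its own, so the formula itself says nothing about
    smoothness; that comes from the values on vector fields, which are those of
    \<open>F\<close>.\<close>
  define \<omega> where "\<omega> p D = (if D \<in> T p then \<Sum>u\<in>bs. D (x p u) * F (E p u) p else 0)" for p D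
  have v: "\<omega> p (Y p) = F Y p" if "Y \<in> VF" for Y p
    using xE(1)[OF that] VF_T[OF that] by (simp add: \<omega>_def)
  have "\<omega> \<in> OF1"
  proof (rule OF1_I)
    show "\<omega> p \<in> cotangent A p" for p
    proof (rule dualI)
      fix D D' c assume D: "D \<in> T p"
      show "\<omega> p (c *\<^sub>R D) = c * \<omega> p D"
        using D T_scale[OF D, of c] by (simp add: \<omega>_def sum_distrib_left mult.assoc)
      assume D': "D' \<in> T p"
      show "\<omega> p (D + D') = \<omega> p D + \<omega> p D'"
        using D D' T_add[OF D D'] by (simp add: \<omega>_def sum.distrib[symmetric] distrib_right)
    qed (simp add: \<omega>_def)
    show "(\<lambda>p. \<omega> p (X p)) \<in> C" if "X \<in> VF" for X using v[OF that] smooth[OF that] by (simp add: ext)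
  qed
  then show ?thesis using that v by blast
qed

lemma covector_add: "\<alpha> \<in> OF1 \<Longrightarrow> D \<in> T p \<Longrightarrow> D' \<in> T p \<Longrightarrow> \<alpha> p (D + D') = \<alpha> p D + \<alpha> p D'"
  and covector_scale: "\<alpha> \<in> OF1 \<Longrightarrow> D \<in> T p \<Longrightarrow> \<alpha> p (c *\<^sub>R D) = c * \<alpha> p D"
  using linear_onD[OF dual_linear[OF OF1_cotangent[of \<alpha> p]]] by simp_all

lemma covector_diff: "\<alpha> \<in> OF1 \<Longrightarrow> D \<in> T p \<Longrightarrow> D' \<in> T p \<Longrightarrow> \<alpha> p (D - D') = \<alpha> p D - \<alpha> p D'"
  and covector_minus: "\<alpha> \<in> OF1 \<Longrightarrow> D \<in> T p \<Longrightarrow> \<alpha> p (- D) = - \<alpha> p D"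
  using linear_on_diff[OF subspace_T dual_linear[OF OF1_cotangent[of \<alpha> p]]]
    linear_on_minus[OF dual_linear[OF OF1_cotangent[of \<alpha> p]]] by simp_all

text \<open>The prescribed expression is function-linear in \<open>Y\<close>: the term with
  \<open>X f\<close> from differentiating \<open>f \<alpha>(Y)\<close> cancels against the one from
  \<open>[X, f Y]\<close>. So \<open>tensor_form\<close> yields a one-form, and it is unique because
  vector fields fill the tangent spaces.\<close>

lemma lie_form:
  assumes X: "X \<in> VF" and \<alpha>: "\<alpha> \<in> OF1"
  shows "lie_form A X \<alpha> \<in> OF1"
    and "Y \<in> VF \<Longrightarrow> lie_form A X \<alpha> p (Y p) = X p (\<lambda>q. \<alpha> q (Y q)) - \<alpha> p (vf_bracket X Y p)"
proof -
  let ?F = "\<lambda>Y p. X p (\<lambda>q. \<alpha> q (Y q)) - \<alpha> p (vf_bracket X Y p)"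
  note T = VF_T[OF X] and B = VF_T[OF vf_bracket_VF[OF X]]
  obtain \<omega> where \<omega>: "\<omega> \<in> OF1" "\<And>Y p. Y \<in> VF \<Longrightarrow> \<omega> p (Y p) = ?F Y p"
  proof (rule tensor_form[of ?F])
    show "?F (\<lambda>p. Y p + Z p) p = ?F Y p + ?F Z p" if "Y \<in> VF" "Z \<in> VF" for Y Z p
      using that by (simp add: vf_bracket_add[OF X] covector_add[OF \<alpha>] B VF_T tangentD(1)[OF T] OF1_C[OF \<alpha>])
    show "?F (\<lambda>p. f p *\<^sub>R Y p) p = f p * ?F Y p" if "f \<in> C" "Y \<in> VF" for f Y p
      using that
      by (simp add: vf_bracket_scale[OF X] covector_add[OF \<alpha>] covector_scale[OF \<alpha>] B VF_T tangentD(3)[OF T] OF1_C[OF \<alpha>]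
          subspace_scale[OF subspace_T] algebra_simps)
    show "?F Y \<in> C" if "Y \<in> VF" for Y
      by (intro C_diff VF_C[OF X] OF1_C[OF \<alpha>] that vf_bracket_VF[OF X])
  qed blast
  have "\<exists>!\<omega>. \<omega> \<in> OF1 \<and> (\<forall>Y\<in>VF. \<forall>p. \<omega> p (Y p) = ?F Y p)"
  proof (rule ex1I[of _ \<omega>])
    fix \<omega>' assume "\<omega>' \<in> OF1 \<and> (\<forall>Y\<in>VF. \<forall>p. \<omega>' p (Y p) = ?F Y p)"
    then show "\<omega>' = \<omega>" using OF1_eqI[of \<omega>' \<omega>] \<omega> by simp
  qed (use \<omega> in simp)
  from theI'[OF this] show "lie_form A X \<alpha> \<in> OF1"
    "Y \<in> VF \<Longrightarrow> lie_form A X \<alpha> p (Y p) = X p (\<lambda>q. \<alpha> q (Y q)) - \<alpha> p (vf_bracket X Y p)"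
    unfolding lie_form_def by auto
qed

lemma lie_form_scale:
  assumes X: "X \<in> VF" and \<alpha>: "\<alpha> \<in> OF1" and f: "f \<in> C"
  shows "lie_form A X (\<lambda>p. f p *\<^sub>R \<alpha> p) = (\<lambda>p. f p *\<^sub>R lie_form A X \<alpha> p + X p f *\<^sub>R \<alpha> p)"
  by (rule OF1_eqI)
    (simp_all add: lie_form[OF X \<alpha>] lie_form[OF X OF1_scale[OF f \<alpha>]] OF1_add OF1_scale f \<alpha> VF_C[OF X]
      tangentD(3)[OF VF_T[OF X]] OF1_C[OF \<alpha>] algebra_simps)

lemma lie_form_add:
  assumes X: "X \<in> VF" and \<alpha>: "\<alpha> \<in> OF1" and \<beta>: "\<beta> \<in> OF1"
  shows "lie_form A X (\<lambda>p. \<alpha> p + \<beta> p) = (\<lambda>p. lie_form A X \<alpha> p + lie_form A X \<beta> p)"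
  by (rule OF1_eqI)
    (simp_all add: lie_form[OF X \<alpha>] lie_form[OF X \<beta>] lie_form[OF X OF1_add[OF \<alpha> \<beta>]] OF1_add
      tangentD(1)[OF VF_T[OF X]] OF1_C[OF \<alpha>] OF1_C[OF \<beta>])

lemma lie_form_vadd:
  assumes X: "X \<in> VF" and Y: "Y \<in> VF" and \<alpha>: "\<alpha> \<in> OF1"
  shows "lie_form A (\<lambda>p. X p + Y p) \<alpha> = (\<lambda>p. lie_form A X \<alpha> p + lie_form A Y \<alpha> p)"
proof (rule OF1_eqI)
  fix Z p assume Z: "Z \<in> VF"
  have "vf_bracket (\<lambda>p. X p + Y p) Z p = vf_bracket X Z p + vf_bracket Y Z p"
    using vf_bracket_add[OF Z X Y] vf_bracket_skew[of "\<lambda>p. X p + Y p" Z p] vf_bracket_skew[of X Z p] vf_bracket_skew[of Y Z p] by simp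
  then show "lie_form A (\<lambda>p. X p + Y p) \<alpha> p (Z p) = (lie_form A X \<alpha> p + lie_form A Y \<alpha> p) (Z p)"
    using Z by (simp add: lie_form(2)[OF VF_add[OF X Y] \<alpha>] lie_form(2)[OF X \<alpha>] lie_form(2)[OF Y \<alpha>]
        covector_add[OF \<alpha>] VF_T vf_bracket_VF X Y)
qed (simp_all add: lie_form OF1_add VF_add X Y \<alpha>)

text \<open>The term with \<open>extd A f\<close> comes from
  \<open>[f X, Z] = f [X, Z] - (Z f) X\<close> paired with \<alpha>; it reappears in
  \<open>form_bracket_scale\<close>, where it has to cancel.\<close>

lemma lie_form_vscale:
  assumes X: "X \<in> VF" and f: "f \<in> C" and \<alpha>: "\<alpha> \<in> OF1"
  shows "lie_form A (\<lambda>p. f p *\<^sub>R X p) \<alpha> = (\<lambda>p. f p *\<^sub>R lie_form A X \<alpha> p + \<alpha> p (X p) *\<^sub>R extd A f p)"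
proof (rule OF1_eqI)
  fix Z p assume Z: "Z \<in> VF"
  have br: "vf_bracket (\<lambda>p. f p *\<^sub>R X p) Z p = f p *\<^sub>R vf_bracket X Z p - Z p f *\<^sub>R X p"
    using vf_bracket_scale[OF Z X f] vf_bracket_skew[of "\<lambda>p. f p *\<^sub>R X p" Z p] vf_bracket_skew[of X Z p] by simp
  show "lie_form A (\<lambda>p. f p *\<^sub>R X p) \<alpha> p (Z p) = (f p *\<^sub>R lie_form A X \<alpha> p + \<alpha> p (X p) *\<^sub>R extd A f p) (Z p)"
    using Z by (simp add: br lie_form(2)[OF VF_scale[OF f X] \<alpha>] lie_form(2)[OF X \<alpha>] covector_diff[OF \<alpha>] covector_scale[OF \<alpha>]
        subspace_scale[OF subspace_T] VF_T vf_bracket_VF X extd_apply algebra_simps)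
qed (simp_all add: lie_form OF1_add OF1_scale OF1_C VF_scale X f \<alpha> extd_OF1)

text \<open>On a field \<open>Y\<close> this is \<open>X (Y f) - [X, Y] f = Y (X f)\<close>.\<close>

lemma lie_form_extd:
  assumes X: "X \<in> VF" and f: "f \<in> C"
  shows "lie_form A X (extd A f) = extd A (\<lambda>p. X p f)"
  by (rule OF1_eqI)
    (simp_all add: lie_form[OF X extd_OF1[OF f]] extd_OF1 f VF_C X extd_apply VF_T vf_bracket_VF, simp add: vf_bracket_def)

end

lemma trilinear_expand:
  assumes V: "subspace V"
    and lin: "\<And>b c. b \<in> V \<Longrightarrow> c \<in> V \<Longrightarrow> linear_on V (\<lambda>a. P a b c)" "\<And>a c. a \<in> V \<Longrightarrow> c \<in> V \<Longrightarrow> linear_on V (\<lambda>b. P a b c)"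
      "\<And>a b. a \<in> V \<Longrightarrow> b \<in> V \<Longrightarrow> linear_on V (\<lambda>c. P a b c)"
    and e: "\<And>i. i \<in> I \<Longrightarrow> e i \<in> V"
  shows "P (\<Sum>i\<in>I. a i *\<^sub>R e i) (\<Sum>j\<in>I. b j *\<^sub>R e j) (\<Sum>k\<in>I. c k *\<^sub>R e k)
    = (\<Sum>i\<in>I. \<Sum>j\<in>I. \<Sum>k\<in>I. a i * b j * c k * (P (e i) (e j) (e k) :: real))"
proof -
  have sV: "(\<Sum>j\<in>I. b j *\<^sub>R e j) \<in> V" for b by (intro subspace_sum[OF V] subspace_scale[OF V] e)
  have s: "L (\<Sum>i\<in>I. a i *\<^sub>R e i) = (\<Sum>i\<in>I. a i * L (e i))" if "linear_on V L" for L :: "_ \<Rightarrow> real" and a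
  proof -
    have "L (\<Sum>i\<in>I. a i *\<^sub>R e i) = (\<Sum>i\<in>I. L (a i *\<^sub>R e i))"
      by (rule linear_on_sum[OF V that]) (intro subspace_scale[OF V] e)
    also have "\<dots> = (\<Sum>i\<in>I. a i * L (e i))"
      by (rule sum.cong) (simp_all add: linear_onD(2)[OF that] e)
    finally show ?thesis .
  qed
  have "P (\<Sum>i\<in>I. a i *\<^sub>R e i) (\<Sum>j\<in>I. b j *\<^sub>R e j) (\<Sum>k\<in>I. c k *\<^sub>R e k)
      = (\<Sum>i\<in>I. a i * P (e i) (\<Sum>j\<in>I. b j *\<^sub>R e j) (\<Sum>k\<in>I. c k *\<^sub>R e k))"
    by (rule s[OF lin(1)[OF sV sV]])
  also have "\<dots> = (\<Sum>i\<in>I. a i * (\<Sum>j\<in>I. b j * (\<Sum>k\<in>I. c k * P (e i) (e j) (e k))))"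
  proof (rule sum.cong[OF refl])
    fix i assume i: "i \<in> I"
    have "P (e i) (\<Sum>j\<in>I. b j *\<^sub>R e j) (\<Sum>k\<in>I. c k *\<^sub>R e k) = (\<Sum>j\<in>I. b j * P (e i) (e j) (\<Sum>k\<in>I. c k *\<^sub>R e k))"
      by (rule s[OF lin(2)[OF e[OF i] sV]])
    also have "\<dots> = (\<Sum>j\<in>I. b j * (\<Sum>k\<in>I. c k * P (e i) (e j) (e k)))"
      using s[OF lin(3)[OF e[OF i] e]] by (intro sum.cong) simp_all
    finally show "a i * P (e i) (\<Sum>j\<in>I. b j *\<^sub>R e j) (\<Sum>k\<in>I. c k *\<^sub>R e k)
        = a i * (\<Sum>j\<in>I. b j * (\<Sum>k\<in>I. c k * P (e i) (e j) (e k)))" by simp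
  qed
  finally show ?thesis by (simp add: sum_distrib_left mult.assoc)
qed

lemma diff_add_cancel_middle: "a + b - (c + - k) - (d + k) = a - c - d + (b :: 'a::ab_group_add)"
  by (simp add: algebra_simps)

section \<open>Bivector fields and the bracket of forms\<close>

locale bivector_manifold = manifold A bs
  for A :: "('m::{t2_space,second_countable_topology}, 'e::real_inner) atlas" and bs :: "'e set" +
  fixes \<pi> :: "'m bivec"
  assumes bivec: "\<pi> \<in> bivector_fields A"
begin

lemma bivec_ext_power2: "\<pi> p \<in> ext_power2 (T p)"
  using bivec by (simp add: bivector_fields_def)

lemma bivec_C:
  assumes "\<alpha> \<in> OF1" "\<beta> \<in> OF1"
  shows "(\<lambda>p. \<pi> p (\<alpha> p) (\<beta> p)) \<in> C"
proof -
  have "\<forall>\<alpha>\<in>OF1. \<forall>\<beta>\<in>OF1. (\<lambda>p. \<pi> p (\<alpha> p) (\<beta> p)) \<in> C" using bivec by (simp add: bivector_fields_def)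
  then show ?thesis using assms by (meson bspec)
qed

lemma bivec_linear:
  assumes "a \<in> cotangent A p"
  shows "linear_on (cotangent A p) (\<pi> p a)" "linear_on (cotangent A p) (\<lambda>b. \<pi> p b a)" "\<pi> p a a = 0"
proof -
  have "\<forall>a\<in>cotangent A p. linear_on (cotangent A p) (\<pi> p a) \<and> linear_on (cotangent A p) (\<lambda>b. \<pi> p b a) \<and> \<pi> p a a = 0"
    using bivec_ext_power2[of p] by (simp add: ext_power2_def)
  from bspec[OF this assms] show "linear_on (cotangent A p) (\<pi> p a)" "linear_on (cotangent A p) (\<lambda>b. \<pi> p b a)" "\<pi> p a a = 0"
    by simp_all
qed

lemma bivec_skew:
  assumes a: "a \<in> cotangent A p" and b: "b \<in> cotangent A p"
  shows "\<pi> p a b = - \<pi> p b a"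
proof -
  note ab = subspace_add[OF subspace_dual a b]
  have "0 = \<pi> p (a + b) (a + b)" using bivec_linear(3)[OF ab] by simp
  also have "\<dots> = \<pi> p a (a + b) + \<pi> p b (a + b)" by (rule linear_onD(1)[OF bivec_linear(2)[OF ab] a b])
  also have "\<dots> = \<pi> p a b + \<pi> p b a"
    using linear_onD(1)[OF bivec_linear(1)[OF a] a b] linear_onD(1)[OF bivec_linear(1)[OF b] a b]
      bivec_linear(3)[OF a] bivec_linear(3)[OF b] by simp
  finally show ?thesis by simp
qed

lemma sharp:
  assumes a: "a \<in> cotangent A p"
  shows "sharp A \<pi> p a \<in> T p" and "b \<in> cotangent A p \<Longrightarrow> b (sharp A \<pi> p a) = \<pi> p a b"
proof -
  obtain W x E where p: "p \<in> W" and fr: "frame_on W x E" using frame_on_exists by blast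
  show "sharp A \<pi> p a \<in> T p" "b \<in> cotangent A p \<Longrightarrow> b (sharp A \<pi> p a) = \<pi> p a b"
    unfolding sharp_def using bidual_elem[OF frame_on_dual_frame[OF fr p] bivec_linear(1)[OF a]] by blast+
qed

lemma sharp_apply:
  assumes a: "a \<in> cotangent A p" and f: "f \<in> C"
  shows "sharp A \<pi> p a f = \<pi> p a (extd A f p)"
  using sharp(2)[OF a extd_cotangent[OF f]] extd_apply[OF sharp(1)[OF a]] by simp

lemma sharp_add:
  assumes a: "a \<in> cotangent A p" and b: "b \<in> cotangent A p"
  shows "sharp A \<pi> p (a + b) = sharp A \<pi> p a + sharp A \<pi> p b"
proof (rule T_eqI)
  note ab = subspace_add[OF subspace_dual a b]
  show "sharp A \<pi> p (a + b) \<in> T p" "sharp A \<pi> p a + sharp A \<pi> p b \<in> T p"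
    using sharp(1)[OF ab] T_add[OF sharp(1)[OF a] sharp(1)[OF b]] by simp_all
  fix f assume f: "f \<in> C"
  show "sharp A \<pi> p (a + b) f = (sharp A \<pi> p a + sharp A \<pi> p b) f"
    using linear_onD(1)[OF bivec_linear(2)[OF extd_cotangent[OF f]] a b]
    by (simp only: plus_fun_apply sharp_apply[OF ab f] sharp_apply[OF a f] sharp_apply[OF b f])
qed

lemma sharp_scale:
  assumes a: "a \<in> cotangent A p"
  shows "sharp A \<pi> p (c *\<^sub>R a) = c *\<^sub>R sharp A \<pi> p a"
proof (rule T_eqI)
  note ca = subspace_scale[OF subspace_dual a, of c]
  show "sharp A \<pi> p (c *\<^sub>R a) \<in> T p" "c *\<^sub>R sharp A \<pi> p a \<in> T p"
    using sharp(1)[OF ca] T_scale[OF sharp(1)[OF a]] by simp_all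
  fix f assume f: "f \<in> C"
  show "sharp A \<pi> p (c *\<^sub>R a) f = (c *\<^sub>R sharp A \<pi> p a) f"
    using linear_onD(2)[OF bivec_linear(2)[OF extd_cotangent[OF f]] a]
    by (simp only: scaleR_fun_apply sharp_apply[OF ca f] sharp_apply[OF a f])
qed

lemma linear_sharp: "linear_on (cotangent A p) (sharp A \<pi> p)"
  unfolding linear_on_def by (intro conjI ballI allI sharp_add sharp_scale)

lemma sharp_VF:
  assumes \<alpha>: "\<alpha> \<in> OF1"
  shows "(\<lambda>p. sharp A \<pi> p (\<alpha> p)) \<in> VF"
proof (rule VF_I)
  show "sharp A \<pi> p (\<alpha> p) \<in> T p" for p by (rule sharp(1)[OF OF1_cotangent[OF \<alpha>]])
  fix f assume f: "f \<in> C"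
  show "(\<lambda>p. sharp A \<pi> p (\<alpha> p) f) \<in> C"
    unfolding sharp_apply[OF OF1_cotangent[OF \<alpha>] f] by (rule bivec_C[OF \<alpha> extd_OF1[OF f]])
qed

lemma form_sharp:
  assumes "\<alpha> \<in> OF1" "\<beta> \<in> OF1"
  shows "\<beta> p (sharp A \<pi> p (\<alpha> p)) = \<pi> p (\<alpha> p) (\<beta> p)"
  by (rule sharp(2)[OF OF1_cotangent[OF assms(1)] OF1_cotangent[OF assms(2)]])

lemma bivec_add1:
  assumes "\<alpha> \<in> OF1" "\<beta> \<in> OF1" "\<gamma> \<in> OF1"
  shows "\<pi> p (\<alpha> p) (\<beta> p + \<gamma> p) = \<pi> p (\<alpha> p) (\<beta> p) + \<pi> p (\<alpha> p) (\<gamma> p)"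
  by (rule linear_onD(1)[OF bivec_linear(1)]) (rule OF1_cotangent assms)+

lemma bivec_scale1:
  assumes "\<alpha> \<in> OF1" "\<beta> \<in> OF1"
  shows "\<pi> p (\<alpha> p) (c *\<^sub>R \<beta> p) = c * \<pi> p (\<alpha> p) (\<beta> p)"
  using linear_onD(2)[OF bivec_linear(1)[OF OF1_cotangent[OF assms(1)]] OF1_cotangent[OF assms(2)]] by simp

lemma form_bracket_apply: "form_bracket A \<pi> \<alpha> \<beta> p = lie_form A (\<lambda>p. sharp A \<pi> p (\<alpha> p)) \<beta> p
    - lie_form A (\<lambda>p. sharp A \<pi> p (\<beta> p)) \<alpha> p - extd A (\<lambda>p. \<pi> p (\<alpha> p) (\<beta> p)) p"
  unfolding form_bracket_def fun_diff_def by (rule refl)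

lemma form_bracket_OF1:
  assumes \<alpha>: "\<alpha> \<in> OF1" and \<beta>: "\<beta> \<in> OF1"
  shows "form_bracket A \<pi> \<alpha> \<beta> \<in> OF1"
  using OF1_diff[OF OF1_diff[OF lie_form(1)[OF sharp_VF[OF \<alpha>] \<beta>] lie_form(1)[OF sharp_VF[OF \<beta>] \<alpha>]]
      extd_OF1[OF bivec_C[OF \<alpha> \<beta>]]]
  unfolding form_bracket_def fun_diff_def .

lemma form_bracket_skew:
  assumes \<alpha>: "\<alpha> \<in> OF1" and \<beta>: "\<beta> \<in> OF1"
  shows "form_bracket A \<pi> \<alpha> \<beta> p = - form_bracket A \<pi> \<beta> \<alpha> p"
proof -
  have "(\<lambda>p. \<pi> p (\<alpha> p) (\<beta> p)) = (\<lambda>p. -1 * \<pi> p (\<beta> p) (\<alpha> p))"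
    using bivec_skew[OF OF1_cotangent[OF \<alpha>] OF1_cotangent[OF \<beta>]] by simp
  then have "extd A (\<lambda>p. \<pi> p (\<alpha> p) (\<beta> p)) p = - extd A (\<lambda>p. \<pi> p (\<beta> p) (\<alpha> p)) p"
    using extd_cmult[OF bivec_C[OF \<beta> \<alpha>], of "-1" p] by simp
  then show ?thesis by (simp add: form_bracket_def)
qed

text \<open>Two terms with \<open>extd A f\<close> arise, one from the Lie derivative along
  \<open>f\<close> times a field, one from the differential of \<open>f\<close> times
  \<open>\<pi>(\<alpha>, \<beta>)\<close>; they cancel by skew-symmetry of \<pi>.\<close>

lemma form_bracket_scale:
  assumes \<alpha>: "\<alpha> \<in> OF1" and \<beta>: "\<beta> \<in> OF1" and f: "f \<in> C"
  shows "form_bracket A \<pi> \<alpha> (\<lambda>p. f p *\<^sub>R \<beta> p)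
    = (\<lambda>p. f p *\<^sub>R form_bracket A \<pi> \<alpha> \<beta> p + sharp A \<pi> p (\<alpha> p) f *\<^sub>R \<beta> p)"
proof
  fix p
  have 1: "lie_form A (\<lambda>p. sharp A \<pi> p (\<alpha> p)) (\<lambda>p. f p *\<^sub>R \<beta> p) p
      = f p *\<^sub>R lie_form A (\<lambda>p. sharp A \<pi> p (\<alpha> p)) \<beta> p + sharp A \<pi> p (\<alpha> p) f *\<^sub>R \<beta> p"
    by (simp only: lie_form_scale[OF sharp_VF[OF \<alpha>] \<beta> f])
  have "(\<lambda>p. sharp A \<pi> p (f p *\<^sub>R \<beta> p)) = (\<lambda>p. f p *\<^sub>R sharp A \<pi> p (\<beta> p))"
    by (simp only: sharp_scale[OF OF1_cotangent[OF \<beta>]])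
  then have 2: "lie_form A (\<lambda>p. sharp A \<pi> p (f p *\<^sub>R \<beta> p)) \<alpha> p
      = f p *\<^sub>R lie_form A (\<lambda>p. sharp A \<pi> p (\<beta> p)) \<alpha> p + \<pi> p (\<beta> p) (\<alpha> p) *\<^sub>R extd A f p"
    by (simp only: lie_form_vscale[OF sharp_VF[OF \<beta>] f \<alpha>] form_sharp[OF \<beta> \<alpha>])
  have 3: "extd A (\<lambda>p. \<pi> p (\<alpha> p) (f p *\<^sub>R \<beta> p)) p
      = f p *\<^sub>R extd A (\<lambda>p. \<pi> p (\<alpha> p) (\<beta> p)) p + \<pi> p (\<alpha> p) (\<beta> p) *\<^sub>R extd A f p"
    by (simp only: bivec_scale1[OF \<alpha> \<beta>] extd_mult[OF f bivec_C[OF \<alpha> \<beta>]])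
  have 4: "\<pi> p (\<beta> p) (\<alpha> p) *\<^sub>R extd A f p = - (\<pi> p (\<alpha> p) (\<beta> p) *\<^sub>R extd A f p)"
    by (subst bivec_skew[OF OF1_cotangent[OF \<beta>] OF1_cotangent[OF \<alpha>]]) (rule scaleR_minus_left)
  show "form_bracket A \<pi> \<alpha> (\<lambda>p. f p *\<^sub>R \<beta> p) p
      = f p *\<^sub>R form_bracket A \<pi> \<alpha> \<beta> p + sharp A \<pi> p (\<alpha> p) f *\<^sub>R \<beta> p"
    unfolding form_bracket_apply 1 2 3 4 scaleR_diff_right by (rule diff_add_cancel_middle)
qed

lemma form_bracket_add:
  assumes \<alpha>: "\<alpha> \<in> OF1" and \<beta>: "\<beta> \<in> OF1" and \<gamma>: "\<gamma> \<in> OF1"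
  shows "form_bracket A \<pi> \<alpha> (\<lambda>p. \<beta> p + \<gamma> p) = (\<lambda>p. form_bracket A \<pi> \<alpha> \<beta> p + form_bracket A \<pi> \<alpha> \<gamma> p)"
proof
  fix p
  have s: "(\<lambda>p. sharp A \<pi> p (\<beta> p + \<gamma> p)) = (\<lambda>p. sharp A \<pi> p (\<beta> p) + sharp A \<pi> p (\<gamma> p))"
    by (simp only: sharp_add[OF OF1_cotangent[OF \<beta>] OF1_cotangent[OF \<gamma>]])
  show "form_bracket A \<pi> \<alpha> (\<lambda>p. \<beta> p + \<gamma> p) p = form_bracket A \<pi> \<alpha> \<beta> p + form_bracket A \<pi> \<alpha> \<gamma> p"
    unfolding form_bracket_apply s lie_form_add[OF sharp_VF[OF \<alpha>] \<beta> \<gamma>]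
      lie_form_vadd[OF sharp_VF[OF \<beta>] sharp_VF[OF \<gamma>] \<alpha>] bivec_add1[OF \<alpha> \<beta> \<gamma>]
      extd_add[OF bivec_C[OF \<alpha> \<beta>] bivec_C[OF \<alpha> \<gamma>]]
    by (simp only: algebra_simps)
qed

section \<open>Hamiltonian vector fields and the Jacobiator as a trivector field\<close>

definition ham :: "('m \<Rightarrow> real) \<Rightarrow> 'm vfield"
  where "ham f = (\<lambda>p. sharp A \<pi> p (extd A f p))"

abbreviation fb :: "('m \<Rightarrow> real) \<Rightarrow> ('m \<Rightarrow> real) \<Rightarrow> 'm \<Rightarrow> real"
  where "fb \<equiv> fun_bracket A \<pi>"

lemma ham_VF: "f \<in> C \<Longrightarrow> ham f \<in> VF"
  unfolding ham_def by (rule sharp_VF[OF extd_OF1])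

lemma ham_apply: "f \<in> C \<Longrightarrow> g \<in> C \<Longrightarrow> ham f p g = fb f g p"
  unfolding ham_def fun_bracket_def by (rule sharp_apply[OF extd_cotangent])

lemma fb_C: "f \<in> C \<Longrightarrow> g \<in> C \<Longrightarrow> fb f g \<in> C"
  unfolding fun_bracket_def by (rule bivec_C[OF extd_OF1 extd_OF1])

lemma fb_skew: "f \<in> C \<Longrightarrow> g \<in> C \<Longrightarrow> fb f g p = - fb g f p"
  unfolding fun_bracket_def by (rule bivec_skew[OF extd_cotangent extd_cotangent])

text \<open>Each of the two Lie derivatives contributes \<open>d {f, g}\<close>, the second after
  using skew-symmetry, and the last term of the bracket removes one copy.\<close>

lemma form_bracket_extd:
  assumes f: "f \<in> C" and g: "g \<in> C"
  shows "form_bracket A \<pi> (extd A f) (extd A g) = extd A (fb f g)"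
proof
  fix p
  have 1: "lie_form A (\<lambda>p. sharp A \<pi> p (extd A f p)) (extd A g) = extd A (fb f g)"
    using lie_form_extd[OF ham_VF[OF f] g] unfolding ham_apply[OF f g] unfolding ham_def .
  have 2: "lie_form A (\<lambda>p. sharp A \<pi> p (extd A g p)) (extd A f) = extd A (fb g f)"
    using lie_form_extd[OF ham_VF[OF g] f] unfolding ham_apply[OF g f] unfolding ham_def .
  have "fb g f = (\<lambda>p. -1 * fb f g p)" using fb_skew[OF g f] by auto
  then have "extd A (fb g f) p = - extd A (fb f g) p" using extd_cmult[OF fb_C[OF f g], of "-1" p] by simp
  then show "form_bracket A \<pi> (extd A f) (extd A g) p = extd A (fb f g) p"
    unfolding form_bracket_apply 1 2 fun_bracket_def[symmetric] by simp
qed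

definition jac :: "('m \<Rightarrow> real) \<Rightarrow> ('m \<Rightarrow> real) \<Rightarrow> ('m \<Rightarrow> real) \<Rightarrow> 'm \<Rightarrow> real"
  where "jac f g h p = fb f (fb g h) p + fb g (fb h f) p + fb h (fb f g) p"

lemma jac_cycle: "jac f g h p = jac g h f p"
  by (simp add: jac_def)

lemma jac_C: "f \<in> C \<Longrightarrow> g \<in> C \<Longrightarrow> h \<in> C \<Longrightarrow> jac f g h \<in> C"
  unfolding jac_def by (intro C_add fb_C)

text \<open>The failure of \<open>ham\<close> to preserve brackets. It is a tangent vector whose
  value on \<open>h\<close> is the Jacobiator, which therefore depends on \<open>h\<close> only
  through its differential at \<open>p\<close>, in spite of the second derivatives in the double
  brackets.\<close>

definition jac_vec :: "('m \<Rightarrow> real) \<Rightarrow> ('m \<Rightarrow> real) \<Rightarrow> 'm vfield"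
  where "jac_vec f g p = vf_bracket (ham f) (ham g) p - ham (fb f g) p"

lemma jac_vec_T: "f \<in> C \<Longrightarrow> g \<in> C \<Longrightarrow> jac_vec f g p \<in> T p"
  unfolding jac_vec_def by (intro T_diff VF_T vf_bracket_VF ham_VF fb_C)

lemma jac_vec_apply:
  assumes f: "f \<in> C" and g: "g \<in> C" and h: "h \<in> C"
  shows "jac_vec f g p h = jac f g h p"
proof -
  have e: "(\<lambda>q. ham f q h) = (\<lambda>q. -1 * fb h f q)" "(\<lambda>q. ham g q h) = fb g h"
    using ham_apply[OF f h] fb_skew[OF f h] ham_apply[OF g h] by auto
  have "ham g p (\<lambda>q. ham f q h) = - fb g (fb h f) p"
    unfolding e tangentD(2)[OF VF_T[OF ham_VF[OF g]] fb_C[OF h f]] ham_apply[OF g fb_C[OF h f]] by simp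
  moreover have "ham f p (\<lambda>q. ham g q h) = fb f (fb g h) p"
    unfolding e ham_apply[OF f fb_C[OF g h]] ..
  moreover have "ham (fb f g) p h = - fb h (fb f g) p"
    unfolding ham_apply[OF fb_C[OF f g] h] by (rule fb_skew[OF fb_C[OF f g] h])
  ultimately show ?thesis by (simp add: jac_vec_def vf_bracket_def jac_def)
qed

lemma jac_extd:
  assumes f: "f \<in> C" and g: "g \<in> C" and h: "h \<in> C"
  shows "jac f g h p = extd A f p (jac_vec g h p)"
  using jac_vec_apply[OF g h f] jac_cycle[of f g h p] extd_apply[OF jac_vec_T[OF g h]] by simp

text \<open>By \<open>jac_extd\<close> the first slot matters only through its differential at
  \<open>p\<close>; cyclic symmetry rotates each slot into first position.\<close>

lemma jac_cong:
  assumes "f \<in> C" "g \<in> C" "h \<in> C" "f' \<in> C" "g' \<in> C" "h' \<in> C"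
    and "extd A f p = extd A f' p" "extd A g p = extd A g' p" "extd A h p = extd A h' p"
  shows "jac f g h p = jac f' g' h' p"
proof -
  have "jac f g h p = jac f' g h p" using assms by (simp add: jac_extd)
  also have "\<dots> = jac f' g' h p"
    unfolding jac_cycle[of f'] using assms by (simp add: jac_extd)
  also have "\<dots> = jac f' g' h' p"
    unfolding jac_cycle[of f'] jac_cycle[of g'] using assms by (simp add: jac_extd)
  finally show ?thesis .
qed

lemma jac_alternating:
  assumes f: "f \<in> C" and g: "g \<in> C"
  shows "jac f f g p = 0"
proof -
  have e: "fb f f = (\<lambda>q. 0)" using fb_skew[OF f f] by (auto simp: fun_eq_iff)
  have s: "fb g f = (\<lambda>p. -1 * fb f g p)" using fb_skew[OF g f] by auto
  have "fb f (fb g f) p = - fb f (fb f g) p"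
    unfolding s ham_apply[OF f C_mult[OF C_const fb_C[OF f g]], symmetric] tangentD(2)[OF VF_T[OF ham_VF[OF f]] fb_C[OF f g]]
      ham_apply[OF f fb_C[OF f g]] by simp
  moreover have "fb g (fb f f) p = 0"
    unfolding e ham_apply[OF g C_const, symmetric] by (rule tangent_const[OF VF_T[OF ham_VF[OF g]]])
  ultimately show ?thesis by (simp add: jac_def)
qed

definition potential :: "'m \<Rightarrow> 'm covec \<Rightarrow> 'm \<Rightarrow> real"
  where "potential p a = (SOME f. f \<in> C \<and> extd A f p = a)"

lemma potential:
  assumes "a \<in> cotangent A p"
  shows "potential p a \<in> C" "extd A (potential p a) p = a"
proof -
  have "\<exists>f. f \<in> C \<and> extd A f p = a" using covector_exact[OF assms] by blast
  from someI_ex[OF this] show "potential p a \<in> C" "extd A (potential p a) p = a"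
    unfolding potential_def by simp_all
qed

text \<open>Independent of the chosen potentials by \<open>jac_cong\<close>. The factor 2 is the
  normalisation of \<open>schouten_square\<close>.\<close>

definition jac_tri :: "'m trivec"
  where "jac_tri p a b c = (if a \<in> cotangent A p \<and> b \<in> cotangent A p \<and> c \<in> cotangent A p
    then 2 * jac (potential p a) (potential p b) (potential p c) p else 0)"

lemma jac_tri_extd:
  assumes "f \<in> C" "g \<in> C" "h \<in> C"
  shows "jac_tri p (extd A f p) (extd A g p) (extd A h p) = 2 * jac f g h p"
  using jac_cong[OF potential(1)[OF extd_cotangent[OF assms(1)]] potential(1)[OF extd_cotangent[OF assms(2)]]
      potential(1)[OF extd_cotangent[OF assms(3)]] assms, of p p p p] potential(2) extd_cotangent assms
  by (simp add: jac_tri_def)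

lemma jac_tri_cycle: "jac_tri p a b c = jac_tri p b c a"
  unfolding jac_tri_def using jac_cycle by auto

lemma jac_tri_linear:
  assumes b: "b \<in> cotangent A p" and c: "c \<in> cotangent A p"
  shows "linear_on (cotangent A p) (\<lambda>a. jac_tri p a b c)"
proof -
  have "jac_tri p a b c = 2 * a (jac_vec (potential p b) (potential p c) p)" if a: "a \<in> cotangent A p" for a
    using jac_extd[OF potential(1)[OF a] potential(1)[OF b] potential(1)[OF c], of p] potential(2)[OF a] a b c
    by (simp add: jac_tri_def)
  then show ?thesis
    by (simp add: linear_on_def subspace_add[OF subspace_dual] subspace_scale[OF subspace_dual])
qed

lemma jac_tri_alternating: "jac_tri p a a b = 0"
  unfolding jac_tri_def using jac_alternating potential(1) by simp

lemma jac_tri_trivector: "jac_tri \<in> trivector_fields A"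
  unfolding trivector_fields_def
proof (intro CollectI conjI allI ballI)
  have cyc2: "jac_tri p a b c = jac_tri p c a b" for p a b c using jac_tri_cycle by metis
  have lin2: "linear_on (cotangent A p) (\<lambda>b. jac_tri p a b c)" if "a \<in> cotangent A p" "c \<in> cotangent A p" for p a c
    using jac_tri_linear[OF that(2,1)] unfolding jac_tri_cycle[of p a] .
  have lin3: "linear_on (cotangent A p) (\<lambda>c. jac_tri p a b c)" if "a \<in> cotangent A p" "b \<in> cotangent A p" for p a b
    using jac_tri_linear[OF that] unfolding cyc2[of p a b] .
  show "jac_tri p \<in> ext_power3 (T p)" for p
    unfolding ext_power3_def
  proof (intro CollectI conjI ballI allI impI)
    fix a b assume a: "a \<in> cotangent A p" and b: "b \<in> cotangent A p"
    show "linear_on (cotangent A p) (\<lambda>c. jac_tri p c a b)" by (rule jac_tri_linear[OF a b])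
    show "linear_on (cotangent A p) (\<lambda>c. jac_tri p a c b)" by (rule lin2[OF a b])
    show "linear_on (cotangent A p) (\<lambda>c. jac_tri p a b c)" by (rule lin3[OF a b])
    show "jac_tri p a a b = 0" by (rule jac_tri_alternating)
    show "jac_tri p a b b = 0" unfolding jac_tri_cycle[of p a] by (rule jac_tri_alternating)
    show "jac_tri p a b a = 0" unfolding cyc2[of p a b] by (rule jac_tri_alternating)
  next
    fix a b c assume "a \<notin> cotangent A p \<or> b \<notin> cotangent A p \<or> c \<notin> cotangent A p"
    then show "jac_tri p a b c = 0" unfolding jac_tri_def by auto
  qed
  fix \<alpha> \<beta> \<gamma> assume \<alpha>: "\<alpha> \<in> OF1" and \<beta>: "\<beta> \<in> OF1" and \<gamma>: "\<gamma> \<in> OF1"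
  show "(\<lambda>p. jac_tri p (\<alpha> p) (\<beta> p) (\<gamma> p)) \<in> C"
  proof (rule C_localI)
    fix p
    obtain W x E where p: "p \<in> W" and fr: "frame_on W x E" using frame_on_exists by blast
    note f = frame_onD[OF fr]
    \<comment> \<open>Over a frame domain the value is a combination of Jacobiators of coordinate
      functions, with coefficients that are all globally smooth.\<close>
    let ?s = "\<lambda>q. \<Sum>u\<in>bs. \<Sum>v\<in>bs. \<Sum>w\<in>bs. \<alpha> q (E u q) * \<beta> q (E v q) * \<gamma> q (E w q) * (2 * jac (x u) (x v) (x w) q)"
    have "?s \<in> C"
      by (intro C_sum C_mult C_const jac_C f(2) OF1_C[OF \<alpha> f(3)] OF1_C[OF \<beta> f(3)] OF1_C[OF \<gamma> f(3)])
    then have s: "smooth_fun_on A W ?s" by (rule C_imp_smooth_fun_on)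
    have "jac_tri q (\<alpha> q) (\<beta> q) (\<gamma> q) = ?s q" if q: "q \<in> W" for q
    proof -
      note ex = dual_frame_expand_dual[OF frame_on_dual_frame[OF fr q] OF1_cotangent, symmetric]
      have "jac_tri q (\<alpha> q) (\<beta> q) (\<gamma> q)
          = jac_tri q (\<Sum>u\<in>bs. \<alpha> q (E u q) *\<^sub>R extd A (x u) q) (\<Sum>u\<in>bs. \<beta> q (E u q) *\<^sub>R extd A (x u) q)
              (\<Sum>u\<in>bs. \<gamma> q (E u q) *\<^sub>R extd A (x u) q)"
        by (rule arg_cong3[OF ex[OF \<alpha>] ex[OF \<beta>] ex[OF \<gamma>]])
      also have "\<dots> = (\<Sum>u\<in>bs. \<Sum>v\<in>bs. \<Sum>w\<in>bs. \<alpha> q (E u q) * \<beta> q (E v q) * \<gamma> q (E w q)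
          * jac_tri q (extd A (x u) q) (extd A (x v) q) (extd A (x w) q))"
        by (rule trilinear_expand[OF subspace_dual jac_tri_linear lin2 lin3 extd_cotangent[OF f(2)]])
      also have "\<dots> = ?s q" by (simp only: jac_tri_extd[OF f(2) f(2) f(2)])
      finally show ?thesis .
    qed
    then have "smooth_fun_on A W (\<lambda>q. jac_tri q (\<alpha> q) (\<beta> q) (\<gamma> q))"
      by (intro smooth_fun_on_cong[OF f(1) s]) simp
    then show "\<exists>V. open V \<and> p \<in> V \<and> smooth_fun_on A V (\<lambda>q. jac_tri q (\<alpha> q) (\<beta> q) (\<gamma> q))"
      using f(1) p by blast
  qed
qed

text \<open>Every covector at a point is a differential, so values on exact forms determine a
  trivector field; outside the cotangent spaces both sides are 0 by convention.\<close>

lemma trivector_eqI: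
  assumes "\<tau> \<in> trivector_fields A" "\<tau>' \<in> trivector_fields A"
    and "\<And>f g h p. f \<in> C \<Longrightarrow> g \<in> C \<Longrightarrow> h \<in> C \<Longrightarrow>
      \<tau> p (extd A f p) (extd A g p) (extd A h p) = \<tau>' p (extd A f p) (extd A g p) (extd A h p)"
  shows "\<tau> = \<tau>'"
proof (intro ext)
  fix p a b c
  show "\<tau> p a b c = \<tau>' p a b c"
  proof (cases "a \<in> cotangent A p \<and> b \<in> cotangent A p \<and> c \<in> cotangent A p")
    case True
    then show ?thesis using assms(3)[OF potential(1)[of a p] potential(1)[of b p] potential(1)[of c p], of p] by (simp add: potential(2))
  next
    case False
    then have "\<tau> p a b c = 0" "\<tau>' p a b c = 0"
      using assms(1,2) by (auto simp: trivector_fields_def ext_power3_def)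
    then show ?thesis by simp
  qed
qed

text \<open>\<open>jac_tri\<close> provides existence and \<open>trivector_eqI\<close> uniqueness,
  which removes the definite description: an equation for the Schouten square becomes an identity of
  Jacobiators.\<close>

lemma schouten_square_eq_iff:
  assumes \<tau>: "\<tau> \<in> trivector_fields A"
  shows "schouten_square A \<pi> = \<tau> \<longleftrightarrow>
    (\<forall>f\<in>C. \<forall>g\<in>C. \<forall>h\<in>C. \<forall>p. \<tau> p (extd A f p) (extd A g p) (extd A h p) = 2 * jac f g h p)"
proof -
  have spec: "1 / 2 * x = fb f (fb g h) p + fb g (fb h f) p + fb h (fb f g) p \<longleftrightarrow> x = 2 * jac f g h p" for x f g h p
    by (auto simp: jac_def)
  have "schouten_square A \<pi> = jac_tri"
    unfolding schouten_square_def spec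
  proof (rule the_equality)
    show "jac_tri \<in> trivector_fields A \<and> (\<forall>f\<in>C. \<forall>g\<in>C. \<forall>h\<in>C. \<forall>p.
        jac_tri p (extd A f p) (extd A g p) (extd A h p) = 2 * jac f g h p)"
      using jac_tri_trivector jac_tri_extd by simp
    fix \<tau> assume "\<tau> \<in> trivector_fields A \<and> (\<forall>f\<in>C. \<forall>g\<in>C. \<forall>h\<in>C. \<forall>p.
        \<tau> p (extd A f p) (extd A g p) (extd A h p) = 2 * jac f g h p)"
    then show "\<tau> = jac_tri"
      by (intro trivector_eqI) (simp_all add: jac_tri_trivector jac_tri_extd)
  qed
  then show ?thesis
    using trivector_eqI[OF \<tau> jac_tri_trivector] jac_tri_extd by auto
qed

end

text \<open>For an indexed family independence includes that no vector is repeated; the coefficients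
  1 at \<open>i\<close> and -1 at \<open>j\<close> exclude a repetition.\<close>

lemma independent_family:
  fixes e :: "'i \<Rightarrow> 'v::real_vector"
  assumes fin: "finite I" and zero: "\<And>a i. (\<Sum>i\<in>I. a i *\<^sub>R e i) = 0 \<Longrightarrow> i \<in> I \<Longrightarrow> a i = 0"
  shows "inj_on e I" "independent (e ` I)"
proof -
  show inj: "inj_on e I"
  proof (rule inj_onI, rule ccontr)
    fix i j assume ij: "i \<in> I" "j \<in> I" "e i = e j" "i \<noteq> j"
    have "(\<Sum>k\<in>I. ((if k = i then 1 else 0) - (if k = j then 1 else 0)) *\<^sub>R e k) = e i - e j"
      using ij(1,2) fin by (simp add: scaleR_diff_left sum_subtractf if_distrib[of "\<lambda>c. c *\<^sub>R _"] cong: if_cong)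
    also have "\<dots> = 0" using ij(3) by simp
    finally show False using zero[of "\<lambda>k. (if k = i then 1 else 0) - (if k = j then 1 else 0)" i] ij(1,4) by simp
  qed
  show "independent (e ` I)"
  proof (rule independent_if_scalars_zero)
    fix f x assume 0: "(\<Sum>x\<in>e ` I. f x *\<^sub>R x) = 0" and x: "x \<in> e ` I"
    have "(\<Sum>i\<in>I. f (e i) *\<^sub>R e i) = 0" using 0 by (simp add: sum.reindex[OF inj])
    then show "f x = 0" using zero[of "\<lambda>i. f (e i)"] x by blast
  qed (use fin in simp)
qed

lemma biorthogonal_family:
  assumes V: "subspace V" and fin: "finite I" and e: "\<And>i. i \<in> I \<Longrightarrow> e i \<in> V"
    and L: "\<And>i. i \<in> I \<Longrightarrow> linear_on V (L i)"
    and LE: "\<And>i j. i \<in> I \<Longrightarrow> j \<in> I \<Longrightarrow> L i (e j) = (if i = j then 1 else 0 :: real)"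
  shows "inj_on e I" "independent (e ` I)"
proof -
  have "a i = 0" if 0: "(\<Sum>i\<in>I. a i *\<^sub>R e i) = 0" and i: "i \<in> I" for a i
  proof -
    have "0 = L i (\<Sum>j\<in>I. a j *\<^sub>R e j)" using linear_on_0[OF L[OF i] subspace_0[OF V]] 0 by simp
    also have "\<dots> = (\<Sum>j\<in>I. L i (a j *\<^sub>R e j))" by (rule linear_on_sum[OF V L[OF i]]) (intro subspace_scale[OF V] e)
    also have "\<dots> = (\<Sum>j\<in>I. if i = j then a j else 0)"
      by (rule sum.cong) (simp_all add: linear_onD(2)[OF L[OF i]] e LE i)
    also have "\<dots> = a i" using i fin by simp
    finally show ?thesis by simp
  qed
  then show "inj_on e I" "independent (e ` I)" using independent_family[OF fin, of e] by blast+
qed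

section \<open>The trivector of a quadratic Lie algebra\<close>

text \<open>The group serves only to produce these data: a finite dimensional Lie algebra of vector
  fields with a basis \<open>us\<close>, the dual basis \<open>cs\<close>, and a nondegenerate
  symmetric form whose bi-invariance is recorded infinitesimally as \<open>B_inv\<close>.\<close>

locale quadratic_lie_algebra =
  fixes \<gg> :: "'g vfield set" and B :: "'g vfield \<Rightarrow> 'g vfield \<Rightarrow> real"
    and n :: nat and us :: "nat \<Rightarrow> 'g vfield" and cs :: "nat \<Rightarrow> 'g vfield \<Rightarrow> real"
  assumes frame: "dual_frame \<gg> {..<n} us cs"
    and biorth: "i < n \<Longrightarrow> j < n \<Longrightarrow> cs i (us j) = (if i = j then 1 else 0)"
    and lie: "lie_bracket_on \<gg> vf_bracket"
    and B_linear: "u \<in> \<gg> \<Longrightarrow> linear_on \<gg> (B u)"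
    and B_sym: "u \<in> \<gg> \<Longrightarrow> v \<in> \<gg> \<Longrightarrow> B u v = B v u"
    and B_nondeg: "u \<in> \<gg> \<Longrightarrow> (\<And>v. v \<in> \<gg> \<Longrightarrow> B u v = 0) \<Longrightarrow> u = 0"
    and B_inv: "u \<in> \<gg> \<Longrightarrow> v \<in> \<gg> \<Longrightarrow> w \<in> \<gg> \<Longrightarrow> B (vf_bracket u v) w = B u (vf_bracket v w)"
begin

lemmas subspace_g = dual_frameD(1)[OF frame]
lemmas g_add = subspace_add[OF subspace_g] and g_scale = subspace_scale[OF subspace_g]
  and g_0 = subspace_0[OF subspace_g]

lemma us_g: "i < n \<Longrightarrow> us i \<in> \<gg>" and cs_dual: "i < n \<Longrightarrow> cs i \<in> dual \<gg>"
  using dual_frameD(3,4)[OF frame] by simp_all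

lemma g_expand: "v \<in> \<gg> \<Longrightarrow> (\<Sum>i<n. cs i v *\<^sub>R us i) = v"
  using dual_frameD(5)[OF frame] .

lemma dual_expand: "a \<in> dual \<gg> \<Longrightarrow> (\<Sum>i<n. a (us i) *\<^sub>R cs i) = a"
  using dual_frame_expand_dual[OF frame] .

lemmas lie_unfolded = lie[unfolded lie_bracket_on_def jacobi_on_def]

lemma lb_closed: "u \<in> \<gg> \<Longrightarrow> v \<in> \<gg> \<Longrightarrow> vf_bracket u v \<in> \<gg>"
  by (rule subsetD[OF conjunct1[OF bspec[OF conjunct1[OF lie_unfolded]]] imageI])

lemma lb_linear: "u \<in> \<gg> \<Longrightarrow> linear_on \<gg> (vf_bracket u)"
  by (rule conjunct2[OF bspec[OF conjunct1[OF lie_unfolded]]])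

lemma lb_skew: "u \<in> \<gg> \<Longrightarrow> v \<in> \<gg> \<Longrightarrow> vf_bracket u v = - vf_bracket v u"
  by (rule bspec[OF bspec[OF conjunct1[OF conjunct2[OF lie_unfolded]]]])

lemma lb_jacobi: "u \<in> \<gg> \<Longrightarrow> v \<in> \<gg> \<Longrightarrow> w \<in> \<gg> \<Longrightarrow>
    vf_bracket u (vf_bracket v w) + vf_bracket v (vf_bracket w u) + vf_bracket w (vf_bracket u v) = 0"
  by (rule bspec[OF bspec[OF bspec[OF conjunct2[OF conjunct2[OF lie_unfolded]]]]])

lemma lb_linear2:
  assumes u: "u \<in> \<gg>"
  shows "linear_on \<gg> (\<lambda>v. vf_bracket v u)"
  unfolding linear_on_def
proof (intro conjI ballI allI)
  fix x y c assume x: "x \<in> \<gg>"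
  show "vf_bracket (c *\<^sub>R x) u = c *\<^sub>R vf_bracket x u"
    unfolding lb_skew[OF g_scale[OF x] u] lb_skew[OF x u] linear_onD(2)[OF lb_linear[OF u] x]
    by (rule scaleR_minus_right[symmetric])
  assume y: "y \<in> \<gg>"
  show "vf_bracket (x + y) u = vf_bracket x u + vf_bracket y u"
    unfolding lb_skew[OF g_add[OF x y] u] lb_skew[OF x u] lb_skew[OF y u] linear_onD(1)[OF lb_linear[OF u] x y]
    by (rule minus_add_distrib)
qed

lemma flat_apply: "v \<in> \<gg> \<Longrightarrow> flat \<gg> B u v = B u v"
  by (simp add: flat_def)

lemma flat_dual: "u \<in> \<gg> \<Longrightarrow> flat \<gg> B u \<in> dual \<gg>"
proof (rule dualI)
  fix x y c assume u: "u \<in> \<gg>" and x: "x \<in> \<gg>"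
  show "flat \<gg> B u (c *\<^sub>R x) = c * flat \<gg> B u x"
    unfolding flat_apply[OF x] flat_apply[OF g_scale[OF x]] linear_onD(2)[OF B_linear[OF u] x] by simp
  assume y: "y \<in> \<gg>"
  show "flat \<gg> B u (x + y) = flat \<gg> B u x + flat \<gg> B u y"
    unfolding flat_apply[OF x] flat_apply[OF y] flat_apply[OF g_add[OF x y]] by (rule linear_onD(1)[OF B_linear[OF u] x y])
qed (simp add: flat_def)

lemma flat_linear: "linear_on \<gg> (flat \<gg> B)"
  unfolding linear_on_def
proof (intro conjI ballI allI)
  fix x y c assume x: "x \<in> \<gg>"
  show "flat \<gg> B (c *\<^sub>R x) = c *\<^sub>R flat \<gg> B x"
  proof (rule dual_eqI[OF flat_dual[OF g_scale[OF x]] subspace_scale[OF subspace_dual flat_dual[OF x]]])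
    fix w assume w: "w \<in> \<gg>"
    show "flat \<gg> B (c *\<^sub>R x) w = (c *\<^sub>R flat \<gg> B x) w"
      using linear_onD(2)[OF B_linear[OF w] x, of c] B_sym[OF g_scale[OF x] w] B_sym[OF x w]
      by (simp only: flat_apply[OF w] scaleR_fun_apply)
  qed
  assume y: "y \<in> \<gg>"
  show "flat \<gg> B (x + y) = flat \<gg> B x + flat \<gg> B y"
  proof (rule dual_eqI[OF flat_dual[OF g_add[OF x y]] subspace_add[OF subspace_dual flat_dual[OF x] flat_dual[OF y]]])
    fix w assume w: "w \<in> \<gg>"
    show "flat \<gg> B (x + y) w = (flat \<gg> B x + flat \<gg> B y) w"
      using linear_onD(1)[OF B_linear[OF w] x y] B_sym[OF g_add[OF x y] w] B_sym[OF x w] B_sym[OF y w]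
      by (simp only: flat_apply[OF w] plus_fun_apply)
  qed
qed

lemma flat_0_iff: "u \<in> \<gg> \<Longrightarrow> flat \<gg> B u = 0 \<Longrightarrow> u = 0"
  by (rule B_nondeg) (metis flat_apply zero_fun_apply)+

lemma flat_inj: "u \<in> \<gg> \<Longrightarrow> v \<in> \<gg> \<Longrightarrow> flat \<gg> B u = flat \<gg> B v \<Longrightarrow> u = v"
  using flat_0_iff[of "u - v"] linear_on_diff[OF subspace_g flat_linear, of u v] subspace_diff[OF subspace_g, of u v] by simp

text \<open>\<open>flat\<close> is onto the dual by counting dimensions.\<close>

lemma flat_surj:
  assumes c: "c \<in> dual \<gg>"
  obtains u where "u \<in> \<gg>" "flat \<gg> B u = c"
proof -
  let ?e = "\<lambda>i. flat \<gg> B (us i)" and ?I = "{..<n}"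
  have "a i = 0" if 0: "(\<Sum>i\<in>?I. a i *\<^sub>R ?e i) = 0" and i: "i \<in> ?I" for a i
  proof -
    have uV: "(\<Sum>i\<in>?I. a i *\<^sub>R us i) \<in> \<gg>" by (intro subspace_sum[OF subspace_g] g_scale us_g) simp
    have "flat \<gg> B (\<Sum>i\<in>?I. a i *\<^sub>R us i) = (\<Sum>i\<in>?I. flat \<gg> B (a i *\<^sub>R us i))"
      by (rule linear_on_sum[OF subspace_g flat_linear]) (intro g_scale us_g, simp)
    also have "\<dots> = (\<Sum>i\<in>?I. a i *\<^sub>R ?e i)"
      by (rule sum.cong[OF refl], rule linear_onD(2)[OF flat_linear us_g]) simp
    also have "\<dots> = 0" by (rule 0)
    finally have z: "(\<Sum>i\<in>?I. a i *\<^sub>R us i) = 0" by (rule flat_0_iff[OF uV])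
    have "0 = cs i (\<Sum>j\<in>?I. a j *\<^sub>R us j)"
      unfolding z using linear_on_0[OF dual_linear[OF cs_dual] g_0] i by simp
    also have "\<dots> = (\<Sum>j\<in>?I. cs i (a j *\<^sub>R us j))"
      by (rule linear_on_sum[OF subspace_g dual_linear[OF cs_dual]]) (use i g_scale us_g in simp_all)
    also have "\<dots> = (\<Sum>j\<in>?I. if j = i then a j else 0)"
      by (rule sum.cong) (use i in \<open>simp_all add: linear_onD(2)[OF dual_linear[OF cs_dual] us_g] biorth\<close>)
    also have "\<dots> = a i" using i by simp
    finally show ?thesis by simp
  qed
  then have inj: "inj_on ?e ?I" and ind: "independent (?e ` ?I)"
    using independent_family[of ?I ?e] by blast+
  have sp: "a \<in> span (cs ` ?I)" if "a \<in> dual \<gg>" for a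
  proof -
    have "(\<Sum>i\<in>?I. a (us i) *\<^sub>R cs i) \<in> span (cs ` ?I)" by (intro span_sum span_scale span_base imageI)
    then show ?thesis unfolding dual_expand[OF that] .
  qed
  have "c \<in> span (?e ` ?I)"
  proof (rule ccontr)
    \<comment> \<open>Otherwise \<open>c\<close> and the \<open>n\<close> images of the basis would
      be \<open>n + 1\<close> independent elements in the span of the \<open>n\<close> functionals
      \<open>cs\<close>.\<close>
    assume nc: "c \<notin> span (?e ` ?I)"
    have "independent (insert c (?e ` ?I))" by (rule independent_insertI[OF nc ind])
    moreover have "insert c (?e ` ?I) \<subseteq> span (cs ` ?I)" using sp c flat_dual us_g by auto
    ultimately have "card (insert c (?e ` ?I)) \<le> card (cs ` ?I)"
      using independent_span_bound[of "cs ` ?I"] by blast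
    also have "\<dots> \<le> n" using card_image_le[of ?I cs] by simp
    finally show False using nc span_base[of c "?e ` ?I"] card_image[OF inj] by (subst (asm) card_insert_disjoint) auto
  qed
  moreover have "span (?e ` ?I) \<subseteq> flat \<gg> B ` \<gg>"
  proof (rule span_minimal)
    show "?e ` ?I \<subseteq> flat \<gg> B ` \<gg>" using us_g by auto
    show "subspace (flat \<gg> B ` \<gg>)"
      unfolding subspace_def
    proof (intro conjI ballI allI)
      show "0 \<in> flat \<gg> B ` \<gg>" using linear_on_0[OF flat_linear g_0] g_0 by (metis imageI)
      fix x y r assume "x \<in> flat \<gg> B ` \<gg>"
      then obtain u where u: "u \<in> \<gg>" "x = flat \<gg> B u" by blast
      show "r *\<^sub>R x \<in> flat \<gg> B ` \<gg>"
        unfolding u(2) linear_onD(2)[OF flat_linear u(1), symmetric] by (intro imageI g_scale u(1))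
      assume "y \<in> flat \<gg> B ` \<gg>"
      then obtain v where v: "v \<in> \<gg>" "y = flat \<gg> B v" by blast
      show "x + y \<in> flat \<gg> B ` \<gg>"
        unfolding u(2) v(2) linear_onD(1)[OF flat_linear u(1) v(1), symmetric] by (intro imageI g_add u(1) v(1))
    qed
  qed
  ultimately show ?thesis using that by blast
qed

definition unflat :: "('g vfield \<Rightarrow> real) \<Rightarrow> 'g vfield"
  where "unflat c = (SOME u. u \<in> \<gg> \<and> flat \<gg> B u = c)"

lemma unflat:
  assumes "c \<in> dual \<gg>"
  shows "unflat c \<in> \<gg>" "flat \<gg> B (unflat c) = c"
proof -
  have "\<exists>u. u \<in> \<gg> \<and> flat \<gg> B u = c" using flat_surj[OF assms] by blast
  from someI_ex[OF this] show "unflat c \<in> \<gg>" "flat \<gg> B (unflat c) = c"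
    unfolding unflat_def by simp_all
qed

lemma unflat_flat: "u \<in> \<gg> \<Longrightarrow> unflat (flat \<gg> B u) = u"
  by (rule flat_inj[OF unflat(1)[OF flat_dual] _ unflat(2)[OF flat_dual]])

text \<open>The trilinear form \<open>1/2 (u, [v, w])\<close> transported to the dual along the
  isomorphism \<open>flat\<close>: the explicit candidate for the description
  \<open>chi_G\<close>.\<close>

definition chi :: "('g vfield \<Rightarrow> real) \<Rightarrow> ('g vfield \<Rightarrow> real) \<Rightarrow> ('g vfield \<Rightarrow> real) \<Rightarrow> real"
  where "chi a b c = (if a \<in> dual \<gg> \<and> b \<in> dual \<gg> \<and> c \<in> dual \<gg>
    then 1/2 * B (unflat a) (vf_bracket (unflat b) (unflat c)) else 0)"

lemma B_cycle: "u \<in> \<gg> \<Longrightarrow> v \<in> \<gg> \<Longrightarrow> w \<in> \<gg> \<Longrightarrow> B u (vf_bracket v w) = B v (vf_bracket w u)"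
  using B_inv[of v w u] B_sym[of u "vf_bracket v w"] lb_closed by simp

lemma chi_cycle: "chi a b c = chi b c a"
  unfolding chi_def using B_cycle[OF unflat(1) unflat(1) unflat(1)] by auto

text \<open>In the first slot \<open>B (unflat a) x = a x\<close>, so \<open>unflat\<close>
  disappears and linearity is evident; cyclicity passes it on to the other slots.\<close>

lemma chi_linear1:
  assumes b: "b \<in> dual \<gg>" and c: "c \<in> dual \<gg>"
  shows "linear_on (dual \<gg>) (\<lambda>a. chi a b c)"
proof -
  let ?x = "vf_bracket (unflat b) (unflat c)"
  have x: "?x \<in> \<gg>" by (rule lb_closed[OF unflat(1)[OF b] unflat(1)[OF c]])
  have e: "chi a b c = 1/2 * a ?x" if a: "a \<in> dual \<gg>" for a
    using arg_cong[OF unflat(2)[OF a], of "\<lambda>f. f ?x"] a b c by (simp add: chi_def flat_apply[OF x])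
  show ?thesis
    unfolding linear_on_def
    by (simp add: e subspace_add[OF subspace_dual] subspace_scale[OF subspace_dual] algebra_simps)
qed

lemma chi_cycle2: "chi a b c = chi c a b"
  using chi_cycle by metis

lemma chi_linear2: "a \<in> dual \<gg> \<Longrightarrow> c \<in> dual \<gg> \<Longrightarrow> linear_on (dual \<gg>) (\<lambda>b. chi a b c)"
  unfolding chi_cycle[of a] by (rule chi_linear1)

lemma chi_linear3: "a \<in> dual \<gg> \<Longrightarrow> b \<in> dual \<gg> \<Longrightarrow> linear_on (dual \<gg>) (\<lambda>c. chi a b c)"
  unfolding chi_cycle2[of a] by (rule chi_linear1)

lemma chi_skew:
  assumes "a \<in> dual \<gg>" "b \<in> dual \<gg>" "c \<in> dual \<gg>"
  shows "chi a b c = - chi a c b"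
proof -
  note u = unflat(1)[OF assms(1)] unflat(1)[OF assms(2)] unflat(1)[OF assms(3)]
  have "B (unflat a) (vf_bracket (unflat b) (unflat c)) = - B (unflat a) (vf_bracket (unflat c) (unflat b))"
    unfolding lb_skew[OF u(2,3)] by (rule linear_on_minus[OF B_linear[OF u(1)] lb_closed[OF u(3,2)]])
  then show ?thesis using assms by (simp add: chi_def)
qed

lemma chi_ext_power3: "chi \<in> ext_power3 \<gg>"
  unfolding ext_power3_def
proof (intro CollectI conjI ballI allI impI)
  fix a b assume a: "a \<in> dual \<gg>" and b: "b \<in> dual \<gg>"
  show "linear_on (dual \<gg>) (\<lambda>c. chi c a b)" by (rule chi_linear1[OF a b])
  show "linear_on (dual \<gg>) (\<lambda>c. chi a c b)" by (rule chi_linear2[OF a b])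
  show "linear_on (dual \<gg>) (\<lambda>c. chi a b c)" by (rule chi_linear3[OF a b])
  have alt: "chi x y y = 0" if "x \<in> dual \<gg>" "y \<in> dual \<gg>" for x y using chi_skew[OF that(1,2,2)] by simp
  show "chi a b b = 0" by (rule alt[OF a b])
  show "chi a a b = 0" unfolding chi_cycle2[of a] by (rule alt[OF b a])
  show "chi a b a = 0" unfolding chi_cycle[of a] by (rule alt[OF b a])
next
  fix a b c assume "a \<notin> dual \<gg> \<or> b \<notin> dual \<gg> \<or> c \<notin> dual \<gg>"
  then show "chi a b c = 0" by (auto simp: chi_def)
qed

text \<open>Uniqueness holds because \<open>flat\<close> maps onto the dual, so the prescribed
  values are all the values.\<close>

lemma chi_G_eq: "chi_G \<gg> B = chi"
  unfolding chi_G_def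
proof (rule the_equality)
  show "chi \<in> ext_power3 \<gg> \<and> (\<forall>u\<in>\<gg>. \<forall>v\<in>\<gg>. \<forall>w\<in>\<gg>.
      chi (flat \<gg> B u) (flat \<gg> B v) (flat \<gg> B w) = 1/2 * B u (vf_bracket v w))"
    using chi_ext_power3 by (simp add: chi_def flat_dual unflat_flat)
  fix \<tau> assume \<tau>: "\<tau> \<in> ext_power3 \<gg> \<and> (\<forall>u\<in>\<gg>. \<forall>v\<in>\<gg>. \<forall>w\<in>\<gg>.
      \<tau> (flat \<gg> B u) (flat \<gg> B v) (flat \<gg> B w) = 1/2 * B u (vf_bracket v w))"
  show "\<tau> = chi"
  proof (intro ext)
    fix a b c
    show "\<tau> a b c = chi a b c"
    proof (cases "a \<in> dual \<gg> \<and> b \<in> dual \<gg> \<and> c \<in> dual \<gg>")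
      case True
      then have "\<tau> (flat \<gg> B (unflat a)) (flat \<gg> B (unflat b)) (flat \<gg> B (unflat c))
          = 1/2 * B (unflat a) (vf_bracket (unflat b) (unflat c))"
        using \<tau> unflat(1) by blast
      then show ?thesis using True by (simp add: chi_def unflat(2))
    next
      case False
      then have "\<tau> a b c = 0" using \<tau> unfolding ext_power3_def by blast
      then show ?thesis using False by (auto simp: chi_def)
    qed
  qed
qed

text \<open>The transpose of \<open>ad v\<close>, without the sign of the coadjoint action.\<close>

definition coad :: "'g vfield \<Rightarrow> ('g vfield \<Rightarrow> real) \<Rightarrow> 'g vfield \<Rightarrow> real"
  where "coad v a = (\<lambda>w. if w \<in> \<gg> then a (vf_bracket v w) else 0)"

lemma coad_apply: "w \<in> \<gg> \<Longrightarrow> coad v a w = a (vf_bracket v w)"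
  by (simp add: coad_def)

lemma coad_dual:
  assumes v: "v \<in> \<gg>" and a: "a \<in> dual \<gg>"
  shows "coad v a \<in> dual \<gg>"
proof (rule dualI)
  fix x y c assume x: "x \<in> \<gg>"
  show "coad v a (c *\<^sub>R x) = c * coad v a x"
    using linear_onD(2)[OF dual_linear[OF a] lb_closed[OF v x], of c]
    unfolding coad_apply[OF x] coad_apply[OF g_scale[OF x]] linear_onD(2)[OF lb_linear[OF v] x] by simp
  assume y: "y \<in> \<gg>"
  show "coad v a (x + y) = coad v a x + coad v a y"
    unfolding coad_apply[OF x] coad_apply[OF y] coad_apply[OF g_add[OF x y]] linear_onD(1)[OF lb_linear[OF v] x y]
    by (rule linear_onD(1)[OF dual_linear[OF a] lb_closed[OF v x] lb_closed[OF v y]])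
qed (simp add: coad_def)

text \<open>Ad-invariance moves the bracket to the other side:
  \<open>a [v, w] = (x, [v, w]) = ([x, v], w)\<close> with \<open>x = unflat a\<close>. This fixes
  the order inside the resulting bracket.\<close>

lemma unflat_coad:
  assumes v: "v \<in> \<gg>" and a: "a \<in> dual \<gg>"
  shows "unflat (coad v a) = vf_bracket (unflat a) v"
proof -
  note u = unflat(1)[OF a]
  have "coad v a = flat \<gg> B (vf_bracket (unflat a) v)"
  proof (rule dual_eqI[OF coad_dual[OF v a] flat_dual[OF lb_closed[OF u v]]])
    fix w assume w: "w \<in> \<gg>"
    have "a (vf_bracket v w) = B (unflat a) (vf_bracket v w)"
      using unflat(2)[OF a] flat_apply[OF lb_closed[OF v w], of "unflat a"] by metis
    then show "coad v a w = flat \<gg> B (vf_bracket (unflat a) v) w"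
      unfolding coad_apply[OF w] flat_apply[OF w] B_inv[OF u v w] .
  qed
  then show ?thesis using unflat_flat[OF lb_closed[OF u v]] by metis
qed

text \<open>With \<open>x, y, z\<close> corresponding to \<open>a, b, c\<close>, ad-invariance
  brings the sum into the form of half the pairing of \<open>x\<close> with
  \<open>[v, [y, z]] + [[y, v], z] + [y, [z, v]]\<close>, which is 0 by the Jacobi identity of
  \<gg>.\<close>

lemma chi_invariant:
  assumes v: "v \<in> \<gg>" and a: "a \<in> dual \<gg>" and b: "b \<in> dual \<gg>" and c: "c \<in> dual \<gg>"
  shows "chi (coad v a) b c + chi a (coad v b) c + chi a b (coad v c) = 0"
proof -
  define x y z where "x = unflat a" and "y = unflat b" and "z = unflat c"
  have g: "x \<in> \<gg>" "y \<in> \<gg>" "z \<in> \<gg>" using unflat(1) a b c by (simp_all add: x_def y_def z_def)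
  let ?p = "vf_bracket v (vf_bracket y z)" and ?q = "vf_bracket (vf_bracket y v) z" and ?r = "vf_bracket y (vf_bracket z v)"
  have m: "?p \<in> \<gg>" "?q \<in> \<gg>" "?r \<in> \<gg>" by (intro lb_closed v g)+
  have "?q = - vf_bracket z (vf_bracket y v)" by (rule lb_skew[OF lb_closed[OF g(2) v] g(3)])
  also have "\<dots> = vf_bracket z (- vf_bracket y v)" by (rule linear_on_minus[OF lb_linear[OF g(3)] lb_closed[OF g(2) v], symmetric])
  also have "- vf_bracket y v = vf_bracket v y" by (rule lb_skew[OF v g(2), symmetric])
  finally have q: "?q = vf_bracket z (vf_bracket v y)" .
  have "?p + ?q + ?r = 0" unfolding q using lb_jacobi[OF v g(2,3)] by (metis add.assoc add.commute)
  then have "0 = B x (?p + ?q + ?r)" using linear_on_0[OF B_linear[OF g(1)] g_0] by simp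
  also have "\<dots> = B x ?p + B x ?q + B x ?r"
    using linear_onD(1)[OF B_linear[OF g(1)] g_add[OF m(1,2)] m(3)] linear_onD(1)[OF B_linear[OF g(1)] m(1,2)] by simp
  also have "B x ?p = B (vf_bracket x v) (vf_bracket y z)"
    by (rule B_inv[OF g(1) v lb_closed[OF g(2,3)], symmetric])
  finally show ?thesis
    using a b c by (simp add: chi_def coad_dual[OF v] unflat_coad[OF v] x_def y_def z_def)
qed

end

section \<open>The action, its dual map, and derivatives of functions with values in the dual of
  \<gg>\<close>

locale bivector_g_manifold = bivector_manifold A bs \<pi> + quadratic_lie_algebra \<gg> B n us cs
  for A :: "('m::{t2_space,second_countable_topology}, 'e::real_inner) atlas" and bs :: "'e set" and \<pi> :: "'m bivec"
    and \<gg> :: "'g vfield set" and B n us cs +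
  fixes \<rho> :: "'g vfield \<Rightarrow> 'm vfield"
  assumes \<rho>_linear: "linear_on \<gg> \<rho>" and \<rho>_VF: "v \<in> \<gg> \<Longrightarrow> \<rho> v \<in> VF"
    and \<rho>_hom: "u \<in> \<gg> \<Longrightarrow> v \<in> \<gg> \<Longrightarrow> \<rho> (vf_bracket u v) = vf_bracket (\<rho> u) (\<rho> v)"
begin

lemma \<rho>_add: "u \<in> \<gg> \<Longrightarrow> v \<in> \<gg> \<Longrightarrow> \<rho> (u + v) p = \<rho> u p + \<rho> v p"
  using linear_onD(1)[OF \<rho>_linear] by simp

lemma \<rho>_scale: "u \<in> \<gg> \<Longrightarrow> \<rho> (c *\<^sub>R u) p = c *\<^sub>R \<rho> u p"
  using linear_onD(2)[OF \<rho>_linear] by simp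

lemma \<rho>_T: "v \<in> \<gg> \<Longrightarrow> \<rho> v p \<in> T p"
  by (rule VF_T[OF \<rho>_VF])

lemma \<rho>_linear_at: "linear_on \<gg> (\<lambda>v. \<rho> v p)"
  unfolding linear_on_def by (intro conjI ballI allI \<rho>_add \<rho>_scale)

lemma coaction_apply: "v \<in> \<gg> \<Longrightarrow> coaction \<gg> \<rho> p a v = a (\<rho> v p)"
  by (simp add: coaction_def)

lemma coaction_dual:
  assumes a: "a \<in> cotangent A p"
  shows "coaction \<gg> \<rho> p a \<in> dual \<gg>"
proof (rule dualI)
  fix x y c assume x: "x \<in> \<gg>"
  show "coaction \<gg> \<rho> p a (c *\<^sub>R x) = c * coaction \<gg> \<rho> p a x"
    using linear_onD(2)[OF dual_linear[OF a] \<rho>_T[OF x], of c]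
    unfolding coaction_apply[OF x] coaction_apply[OF g_scale[OF x]] \<rho>_scale[OF x] by simp
  assume y: "y \<in> \<gg>"
  show "coaction \<gg> \<rho> p a (x + y) = coaction \<gg> \<rho> p a x + coaction \<gg> \<rho> p a y"
    unfolding coaction_apply[OF x] coaction_apply[OF y] coaction_apply[OF g_add[OF x y]] \<rho>_add[OF x y]
    by (rule linear_onD(1)[OF dual_linear[OF a] \<rho>_T[OF x] \<rho>_T[OF y]])
qed (simp add: coaction_def)

lemma coaction_linear: "linear_on V (coaction \<gg> \<rho> p)"
  by (auto simp: linear_on_def coaction_def fun_eq_iff)

definition smooth_dual :: "('m \<Rightarrow> 'g vfield \<Rightarrow> real) \<Rightarrow> bool"
  where "smooth_dual \<Phi> \<longleftrightarrow> (\<forall>p. \<Phi> p \<in> dual \<gg>) \<and> (\<forall>v\<in>\<gg>. (\<lambda>p. \<Phi> p v) \<in> C)"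

lemma smooth_dualD: "smooth_dual \<Phi> \<Longrightarrow> \<Phi> p \<in> dual \<gg>" "smooth_dual \<Phi> \<Longrightarrow> v \<in> \<gg> \<Longrightarrow> (\<lambda>p. \<Phi> p v) \<in> C"
  by (auto simp: smooth_dual_def)

lemma smooth_dual_const: "c \<in> dual \<gg> \<Longrightarrow> smooth_dual (\<lambda>p. c)"
  by (simp add: smooth_dual_def)

lemma smooth_dual_coaction:
  assumes \<alpha>: "\<alpha> \<in> OF1"
  shows "smooth_dual (\<lambda>p. coaction \<gg> \<rho> p (\<alpha> p))"
  unfolding smooth_dual_def
proof (intro conjI allI ballI)
  show "coaction \<gg> \<rho> p (\<alpha> p) \<in> dual \<gg>" for p by (rule coaction_dual[OF OF1_cotangent[OF \<alpha>]])
  fix v assume v: "v \<in> \<gg>"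
  show "(\<lambda>p. coaction \<gg> \<rho> p (\<alpha> p) v) \<in> C" unfolding coaction_apply[OF v] by (rule OF1_C[OF \<alpha> \<rho>_VF[OF v]])
qed

text \<open>Componentwise derivative of a function into the dual of \<gg>, a fixed vector space;
  this is the flat derivative on the trivial bundle.\<close>

definition dual_deriv :: "'m tvec \<Rightarrow> ('m \<Rightarrow> 'g vfield \<Rightarrow> real) \<Rightarrow> 'g vfield \<Rightarrow> real"
  where "dual_deriv D \<Phi> = (\<lambda>v. if v \<in> \<gg> then D (\<lambda>q. \<Phi> q v) else 0)"

lemma dual_deriv_apply: "v \<in> \<gg> \<Longrightarrow> dual_deriv D \<Phi> v = D (\<lambda>q. \<Phi> q v)"
  by (simp add: dual_deriv_def)

lemma dual_deriv_dual:
  assumes D: "D \<in> T p" and \<Phi>: "smooth_dual \<Phi>"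
  shows "dual_deriv D \<Phi> \<in> dual \<gg>"
proof (rule dualI)
  note l = linear_onD[OF dual_linear[OF smooth_dualD(1)[OF \<Phi>]]] and c = smooth_dualD(2)[OF \<Phi>]
  fix x y r assume x: "x \<in> \<gg>"
  show "dual_deriv D \<Phi> (r *\<^sub>R x) = r * dual_deriv D \<Phi> x"
    unfolding dual_deriv_apply[OF x] dual_deriv_apply[OF g_scale[OF x]] l(2)[OF x] real_scaleR_def
    by (rule tangentD(2)[OF D c[OF x]])
  assume y: "y \<in> \<gg>"
  show "dual_deriv D \<Phi> (x + y) = dual_deriv D \<Phi> x + dual_deriv D \<Phi> y"
    unfolding dual_deriv_apply[OF x] dual_deriv_apply[OF y] dual_deriv_apply[OF g_add[OF x y]] l(1)[OF x y]
    by (rule tangentD(1)[OF D c[OF x] c[OF y]])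
qed (simp add: dual_deriv_def)

lemma chi_expand:
  assumes "a \<in> dual \<gg>" "b \<in> dual \<gg>" "c \<in> dual \<gg>"
  shows "chi a b c = (\<Sum>i<n. \<Sum>j<n. \<Sum>k<n. a (us i) * b (us j) * c (us k) * chi (cs i) (cs j) (cs k))"
proof -
  have "chi a b c = chi (\<Sum>i<n. a (us i) *\<^sub>R cs i) (\<Sum>i<n. b (us i) *\<^sub>R cs i) (\<Sum>i<n. c (us i) *\<^sub>R cs i)"
    by (simp only: dual_expand assms)
  also have "\<dots> = (\<Sum>i<n. \<Sum>j<n. \<Sum>k<n. a (us i) * b (us j) * c (us k) * chi (cs i) (cs j) (cs k))"
    by (rule trilinear_expand[OF subspace_dual chi_linear1 chi_linear2 chi_linear3 cs_dual]) simp_all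
  finally show ?thesis .
qed

lemma chi_C:
  assumes "smooth_dual \<Phi>" "smooth_dual \<Psi>" "smooth_dual \<Theta>"
  shows "(\<lambda>p. chi (\<Phi> p) (\<Psi> p) (\<Theta> p)) \<in> C"
proof -
  have c: "(\<lambda>q. \<Phi> q (us i)) \<in> C" "(\<lambda>q. \<Psi> q (us i)) \<in> C" "(\<lambda>q. \<Theta> q (us i)) \<in> C" if "i \<in> {..<n}" for i
    using smooth_dualD(2)[OF assms(1)] smooth_dualD(2)[OF assms(2)] smooth_dualD(2)[OF assms(3)] us_g that by simp_all
  show ?thesis
    unfolding chi_expand[OF smooth_dualD(1)[OF assms(1)] smooth_dualD(1)[OF assms(2)] smooth_dualD(1)[OF assms(3)]]
    by (rule C_sum, rule C_sum, rule C_sum, intro C_mult C_const) (erule c)+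
qed

text \<open>In the basis, the coefficients \<open>chi (cs i) (cs j) (cs k)\<close> are constants, so
  the derivative falls on one argument at a time.\<close>

lemma chi_leibniz:
  assumes D: "D \<in> T p" and s: "smooth_dual \<Phi>" "smooth_dual \<Psi>" "smooth_dual \<Theta>"
  shows "D (\<lambda>q. chi (\<Phi> q) (\<Psi> q) (\<Theta> q)) = chi (dual_deriv D \<Phi>) (\<Psi> p) (\<Theta> p)
    + chi (\<Phi> p) (dual_deriv D \<Psi>) (\<Theta> p) + chi (\<Phi> p) (\<Psi> p) (dual_deriv D \<Theta>)"
proof -
  note d = smooth_dualD(1)[OF s(1)] smooth_dualD(1)[OF s(2)] smooth_dualD(1)[OF s(3)]
  note dd = dual_deriv_dual[OF D s(1)] dual_deriv_dual[OF D s(2)] dual_deriv_dual[OF D s(3)]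
  have c: "(\<lambda>q. \<Phi> q (us i)) \<in> C" "(\<lambda>q. \<Psi> q (us i)) \<in> C" "(\<lambda>q. \<Theta> q (us i)) \<in> C" if "i < n" for i
    using smooth_dualD(2)[OF s(1)] smooth_dualD(2)[OF s(2)] smooth_dualD(2)[OF s(3)] us_g[OF that] by simp_all
  let ?X = "\<lambda>i j k. chi (cs i) (cs j) (cs k)"
  have tm: "D (\<lambda>q. \<Phi> q (us i) * \<Psi> q (us j) * \<Theta> q (us k) * ?X i j k)
      = dual_deriv D \<Phi> (us i) * \<Psi> p (us j) * \<Theta> p (us k) * ?X i j k
      + \<Phi> p (us i) * dual_deriv D \<Psi> (us j) * \<Theta> p (us k) * ?X i j k
      + \<Phi> p (us i) * \<Psi> p (us j) * dual_deriv D \<Theta> (us k) * ?X i j k"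
    if i: "i < n" and j: "j < n" and k: "k < n" for i j k
  proof -
    note m = C_mult[OF c(1)[OF i] c(2)[OF j]]
    have "D (\<lambda>q. \<Phi> q (us i) * \<Psi> q (us j) * \<Theta> q (us k) * ?X i j k)
        = D (\<lambda>q. \<Phi> q (us i) * \<Psi> q (us j) * \<Theta> q (us k)) * ?X i j k"
      using tangentD(3)[OF D C_mult[OF m c(3)[OF k]] C_const] tangent_const[OF D] by simp
    then show ?thesis
      unfolding tangentD(3)[OF D m c(3)[OF k]] tangentD(3)[OF D c(1)[OF i] c(2)[OF j]]
        dual_deriv_apply[OF us_g[OF i]] dual_deriv_apply[OF us_g[OF j]] dual_deriv_apply[OF us_g[OF k]]
      by (simp add: algebra_simps)
  qed
  have m: "(\<lambda>q. \<Phi> q (us i) * \<Psi> q (us j) * \<Theta> q (us k) * ?X i j k) \<in> C" if "i < n" "j < n" "k < n" for i j k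
    using that by (intro C_mult c C_const)
  have "D (\<lambda>q. chi (\<Phi> q) (\<Psi> q) (\<Theta> q))
      = (\<Sum>i<n. \<Sum>j<n. \<Sum>k<n. D (\<lambda>q. \<Phi> q (us i) * \<Psi> q (us j) * \<Theta> q (us k) * ?X i j k))"
  proof -
    let ?t = "\<lambda>i j k q. \<Phi> q (us i) * \<Psi> q (us j) * \<Theta> q (us k) * ?X i j k"
    have "D (\<lambda>q. \<Sum>k<n. ?t i j k q) = (\<Sum>k<n. D (?t i j k))" if "i < n" "j < n" for i j
      by (rule tangent_sum[OF D m]) (use that in simp_all)
    moreover have s1: "(\<lambda>q. \<Sum>k<n. ?t i j k q) \<in> C" if "i < n" "j < n" for i j
      by (rule C_sum, rule m) (use that in simp_all)
    moreover have "D (\<lambda>q. \<Sum>j<n. \<Sum>k<n. ?t i j k q) = (\<Sum>j<n. D (\<lambda>q. \<Sum>k<n. ?t i j k q))" if "i < n" for i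
      by (rule tangent_sum[OF D s1]) (use that in simp_all)
    moreover have s2: "(\<lambda>q. \<Sum>j<n. \<Sum>k<n. ?t i j k q) \<in> C" if "i < n" for i
      by (rule C_sum, rule s1) (use that in simp_all)
    moreover have "D (\<lambda>q. \<Sum>i<n. \<Sum>j<n. \<Sum>k<n. ?t i j k q) = (\<Sum>i<n. D (\<lambda>q. \<Sum>j<n. \<Sum>k<n. ?t i j k q))"
      by (rule tangent_sum[OF D s2]) simp_all
    ultimately show ?thesis unfolding chi_expand[OF d] by simp
  qed
  also have "\<dots> = (\<Sum>i<n. \<Sum>j<n. \<Sum>k<n. dual_deriv D \<Phi> (us i) * \<Psi> p (us j) * \<Theta> p (us k) * ?X i j k
      + \<Phi> p (us i) * dual_deriv D \<Psi> (us j) * \<Theta> p (us k) * ?X i j k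
      + \<Phi> p (us i) * \<Psi> p (us j) * dual_deriv D \<Theta> (us k) * ?X i j k)"
    by (intro sum.cong refl tm) simp_all
  also have "\<dots> = chi (dual_deriv D \<Phi>) (\<Psi> p) (\<Theta> p)
    + chi (\<Phi> p) (dual_deriv D \<Psi>) (\<Theta> p) + chi (\<Phi> p) (\<Psi> p) (dual_deriv D \<Theta>)"
    unfolding chi_expand[OF dd(1) d(2,3)] chi_expand[OF d(1) dd(2) d(3)] chi_expand[OF d(1,2) dd(3)]
    by (simp only: sum.distrib)
  finally show ?thesis .
qed

lemma push_trivector_field: "push_trivector A \<gg> \<rho> chi \<in> trivector_fields A"
  unfolding trivector_fields_def
proof (intro CollectI conjI allI ballI)
  let ?P = "push_trivector A \<gg> \<rho> chi"
  have P: "?P p a b c = chi (coaction \<gg> \<rho> p a) (coaction \<gg> \<rho> p b) (coaction \<gg> \<rho> p c)"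
    if "a \<in> cotangent A p" "b \<in> cotangent A p" "c \<in> cotangent A p" for p a b c
    using that by (simp add: push_trivector_def)
  show "?P p \<in> ext_power3 (T p)" for p
    unfolding ext_power3_def
  proof (intro CollectI conjI ballI allI impI)
    let ?r = "coaction \<gg> \<rho> p"
    note add = subspace_add[OF subspace_dual] and sc = subspace_scale[OF subspace_dual]
    have rl: "?r (x + y) = ?r x + ?r y" "?r (k *\<^sub>R x) = k *\<^sub>R ?r x" for x y k
      using linear_onD[OF coaction_linear[of UNIV p]] by simp_all
    fix a b assume a: "a \<in> cotangent A p" and b: "b \<in> cotangent A p"
    have comp: "linear_on (cotangent A p) (\<lambda>c. L (?r c))" if L: "linear_on (dual \<gg>) L" for L :: "_ \<Rightarrow> real"
      unfolding linear_on_def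
    proof (intro conjI ballI allI)
      fix x y k assume x: "x \<in> cotangent A p"
      show "L (?r (k *\<^sub>R x)) = k *\<^sub>R L (?r x)" unfolding rl by (rule linear_onD(2)[OF L coaction_dual[OF x]])
      assume y: "y \<in> cotangent A p"
      show "L (?r (x + y)) = L (?r x) + L (?r y)" unfolding rl by (rule linear_onD(1)[OF L coaction_dual[OF x] coaction_dual[OF y]])
    qed
    have cong: "linear_on (cotangent A p) F" if "linear_on (cotangent A p) G" "\<And>c. c \<in> cotangent A p \<Longrightarrow> F c = G c" for F G :: "_ \<Rightarrow> real"
      using linear_onD[OF that(1)] by (simp add: linear_on_def that(2) add sc)
    show "linear_on (cotangent A p) (\<lambda>c. ?P p c a b)"
      by (rule cong[OF comp[OF chi_linear1[OF coaction_dual[OF a] coaction_dual[OF b]]] P[OF _ a b]])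
    show "linear_on (cotangent A p) (\<lambda>c. ?P p a c b)"
      by (rule cong[OF comp[OF chi_linear2[OF coaction_dual[OF a] coaction_dual[OF b]]] P[OF a _ b]])
    show "linear_on (cotangent A p) (\<lambda>c. ?P p a b c)"
      by (rule cong[OF comp[OF chi_linear3[OF coaction_dual[OF a] coaction_dual[OF b]]] P[OF a b]])
    have "\<forall>a\<in>dual \<gg>. \<forall>b\<in>dual \<gg>. chi a a b = 0 \<and> chi a b b = 0 \<and> chi a b a = 0"
      using chi_ext_power3 unfolding ext_power3_def by blast
    then show "?P p a a b = 0" "?P p a b b = 0" "?P p a b a = 0"
      using a b coaction_dual by (simp_all add: P)
  next
    fix a b c assume "a \<notin> cotangent A p \<or> b \<notin> cotangent A p \<or> c \<notin> cotangent A p"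
    then show "?P p a b c = 0" unfolding push_trivector_def by auto
  qed
  fix \<alpha> \<beta> \<gamma> assume o: "\<alpha> \<in> OF1" "\<beta> \<in> OF1" "\<gamma> \<in> OF1"
  show "(\<lambda>p. ?P p (\<alpha> p) (\<beta> p) (\<gamma> p)) \<in> C"
    unfolding P[OF OF1_cotangent[OF o(1)] OF1_cotangent[OF o(2)] OF1_cotangent[OF o(3)]]
    by (rule chi_C[OF smooth_dual_coaction[OF o(1)] smooth_dual_coaction[OF o(2)] smooth_dual_coaction[OF o(3)]])
qed

text \<open>The pullback of \<open>df\<close> under the action map, that is the functional sending
  \<open>v\<close> to \<open>\<rho>(v) f\<close>.\<close>

definition mom :: "('m \<Rightarrow> real) \<Rightarrow> 'm \<Rightarrow> 'g vfield \<Rightarrow> real"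
  where "mom f p = coaction \<gg> \<rho> p (extd A f p)"

lemma mom_apply: "v \<in> \<gg> \<Longrightarrow> mom f p v = \<rho> v p f"
  unfolding mom_def by (simp add: coaction_apply extd_apply \<rho>_T)

lemma mom_smooth: "f \<in> C \<Longrightarrow> smooth_dual (mom f)"
  unfolding mom_def[abs_def] by (rule smooth_dual_coaction[OF extd_OF1])

lemma mom_dual: "f \<in> C \<Longrightarrow> mom f p \<in> dual \<gg>"
  by (rule smooth_dualD(1)[OF mom_smooth])

text \<open>Both sides are trivector fields and can be compared on differentials, where the pushed
  forward trivector becomes \<open>chi\<close> of the functionals \<open>mom\<close>.\<close>

lemma schouten_iff:
  "schouten_square A \<pi> = push_trivector A \<gg> \<rho> (chi_G \<gg> B) \<longleftrightarrow>
    (\<forall>f\<in>C. \<forall>g\<in>C. \<forall>h\<in>C. \<forall>p. chi (mom f p) (mom g p) (mom h p) = 2 * jac f g h p)"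
  unfolding chi_G_eq schouten_square_eq_iff[OF push_trivector_field]
  by (simp add: push_trivector_def extd_cotangent mom_def)

end

lemma add_diff_regroup: "(a + a') + (b + b') - (c + c') = (a + b - c) + (a' + b' - (c' :: 'a::ab_group_add))"
  by (simp add: algebra_simps)

lemma add_diff_regroup4:
  "(a + a') + (b + b') + (c + c') - (d + d') = (a + b + c - d) + (a' + b' + c' - (d' :: 'a::ab_group_add))"
  by (simp add: algebra_simps)

lemma scale_regroup:
  "(f *\<^sub>R a + x *\<^sub>R b) + (f *\<^sub>R c + y *\<^sub>R b) - f *\<^sub>R d = f *\<^sub>R (a + c - d) + (x + y) *\<^sub>R (b :: 'a::real_vector)"
  by (simp add: algebra_simps)

lemma scale_regroup4:
  "f *\<^sub>R a + f *\<^sub>R c + (f *\<^sub>R e + y *\<^sub>R b) - f *\<^sub>R d = f *\<^sub>R (a + c + e - d) + y *\<^sub>R (b :: 'a::real_vector)"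
  by (simp add: algebra_simps)

section \<open>The bracket on sections and its anchor defect\<close>

context bivector_g_manifold
begin

abbreviation "\<Gamma> \<equiv> sections A \<gg>"
abbreviation "GF \<equiv> smooth_g_funs A \<gg>"

lemma g_eqI: "x \<in> \<gg> \<Longrightarrow> y \<in> \<gg> \<Longrightarrow> (\<And>c. c \<in> dual \<gg> \<Longrightarrow> c x = c y) \<Longrightarrow> x = y"
  by (rule dual_frame_separates[OF frame])

lemma GF_g: "s \<in> GF \<Longrightarrow> s p \<in> \<gg>" and GF_C: "s \<in> GF \<Longrightarrow> c \<in> dual \<gg> \<Longrightarrow> (\<lambda>p. c (s p)) \<in> C"
  by (simp_all add: smooth_g_funs_def)

lemma dual_eval:
  assumes c: "c \<in> dual \<gg>" and v: "v \<in> \<gg>"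
  shows "c v = (\<Sum>i<n. c (us i) * cs i v)"
proof -
  have "c v = (\<Sum>i<n. c (us i) *\<^sub>R cs i) v" by (simp only: dual_expand[OF c])
  then show ?thesis by (simp only: sum_fun_apply scaleR_fun_apply real_scaleR_def)
qed

lemma GF_I:
  assumes g: "\<And>p. s p \<in> \<gg>" and c: "\<And>i. i < n \<Longrightarrow> (\<lambda>p. cs i (s p)) \<in> C"
  shows "s \<in> GF"
  unfolding smooth_g_funs_def
proof (intro CollectI conjI allI ballI g)
  fix c' assume c': "c' \<in> dual \<gg>"
  show "(\<lambda>p. c' (s p)) \<in> C"
    unfolding dual_eval[OF c' g] by (rule C_sum, rule C_mult[OF C_const c]) simp
qed

lemma dual_add: "c \<in> dual \<gg> \<Longrightarrow> x \<in> \<gg> \<Longrightarrow> y \<in> \<gg> \<Longrightarrow> c (x + y) = c x + c y"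
  and dual_scale: "c \<in> dual \<gg> \<Longrightarrow> x \<in> \<gg> \<Longrightarrow> c (r *\<^sub>R x) = r * c x"
  and dual_diff: "c \<in> dual \<gg> \<Longrightarrow> x \<in> \<gg> \<Longrightarrow> y \<in> \<gg> \<Longrightarrow> c (x - y) = c x - c y"
  and dual_0: "c \<in> dual \<gg> \<Longrightarrow> c 0 = 0"
  using linear_onD[OF dual_linear[of c \<gg>]] linear_on_diff[OF subspace_g dual_linear[of c \<gg>]]
    linear_on_0[OF dual_linear[of c \<gg>] g_0] by simp_all

lemmas g_diff = subspace_diff[OF subspace_g]

lemma GF_const: "v \<in> \<gg> \<Longrightarrow> (\<lambda>p. v) \<in> GF"
  by (simp add: smooth_g_funs_def)

lemma GF_add:
  assumes s: "s \<in> GF" and t: "t \<in> GF"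
  shows "(\<lambda>p. s p + t p) \<in> GF"
proof (rule GF_I)
  show "s p + t p \<in> \<gg>" for p by (rule g_add[OF GF_g[OF s] GF_g[OF t]])
  fix i assume i: "i < n"
  show "(\<lambda>p. cs i (s p + t p)) \<in> C"
    unfolding dual_add[OF cs_dual[OF i] GF_g[OF s] GF_g[OF t]] by (rule C_add[OF GF_C[OF s cs_dual[OF i]] GF_C[OF t cs_dual[OF i]]])
qed

lemma GF_scale:
  assumes f: "f \<in> C" and t: "t \<in> GF"
  shows "(\<lambda>p. f p *\<^sub>R t p) \<in> GF"
proof (rule GF_I)
  show "f p *\<^sub>R t p \<in> \<gg>" for p by (rule g_scale[OF GF_g[OF t]])
  fix i assume i: "i < n"
  show "(\<lambda>p. cs i (f p *\<^sub>R t p)) \<in> C"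
    unfolding dual_scale[OF cs_dual[OF i] GF_g[OF t]] by (rule C_mult[OF f GF_C[OF t cs_dual[OF i]]])
qed

lemma GF_diff:
  assumes s: "s \<in> GF" and t: "t \<in> GF"
  shows "(\<lambda>p. s p - t p) \<in> GF"
  using GF_add[OF s GF_scale[OF C_const[of "-1"] t]] by (simp only: scaleR_minus1_left diff_conv_add_uminus)

text \<open>In terms of structure constants the coordinates of the bracket are bilinear in the
  smooth coordinates of \<open>s\<close> and \<open>t\<close>.\<close>

lemma GF_bracket:
  assumes s: "s \<in> GF" and t: "t \<in> GF"
  shows "(\<lambda>p. vf_bracket (s p) (t p)) \<in> GF"
proof (rule GF_I)
  show "vf_bracket (s p) (t p) \<in> \<gg>" for p by (rule lb_closed[OF GF_g[OF s] GF_g[OF t]])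
  fix k assume k: "k < n"
  note ck = dual_linear[OF cs_dual[OF k]]
  have "cs k (vf_bracket (s p) (t p)) = (\<Sum>i<n. \<Sum>j<n. cs i (s p) * (cs j (t p) * cs k (vf_bracket (us i) (us j))))" for p
  proof -
    note sp = GF_g[OF s, of p] and tp = GF_g[OF t, of p]
    have L: "linear_on \<gg> (\<lambda>v. cs k (vf_bracket v (t p)))"
      unfolding linear_on_def
      by (intro conjI ballI allI)
        (simp_all only: linear_onD[OF lb_linear2[OF tp]] linear_onD[OF ck] lb_closed tp)
    have L2: "linear_on \<gg> (\<lambda>v. cs k (vf_bracket (us i) v))" if "i < n" for i
      unfolding linear_on_def
      by (intro conjI ballI allI)
        (simp_all only: linear_onD[OF lb_linear[OF us_g[OF that]]] linear_onD[OF ck] lb_closed us_g that)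
    have ev: "F v = (\<Sum>i<n. F (us i) * cs i v)" if F: "linear_on \<gg> F" and v: "v \<in> \<gg>" for F v
    proof -
      let ?F = "\<lambda>v. if v \<in> \<gg> then F v else 0"
      have "?F \<in> dual \<gg>"
        by (rule dualI) (simp_all add: linear_onD[OF F] g_add g_scale)
      from dual_eval[OF this v] show ?thesis using v us_g by simp
    qed
    have "cs k (vf_bracket (s p) (t p)) = (\<Sum>i<n. cs k (vf_bracket (us i) (t p)) * cs i (s p))"
      by (rule ev[OF L sp])
    also have "\<dots> = (\<Sum>i<n. (\<Sum>j<n. cs k (vf_bracket (us i) (us j)) * cs j (t p)) * cs i (s p))"
      by (rule sum.cong[OF refl]) (use ev[OF L2 tp] in simp)
    finally show ?thesis by (simp only: sum_distrib_left sum_distrib_right mult_ac)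
  qed
  moreover have "(\<lambda>p. \<Sum>i<n. \<Sum>j<n. cs i (s p) * (cs j (t p) * cs k (vf_bracket (us i) (us j)))) \<in> C"
    by (rule C_sum, rule C_sum, rule C_mult[OF GF_C[OF s cs_dual] C_mult[OF GF_C[OF t cs_dual] C_const]]) simp_all
  ultimately show "(\<lambda>p. cs k (vf_bracket (s p) (t p))) \<in> C" by (simp only:)
qed

text \<open>Derivative of a \<gg>-valued function for the flat connection of the trivial bundle, for
  which constant sections are parallel.\<close>

definition nab :: "'m tvec \<Rightarrow> ('m \<Rightarrow> 'g vfield) \<Rightarrow> 'g vfield"
  where "nab D t = (\<Sum>i<n. D (\<lambda>q. cs i (t q)) *\<^sub>R us i)"

lemma nab_g: "nab D t \<in> \<gg>"
  unfolding nab_def by (intro subspace_sum[OF subspace_g] g_scale us_g) simp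

lemma nab_pair:
  assumes D: "D \<in> T p" and t: "t \<in> GF" and c: "c \<in> dual \<gg>"
  shows "c (nab D t) = D (\<lambda>q. c (t q))"
proof -
  have "c (nab D t) = (\<Sum>i<n. c (D (\<lambda>q. cs i (t q)) *\<^sub>R us i))"
    unfolding nab_def by (rule linear_on_sum[OF subspace_g dual_linear[OF c]]) (intro g_scale us_g, simp)
  also have "\<dots> = (\<Sum>i<n. D (\<lambda>q. c (us i) * cs i (t q)))"
  proof (rule sum.cong[OF refl])
    fix i assume "i \<in> {..<n}"
    then have i: "i < n" by simp
    show "c (D (\<lambda>q. cs i (t q)) *\<^sub>R us i) = D (\<lambda>q. c (us i) * cs i (t q))"
      unfolding dual_scale[OF c us_g[OF i]] tangentD(2)[OF D GF_C[OF t cs_dual[OF i]]] by (rule mult.commute)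
  qed
  also have "\<dots> = D (\<lambda>q. \<Sum>i<n. c (us i) * cs i (t q))"
    by (rule tangent_sum[OF D, symmetric], rule C_mult[OF C_const GF_C[OF t cs_dual]]) simp
  finally show ?thesis unfolding dual_eval[OF c GF_g[OF t]] .
qed

lemma nab_GF:
  assumes X: "X \<in> VF" and t: "t \<in> GF"
  shows "(\<lambda>p. nab (X p) t) \<in> GF"
proof (rule GF_I[OF nab_g])
  fix i assume i: "i < n"
  show "(\<lambda>p. cs i (nab (X p) t)) \<in> C"
    unfolding nab_pair[OF VF_T[OF X] t cs_dual[OF i]] by (rule VF_C[OF X GF_C[OF t cs_dual[OF i]]])
qed

lemma nab_add_vec: "nab (D + D') t = nab D t + nab D' t"
  unfolding nab_def by (simp only: plus_fun_apply scaleR_left_distrib sum.distrib)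

lemma nab_scale_vec: "nab (c *\<^sub>R D) t = c *\<^sub>R nab D t"
  unfolding nab_def by (simp only: scaleR_fun_apply real_scaleR_def scaleR_sum_right scaleR_scaleR)

lemma nab_add:
  assumes D: "D \<in> T p" and s: "s \<in> GF" and t: "t \<in> GF"
  shows "nab D (\<lambda>p. s p + t p) = nab D s + nab D t"
proof (rule g_eqI[OF nab_g g_add[OF nab_g nab_g]])
  fix c assume c: "c \<in> dual \<gg>"
  show "c (nab D (\<lambda>p. s p + t p)) = c (nab D s + nab D t)"
    unfolding dual_add[OF c nab_g nab_g] nab_pair[OF D s c] nab_pair[OF D t c] nab_pair[OF D GF_add[OF s t] c]
      dual_add[OF c GF_g[OF s] GF_g[OF t]]
    by (rule tangentD(1)[OF D GF_C[OF s c] GF_C[OF t c]])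
qed

lemma nab_scale:
  assumes D: "D \<in> T p" and f: "f \<in> C" and t: "t \<in> GF"
  shows "nab D (\<lambda>p. f p *\<^sub>R t p) = f p *\<^sub>R nab D t + D f *\<^sub>R t p"
proof (rule g_eqI[OF nab_g g_add[OF g_scale[OF nab_g] g_scale[OF GF_g[OF t]]]])
  fix c assume c: "c \<in> dual \<gg>"
  show "c (nab D (\<lambda>p. f p *\<^sub>R t p)) = c (f p *\<^sub>R nab D t + D f *\<^sub>R t p)"
    unfolding dual_add[OF c g_scale[OF nab_g] g_scale[OF GF_g[OF t]]] dual_scale[OF c nab_g] dual_scale[OF c GF_g[OF t]]
      nab_pair[OF D t c] nab_pair[OF D GF_scale[OF f t] c] tangentD(3)[OF D f GF_C[OF t c]]
    by (rule add.commute)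
qed

lemma nab_const: "D \<in> T p \<Longrightarrow> nab D (\<lambda>p. v) = 0"
  unfolding nab_def by (simp only: tangent_const scaleR_zero_left sum.neutral_const)

definition ychi :: "('g vfield \<Rightarrow> real) \<Rightarrow> ('g vfield \<Rightarrow> real) \<Rightarrow> 'g vfield"
  where "ychi a b = (1/2) *\<^sub>R bidual_elem \<gg> (chi a b)"

lemma ychi_g: "a \<in> dual \<gg> \<Longrightarrow> b \<in> dual \<gg> \<Longrightarrow> ychi a b \<in> \<gg>"
  unfolding ychi_def by (intro g_scale bidual_elem(1)[OF frame] chi_linear3)

lemma ychi_pair:
  assumes "a \<in> dual \<gg>" "b \<in> dual \<gg>" "c \<in> dual \<gg>"
  shows "c (ychi a b) = 1/2 * chi a b c"
  unfolding ychi_def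
  using dual_scale[OF assms(3) bidual_elem(1)[OF frame chi_linear3[OF assms(1,2)]], of "1/2"]
    bidual_elem(2)[OF frame chi_linear3[OF assms(1,2)] assms(3)] by (simp only:)

lemma ychi_linear:
  assumes a: "a \<in> dual \<gg>"
  shows "linear_on (dual \<gg>) (ychi a)"
  unfolding linear_on_def
proof (intro conjI ballI allI)
  fix x y r assume x: "x \<in> dual \<gg>"
  show "ychi a (r *\<^sub>R x) = r *\<^sub>R ychi a x"
  proof (rule g_eqI)
    note rx = subspace_scale[OF subspace_dual x, of r]
    show "ychi a (r *\<^sub>R x) \<in> \<gg>" "r *\<^sub>R ychi a x \<in> \<gg>" by (rule ychi_g[OF a rx], rule g_scale[OF ychi_g[OF a x]])
    fix c assume c: "c \<in> dual \<gg>"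
    show "c (ychi a (r *\<^sub>R x)) = c (r *\<^sub>R ychi a x)"
      unfolding dual_scale[OF c ychi_g[OF a x]] ychi_pair[OF a rx c] ychi_pair[OF a x c] linear_onD(2)[OF chi_linear2[OF a c] x]
      by simp
  qed
  assume y: "y \<in> dual \<gg>"
  show "ychi a (x + y) = ychi a x + ychi a y"
  proof (rule g_eqI)
    note xy = subspace_add[OF subspace_dual x y]
    show "ychi a (x + y) \<in> \<gg>" "ychi a x + ychi a y \<in> \<gg>"
      by (rule ychi_g[OF a xy], rule g_add[OF ychi_g[OF a x] ychi_g[OF a y]])
    fix c assume c: "c \<in> dual \<gg>"
    show "c (ychi a (x + y)) = c (ychi a x + ychi a y)"
      unfolding dual_add[OF c ychi_g[OF a x] ychi_g[OF a y]] ychi_pair[OF a xy c] ychi_pair[OF a x c] ychi_pair[OF a y c]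
        linear_onD(1)[OF chi_linear2[OF a c] x y]
      by (rule distrib_left)
  qed
qed

lemma ychi_skew:
  assumes a: "a \<in> dual \<gg>" and b: "b \<in> dual \<gg>"
  shows "ychi a b = - ychi b a"
proof (rule g_eqI[OF ychi_g[OF a b]])
  show "- ychi b a \<in> \<gg>" by (rule subspace_neg[OF subspace_g ychi_g[OF b a]])
  fix c assume c: "c \<in> dual \<gg>"
  have "c (- ychi b a) = - c (ychi b a)" by (rule linear_on_minus[OF dual_linear[OF c] ychi_g[OF b a]])
  then show "c (ychi a b) = c (- ychi b a)"
    unfolding ychi_pair[OF a b c] ychi_pair[OF b a c] using chi_skew[OF c a b] unfolding chi_cycle[of c] by simp
qed

definition ysec :: "'m form \<Rightarrow> 'm form \<Rightarrow> 'm \<Rightarrow> 'g vfield"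
  where "ysec \<alpha> \<beta> p = ychi (coaction \<gg> \<rho> p (\<alpha> p)) (coaction \<gg> \<rho> p (\<beta> p))"

lemmas coaction_OF1 = coaction_dual[OF OF1_cotangent]

lemma ysec_GF:
  assumes \<alpha>: "\<alpha> \<in> OF1" and \<beta>: "\<beta> \<in> OF1"
  shows "ysec \<alpha> \<beta> \<in> GF"
proof (rule GF_I)
  show "ysec \<alpha> \<beta> p \<in> \<gg>" for p unfolding ysec_def by (rule ychi_g[OF coaction_OF1[OF \<alpha>] coaction_OF1[OF \<beta>]])
  fix i assume i: "i < n"
  show "(\<lambda>p. cs i (ysec \<alpha> \<beta> p)) \<in> C"
    unfolding ysec_def ychi_pair[OF coaction_OF1[OF \<alpha>] coaction_OF1[OF \<beta>] cs_dual[OF i]]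
    by (rule C_mult[OF C_const chi_C[OF smooth_dual_coaction[OF \<alpha>] smooth_dual_coaction[OF \<beta>] smooth_dual_const[OF cs_dual[OF i]]]])
qed

lemma \<rho>_fun_add: "u \<in> \<gg> \<Longrightarrow> v \<in> \<gg> \<Longrightarrow> \<rho> (u + v) = (\<lambda>p. \<rho> u p + \<rho> v p)"
  by (rule ext) (rule \<rho>_add)

lemma \<rho>_fun_scale: "u \<in> \<gg> \<Longrightarrow> \<rho> (c *\<^sub>R u) = (\<lambda>p. c *\<^sub>R \<rho> u p)"
  by (rule ext) (rule \<rho>_scale)

lemma lie_\<rho>_add:
  "u \<in> \<gg> \<Longrightarrow> v \<in> \<gg> \<Longrightarrow> \<alpha> \<in> OF1 \<Longrightarrow> lie_form A (\<rho> (u + v)) \<alpha> p = lie_form A (\<rho> u) \<alpha> p + lie_form A (\<rho> v) \<alpha> p"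
  by (simp only: \<rho>_fun_add lie_form_vadd[OF \<rho>_VF \<rho>_VF])

lemma lie_\<rho>_scale:
  assumes u: "u \<in> \<gg>" and \<alpha>: "\<alpha> \<in> OF1"
  shows "lie_form A (\<rho> (c *\<^sub>R u)) \<alpha> p = c *\<^sub>R lie_form A (\<rho> u) \<alpha> p"
  unfolding \<rho>_fun_scale[OF u] lie_form_vscale[OF \<rho>_VF[OF u] C_const \<alpha>] extd_const by (simp only: scaleR_zero_right add_0_right)

lemma lie_\<rho>_linear: "\<alpha> \<in> OF1 \<Longrightarrow> linear_on \<gg> (\<lambda>v. lie_form A (\<rho> v) \<alpha> p)"
  unfolding linear_on_def by (intro conjI ballI allI lie_\<rho>_add lie_\<rho>_scale)

lemma linear_g_expand:
  assumes L: "linear_on \<gg> L" and v: "v \<in> \<gg>"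
  shows "L v = (\<Sum>i<n. cs i v *\<^sub>R L (us i))"
proof -
  have "L v = L (\<Sum>i<n. cs i v *\<^sub>R us i)" by (simp only: g_expand[OF v])
  also have "\<dots> = (\<Sum>i<n. L (cs i v *\<^sub>R us i))"
    by (rule linear_on_sum[OF subspace_g L]) (intro g_scale us_g, simp)
  also have "\<dots> = (\<Sum>i<n. cs i v *\<^sub>R L (us i))"
    by (rule sum.cong[OF refl], rule linear_onD(2)[OF L us_g]) simp
  finally show ?thesis .
qed

lemma lie_\<rho>_OF1:
  assumes s: "s \<in> GF" and \<alpha>: "\<alpha> \<in> OF1"
  shows "(\<lambda>p. lie_form A (\<rho> (s p)) \<alpha> p) \<in> OF1"
proof -
  have "(\<lambda>p. \<Sum>i<n. cs i (s p) *\<^sub>R lie_form A (\<rho> (us i)) \<alpha> p) \<in> OF1"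
    by (rule OF1_sum, rule OF1_scale[OF GF_C[OF s cs_dual] lie_form(1)[OF \<rho>_VF[OF us_g] \<alpha>]]) simp_all
  then show ?thesis unfolding linear_g_expand[OF lie_\<rho>_linear[OF \<alpha>] GF_g[OF s]] .
qed

lemma \<rho>_GF_VF:
  assumes s: "s \<in> GF"
  shows "(\<lambda>p. \<rho> (s p) p) \<in> VF"
proof -
  have "(\<lambda>p. \<Sum>i<n. cs i (s p) *\<^sub>R \<rho> (us i) p) \<in> VF"
    by (rule VF_sum, rule VF_scale[OF GF_C[OF s cs_dual] \<rho>_VF[OF us_g]]) simp_all
  then show ?thesis unfolding linear_g_expand[OF \<rho>_linear_at GF_g[OF s]] .
qed

abbreviation r :: "'m \<Rightarrow> 'm covec \<times> 'g vfield \<Rightarrow> 'm tvec"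
  where "r \<equiv> anchor A \<rho> \<pi>"

lemma r_Pair: "r p (a, v) = sharp A \<pi> p a + \<rho> v p"
  by (simp only: anchor_def prod.case)

lemma r_VF: "\<alpha> \<in> OF1 \<Longrightarrow> s \<in> GF \<Longrightarrow> (\<lambda>p. r p (\<alpha> p, s p)) \<in> VF"
  unfolding r_Pair by (intro VF_add sharp_VF \<rho>_GF_VF)

lemma r_T: "a \<in> cotangent A p \<Longrightarrow> v \<in> \<gg> \<Longrightarrow> r p (a, v) \<in> T p"
  unfolding r_Pair by (intro T_add sharp(1) \<rho>_T)

lemma r_add:
  assumes "a \<in> cotangent A p" "b \<in> cotangent A p" "u \<in> \<gg>" "v \<in> \<gg>"
  shows "r p (a + b, u + v) = r p (a, u) + r p (b, v)"
  unfolding r_Pair sharp_add[OF assms(1,2)] \<rho>_add[OF assms(3,4)] by (simp only: ac_simps)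

lemma r_scale:
  assumes "a \<in> cotangent A p" "u \<in> \<gg>"
  shows "r p (c *\<^sub>R a, c *\<^sub>R u) = c *\<^sub>R r p (a, u)"
  unfolding r_Pair sharp_scale[OF assms(1)] \<rho>_scale[OF assms(2)] by (simp only: scaleR_right_distrib)

lemma section_iff: "(\<lambda>p. (\<alpha> p, s p)) \<in> \<Gamma> \<longleftrightarrow> \<alpha> \<in> OF1 \<and> s \<in> GF"
  by (simp add: sections_def)

lemma section_cases:
  assumes "\<xi> \<in> \<Gamma>"
  obtains \<alpha> s where "\<xi> = (\<lambda>p. (\<alpha> p, s p))" "\<alpha> \<in> OF1" "s \<in> GF"
  by (rule that[of "\<lambda>p. fst (\<xi> p)" "\<lambda>p. snd (\<xi> p)"]) (use assms in \<open>simp_all add: sections_def\<close>)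

text \<open>The closed formula that results from extending the prescribed values by the Leibniz
  rule. In the form component the value \<open>snd (\<xi> p)\<close> is frozen: the Lie derivative
  is taken along the action field of this fixed element and evaluated at \<open>p\<close>, so the
  term is function-linear in the \<gg>-part. Derivatives of the \<gg>-parts enter only through
  \<open>nab\<close>, along the anchor; \<open>ysec\<close> is half the contraction with
  \<open>chi_G\<close>.\<close>

definition sbr :: "('m \<Rightarrow> 'm covec \<times> 'g vfield) \<Rightarrow> ('m \<Rightarrow> 'm covec \<times> 'g vfield) \<Rightarrow> 'm \<Rightarrow> 'm covec \<times> 'g vfield"
  where "sbr \<xi> \<eta> = (if \<xi> \<in> \<Gamma> \<and> \<eta> \<in> \<Gamma> then (\<lambda>p.
    (form_bracket A \<pi> (\<lambda>p. fst (\<xi> p)) (\<lambda>p. fst (\<eta> p)) p + lie_form A (\<rho> (snd (\<xi> p))) (\<lambda>p. fst (\<eta> p)) p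
       - lie_form A (\<rho> (snd (\<eta> p))) (\<lambda>p. fst (\<xi> p)) p,
     ysec (\<lambda>p. fst (\<xi> p)) (\<lambda>p. fst (\<eta> p)) p + vf_bracket (snd (\<xi> p)) (snd (\<eta> p))
       + nab (r p (\<xi> p)) (\<lambda>p. snd (\<eta> p)) - nab (r p (\<eta> p)) (\<lambda>p. snd (\<xi> p)))) else 0)"

lemma sbr_eq:
  assumes "\<alpha> \<in> OF1" "s \<in> GF" "\<beta> \<in> OF1" "t \<in> GF"
  shows "sbr (\<lambda>p. (\<alpha> p, s p)) (\<lambda>p. (\<beta> p, t p)) p =
    (form_bracket A \<pi> \<alpha> \<beta> p + lie_form A (\<rho> (s p)) \<beta> p - lie_form A (\<rho> (t p)) \<alpha> p,
     ysec \<alpha> \<beta> p + vf_bracket (s p) (t p) + nab (r p (\<alpha> p, s p)) t - nab (r p (\<beta> p, t p)) s)"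
  unfolding sbr_def section_iff using assms by (simp only: if_True conj_absorb simp_thms fst_conv snd_conv)

lemma sbr_sections:
  assumes "\<xi> \<in> \<Gamma>" "\<eta> \<in> \<Gamma>"
  shows "sbr \<xi> \<eta> \<in> \<Gamma>"
proof -
  obtain \<alpha> s where x: "\<xi> = (\<lambda>p. (\<alpha> p, s p))" "\<alpha> \<in> OF1" "s \<in> GF" using section_cases[OF assms(1)] .
  obtain \<beta> t where y: "\<eta> = (\<lambda>p. (\<beta> p, t p))" "\<beta> \<in> OF1" "t \<in> GF" using section_cases[OF assms(2)] .
  have "sbr \<xi> \<eta> = (\<lambda>p. (form_bracket A \<pi> \<alpha> \<beta> p + lie_form A (\<rho> (s p)) \<beta> p - lie_form A (\<rho> (t p)) \<alpha> p,
     ysec \<alpha> \<beta> p + vf_bracket (s p) (t p) + nab (r p (\<alpha> p, s p)) t - nab (r p (\<beta> p, t p)) s))"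
    unfolding x(1) y(1) by (rule ext) (rule sbr_eq[OF x(2,3) y(2,3)])
  moreover have "\<dots> \<in> \<Gamma>"
    unfolding section_iff
    by (intro conjI OF1_add OF1_diff GF_add GF_diff form_bracket_OF1 lie_\<rho>_OF1 ysec_GF GF_bracket nab_GF r_VF x(2,3) y(2,3))
  ultimately show ?thesis by (simp only:)
qed

lemma sbr_skew:
  assumes "\<xi> \<in> \<Gamma>" "\<eta> \<in> \<Gamma>"
  shows "sbr \<xi> \<eta> p = - sbr \<eta> \<xi> p"
proof -
  obtain \<alpha> s where x: "\<xi> = (\<lambda>p. (\<alpha> p, s p))" "\<alpha> \<in> OF1" "s \<in> GF" using section_cases[OF assms(1)] .
  obtain \<beta> t where y: "\<eta> = (\<lambda>p. (\<beta> p, t p))" "\<beta> \<in> OF1" "t \<in> GF" using section_cases[OF assms(2)] .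
  have neg1: "- a + b - c = - (a + c - (b :: 'm covec))" for a b c by (simp add: algebra_simps)
  have neg2: "- a + - b + c - d = - (a + b + d - (c :: 'g vfield))" for a b c d by (simp add: algebra_simps)
  show ?thesis
    unfolding x(1) y(1) sbr_eq[OF x(2,3) y(2,3)] sbr_eq[OF y(2,3) x(2,3)] form_bracket_skew[OF x(2) y(2)]
      lb_skew[OF GF_g[OF x(3)] GF_g[OF y(3)]] ysec_def ychi_skew[OF coaction_OF1[OF x(2)] coaction_OF1[OF y(2)]] neg1 neg2
    by (rule uminus_Pair[symmetric])
qed

lemma ysec_add:
  assumes "\<alpha> \<in> OF1" "\<beta> \<in> OF1" "\<gamma> \<in> OF1"
  shows "ysec \<alpha> (\<lambda>p. \<beta> p + \<gamma> p) p = ysec \<alpha> \<beta> p + ysec \<alpha> \<gamma> p"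
  unfolding ysec_def linear_onD(1)[OF coaction_linear[of UNIV] UNIV_I UNIV_I]
  by (rule linear_onD(1)[OF ychi_linear[OF coaction_OF1[OF assms(1)]] coaction_OF1[OF assms(2)] coaction_OF1[OF assms(3)]])

lemma ysec_scale:
  assumes "\<alpha> \<in> OF1" "\<beta> \<in> OF1"
  shows "ysec \<alpha> (\<lambda>p. f p *\<^sub>R \<beta> p) p = f p *\<^sub>R ysec \<alpha> \<beta> p"
  unfolding ysec_def linear_onD(2)[OF coaction_linear[of UNIV] UNIV_I]
  by (rule linear_onD(2)[OF ychi_linear[OF coaction_OF1[OF assms(1)]] coaction_OF1[OF assms(2)]])

lemma section_add: "\<xi> \<in> \<Gamma> \<Longrightarrow> \<eta> \<in> \<Gamma> \<Longrightarrow> (\<lambda>p. \<xi> p + \<eta> p) \<in> \<Gamma>"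
  by (erule section_cases, erule section_cases) (simp only: section_iff add_Pair OF1_add GF_add simp_thms)

lemma section_scale: "f \<in> C \<Longrightarrow> \<xi> \<in> \<Gamma> \<Longrightarrow> (\<lambda>p. f p *\<^sub>R \<xi> p) \<in> \<Gamma>"
  by (erule section_cases) (simp only: section_iff scaleR_Pair OF1_scale GF_scale simp_thms)

lemma sbr_add:
  assumes "\<xi> \<in> \<Gamma>" "\<eta> \<in> \<Gamma>" "\<zeta> \<in> \<Gamma>"
  shows "sbr \<xi> (\<lambda>p. \<eta> p + \<zeta> p) p = sbr \<xi> \<eta> p + sbr \<xi> \<zeta> p"
proof -
  obtain \<alpha> s where x: "\<xi> = (\<lambda>p. (\<alpha> p, s p))" "\<alpha> \<in> OF1" "s \<in> GF" using section_cases[OF assms(1)] .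
  obtain \<beta> t where y: "\<eta> = (\<lambda>p. (\<beta> p, t p))" "\<beta> \<in> OF1" "t \<in> GF" using section_cases[OF assms(2)] .
  obtain \<gamma> u where z: "\<zeta> = (\<lambda>p. (\<gamma> p, u p))" "\<gamma> \<in> OF1" "u \<in> GF" using section_cases[OF assms(3)] .
  note c = OF1_cotangent[OF x(2)] OF1_cotangent[OF y(2)] OF1_cotangent[OF z(2)] and g = GF_g[OF x(3)] GF_g[OF y(3)] GF_g[OF z(3)]
  show ?thesis
    unfolding x(1) y(1) z(1) add_Pair sbr_eq[OF x(2,3) y(2,3)] sbr_eq[OF x(2,3) z(2,3)]
      sbr_eq[OF x(2,3) OF1_add[OF y(2) z(2)] GF_add[OF y(3) z(3)]]
      form_bracket_add[OF x(2) y(2) z(2)] lie_form_add[OF \<rho>_VF[OF g(1)] y(2) z(2)] lie_\<rho>_add[OF g(2,3) x(2)]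
      ysec_add[OF x(2) y(2) z(2)] linear_onD(1)[OF lb_linear[OF g(1)] g(2,3)] nab_add[OF r_T[OF c(1) g(1)] y(3) z(3)]
      r_add[OF c(2,3) g(2,3)] nab_add_vec prod.inject by (intro conjI add_diff_regroup add_diff_regroup4)
qed

text \<open>In the form component the derivative of \<open>f\<close> arrives in two pieces, along
  \<open>sharp\<close> from the bracket of forms and along \<open>\<rho>\<close> from the Lie
  derivative; together they are the anchor. In the \<gg>-component \<open>nab\<close> already
  differentiates along the anchor.\<close>

lemma sbr_scale:
  assumes "\<xi> \<in> \<Gamma>" "\<eta> \<in> \<Gamma>" and f: "f \<in> C"
  shows "sbr \<xi> (\<lambda>p. f p *\<^sub>R \<eta> p) p = f p *\<^sub>R sbr \<xi> \<eta> p + r p (\<xi> p) f *\<^sub>R \<eta> p"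
proof -
  obtain \<alpha> s where x: "\<xi> = (\<lambda>p. (\<alpha> p, s p))" "\<alpha> \<in> OF1" "s \<in> GF" using section_cases[OF assms(1)] .
  obtain \<beta> t where y: "\<eta> = (\<lambda>p. (\<beta> p, t p))" "\<beta> \<in> OF1" "t \<in> GF" using section_cases[OF assms(2)] .
  note c = OF1_cotangent[OF x(2)] OF1_cotangent[OF y(2)] and g = GF_g[OF x(3)] GF_g[OF y(3)]
  have rf: "r p (\<alpha> p, s p) f = sharp A \<pi> p (\<alpha> p) f + \<rho> (s p) p f" by (simp only: r_Pair plus_fun_apply)
  show ?thesis
    unfolding x(1) y(1) scaleR_Pair sbr_eq[OF x(2,3) y(2,3)]
      sbr_eq[OF x(2,3) OF1_scale[OF f y(2)] GF_scale[OF f y(3)]]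
      form_bracket_scale[OF x(2) y(2) f] lie_form_scale[OF \<rho>_VF[OF g(1)] y(2) f] lie_\<rho>_scale[OF g(2) x(2)]
      ysec_scale[OF x(2) y(2)] linear_onD(2)[OF lb_linear[OF g(1)] g(2)] nab_scale[OF r_T[OF c(1) g(1)] f y(3)]
      r_scale[OF c(2) g(2)] nab_scale_vec scale_regroup scale_regroup4 add_Pair rf by (rule refl)
qed

lemma form_0_sections: "\<alpha> \<in> OF1 \<Longrightarrow> (\<lambda>p. (\<alpha> p, 0)) \<in> \<Gamma>"
  and const_sections: "v \<in> \<gg> \<Longrightarrow> (\<lambda>p. (0, v)) \<in> \<Gamma>"
  unfolding section_iff using OF1_0 GF_const g_0 by simp_all

lemma lie_\<rho>_0: "\<alpha> \<in> OF1 \<Longrightarrow> lie_form A (\<rho> 0) \<alpha> p = 0"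
  by (rule linear_on_0[OF lie_\<rho>_linear g_0])

lemma lie_form_0: "v \<in> \<gg> \<Longrightarrow> lie_form A (\<rho> v) (\<lambda>p. 0) p = 0"
  using lie_form_scale[OF \<rho>_VF OF1_0 C_const, of v 0] by (simp add: tangent_const[OF \<rho>_T])

lemma form_bracket_0: "\<alpha> \<in> OF1 \<Longrightarrow> form_bracket A \<pi> \<alpha> (\<lambda>p. 0) p = 0"
  using form_bracket_scale[OF _ OF1_0 C_const, of \<alpha> 0] by (simp add: tangent_const[OF sharp(1)[OF OF1_cotangent]])

lemma form_bracket_0': "\<alpha> \<in> OF1 \<Longrightarrow> form_bracket A \<pi> (\<lambda>p. 0) \<alpha> p = 0"
  using form_bracket_skew[OF OF1_0, of \<alpha> p] form_bracket_0[of \<alpha> p] by simp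

lemma ysec_0: "\<alpha> \<in> OF1 \<Longrightarrow> ysec \<alpha> (\<lambda>p. 0) p = 0"
  using ysec_scale[OF _ OF1_0, of \<alpha> "\<lambda>p. 0" p] by simp

lemma ysec_skew: "\<alpha> \<in> OF1 \<Longrightarrow> \<beta> \<in> OF1 \<Longrightarrow> ysec \<alpha> \<beta> p = - ysec \<beta> \<alpha> p"
  unfolding ysec_def by (rule ychi_skew[OF coaction_OF1 coaction_OF1])

lemma ysec_0': "\<alpha> \<in> OF1 \<Longrightarrow> ysec (\<lambda>p. 0) \<alpha> p = 0"
  using ysec_skew[OF OF1_0, of \<alpha> p] ysec_0[of \<alpha> p] by simp

lemma lb_0: "v \<in> \<gg> \<Longrightarrow> vf_bracket v 0 = 0" and lb_0': "v \<in> \<gg> \<Longrightarrow> vf_bracket 0 v = 0"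
  by (rule linear_on_0[OF lb_linear g_0], assumption, rule linear_on_0[OF lb_linear2 g_0])

lemma r_form: "r p (a, 0) = sharp A \<pi> p a"
  unfolding r_Pair linear_on_0[OF \<rho>_linear_at g_0] by (rule add_0_right)

lemma r_const: "r p (0, v) = \<rho> v p"
  unfolding r_Pair linear_on_0[OF linear_sharp subspace_0[OF subspace_dual]] by (rule add_0_left)

text \<open>The second argument keeps a \<gg>-part because the bracket of two differentials can have
  one, so iterated brackets leave the pure forms.\<close>

lemma sbr_form_form:
  assumes "\<alpha> \<in> OF1" "\<beta> \<in> OF1" "t \<in> GF"
  shows "sbr (\<lambda>p. (\<alpha> p, 0)) (\<lambda>p. (\<beta> p, t p)) p =
    (form_bracket A \<pi> \<alpha> \<beta> p - lie_form A (\<rho> (t p)) \<alpha> p, ysec \<alpha> \<beta> p + nab (sharp A \<pi> p (\<alpha> p)) t)"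
proof -
  have "nab (r p (\<beta> p, t p)) (\<lambda>p. 0) = 0" by (rule nab_const[OF r_T[OF OF1_cotangent[OF assms(2)] GF_g[OF assms(3)]]])
  then show ?thesis
    unfolding sbr_eq[OF assms(1) GF_const[OF g_0] assms(2,3)] lie_\<rho>_0[OF assms(2)] lb_0'[OF GF_g[OF assms(3)]] r_form
    by (simp only: add_0_right diff_zero)
qed

lemma sbr_const:
  assumes "v \<in> \<gg>" "\<beta> \<in> OF1" "t \<in> GF"
  shows "sbr (\<lambda>p. (0, v)) (\<lambda>p. (\<beta> p, t p)) p =
    (lie_form A (\<rho> v) \<beta> p, vf_bracket v (t p) + nab (\<rho> v p) t)"
proof -
  have "nab (r p (\<beta> p, t p)) (\<lambda>p. v) = 0" by (rule nab_const[OF r_T[OF OF1_cotangent[OF assms(2)] GF_g[OF assms(3)]]])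
  then show ?thesis
    unfolding sbr_eq[OF OF1_0 GF_const[OF assms(1)] assms(2,3)] form_bracket_0'[OF assms(2)] ysec_0'[OF assms(2)] r_const
      lie_form_0[OF GF_g[OF assms(3)]]
    by (simp only: add_0_left diff_zero)
qed

text \<open>The existence half for the definite description \<open>section_bracket\<close>.\<close>

lemma is_section_bracket_sbr: "is_section_bracket A \<gg> B \<rho> \<pi> sbr"
  unfolding is_section_bracket_def
proof (intro conjI ballI allI impI)
  fix \<xi> assume x: "\<xi> \<in> \<Gamma>"
  show "sbr \<xi> ` \<Gamma> \<subseteq> \<Gamma>" using sbr_sections[OF x] by (rule image_subsetI)
  show "linear_on \<Gamma> (sbr \<xi>)"
    unfolding linear_on_def
  proof (intro conjI ballI allI)
    fix \<eta> \<zeta> c assume y: "\<eta> \<in> \<Gamma>"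
    have "r p (\<xi> p) (\<lambda>q. c) = 0" for p
      using x by (rule section_cases) (simp only: tangent_const[OF r_T[OF OF1_cotangent GF_g]])
    then show "sbr \<xi> (c *\<^sub>R \<eta>) = c *\<^sub>R sbr \<xi> \<eta>"
      using sbr_scale[OF x y C_const[of c]] unfolding scaleR_fun_def by (intro ext) (simp only: scaleR_zero_left add_0_right)
    assume z: "\<zeta> \<in> \<Gamma>"
    show "sbr \<xi> (\<eta> + \<zeta>) = sbr \<xi> \<eta> + sbr \<xi> \<zeta>"
      using sbr_add[OF x y z] unfolding plus_fun_def by (intro ext) (simp only:)
  qed
  fix \<eta> assume y: "\<eta> \<in> \<Gamma>"
  show "sbr \<xi> \<eta> = - sbr \<eta> \<xi>" unfolding fun_Compl_def by (rule ext) (rule sbr_skew[OF x y])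
next
  fix \<alpha> \<beta> assume o: "\<alpha> \<in> OF1" "\<beta> \<in> OF1"
  have "nab (sharp A \<pi> p (\<alpha> p)) (\<lambda>p. 0) = 0" for p by (rule nab_const[OF sharp(1)[OF OF1_cotangent[OF o(1)]]])
  then show "sbr (\<lambda>p. (\<alpha> p, 0)) (\<lambda>p. (\<beta> p, 0)) = (\<lambda>p. (form_bracket A \<pi> \<alpha> \<beta> p,
      (1/2) *\<^sub>R bidual_elem \<gg> (chi_G \<gg> B (coaction \<gg> \<rho> p (\<alpha> p)) (coaction \<gg> \<rho> p (\<beta> p)))))"
    unfolding chi_G_eq ychi_def[symmetric] ysec_def[symmetric]
    by (intro ext) (simp only: sbr_form_form[OF o GF_const[OF g_0]] lie_\<rho>_0[OF o(1)] diff_zero add_0_right)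
next
  fix v w assume v: "v \<in> \<gg>" and w: "w \<in> \<gg>"
  show "sbr (\<lambda>p. (0, v)) (\<lambda>p. (0, w)) = (\<lambda>p. (0, vf_bracket v w))"
    by (intro ext) (simp only: sbr_const[OF v OF1_0 GF_const[OF w]] lie_form_0[OF v] nab_const[OF \<rho>_T[OF v]] add_0_right)
next
  fix v \<alpha> assume v: "v \<in> \<gg>" and \<alpha>: "\<alpha> \<in> OF1"
  show "sbr (\<lambda>p. (0, v)) (\<lambda>p. (\<alpha> p, 0)) = (\<lambda>p. (lie_form A (\<rho> v) \<alpha> p, 0))"
    by (intro ext) (simp only: sbr_const[OF v \<alpha> GF_const[OF g_0]] lb_0[OF v] nab_const[OF \<rho>_T[OF v]] add_0_right)
next
  show "leibniz_on A \<Gamma> r sbr"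
    unfolding leibniz_on_def by (intro ballI ext sbr_scale)
next
  fix \<xi> \<eta> assume "\<xi> \<notin> \<Gamma> \<or> \<eta> \<notin> \<Gamma>"
  then show "sbr \<xi> \<eta> = 0" by (auto simp only: sbr_def if_False simp_thms)
qed

lemma section_sum: "(\<And>i. i \<in> I \<Longrightarrow> \<xi> i \<in> \<Gamma>) \<Longrightarrow> (\<lambda>p. \<Sum>i\<in>I. \<xi> i p) \<in> \<Gamma>"
proof (induction I rule: infinite_finite_induct)
  case (insert i I)
  show ?case unfolding sum.insert[OF insert(1,2)] by (intro section_add insert) simp_all
qed (simp_all only: sum.infinite sum.empty not_False_eq_True const_sections[OF g_0] zero_prod_def)

lemma section_expand:
  assumes "\<alpha> \<in> OF1" "t \<in> GF"
  shows "(\<lambda>p. (\<alpha> p, t p)) = (\<lambda>p. (\<alpha> p, 0) + (\<Sum>i<n. cs i (t p) *\<^sub>R (0, us i)))"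
proof
  fix p
  have "(\<Sum>i<n. cs i (t p) *\<^sub>R (0, us i)) = ((0 :: 'm covec), \<Sum>i<n. cs i (t p) *\<^sub>R us i)"
    by (simp only: scaleR_Pair scaleR_zero_right sum_prod sum.neutral_const fst_conv snd_conv split: prod.splits)
  then show "(\<alpha> p, t p) = (\<alpha> p, 0) + (\<Sum>i<n. cs i (t p) *\<^sub>R (0, us i))"
    by (simp only: g_expand[OF GF_g[OF assms(2)]] add_Pair add_0_left add_0_right)
qed

text \<open>The Leibniz rule determines a bracket from its values on forms and on constants.\<close>

lemma section_bracket_unique:
  assumes b: "is_section_bracket A \<gg> B \<rho> \<pi> b" and b': "is_section_bracket A \<gg> B \<rho> \<pi> b'"
  shows "b = b'"
proof -
  have props: "\<And>\<xi> \<eta> \<zeta>. \<xi> \<in> \<Gamma> \<Longrightarrow> \<eta> \<in> \<Gamma> \<Longrightarrow> \<zeta> \<in> \<Gamma> \<Longrightarrow> b \<xi> (\<lambda>p. \<eta> p + \<zeta> p) = (\<lambda>p. b \<xi> \<eta> p + b \<xi> \<zeta> p)"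
    "\<And>\<xi> \<eta> f. \<xi> \<in> \<Gamma> \<Longrightarrow> \<eta> \<in> \<Gamma> \<Longrightarrow> f \<in> C \<Longrightarrow> b \<xi> (\<lambda>p. f p *\<^sub>R \<eta> p) = (\<lambda>p. f p *\<^sub>R b \<xi> \<eta> p + r p (\<xi> p) f *\<^sub>R \<eta> p)"
    "\<And>\<xi> \<eta>. \<xi> \<in> \<Gamma> \<Longrightarrow> \<eta> \<in> \<Gamma> \<Longrightarrow> b \<xi> \<eta> = (\<lambda>p. - b \<eta> \<xi> p)"
    if "is_section_bracket A \<gg> B \<rho> \<pi> b" for b
  proof -
    note d = that[unfolded is_section_bracket_def]
    fix \<xi> \<eta> \<zeta> f assume x: "\<xi> \<in> \<Gamma>" and y: "\<eta> \<in> \<Gamma>"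
    have l: "linear_on \<Gamma> (b \<xi>)" by (rule conjunct2[OF bspec[OF conjunct1[OF d] x]])
    show "b \<xi> \<eta> = (\<lambda>p. - b \<eta> \<xi> p)"
      using bspec[OF bspec[OF conjunct1[OF conjunct2[OF d]] x] y] unfolding fun_Compl_def .
    show "b \<xi> (\<lambda>p. \<eta> p + \<zeta> p) = (\<lambda>p. b \<xi> \<eta> p + b \<xi> \<zeta> p)" if z: "\<zeta> \<in> \<Gamma>"
      using linear_onD(1)[OF l y z] unfolding plus_fun_def .
    have "leibniz_on A \<Gamma> r b" using d by (elim conjE)
    then show "b \<xi> (\<lambda>p. f p *\<^sub>R \<eta> p) = (\<lambda>p. f p *\<^sub>R b \<xi> \<eta> p + r p (\<xi> p) f *\<^sub>R \<eta> p)" if "f \<in> C"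
      unfolding leibniz_on_def using x y that by blast
  qed
  \<comment> \<open>For a fixed first argument, agreement on forms and on constants spreads to all
    second arguments. Skew-symmetry, in \<open>swap\<close> below, then lets the same statement
    treat the first argument.\<close>
  have gen: "b \<xi> \<eta> = b' \<xi> \<eta>"
    if x: "\<xi> \<in> \<Gamma>" and y: "\<eta> \<in> \<Gamma>"
      and f: "\<And>\<beta>. \<beta> \<in> OF1 \<Longrightarrow> b \<xi> (\<lambda>p. (\<beta> p, 0)) = b' \<xi> (\<lambda>p. (\<beta> p, 0))"
      and g: "\<And>v. v \<in> \<gg> \<Longrightarrow> b \<xi> (\<lambda>p. (0, v)) = b' \<xi> (\<lambda>p. (0, v))" for \<xi> \<eta>
  proof -
    obtain \<beta> t where e: "\<eta> = (\<lambda>p. (\<beta> p, t p))" "\<beta> \<in> OF1" "t \<in> GF" using section_cases[OF y] .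
    have c: "(\<lambda>p. cs i (t p) *\<^sub>R (0, us i)) \<in> \<Gamma>" if "i < n" for i
      by (rule section_scale[OF GF_C[OF e(3) cs_dual[OF that]] const_sections[OF us_g[OF that]]])
    have s: "b \<xi> (\<lambda>p. \<Sum>i\<in>I. cs i (t p) *\<^sub>R (0, us i)) = b' \<xi> (\<lambda>p. \<Sum>i\<in>I. cs i (t p) *\<^sub>R (0, us i))"
      if "finite I" "I \<subseteq> {..<n}" for I
      using that
    proof (induction I)
      case empty
      have "b \<xi> (\<lambda>p. 0) = b' \<xi> (\<lambda>p. 0)" using g[OF g_0] unfolding zero_prod_def .
      then show ?case by (simp only: sum.empty)
    next
      case (insert i I)
      then have i: "i < n" by simp
      have I: "(\<lambda>p. \<Sum>i\<in>I. cs i (t p) *\<^sub>R (0, us i)) \<in> \<Gamma>"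
        by (rule section_sum, rule c) (use insert.prems in auto)
      have IH: "b \<xi> (\<lambda>p. \<Sum>i\<in>I. cs i (t p) *\<^sub>R (0, us i)) = b' \<xi> (\<lambda>p. \<Sum>i\<in>I. cs i (t p) *\<^sub>R (0, us i))"
        by (rule insert.IH) (use insert.prems in blast)
      note p = props(1)[OF _ x c[OF i] I] props(2)[OF _ x const_sections[OF us_g[OF i]] GF_C[OF e(3) cs_dual[OF i]]]
      show ?case
        unfolding sum.insert[OF insert(1,2)] p(1)[OF b] p(1)[OF b'] p(2)[OF b] p(2)[OF b'] IH g[OF us_g[OF i]] by (rule refl)
    qed
    have cs: "(\<lambda>p. \<Sum>i<n. cs i (t p) *\<^sub>R (0, us i)) \<in> \<Gamma>" by (rule section_sum, rule c) simp
    note p = props(1)[OF _ x form_0_sections[OF e(2)] cs]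
    show ?thesis
      unfolding e(1) section_expand[OF e(2,3)] p[OF b] p[OF b'] f[OF e(2)] s[OF finite_lessThan subset_refl] by (rule refl)
  qed
  note d = b[unfolded is_section_bracket_def] and d' = b'[unfolded is_section_bracket_def]
  have ff: "b (\<lambda>p. (\<alpha> p, 0)) (\<lambda>p. (\<beta> p, 0)) = b' (\<lambda>p. (\<alpha> p, 0)) (\<lambda>p. (\<beta> p, 0))" if "\<alpha> \<in> OF1" "\<beta> \<in> OF1" for \<alpha> \<beta>
    using d d' that by (elim conjE) (simp only:)
  have gg: "b (\<lambda>p. (0, v)) (\<lambda>p. (0, w)) = b' (\<lambda>p. (0, v)) (\<lambda>p. (0, w))" if "v \<in> \<gg>" "w \<in> \<gg>" for v w
    using d d' that by (elim conjE) (simp only:)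
  have gf: "b (\<lambda>p. (0, v)) (\<lambda>p. (\<alpha> p, 0)) = b' (\<lambda>p. (0, v)) (\<lambda>p. (\<alpha> p, 0))" if "v \<in> \<gg>" "\<alpha> \<in> OF1" for v \<alpha>
    using d d' that by (elim conjE) (simp only:)
  have fg: "b (\<lambda>p. (\<alpha> p, 0)) (\<lambda>p. (0, v)) = b' (\<lambda>p. (\<alpha> p, 0)) (\<lambda>p. (0, v))" if "v \<in> \<gg>" "\<alpha> \<in> OF1" for v \<alpha>
    unfolding props(3)[OF b form_0_sections[OF that(2)] const_sections[OF that(1)]]
      props(3)[OF b' form_0_sections[OF that(2)] const_sections[OF that(1)]] gf[OF that] by (rule refl)
  have swap: "b \<xi> \<eta> = b' \<xi> \<eta>" if "\<xi> \<in> \<Gamma>" "\<eta> \<in> \<Gamma>" "b \<eta> \<xi> = b' \<eta> \<xi>" for \<xi> \<eta>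
    unfolding props(3)[OF b that(1,2)] props(3)[OF b' that(1,2)] that(3) by (rule refl)
  have "b \<xi> \<eta> = b' \<xi> \<eta>" if x: "\<xi> \<in> \<Gamma>" and y: "\<eta> \<in> \<Gamma>" for \<xi> \<eta>
  proof (rule gen[OF x y])
    show "b \<xi> (\<lambda>p. (\<beta> p, 0)) = b' \<xi> (\<lambda>p. (\<beta> p, 0))" if "\<beta> \<in> OF1" for \<beta>
      by (rule swap[OF x form_0_sections[OF that]], rule gen[OF form_0_sections[OF that] x]) (simp_all only: ff fg that)
    show "b \<xi> (\<lambda>p. (0, v)) = b' \<xi> (\<lambda>p. (0, v))" if "v \<in> \<gg>" for v
      by (rule swap[OF x const_sections[OF that]], rule gen[OF const_sections[OF that] x]) (simp_all only: gf gg that)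
  qed
  moreover have "b \<xi> \<eta> = b' \<xi> \<eta>" if "\<xi> \<notin> \<Gamma> \<or> \<eta> \<notin> \<Gamma>" for \<xi> \<eta>
    using d d' that by (elim conjE) (simp only:)
  ultimately show ?thesis by (intro ext) metis
qed

lemma section_bracket_eq: "section_bracket A \<gg> B \<rho> \<pi> = sbr"
  unfolding section_bracket_def
  by (rule the_equality[where P = "is_section_bracket A \<gg> B \<rho> \<pi>", OF is_section_bracket_sbr])
    (erule section_bracket_unique[OF _ is_section_bracket_sbr])

end

lemma sum_split_less:
  fixes f :: "nat \<Rightarrow> 'a::comm_monoid_add"
  shows "(\<Sum>j<m + n. if j < m then f j else g (j - m)) = (\<Sum>j<m. f j) + (\<Sum>i<n. g i)"
  by (induction n) (simp_all add: add.assoc)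

section \<open>Generators of the module of sections and the anchor defect\<close>

context bivector_g_manifold
begin

lemma R_VF:
  assumes "\<xi> \<in> \<Gamma>"
  shows "(\<lambda>p. r p (\<xi> p)) \<in> VF"
proof -
  obtain \<alpha> s where x: "\<xi> = (\<lambda>p. (\<alpha> p, s p))" "\<alpha> \<in> OF1" "s \<in> GF" using section_cases[OF assms] .
  show ?thesis unfolding x(1) by (rule r_VF[OF x(2,3)])
qed

lemma r_section_add:
  assumes "\<xi> \<in> \<Gamma>" "\<eta> \<in> \<Gamma>"
  shows "r p (\<xi> p + \<eta> p) = r p (\<xi> p) + r p (\<eta> p)"
proof -
  obtain \<alpha> s where x: "\<xi> = (\<lambda>p. (\<alpha> p, s p))" "\<alpha> \<in> OF1" "s \<in> GF" using section_cases[OF assms(1)] .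
  obtain \<beta> t where y: "\<eta> = (\<lambda>p. (\<beta> p, t p))" "\<beta> \<in> OF1" "t \<in> GF" using section_cases[OF assms(2)] .
  show ?thesis
    unfolding x(1) y(1) add_Pair
    by (rule r_add[OF OF1_cotangent[OF x(2)] OF1_cotangent[OF y(2)] GF_g[OF x(3)] GF_g[OF y(3)]])
qed

lemma r_section_scale:
  assumes "\<xi> \<in> \<Gamma>"
  shows "r p (c *\<^sub>R \<xi> p) = c *\<^sub>R r p (\<xi> p)"
proof -
  obtain \<alpha> s where x: "\<xi> = (\<lambda>p. (\<alpha> p, s p))" "\<alpha> \<in> OF1" "s \<in> GF" using section_cases[OF assms(1)] .
  show ?thesis unfolding x(1) scaleR_Pair by (rule r_scale[OF OF1_cotangent[OF x(2)] GF_g[OF x(3)]])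
qed

text \<open>Near \<open>p\<close> a section is a combination of coordinate differentials and
  constants; multiplied by a bump function the expansion holds globally, so \<open>K\<close> can be
  evaluated on it at \<open>p\<close>. The target type is left open because the lemma serves both
  the defect and the Jacobiator.\<close>

lemma sections_generated:
  fixes K :: "('m \<Rightarrow> 'm covec \<times> 'g vfield) \<Rightarrow> 'm \<Rightarrow> 'w::real_vector"
  assumes add: "\<And>\<xi> \<eta> p. \<xi> \<in> \<Gamma> \<Longrightarrow> \<eta> \<in> \<Gamma> \<Longrightarrow> K (\<lambda>p. \<xi> p + \<eta> p) p = K \<xi> p + K \<eta> p"
    and scale: "\<And>f \<xi> p. f \<in> C \<Longrightarrow> \<xi> \<in> \<Gamma> \<Longrightarrow> K (\<lambda>p. f p *\<^sub>R \<xi> p) p = f p *\<^sub>R K \<xi> p"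
    and forms: "\<And>f p. f \<in> C \<Longrightarrow> K (\<lambda>p. (extd A f p, 0)) p = 0"
    and const0: "\<And>v p. v \<in> \<gg> \<Longrightarrow> K (\<lambda>p. (0, v)) p = 0"
    and \<xi>: "\<xi> \<in> \<Gamma>"
  shows "K \<xi> p = 0"
proof -
  obtain \<alpha> t where x: "\<xi> = (\<lambda>p. (\<alpha> p, t p))" "\<alpha> \<in> OF1" "t \<in> GF" using section_cases[OF \<xi>] .
  obtain W x E where p: "p \<in> W" and fr: "frame_on W x E" using frame_on_exists by blast
  note f = frame_onD[OF fr]
  obtain \<beta> V where \<beta>: "\<beta> \<in> C" "open V" "p \<in> V" "\<And>q. q \<in> V \<Longrightarrow> \<beta> q = 1" "\<And>q. q \<notin> W \<Longrightarrow> \<beta> q = 0"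
    using bump_fun[OF f(1) p] by blast
  have K_sum: "K (\<lambda>q. \<Sum>i\<in>I. c i q *\<^sub>R e i q) p = 0"
    if "finite I" "\<And>i. i \<in> I \<Longrightarrow> c i \<in> C" "\<And>i. i \<in> I \<Longrightarrow> e i \<in> \<Gamma>" "\<And>i. i \<in> I \<Longrightarrow> K (e i) p = 0"
    for I :: "'i set" and c e
    using that
  proof (induction I)
    case empty
    show ?case using const0[OF g_0, of p] unfolding sum.empty zero_prod_def .
  next
    case (insert i I)
    have 1: "(\<lambda>q. c i q *\<^sub>R e i q) \<in> \<Gamma>" by (rule section_scale) (use insert.prems in blast)+
    have 2: "(\<lambda>q. \<Sum>i\<in>I. c i q *\<^sub>R e i q) \<in> \<Gamma>"
      by (rule section_sum, rule section_scale) (use insert.prems in blast)+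
    have 3: "K (\<lambda>q. c i q *\<^sub>R e i q) p = 0"
      using scale[of "c i" "e i" p] insert.prems by simp
    have 4: "K (\<lambda>q. \<Sum>i\<in>I. c i q *\<^sub>R e i q) p = 0" by (rule insert.IH) (use insert.prems in blast)+
    show ?case unfolding sum.insert[OF insert(1,2)] add[OF 1 2] 3 4 by (rule add_0_left)
  qed
  let ?c = "\<lambda>u q. \<beta> q * \<alpha> q (E u q)" and ?e = "\<lambda>u q. (extd A (x u) q, 0 :: 'g vfield)"
  let ?d = "\<lambda>i q. \<beta> q * cs i (t q)" and ?k = "\<lambda>i q. (0 :: 'm covec, us i)"
  have c: "?c u \<in> C" "?e u \<in> \<Gamma>" for u
    by (rule C_mult[OF \<beta>(1) OF1_C[OF x(2) f(3)]], rule form_0_sections[OF extd_OF1[OF f(2)]])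
  have d: "?d i \<in> C" "?k i \<in> \<Gamma>" if "i < n" for i
    by (rule C_mult[OF \<beta>(1) GF_C[OF x(3) cs_dual[OF that]]], rule const_sections[OF us_g[OF that]])
  have "(\<lambda>q. \<beta> q *\<^sub>R \<xi> q) = (\<lambda>q. (\<Sum>u\<in>bs. ?c u q *\<^sub>R ?e u q) + (\<Sum>i<n. ?d i q *\<^sub>R ?k i q))"
  proof
    fix q
    have "(\<Sum>u\<in>bs. ?c u q *\<^sub>R ?e u q) = (\<beta> q *\<^sub>R \<alpha> q, 0)"
    proof (cases "q \<in> W")
      case True
      have "(\<Sum>u\<in>bs. ?c u q *\<^sub>R extd A (x u) q) = \<beta> q *\<^sub>R \<alpha> q"
        using arg_cong[OF dual_frame_expand_dual[OF frame_on_dual_frame[OF fr True] OF1_cotangent[OF x(2)]], of "scaleR (\<beta> q)"]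
        by (simp only: scaleR_sum_right scaleR_scaleR)
      then show ?thesis by (intro prod_eqI) (simp_all only: fst_sum snd_sum scaleR_Pair fst_conv snd_conv scaleR_zero_right sum.neutral_const)
    next
      case False
      then show ?thesis by (simp only: \<beta>(5)[OF False] mult_zero_left scaleR_zero_left sum.neutral_const zero_prod_def[symmetric])
    qed
    moreover have "(\<Sum>i<n. ?d i q *\<^sub>R ?k i q) = (0, \<beta> q *\<^sub>R t q)"
      using arg_cong[OF g_expand[OF GF_g[OF x(3)]], of "scaleR (\<beta> q)" q]
      by (intro prod_eqI) (simp_all only: fst_sum snd_sum scaleR_Pair fst_conv snd_conv scaleR_zero_right sum.neutral_const scaleR_sum_right scaleR_scaleR)
    ultimately show "\<beta> q *\<^sub>R \<xi> q = (\<Sum>u\<in>bs. ?c u q *\<^sub>R ?e u q) + (\<Sum>i<n. ?d i q *\<^sub>R ?k i q)"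
      by (simp only: x(1) scaleR_Pair add_Pair add_0_left add_0_right)
  qed
  moreover have "K (\<lambda>q. (\<Sum>u\<in>bs. ?c u q *\<^sub>R ?e u q) + (\<Sum>i<n. ?d i q *\<^sub>R ?k i q)) p
      = K (\<lambda>q. \<Sum>u\<in>bs. ?c u q *\<^sub>R ?e u q) p + K (\<lambda>q. \<Sum>i<n. ?d i q *\<^sub>R ?k i q) p"
    by (rule add; rule section_sum; rule section_scale) (simp_all only: c d lessThan_iff)
  moreover have "K (\<lambda>q. \<Sum>u\<in>bs. ?c u q *\<^sub>R ?e u q) p = 0"
    by (rule K_sum[OF onbD1[OF bs] c forms[OF f(2)]])
  moreover have "K (\<lambda>q. \<Sum>i<n. ?d i q *\<^sub>R ?k i q) p = 0"
    by (rule K_sum[OF finite_lessThan]) (simp_all only: d lessThan_iff const0 us_g)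
  ultimately have "K (\<lambda>q. \<beta> q *\<^sub>R \<xi> q) p = 0" by (simp only: add_0_left)
  then show ?thesis using scale[OF \<beta>(1) \<xi>, of p] \<beta>(3,4) by simp
qed

definition defect :: "('m \<Rightarrow> 'm covec \<times> 'g vfield) \<Rightarrow> ('m \<Rightarrow> 'm covec \<times> 'g vfield) \<Rightarrow> 'm vfield"
  where "defect \<xi> \<eta> p = r p (sbr \<xi> \<eta> p) - vf_bracket (\<lambda>p. r p (\<xi> p)) (\<lambda>p. r p (\<eta> p)) p"

lemma defect_T: "\<xi> \<in> \<Gamma> \<Longrightarrow> \<eta> \<in> \<Gamma> \<Longrightarrow> defect \<xi> \<eta> p \<in> T p"
  unfolding defect_def by (rule T_diff[OF VF_T[OF R_VF[OF sbr_sections]] VF_T[OF vf_bracket_VF[OF R_VF R_VF]]])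

lemma defect_add:
  assumes "\<xi> \<in> \<Gamma>" "\<eta> \<in> \<Gamma>" "\<zeta> \<in> \<Gamma>"
  shows "defect \<xi> (\<lambda>p. \<eta> p + \<zeta> p) p = defect \<xi> \<eta> p + defect \<xi> \<zeta> p"
  unfolding defect_def sbr_add[OF assms] r_section_add[OF assms(2,3)] r_section_add[OF sbr_sections[OF assms(1,2)] sbr_sections[OF assms(1,3)]]
    vf_bracket_add[OF R_VF[OF assms(1)] R_VF[OF assms(2)] R_VF[OF assms(3)]]
  by (rule add_diff_add)

text \<open>Both brackets obey a Leibniz rule with the same derivative \<open>r(\<xi>) f\<close>, so
  the inhomogeneous terms cancel in the difference.\<close>

lemma defect_scale:
  assumes \<xi>: "\<xi> \<in> \<Gamma>" and \<eta>: "\<eta> \<in> \<Gamma>" and f: "f \<in> C"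
  shows "defect \<xi> (\<lambda>p. f p *\<^sub>R \<eta> p) p = f p *\<^sub>R defect \<xi> \<eta> p"
proof -
  have "r p (f p *\<^sub>R sbr \<xi> \<eta> p + r p (\<xi> p) f *\<^sub>R \<eta> p) = f p *\<^sub>R r p (sbr \<xi> \<eta> p) + r p (\<xi> p) f *\<^sub>R r p (\<eta> p)"
    using r_section_add[OF section_scale[OF f sbr_sections[OF \<xi> \<eta>]] section_scale[OF VF_C[OF R_VF[OF \<xi>] f] \<eta>], of p]
    by (simp only: r_section_scale[OF sbr_sections[OF \<xi> \<eta>]] r_section_scale[OF \<eta>])
  then show ?thesis
    unfolding defect_def sbr_scale[OF \<xi> \<eta> f] r_section_scale[OF \<eta>] vf_bracket_scale[OF R_VF[OF \<xi>] R_VF[OF \<eta>] f]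
    by (simp only: add_diff_cancel_right scaleR_diff_right)
qed

lemma defect_skew:
  assumes \<xi>: "\<xi> \<in> \<Gamma>" and \<eta>: "\<eta> \<in> \<Gamma>"
  shows "defect \<xi> \<eta> p = - defect \<eta> \<xi> p"
proof -
  have "r p (sbr \<xi> \<eta> p) = - r p (sbr \<eta> \<xi> p)"
    unfolding sbr_skew[OF \<xi> \<eta>] using r_section_scale[OF sbr_sections[OF \<eta> \<xi>], of p "-1"] by (simp only: scaleR_minus1_left)
  then show ?thesis
    unfolding defect_def vf_bracket_skew[of "\<lambda>p. r p (\<xi> p)" "\<lambda>p. r p (\<eta> p)"]
    by (simp only: minus_diff_minus)
qed

lemma anchor_preserves_iff:
  "anchor_preserves_brackets A \<gg> B \<rho> \<pi> \<longleftrightarrow> (\<forall>\<xi>\<in>\<Gamma>. \<forall>\<eta>\<in>\<Gamma>. \<forall>p. defect \<xi> \<eta> p = 0)"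
  unfolding anchor_preserves_brackets_def section_bracket_eq defect_def by (simp only: fun_eq_iff[of "\<lambda>p. r p (sbr _ _ p)"] right_minus_eq)

abbreviation "ex f \<equiv> (\<lambda>p. (extd A f p, 0 :: 'g vfield))"
abbreviation "cst v \<equiv> (\<lambda>p. (0 :: 'm covec, v))"

lemma ex_section: "f \<in> C \<Longrightarrow> ex f \<in> \<Gamma>"
  by (rule form_0_sections[OF extd_OF1])

text \<open>The defect here is \<open>sharp\<close> of \<open>L\<alpha>\<close> minus the bracket of
  \<open>\<rho> v\<close> with \<open>sharp\<close> of \<alpha>, where \<open>L\<close> is the Lie
  derivative along \<open>\<rho> v\<close>. Pairing with \<beta> and using \<open>L\<close> of
  \<beta> to rewrite the second term yields the three terms of the Lie derivative of \<pi> with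
  opposite sign.\<close>

lemma defect_const_form:
  assumes v: "v \<in> \<gg>" and \<alpha>: "\<alpha> \<in> OF1" and \<beta>: "\<beta> \<in> OF1"
  shows "\<beta> p (defect (cst v) (\<lambda>p. (\<alpha> p, 0)) p) = - lie_bivec A (\<rho> v) \<pi> \<alpha> \<beta> p"
proof -
  note V = \<rho>_VF[OF v] and X = sharp_VF[OF \<alpha>] and l\<alpha> = lie_form(1)[OF \<rho>_VF[OF v] \<alpha>] and l\<beta> = lie_form(1)[OF \<rho>_VF[OF v] \<beta>]
  have s: "sbr (cst v) (\<lambda>p. (\<alpha> p, 0)) p = (lie_form A (\<rho> v) \<alpha> p, 0)"
    by (simp only: sbr_const[OF v \<alpha> GF_const[OF g_0]] lb_0[OF v] nab_const[OF \<rho>_T[OF v]] add_0_right)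
  have "\<beta> p (sharp A \<pi> p (lie_form A (\<rho> v) \<alpha> p)) = \<pi> p (lie_form A (\<rho> v) \<alpha> p) (\<beta> p)" by (rule form_sharp[OF l\<alpha> \<beta>])
  moreover have "lie_form A (\<rho> v) \<beta> p (sharp A \<pi> p (\<alpha> p)) = \<pi> p (\<alpha> p) (lie_form A (\<rho> v) \<beta> p)" by (rule form_sharp[OF \<alpha> l\<beta>])
  moreover have "lie_form A (\<rho> v) \<beta> p (sharp A \<pi> p (\<alpha> p)) = \<rho> v p (\<lambda>q. \<pi> q (\<alpha> q) (\<beta> q))
      - \<beta> p (vf_bracket (\<rho> v) (\<lambda>p. sharp A \<pi> p (\<alpha> p)) p)"
    using lie_form(2)[OF V \<beta> X, of p] unfolding form_sharp[OF \<alpha> \<beta>] .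
  moreover have "\<beta> p (defect (cst v) (\<lambda>p. (\<alpha> p, 0)) p) = \<beta> p (sharp A \<pi> p (lie_form A (\<rho> v) \<alpha> p))
      - \<beta> p (vf_bracket (\<rho> v) (\<lambda>p. sharp A \<pi> p (\<alpha> p)) p)"
    unfolding defect_def s r_form r_const
    by (rule covector_diff[OF \<beta> sharp(1)[OF OF1_cotangent[OF l\<alpha>]] VF_T[OF vf_bracket_VF[OF V X]]])
  ultimately show ?thesis unfolding lie_bivec_def by linarith
qed

lemma invariant_iff_defect:
  assumes v: "v \<in> \<gg>"
  shows "(\<forall>\<alpha>\<in>OF1. \<forall>\<beta>\<in>OF1. \<forall>p. lie_bivec A (\<rho> v) \<pi> \<alpha> \<beta> p = 0)
    \<longleftrightarrow> (\<forall>\<alpha>\<in>OF1. \<forall>p. defect (cst v) (\<lambda>p. (\<alpha> p, 0)) p = 0)"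
proof (intro iffI ballI allI)
  fix \<alpha> p assume inv: "\<forall>\<alpha>\<in>OF1. \<forall>\<beta>\<in>OF1. \<forall>p. lie_bivec A (\<rho> v) \<pi> \<alpha> \<beta> p = 0" and \<alpha>: "\<alpha> \<in> OF1"
  note t = defect_T[OF const_sections[OF v] form_0_sections[OF \<alpha>], of p]
  show "defect (cst v) (\<lambda>p. (\<alpha> p, 0)) p = 0"
  proof (rule T_eqI[OF t T_0])
    fix f assume f: "f \<in> C"
    have "extd A f p (defect (cst v) (\<lambda>p. (\<alpha> p, 0)) p) = 0"
      unfolding defect_const_form[OF v \<alpha> extd_OF1[OF f]] using inv \<alpha> extd_OF1[OF f] by simp
    then show "defect (cst v) (\<lambda>p. (\<alpha> p, 0)) p f = 0 f"
      unfolding extd_apply[OF t] by (simp only: zero_fun_apply)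
  qed
next
  fix \<alpha> \<beta> p assume d: "\<forall>\<alpha>\<in>OF1. \<forall>p. defect (cst v) (\<lambda>p. (\<alpha> p, 0)) p = 0" and o: "\<alpha> \<in> OF1" "\<beta> \<in> OF1"
  have "\<beta> p 0 = 0" by (rule linear_on_0[OF dual_linear[OF OF1_cotangent[OF o(2)]] T_0])
  then show "lie_bivec A (\<rho> v) \<pi> \<alpha> \<beta> p = 0"
    using defect_const_form[OF v o, of p] d o(1) by simp
qed

lemma ysec_extd: "ysec (extd A f) (extd A g) p = ychi (mom f p) (mom g p)"
  unfolding ysec_def mom_def by (rule refl)

lemma sbr_ex_ex:
  assumes f: "f \<in> C" and g: "g \<in> C"
  shows "sbr (ex f) (ex g) = (\<lambda>p. (extd A (fb f g) p, ysec (extd A f) (extd A g) p))"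
proof
  fix p
  have "nab (sharp A \<pi> p (extd A f p)) (\<lambda>p. 0) = 0" by (rule nab_const[OF sharp(1)[OF extd_cotangent[OF f]]])
  then show "sbr (ex f) (ex g) p = (extd A (fb f g) p, ysec (extd A f) (extd A g) p)"
    by (simp only: sbr_form_form[OF extd_OF1[OF f] extd_OF1[OF g] GF_const[OF g_0]] form_bracket_extd[OF f g]
        lie_\<rho>_0[OF extd_OF1[OF f]] diff_zero add_0_right)
qed

text \<open>The \<gg>-part of the bracket acts on \<open>h\<close> by pairing with
  \<open>mom h\<close>, which gives \<open>1/2 * chi\<close>; the form part against the bracket of
  Hamiltonian fields is minus the Jacobiator. So the defect vanishes exactly when \<open>chi\<close>
  is twice the Jacobiator, as in \<open>schouten_iff\<close>.\<close>

lemma defect_ex_ex: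
  assumes f: "f \<in> C" and g: "g \<in> C" and h: "h \<in> C"
  shows "defect (ex f) (ex g) p h = 1/2 * chi (mom f p) (mom g p) (mom h p) - jac f g h p"
proof -
  let ?y = "ysec (extd A f) (extd A g) p"
  have y: "?y \<in> \<gg>" by (rule GF_g[OF ysec_GF[OF extd_OF1[OF f] extd_OF1[OF g]]])
  have "\<rho> ?y p h = mom h p ?y" by (rule mom_apply[OF y, symmetric])
  also have "\<dots> = 1/2 * chi (mom f p) (mom g p) (mom h p)"
    unfolding ysec_extd by (rule ychi_pair[OF mom_dual[OF f] mom_dual[OF g] mom_dual[OF h]])
  finally have y2: "\<rho> ?y p h = 1/2 * chi (mom f p) (mom g p) (mom h p)" .
  have "r p (sbr (ex f) (ex g) p) = ham (fb f g) p + \<rho> ?y p"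
    unfolding sbr_ex_ex[OF f g] r_Pair ham_def by (rule refl)
  moreover have "vf_bracket (\<lambda>p. r p (ex f p)) (\<lambda>p. r p (ex g p)) p = vf_bracket (ham f) (ham g) p"
    unfolding r_form ham_def by (rule refl)
  ultimately have "defect (ex f) (ex g) p h = ham (fb f g) p h + \<rho> ?y p h - vf_bracket (ham f) (ham g) p h"
    unfolding defect_def by (simp only: minus_apply plus_fun_apply)
  moreover have "vf_bracket (ham f) (ham g) p h - ham (fb f g) p h = jac f g h p"
    using jac_vec_apply[OF f g h, of p] unfolding jac_vec_def by (simp only: minus_apply)
  ultimately show ?thesis unfolding y2 by linarith
qed

lemma sbr_cst_cst:
  assumes "v \<in> \<gg>" "w \<in> \<gg>"
  shows "sbr (cst v) (cst w) = cst (vf_bracket v w)"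
  by (intro ext) (simp only: sbr_const[OF assms(1) OF1_0 GF_const[OF assms(2)]] lie_form_0[OF assms(1)]
      nab_const[OF \<rho>_T[OF assms(1)]] add_0_right)

lemma defect_cst_cst:
  assumes "v \<in> \<gg>" "w \<in> \<gg>"
  shows "defect (cst v) (cst w) p = 0"
  unfolding defect_def sbr_cst_cst[OF assms] r_const \<rho>_hom[OF assms] by (rule diff_self)

text \<open>Pairs of constants impose no condition, since \<open>\<rho>\<close> is a homomorphism;
  the two remaining kinds of generator pairs carry the two quasi-Poisson conditions
  separately.\<close>

theorem quasi_poisson_iff_anchor:
  assumes gm: "g_manifold A \<gg> \<rho>"
  shows "quasi_poisson A \<gg> B \<rho> \<pi> \<longleftrightarrow> anchor_preserves_brackets A \<gg> B \<rho> \<pi>"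
proof -
  have "quasi_poisson A \<gg> B \<rho> \<pi> \<longleftrightarrow>
      (\<forall>v\<in>\<gg>. \<forall>\<alpha>\<in>OF1. \<forall>p. defect (cst v) (\<lambda>p. (\<alpha> p, 0)) p = 0) \<and>
      (\<forall>f\<in>C. \<forall>g\<in>C. \<forall>h\<in>C. \<forall>p. defect (ex f) (ex g) p h = 0)"
    (is "_ \<longleftrightarrow> ?I \<and> ?J")
  proof -
    have half: "x = 2 * y \<longleftrightarrow> 1/2 * x - y = 0" for x y :: real by auto
    have "?J \<longleftrightarrow> (\<forall>f\<in>C. \<forall>g\<in>C. \<forall>h\<in>C. \<forall>p. chi (mom f p) (mom g p) (mom h p) = 2 * jac f g h p)"
      unfolding half by (simp add: defect_ex_ex cong: ball_cong)
    then show ?thesis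
      unfolding quasi_poisson_def schouten_iff using gm bivec invariant_iff_defect by (simp cong: ball_cong)
  qed
  also have "\<dots> \<longleftrightarrow> (\<forall>\<xi>\<in>\<Gamma>. \<forall>\<eta>\<in>\<Gamma>. \<forall>p. defect \<xi> \<eta> p = 0)"
  proof
    assume *: "?I \<and> ?J"
    have cf: "defect (cst v) (ex f) p = 0" if "v \<in> \<gg>" "f \<in> C" for v f p
      using * that extd_OF1 by blast
    have ff: "defect (ex f) (ex g) p = 0" if "f \<in> C" "g \<in> C" for f g p
    proof (rule T_eqI[OF defect_T[OF ex_section[OF that(1)] ex_section[OF that(2)]] T_0])
      fix h assume "h \<in> C"
      then show "defect (ex f) (ex g) p h = 0 h" using * that by (simp only: zero_fun_apply)
    qed
    \<comment> \<open>\<open>sections_generated\<close> treats one slot at a time; skew-symmetry of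
      the defect brings the other argument into that slot.\<close>
    have c: "defect (cst v) \<eta> p = 0" if v: "v \<in> \<gg>" and "\<eta> \<in> \<Gamma>" for v \<eta> p
      by (rule sections_generated[of "defect (cst v)", OF defect_add[OF const_sections[OF v]]
          defect_scale[OF const_sections[OF v]] cf[OF v] defect_cst_cst[OF v] that(2)])
    have fc: "defect (ex f) (cst v) p = 0" if "f \<in> C" "v \<in> \<gg>" for f v p
      using defect_skew[OF ex_section[OF that(1)] const_sections[OF that(2)], of p] cf[OF that(2,1), of p] by simp
    have e: "defect (ex f) \<eta> p = 0" if f: "f \<in> C" and "\<eta> \<in> \<Gamma>" for f \<eta> p
      by (rule sections_generated[of "defect (ex f)", OF defect_add[OF ex_section[OF f]]
          defect_scale[OF ex_section[OF f]] ff[OF f] fc[OF f] that(2)])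
    show "\<forall>\<xi>\<in>\<Gamma>. \<forall>\<eta>\<in>\<Gamma>. \<forall>p. defect \<xi> \<eta> p = 0"
    proof (intro ballI allI)
      fix \<xi> \<eta> p assume x: "\<xi> \<in> \<Gamma>" and y: "\<eta> \<in> \<Gamma>"
      show "defect \<xi> \<eta> p = 0"
      proof (rule sections_generated[of "defect \<xi>", OF defect_add[OF x] defect_scale[OF x] _ _ y])
        show "defect \<xi> (ex f) p = 0" if "f \<in> C" for f p
          using defect_skew[OF x ex_section[OF that], of p] e[OF that x, of p] by simp
        show "defect \<xi> (cst v) p = 0" if "v \<in> \<gg>" for v p
          using defect_skew[OF x const_sections[OF that], of p] c[OF that x, of p] by simp
      qed
    qed
  next
    assume "\<forall>\<xi>\<in>\<Gamma>. \<forall>\<eta>\<in>\<Gamma>. \<forall>p. defect \<xi> \<eta> p = 0"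
    then have *: "defect \<xi> \<eta> p = 0" if "\<xi> \<in> \<Gamma>" "\<eta> \<in> \<Gamma>" for \<xi> \<eta> p using that by blast
    show "?I \<and> ?J"
    proof (intro conjI ballI allI)
      show "defect (cst v) (\<lambda>p. (\<alpha> p, 0)) p = 0" if "v \<in> \<gg>" "\<alpha> \<in> OF1" for v \<alpha> p
        by (rule *[OF const_sections[OF that(1)] form_0_sections[OF that(2)]])
      show "defect (ex f) (ex g) p h = 0" if "f \<in> C" "g \<in> C" for f g h p
        unfolding *[OF ex_section[OF that(1)] ex_section[OF that(2)]] by (rule zero_fun_apply)
    qed
  qed
  finally show ?thesis unfolding anchor_preserves_iff .
qed

section \<open>The Jacobiator of the bracket on sections\<close>

definition Jac :: "('m \<Rightarrow> 'm covec \<times> 'g vfield) \<Rightarrow> ('m \<Rightarrow> 'm covec \<times> 'g vfield) \<Rightarrow> ('m \<Rightarrow> 'm covec \<times> 'g vfield)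
    \<Rightarrow> 'm \<Rightarrow> 'm covec \<times> 'g vfield"
  where "Jac \<xi> \<eta> \<zeta> p = sbr \<xi> (sbr \<eta> \<zeta>) p + sbr \<eta> (sbr \<zeta> \<xi>) p + sbr \<zeta> (sbr \<xi> \<eta>) p"

lemma Jac_cycle: "Jac \<xi> \<eta> \<zeta> p = Jac \<eta> \<zeta> \<xi> p"
  unfolding Jac_def by (simp only: ac_simps)

lemma jacobi_iff: "jacobi_on \<Gamma> (section_bracket A \<gg> B \<rho> \<pi>) \<longleftrightarrow> (\<forall>\<xi>\<in>\<Gamma>. \<forall>\<eta>\<in>\<Gamma>. \<forall>\<zeta>\<in>\<Gamma>. \<forall>p. Jac \<xi> \<eta> \<zeta> p = 0)"
  unfolding jacobi_on_def section_bracket_eq Jac_def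
  by (simp only: fun_eq_iff[of "_ + _" 0] plus_fun_apply zero_fun_apply)

lemma sbr_add_left:
  assumes "\<xi> \<in> \<Gamma>" "\<eta> \<in> \<Gamma>" "\<zeta> \<in> \<Gamma>"
  shows "sbr (\<lambda>p. \<eta> p + \<zeta> p) \<xi> p = sbr \<eta> \<xi> p + sbr \<zeta> \<xi> p"
  unfolding sbr_skew[OF section_add[OF assms(2,3)] assms(1)] sbr_add[OF assms] sbr_skew[OF assms(2,1)] sbr_skew[OF assms(3,1)]
  by (rule minus_add_distrib)

lemma sbr_scale_left:
  assumes "\<xi> \<in> \<Gamma>" "\<eta> \<in> \<Gamma>" and f: "f \<in> C"
  shows "sbr (\<lambda>p. f p *\<^sub>R \<eta> p) \<xi> p = f p *\<^sub>R sbr \<eta> \<xi> p + (- r p (\<xi> p) f) *\<^sub>R \<eta> p"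
  unfolding sbr_skew[OF section_scale[OF f assms(2)] assms(1)] sbr_scale[OF assms] sbr_skew[OF assms(2,1)]
  by (simp only: minus_add_distrib scaleR_minus_left scaleR_minus_right)

lemma Jac_add:
  assumes x: "\<xi> \<in> \<Gamma>" and y: "\<eta> \<in> \<Gamma>" and z: "\<zeta> \<in> \<Gamma>" and w: "\<omega> \<in> \<Gamma>"
  shows "Jac \<xi> \<eta> (\<lambda>p. \<zeta> p + \<omega> p) p = Jac \<xi> \<eta> \<zeta> p + Jac \<xi> \<eta> \<omega> p"
proof -
  have e: "sbr \<eta> (\<lambda>p. \<zeta> p + \<omega> p) = (\<lambda>p. sbr \<eta> \<zeta> p + sbr \<eta> \<omega> p)"
    "sbr (\<lambda>p. \<zeta> p + \<omega> p) \<xi> = (\<lambda>p. sbr \<zeta> \<xi> p + sbr \<omega> \<xi> p)"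
    by (intro ext sbr_add[OF y z w], intro ext sbr_add_left[OF x z w])
  show ?thesis
    unfolding Jac_def e sbr_add[OF x sbr_sections[OF y z] sbr_sections[OF y w]] sbr_add[OF y sbr_sections[OF z x] sbr_sections[OF w x]]
      sbr_add_left[OF sbr_sections[OF x y] z w]
    by (simp only: ac_simps)
qed

text \<open>Terms containing a bracket times a first derivative of \<open>f\<close> cancel in pairs,
  partly by skew-symmetry. What multiplies \<zeta> is the commutator of \<open>r \<xi>\<close> and
  \<open>r \<eta>\<close> on \<open>f\<close>, from the first two summands, against
  \<open>r [\<xi>, \<eta>] f\<close> from the third.\<close>

lemma Jac_scale:
  assumes x: "\<xi> \<in> \<Gamma>" and y: "\<eta> \<in> \<Gamma>" and z: "\<zeta> \<in> \<Gamma>" and f: "f \<in> C"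
  shows "Jac \<xi> \<eta> (\<lambda>p. f p *\<^sub>R \<zeta> p) p = f p *\<^sub>R Jac \<xi> \<eta> \<zeta> p - defect \<xi> \<eta> p f *\<^sub>R \<zeta> p"
proof -
  let ?X = "\<lambda>p. r p (\<xi> p)" and ?Y = "\<lambda>p. r p (\<eta> p)"
  have Xf: "(\<lambda>p. ?X p f) \<in> C" and Yf: "(\<lambda>p. ?Y p f) \<in> C" using VF_C[OF R_VF[OF x] f] VF_C[OF R_VF[OF y] f] .
  have mXf: "(\<lambda>p. - ?X p f) \<in> C" by (rule C_minus[OF Xf])
  have e: "sbr \<eta> (\<lambda>p. f p *\<^sub>R \<zeta> p) = (\<lambda>p. f p *\<^sub>R sbr \<eta> \<zeta> p + ?Y p f *\<^sub>R \<zeta> p)"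
    "sbr (\<lambda>p. f p *\<^sub>R \<zeta> p) \<xi> = (\<lambda>p. f p *\<^sub>R sbr \<zeta> \<xi> p + (- ?X p f) *\<^sub>R \<zeta> p)"
    by (intro ext sbr_scale[OF y z f], intro ext sbr_scale_left[OF x z f])
  have 1: "sbr \<xi> (sbr \<eta> (\<lambda>p. f p *\<^sub>R \<zeta> p)) p = (f p *\<^sub>R sbr \<xi> (sbr \<eta> \<zeta>) p + ?X p f *\<^sub>R sbr \<eta> \<zeta> p)
      + (?Y p f *\<^sub>R sbr \<xi> \<zeta> p + ?X p (\<lambda>p. ?Y p f) *\<^sub>R \<zeta> p)"
    unfolding e sbr_add[OF x section_scale[OF f sbr_sections[OF y z]] section_scale[OF Yf z]]
      sbr_scale[OF x sbr_sections[OF y z] f] sbr_scale[OF x z Yf] by (rule refl)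
  have 2: "sbr \<eta> (sbr (\<lambda>p. f p *\<^sub>R \<zeta> p) \<xi>) p = (f p *\<^sub>R sbr \<eta> (sbr \<zeta> \<xi>) p + ?Y p f *\<^sub>R sbr \<zeta> \<xi> p)
      + ((- ?X p f) *\<^sub>R sbr \<eta> \<zeta> p + (- ?Y p (\<lambda>p. ?X p f)) *\<^sub>R \<zeta> p)"
    unfolding e sbr_add[OF y section_scale[OF f sbr_sections[OF z x]] section_scale[OF mXf z]]
      sbr_scale[OF y sbr_sections[OF z x] f] sbr_scale[OF y z mXf] tangent_minus[OF VF_T[OF R_VF[OF y]] Xf] by (rule refl)
  have 3: "sbr (\<lambda>p. f p *\<^sub>R \<zeta> p) (sbr \<xi> \<eta>) p = f p *\<^sub>R sbr \<zeta> (sbr \<xi> \<eta>) p + (- r p (sbr \<xi> \<eta> p) f) *\<^sub>R \<zeta> p"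
    by (rule sbr_scale_left[OF sbr_sections[OF x y] z f])
  have 4: "sbr \<zeta> \<xi> p = - sbr \<xi> \<zeta> p" by (rule sbr_skew[OF z x])
  have 5: "defect \<xi> \<eta> p f = r p (sbr \<xi> \<eta> p) f - (?X p (\<lambda>p. ?Y p f) - ?Y p (\<lambda>p. ?X p f))"
    unfolding defect_def by (simp only: minus_apply vf_bracket_def)
  \<comment> \<open>A pure vector space identity, stated with letters in place of the iterated
    brackets.\<close>
  have gen: "((f *\<^sub>R a + x *\<^sub>R n) + (y *\<^sub>R k + xy *\<^sub>R z)) + ((f *\<^sub>R b + y *\<^sub>R (- k)) + ((- x) *\<^sub>R n + (- yx) *\<^sub>R z))
      + (f *\<^sub>R c + (- d) *\<^sub>R z) = f *\<^sub>R (a + b + c) - (d - (xy - yx)) *\<^sub>R z"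
    for f x y xy yx d :: real and a b c k n z :: "'m covec \<times> 'g vfield"
    by (simp add: scaleR_add_left scaleR_add_right scaleR_diff_left)
  show ?thesis unfolding Jac_def 1 2 3 4 5 by (rule gen)
qed

text \<open>With \<zeta> = df the Leibniz formula leaves \<open>(\<Delta> f) df = 0\<close>.
  Evaluating this covector on \<Delta> itself gives the square of \<open>\<Delta> f\<close>, so the
  argument works whether or not \<open>df\<close> vanishes at the point.\<close>

lemma jacobi_imp_anchor:
  assumes J: "\<And>\<xi> \<eta> \<zeta> p. \<xi> \<in> \<Gamma> \<Longrightarrow> \<eta> \<in> \<Gamma> \<Longrightarrow> \<zeta> \<in> \<Gamma> \<Longrightarrow> Jac \<xi> \<eta> \<zeta> p = 0"
    and x: "\<xi> \<in> \<Gamma>" and y: "\<eta> \<in> \<Gamma>"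
  shows "defect \<xi> \<eta> p = 0"
proof (rule T_eqI[OF defect_T[OF x y] T_0])
  fix f assume f: "f \<in> C"
  let ?d = "defect \<xi> \<eta> p"
  have "0 = f p *\<^sub>R 0 - ?d f *\<^sub>R ex f p"
    using Jac_scale[OF x y ex_section[OF f] f, of p]
    unfolding J[OF x y ex_section[OF f]] J[OF x y section_scale[OF f ex_section[OF f]]] .
  then have "0 = ?d f *\<^sub>R ex f p" by (simp only: scaleR_zero_right diff_0 neg_0_equal_iff_equal)
  then have "0 = ?d f *\<^sub>R extd A f p" unfolding scaleR_Pair by (simp only: prod_eq_iff fst_conv fst_zero)
  then have "0 = (?d f *\<^sub>R extd A f p) ?d" using arg_cong[of 0 _ "\<lambda>x. x ?d"] by (simp only: zero_fun_apply)
  then have "?d f * ?d f = 0" by (simp only: scaleR_fun_apply extd_apply[OF defect_T[OF x y]] real_scaleR_def)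
  then show "?d f = 0 f" by simp
qed

lemma sbr_cst_ex:
  assumes v: "v \<in> \<gg>" and f: "f \<in> C"
  shows "sbr (cst v) (ex f) = ex (\<lambda>p. \<rho> v p f)"
  by (intro ext) (simp only: sbr_const[OF v extd_OF1[OF f] GF_const[OF g_0]] lie_form_extd[OF \<rho>_VF[OF v] f]
      lb_0[OF v] nab_const[OF \<rho>_T[OF v]] add_0_right)

lemma \<rho>_C: "v \<in> \<gg> \<Longrightarrow> f \<in> C \<Longrightarrow> (\<lambda>p. \<rho> v p f) \<in> C"
  by (rule VF_C[OF \<rho>_VF])

lemma extd_minus: "f \<in> C \<Longrightarrow> extd A (\<lambda>q. - f q) p = - extd A f p"
  using extd_cmult[of f "-1" p] by (simp only: scaleR_minus1_left mult_minus1)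

lemma sbr_ex_cst:
  assumes v: "v \<in> \<gg>" and f: "f \<in> C"
  shows "sbr (ex f) (cst v) = ex (\<lambda>p. - \<rho> v p f)"
  by (intro ext) (simp only: sbr_skew[OF ex_section[OF f] const_sections[OF v]] sbr_cst_ex[OF v f] extd_minus[OF \<rho>_C[OF v f]]
      uminus_Pair minus_zero)

lemma Jac_ccc:
  assumes "u \<in> \<gg>" "v \<in> \<gg>" "w \<in> \<gg>"
  shows "Jac (cst u) (cst v) (cst w) p = 0"
  unfolding Jac_def sbr_cst_cst[OF assms(1,2)] sbr_cst_cst[OF assms(2,3)] sbr_cst_cst[OF assms(3,1)]
    sbr_cst_cst[OF assms(1) lb_closed[OF assms(2,3)]] sbr_cst_cst[OF assms(2) lb_closed[OF assms(3,1)]]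
    sbr_cst_cst[OF assms(3) lb_closed[OF assms(1,2)]] add_Pair lb_jacobi[OF assms]
  by (simp only: add_0_right zero_prod_def)

text \<open>The form component is the differential of
  \<open>[\<rho> u, \<rho> v] f - \<rho> [u, v] f\<close>, which is 0 because \<open>\<rho>\<close>
  is a homomorphism; the \<gg>-component consists of zeros.\<close>

lemma Jac_cce:
  assumes u: "u \<in> \<gg>" and v: "v \<in> \<gg>" and f: "f \<in> C"
  shows "Jac (cst u) (cst v) (ex f) p = 0"
proof -
  note uv = lb_closed[OF u v]
  note c = \<rho>_C[OF u \<rho>_C[OF v f]] \<rho>_C[OF v C_minus[OF \<rho>_C[OF u f]]] C_minus[OF \<rho>_C[OF uv f]]
  have z: "(\<lambda>p. \<rho> u p (\<lambda>p. \<rho> v p f) + \<rho> v p (\<lambda>p. - \<rho> u p f) + - \<rho> (vf_bracket u v) p f) = (\<lambda>p. 0)"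
  proof
    fix p
    show "\<rho> u p (\<lambda>p. \<rho> v p f) + \<rho> v p (\<lambda>p. - \<rho> u p f) + - \<rho> (vf_bracket u v) p f = 0"
      unfolding tangent_minus[OF \<rho>_T[OF v] \<rho>_C[OF u f]] \<rho>_hom[OF u v] by (simp add: vf_bracket_def)
  qed
  show ?thesis
    unfolding Jac_def sbr_cst_ex[OF v f] sbr_ex_cst[OF u f] sbr_cst_cst[OF u v]
      sbr_cst_ex[OF u \<rho>_C[OF v f]] sbr_cst_ex[OF v C_minus[OF \<rho>_C[OF u f]]] sbr_ex_cst[OF uv f] add_Pair
      extd_add[OF c(1,2), symmetric] extd_add[OF C_add[OF c(1,2)] c(3), symmetric] z extd_const
    by (simp only: add_0_right zero_prod_def)
qed

lemma sbr_cst_gen: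
  assumes v: "v \<in> \<gg>" and h: "h \<in> C" and y: "y \<in> GF"
  shows "sbr (cst v) (\<lambda>p. (extd A h p, y p)) p = (extd A (\<lambda>p. \<rho> v p h) p, vf_bracket v (y p) + nab (\<rho> v p) y)"
  unfolding sbr_const[OF v extd_OF1[OF h] y] lie_form_extd[OF \<rho>_VF[OF v] h] by (rule refl)

lemma sbr_ex_gen:
  assumes f: "f \<in> C" and h: "h \<in> C" and y: "y \<in> GF"
  shows "sbr (ex f) (\<lambda>p. (extd A h p, y p)) p =
    (extd A (fb f h) p - extd A (\<lambda>q. \<rho> (y p) q f) p, ysec (extd A f) (extd A h) p + nab (ham f p) y)"
  unfolding sbr_form_form[OF extd_OF1[OF f] extd_OF1[OF h] y] form_bracket_extd[OF f h] lie_form_extd[OF \<rho>_VF[OF GF_g[OF y]] f]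
    ham_def by (rule refl)

abbreviation "yf f g \<equiv> ysec (extd A f) (extd A g)"

lemma yf_GF: "f \<in> C \<Longrightarrow> g \<in> C \<Longrightarrow> yf f g \<in> GF"
  by (rule ysec_GF[OF extd_OF1 extd_OF1])

lemma yf_pair: "f \<in> C \<Longrightarrow> g \<in> C \<Longrightarrow> c \<in> dual \<gg> \<Longrightarrow> c (yf f g p) = 1/2 * chi (mom f p) (mom g p) c"
  unfolding ysec_extd by (rule ychi_pair[OF mom_dual mom_dual])

text \<open>The Leibniz rule for \<open>chi\<close> with constant third argument \<open>c\<close>,
  whose derivative is 0.\<close>

lemma nab_yf_pair:
  assumes D: "D \<in> T p" and f: "f \<in> C" and g: "g \<in> C" and c: "c \<in> dual \<gg>"
  shows "c (nab D (yf f g)) = 1/2 * (chi (dual_deriv D (mom f)) (mom g p) c + chi (mom f p) (dual_deriv D (mom g)) c)"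
proof -
  have "dual_deriv D (\<lambda>p. c) = 0" by (rule ext) (simp add: dual_deriv_def tangent_const[OF D])
  then have 0: "chi (mom f p) (mom g p) (dual_deriv D (\<lambda>p. c)) = 0"
    using linear_on_0[OF chi_linear3[OF mom_dual[OF f] mom_dual[OF g]] subspace_0[OF subspace_dual]] by simp
  have "c (nab D (yf f g)) = D (\<lambda>q. 1/2 * chi (mom f q) (mom g q) c)"
    unfolding nab_pair[OF D yf_GF[OF f g] c] yf_pair[OF f g c] by (rule refl)
  also have "\<dots> = 1/2 * D (\<lambda>q. chi (mom f q) (mom g q) c)"
    by (rule tangentD(2)[OF D chi_C[OF mom_smooth[OF f] mom_smooth[OF g] smooth_dual_const[OF c]]])
  finally show ?thesis
    unfolding chi_leibniz[OF D mom_smooth[OF f] mom_smooth[OF g] smooth_dual_const[OF c]] 0 by simp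
qed

lemma chi_add1: "a \<in> dual \<gg> \<Longrightarrow> a' \<in> dual \<gg> \<Longrightarrow> b \<in> dual \<gg> \<Longrightarrow> c \<in> dual \<gg> \<Longrightarrow> chi (a + a') b c = chi a b c + chi a' b c"
  and chi_add2: "a \<in> dual \<gg> \<Longrightarrow> b \<in> dual \<gg> \<Longrightarrow> b' \<in> dual \<gg> \<Longrightarrow> c \<in> dual \<gg> \<Longrightarrow> chi a (b + b') c = chi a b c + chi a b' c"
  and chi_diff2: "a \<in> dual \<gg> \<Longrightarrow> b \<in> dual \<gg> \<Longrightarrow> b' \<in> dual \<gg> \<Longrightarrow> c \<in> dual \<gg> \<Longrightarrow> chi a (b - b') c = chi a b c - chi a b' c"
  and chi_neg2: "a \<in> dual \<gg> \<Longrightarrow> b \<in> dual \<gg> \<Longrightarrow> c \<in> dual \<gg> \<Longrightarrow> chi a (- b) c = - chi a b c"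
  by (rule linear_onD(1)[OF chi_linear1], assumption+, rule linear_onD(1)[OF chi_linear2], assumption+,
      rule linear_on_diff[OF subspace_dual chi_linear2], assumption+, rule linear_on_minus[OF chi_linear2], assumption+)

lemma chi_swap: "a \<in> dual \<gg> \<Longrightarrow> b \<in> dual \<gg> \<Longrightarrow> c \<in> dual \<gg> \<Longrightarrow> chi a b c = - chi b a c"
  using chi_skew[of c a b] unfolding chi_cycle[of c] by simp

text \<open>Equivariance of \<open>mom\<close>: the identity \<open>\<rho> v (\<rho> w f) = \<rho> w
  (\<rho> v f) + \<rho> [v, w] f\<close>, read as an equation of functionals in
  \<open>w\<close>.\<close>

lemma deriv_mom_action:
  assumes v: "v \<in> \<gg>" and f: "f \<in> C"
  shows "dual_deriv (\<rho> v p) (mom f) = mom (\<lambda>q. \<rho> v q f) p + coad v (mom f p)"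
proof (rule dual_eqI)
  note vf = \<rho>_C[OF v f]
  show "dual_deriv (\<rho> v p) (mom f) \<in> dual \<gg>" by (rule dual_deriv_dual[OF \<rho>_T[OF v] mom_smooth[OF f]])
  show "mom (\<lambda>q. \<rho> v q f) p + coad v (mom f p) \<in> dual \<gg>"
    by (rule subspace_add[OF subspace_dual mom_dual[OF vf] coad_dual[OF v mom_dual[OF f]]])
  fix w assume w: "w \<in> \<gg>"
  have "vf_bracket (\<rho> v) (\<rho> w) p f = \<rho> v p (\<lambda>q. \<rho> w q f) - \<rho> w p (\<lambda>q. \<rho> v q f)" by (simp only: vf_bracket_def)
  then show "dual_deriv (\<rho> v p) (mom f) w = (mom (\<lambda>q. \<rho> v q f) p + coad v (mom f p)) w"
    by (simp only: plus_fun_apply dual_deriv_apply[OF w] mom_apply[OF w] coad_apply[OF w] mom_apply[OF lb_closed[OF v w]] \<rho>_hom[OF v w])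
qed

lemma fb_minus: "f \<in> C \<Longrightarrow> g \<in> C \<Longrightarrow> fb f (\<lambda>q. - g q) p = - fb f g p"
  using tangent_minus[OF VF_T[OF ham_VF], of f g p] by (simp only: ham_apply C_minus)

lemma mom_minus: "f \<in> C \<Longrightarrow> mom (\<lambda>q. - f q) p = - mom f p"
  unfolding mom_def by (rule ext) (simp add: extd_minus coaction_def)

text \<open>Invariance of \<pi> says \<open>w {g, h} = {w g, h} + {g, w h}\<close>, with
  \<open>w\<close> acting through \<open>\<rho>\<close>. Read as an equation of functionals in
  \<open>w\<close>, and with \<open>{w g, h}\<close> turned around by skew-symmetry, it involves
  only derivatives along Hamiltonian fields.\<close>

lemma sharp_action:
  assumes inv: "\<And>v f g p. v \<in> \<gg> \<Longrightarrow> f \<in> C \<Longrightarrow> g \<in> C \<Longrightarrow> \<rho> v p (fb f g) = fb (\<lambda>q. \<rho> v q f) g p + fb f (\<lambda>q. \<rho> v q g) p"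
    and g: "g \<in> C" and h: "h \<in> C"
  shows "mom (fb g h) p = dual_deriv (ham g p) (mom h) - dual_deriv (ham h p) (mom g)"
proof (rule dual_eqI)
  show "mom (fb g h) p \<in> dual \<gg>" by (rule mom_dual[OF fb_C[OF g h]])
  show "dual_deriv (ham g p) (mom h) - dual_deriv (ham h p) (mom g) \<in> dual \<gg>"
    by (rule subspace_diff[OF subspace_dual dual_deriv_dual[OF VF_T[OF ham_VF[OF g]] mom_smooth[OF h]]
          dual_deriv_dual[OF VF_T[OF ham_VF[OF h]] mom_smooth[OF g]]])
  fix w assume w: "w \<in> \<gg>"
  have "\<rho> w p (fb g h) = fb g (\<lambda>q. \<rho> w q h) p - fb h (\<lambda>q. \<rho> w q g) p"
    using inv[OF w g h, of p] fb_skew[OF \<rho>_C[OF w g] h, of p] by simp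
  then show "mom (fb g h) p w = (dual_deriv (ham g p) (mom h) - dual_deriv (ham h p) (mom g)) w"
    by (simp only: minus_apply dual_deriv_apply[OF w] mom_apply[OF w] ham_apply[OF g \<rho>_C[OF w h]] ham_apply[OF h \<rho>_C[OF w g]])
qed

lemma Jac_cee:
  assumes inv: "\<And>v f g p. v \<in> \<gg> \<Longrightarrow> f \<in> C \<Longrightarrow> g \<in> C \<Longrightarrow> \<rho> v p (fb f g) = fb (\<lambda>q. \<rho> v q f) g p + fb f (\<lambda>q. \<rho> v q g) p"
    and v: "v \<in> \<gg>" and f: "f \<in> C" and g: "g \<in> C"
  shows "Jac (cst v) (ex f) (ex g) p = 0"
proof -
  let ?vf = "\<lambda>q. \<rho> v q f" and ?vg = "\<lambda>q. \<rho> v q g"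
  note vf = \<rho>_C[OF v f] and vg = \<rho>_C[OF v g] and mvg = C_minus[OF \<rho>_C[OF v g]]
  have 1: "sbr (cst v) (sbr (ex f) (ex g)) p = (extd A (\<lambda>p. \<rho> v p (fb f g)) p, vf_bracket v (yf f g p) + nab (\<rho> v p) (yf f g))"
    unfolding sbr_ex_ex[OF f g] by (rule sbr_cst_gen[OF v fb_C[OF f g] yf_GF[OF f g]])
  have 2: "sbr (ex f) (sbr (ex g) (cst v)) p = (extd A (fb f (\<lambda>q. - ?vg q)) p, yf f (\<lambda>q. - ?vg q) p)"
    unfolding sbr_ex_cst[OF v g] sbr_ex_ex[OF f mvg] by (rule refl)
  have 3: "sbr (ex g) (sbr (cst v) (ex f)) p = (extd A (fb g ?vf) p, yf g ?vf p)"
    unfolding sbr_cst_ex[OF v f] sbr_ex_ex[OF g vf] by (rule refl)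
  note c = \<rho>_C[OF v fb_C[OF f g]] fb_C[OF f mvg] fb_C[OF g vf]
  have z: "(\<lambda>p. \<rho> v p (fb f g) + fb f (\<lambda>q. - ?vg q) p + fb g ?vf p) = (\<lambda>p. 0)"
    using inv[OF v f g] fb_minus[OF f vg] fb_skew[OF g vf] by (intro ext) simp
  have form: "extd A (\<lambda>p. \<rho> v p (fb f g)) p + extd A (fb f (\<lambda>q. - ?vg q)) p + extd A (fb g ?vf) p = 0"
    unfolding extd_add[OF c(1,2), symmetric] extd_add[OF C_add[OF c(1,2)] c(3), symmetric] z by (rule extd_const)
  let ?y = "vf_bracket v (yf f g p) + nab (\<rho> v p) (yf f g)"
  have y: "yf f g p \<in> \<gg>" "yf f (\<lambda>q. - ?vg q) p \<in> \<gg>" "yf g ?vf p \<in> \<gg>"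
    by (intro GF_g[OF yf_GF] f g mvg vf)+
  note vy = lb_closed[OF v y(1)]
  \<comment> \<open>Paired with \<open>c\<close>, the summands in \<open>mom ?vf\<close> and
    \<open>mom ?vg\<close> produced by the Leibniz rule cancel against the last two sections. What
    remains are the three summands with \<open>coad v\<close>, whose sum is 0 by invariance of
    \<open>chi\<close>.\<close>
  have gpart: "?y + yf f (\<lambda>q. - ?vg q) p + yf g ?vf p = 0"
  proof (rule g_eqI[OF g_add[OF g_add[OF g_add[OF vy nab_g] y(2)] y(3)] g_0])
    fix c assume c: "c \<in> dual \<gg>"
    let ?mf = "mom f p" and ?mg = "mom g p" and ?mvf = "mom ?vf p" and ?mvg = "mom ?vg p"
    note m = mom_dual[OF f, of p] mom_dual[OF g, of p] mom_dual[OF vf, of p] mom_dual[OF vg, of p]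
    note cm = coad_dual[OF v m(1)] coad_dual[OF v m(2)]
    have a: "c (vf_bracket v (yf f g p)) = 1/2 * chi ?mf ?mg (coad v c)"
      unfolding yf_pair[OF f g coad_dual[OF v c], symmetric] by (rule coad_apply[OF y(1), symmetric])
    have b: "c (nab (\<rho> v p) (yf f g)) = 1/2 * (chi ?mvf ?mg c + chi (coad v ?mf) ?mg c + (chi ?mf ?mvg c + chi ?mf (coad v ?mg) c))"
      unfolding nab_yf_pair[OF \<rho>_T[OF v] f g c] deriv_mom_action[OF v f] deriv_mom_action[OF v g]
        chi_add1[OF m(3) cm(1) m(2) c] chi_add2[OF m(1) m(4) cm(2) c] by (rule refl)
    have d: "c (yf f (\<lambda>q. - ?vg q) p) = - (1/2 * chi ?mf ?mvg c)"
      unfolding yf_pair[OF f mvg c] mom_minus[OF vg] chi_neg2[OF m(1,4) c] by simp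
    have e: "c (yf g ?vf p) = - (1/2 * chi ?mvf ?mg c)"
      unfolding yf_pair[OF g vf c] chi_swap[OF m(2,3) c] by simp
    show "c (?y + yf f (\<lambda>q. - ?vg q) p + yf g ?vf p) = c 0"
      unfolding dual_add[OF c g_add[OF g_add[OF vy nab_g] y(2)] y(3)] dual_add[OF c g_add[OF vy nab_g] y(2)]
        dual_add[OF c vy nab_g] dual_0[OF c] a b d e
      using chi_invariant[OF v m(1,2) c] by argo
  qed
  show ?thesis unfolding Jac_def 1 2 3 add_Pair form gpart by (rule zero_prod_def[symmetric])
qed

text \<open>The Lie algebra element \<open>yf g h p\<close> is frozen at \<open>p\<close> while
  \<open>q\<close> varies, so \<open>D\<close> differentiates only the functional
  \<open>mom f\<close>.\<close>

lemma extd_action_pair: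
  assumes D: "D \<in> T p" and f: "f \<in> C" and g: "g \<in> C" and h: "h \<in> C"
  shows "extd A (\<lambda>q. \<rho> (yf g h p) q f) p D = 1/2 * chi (mom g p) (mom h p) (dual_deriv D (mom f))"
proof -
  have y: "yf g h p \<in> \<gg>" by (rule GF_g[OF yf_GF[OF g h]])
  have "extd A (\<lambda>q. \<rho> (yf g h p) q f) p D = dual_deriv D (mom f) (yf g h p)"
    unfolding extd_apply[OF D] dual_deriv_apply[OF y] mom_apply[OF y] by (rule refl)
  also have "\<dots> = 1/2 * chi (mom g p) (mom h p) (dual_deriv D (mom f))"
    by (rule yf_pair[OF g h dual_deriv_dual[OF D mom_smooth[OF f]]])
  finally show ?thesis .
qed

lemma Jac_eee:
  assumes inv: "\<And>v f g p. v \<in> \<gg> \<Longrightarrow> f \<in> C \<Longrightarrow> g \<in> C \<Longrightarrow> \<rho> v p (fb f g) = fb (\<lambda>q. \<rho> v q f) g p + fb f (\<lambda>q. \<rho> v q g) p"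
    and jac: "\<And>f g h p. f \<in> C \<Longrightarrow> g \<in> C \<Longrightarrow> h \<in> C \<Longrightarrow> jac f g h p = 1/2 * chi (mom f p) (mom g p) (mom h p)"
    and f: "f \<in> C" and g: "g \<in> C" and h: "h \<in> C"
  shows "Jac (ex f) (ex g) (ex h) p = 0"
proof -
  have s: "sbr (ex f) (sbr (ex g) (ex h)) p = (extd A (fb f (fb g h)) p - extd A (\<lambda>q. \<rho> (yf g h p) q f) p,
      yf f (fb g h) p + nab (ham f p) (yf g h))" if "f \<in> C" "g \<in> C" "h \<in> C" for f g h
    unfolding sbr_ex_ex[OF that(2,3)] by (rule sbr_ex_gen[OF that(1) fb_C[OF that(2,3)] yf_GF[OF that(2,3)]])
  \<comment> \<open>This is the differential of the identity between the Jacobiator and half of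
    \<open>chi\<close>: the three subtracted terms are the three summands of the Leibniz rule for
    \<open>chi\<close>.\<close>
  have form: "extd A (fb f (fb g h)) p - extd A (\<lambda>q. \<rho> (yf g h p) q f) p
      + (extd A (fb g (fb h f)) p - extd A (\<lambda>q. \<rho> (yf h f p) q g) p)
      + (extd A (fb h (fb f g)) p - extd A (\<lambda>q. \<rho> (yf f g p) q h) p) = 0" (is "?L = 0")
  proof (rule dual_eqI)
    have c: "extd A (fb f (fb g h)) p - extd A (\<lambda>q. \<rho> (yf g h p) q f) p \<in> cotangent A p" if "f \<in> C" "g \<in> C" "h \<in> C" for f g h
      by (rule subspace_diff[OF subspace_dual extd_cotangent[OF fb_C[OF that(1) fb_C[OF that(2,3)]]]
            extd_cotangent[OF \<rho>_C[OF GF_g[OF yf_GF[OF that(2,3)]] that(1)]]])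
    show "?L \<in> cotangent A p"
      by (rule subspace_add[OF subspace_dual subspace_add[OF subspace_dual c[OF f g h] c[OF g h f]] c[OF h f g]])
    show "0 \<in> cotangent A p" by (rule subspace_0[OF subspace_dual])
    fix D assume D: "D \<in> T p"
    note cc = fb_C[OF f fb_C[OF g h]] fb_C[OF g fb_C[OF h f]] fb_C[OF h fb_C[OF f g]]
    note m = mom_smooth[OF f] mom_smooth[OF g] mom_smooth[OF h]
    have "D (jac f g h) = D (\<lambda>q. 1/2 * chi (mom f q) (mom g q) (mom h q))"
      by (rule arg_cong[of _ _ D]) (intro ext jac[OF f g h])
    also have "\<dots> = 1/2 * D (\<lambda>q. chi (mom f q) (mom g q) (mom h q))" by (rule tangentD(2)[OF D chi_C[OF m]])
    finally have 1: "D (jac f g h) = 1/2 * (chi (dual_deriv D (mom f)) (mom g p) (mom h p)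
        + chi (mom f p) (dual_deriv D (mom g)) (mom h p) + chi (mom f p) (mom g p) (dual_deriv D (mom h)))"
      unfolding chi_leibniz[OF D m] .
    have "jac f g h = (\<lambda>p. fb f (fb g h) p + fb g (fb h f) p + fb h (fb f g) p)" by (rule ext) (rule jac_def)
    then have 2: "D (jac f g h) = D (fb f (fb g h)) + D (fb g (fb h f)) + D (fb h (fb f g))"
      using tangentD(1)[OF D C_add[OF cc(1,2)] cc(3)] tangentD(1)[OF D cc(1,2)] by (simp only:)
    have e: "?L D = D (fb f (fb g h)) - 1/2 * chi (mom g p) (mom h p) (dual_deriv D (mom f))
      + (D (fb g (fb h f)) - 1/2 * chi (mom h p) (mom f p) (dual_deriv D (mom g)))
      + (D (fb h (fb f g)) - 1/2 * chi (mom f p) (mom g p) (dual_deriv D (mom h)))"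
      by (simp only: plus_fun_apply minus_apply extd_action_pair[OF D f g h] extd_action_pair[OF D g h f]
          extd_action_pair[OF D h f g] extd_apply[OF D])
    show "?L D = 0 D"
      unfolding e zero_fun_apply
      using 1 2 chi_cycle2[of "mom g p" "mom h p" "dual_deriv D (mom f)"] chi_cycle[of "mom h p" "mom f p" "dual_deriv D (mom g)"]
      by argo
  qed
  have y: "yf f (fb g h) p \<in> \<gg>" if "f \<in> C" "g \<in> C" "h \<in> C" for f g h by (intro GF_g[OF yf_GF] fb_C that)
  \<comment> \<open>Invariance, through \<open>sharp_action\<close>, rewrites
    \<open>mom (fb g h)\<close> as a difference of two derivatives. In the cyclic sum each of the
    six expressions \<open>chi (mom f p) (dual_deriv (ham g p) (mom h)) c\<close>, over the
    permutations of \<open>f\<close>, \<open>g\<close>, \<open>h\<close>, then occurs twice with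
    opposite signs.\<close>
  have gpart: "yf f (fb g h) p + nab (ham f p) (yf g h) + (yf g (fb h f) p + nab (ham g p) (yf h f))
      + (yf h (fb f g) p + nab (ham h p) (yf f g)) = 0"
  proof (rule g_eqI[OF g_add[OF g_add[OF g_add[OF y nab_g] g_add[OF y nab_g]] g_add[OF y nab_g]] g_0])
    fix c assume c: "c \<in> dual \<gg>"
    let ?P = "\<lambda>f g. dual_deriv (ham f p) (mom g)"
    have P: "?P f g \<in> dual \<gg>" if "f \<in> C" "g \<in> C" for f g
      by (rule dual_deriv_dual[OF VF_T[OF ham_VF[OF that(1)]] mom_smooth[OF that(2)]])
    have sa: "mom (fb g h) p = ?P g h - ?P h g" if "g \<in> C" "h \<in> C" for g h
      by (rule sharp_action[OF _ that]) (rule inv)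
    have one: "c (yf f (fb g h) p + nab (ham f p) (yf g h)) =
        1/2 * (chi (mom f p) (?P g h) c - chi (mom f p) (?P h g) c - chi (mom h p) (?P f g) c + chi (mom g p) (?P f h) c)"
      if f: "f \<in> C" and g: "g \<in> C" and h: "h \<in> C" for f g h
      unfolding dual_add[OF c y[OF f g h] nab_g] yf_pair[OF f fb_C[OF g h] c] nab_yf_pair[OF VF_T[OF ham_VF[OF f]] g h c]
        sa[OF g h] chi_diff2[OF mom_dual[OF f] P[OF g h] P[OF h g] c] chi_swap[OF P[OF f g] mom_dual[OF h] c]
      by (simp add: algebra_simps)
    have m: "yf f (fb g h) p + nab (ham f p) (yf g h) \<in> \<gg>" if "f \<in> C" "g \<in> C" "h \<in> C" for f g h
      by (rule g_add[OF y[OF that] nab_g])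
    show "c (yf f (fb g h) p + nab (ham f p) (yf g h) + (yf g (fb h f) p + nab (ham g p) (yf h f))
        + (yf h (fb f g) p + nab (ham h p) (yf f g))) = c 0"
      unfolding dual_add[OF c g_add[OF m[OF f g h] m[OF g h f]] m[OF h f g]] dual_add[OF c m[OF f g h] m[OF g h f]]
        one[OF f g h] one[OF g h f] one[OF h f g] dual_0[OF c]
      by argo
  qed (intro f g h)+
  show ?thesis
    unfolding Jac_def s[OF f g h] s[OF g h f] s[OF h f g] add_Pair form gpart by (rule zero_prod_def[symmetric])
qed

lemma anchor_imp_jacobi:
  assumes defect0: "\<And>\<xi> \<eta> p. \<xi> \<in> \<Gamma> \<Longrightarrow> \<eta> \<in> \<Gamma> \<Longrightarrow> defect \<xi> \<eta> p = 0"
    and x: "\<xi> \<in> \<Gamma>" and y: "\<eta> \<in> \<Gamma>" and z: "\<zeta> \<in> \<Gamma>"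
  shows "Jac \<xi> \<eta> \<zeta> p = 0"
proof -
  have inv: "\<rho> v p (fb f g) = fb (\<lambda>q. \<rho> v q f) g p + fb f (\<lambda>q. \<rho> v q g) p" if v: "v \<in> \<gg>" and f: "f \<in> C" and g: "g \<in> C" for v f g p
  proof -
    have "lie_bivec A (\<rho> v) \<pi> (extd A f) (extd A g) p = 0"
      using invariant_iff_defect[OF v] defect0[OF const_sections[OF v] form_0_sections] extd_OF1[OF f] extd_OF1[OF g] by blast
    then show ?thesis
      unfolding lie_bivec_def lie_form_extd[OF \<rho>_VF[OF v] f] lie_form_extd[OF \<rho>_VF[OF v] g] fun_bracket_def by simp
  qed
  have jac: "jac f g h p = 1/2 * chi (mom f p) (mom g p) (mom h p)" if "f \<in> C" "g \<in> C" "h \<in> C" for f g h p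
    using defect_ex_ex[OF that, of p] unfolding defect0[OF ex_section[OF that(1)] ex_section[OF that(2)]] by (simp only: zero_fun_apply)
  define gen where "gen \<xi> \<longleftrightarrow> (\<exists>f\<in>C. \<xi> = ex f) \<or> (\<exists>v\<in>\<gg>. \<xi> = cst v)" for \<xi>
  have gen_sec: "\<xi> \<in> \<Gamma>" if "gen \<xi>" for \<xi> using that ex_section const_sections unfolding gen_def by blast
  have gen_ex: "gen (ex f)" if "f \<in> C" for f using that unfolding gen_def by blast
  have gen_cst: "gen (cst v)" if "v \<in> \<gg>" for v using that unfolding gen_def by blast
  \<comment> \<open>Vanishing of the defect removes the inhomogeneous term of
    \<open>Jac_scale\<close>, so the Jacobiator is tensorial in its last slot and generators decide
    there.\<close>
  have step: "Jac \<xi> \<eta> \<zeta> p = 0" if "\<xi> \<in> \<Gamma>" "\<eta> \<in> \<Gamma>" "\<And>\<zeta> p. gen \<zeta> \<Longrightarrow> Jac \<xi> \<eta> \<zeta> p = 0" "\<zeta> \<in> \<Gamma>" for \<xi> \<eta> \<zeta> p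
  proof (rule sections_generated[of "Jac \<xi> \<eta>", OF Jac_add[OF that(1,2)] _ that(3)[OF gen_ex] that(3)[OF gen_cst] that(4)])
    show "Jac \<xi> \<eta> (\<lambda>p. f p *\<^sub>R \<zeta> p) p = f p *\<^sub>R Jac \<xi> \<eta> \<zeta> p" if "f \<in> C" "\<zeta> \<in> \<Gamma>" for f \<zeta> p
      unfolding Jac_scale[OF \<open>\<xi> \<in> \<Gamma>\<close> \<open>\<eta> \<in> \<Gamma>\<close> that(2,1)] defect0[OF \<open>\<xi> \<in> \<Gamma>\<close> \<open>\<eta> \<in> \<Gamma>\<close>]
      by (simp only: zero_fun_apply scaleR_zero_left diff_zero)
  qed
  have ggg: "Jac \<xi> \<eta> \<zeta> p = 0" if a: "gen \<xi>" and b: "gen \<eta>" and c: "gen \<zeta>" for \<xi> \<eta> \<zeta> p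
  proof -
    have cee: "Jac (cst v) (ex f) (ex g) p = 0" if "v \<in> \<gg>" "f \<in> C" "g \<in> C" for v f g p
      by (rule Jac_cee[OF _ that]) (rule inv)
    have eee: "Jac (ex f) (ex g) (ex h) p = 0" if "f \<in> C" "g \<in> C" "h \<in> C" for f g h p
      by (rule Jac_eee[OF _ _ that]) (rule inv jac, assumption+)+
    have ece: "Jac (ex f) (cst v) (ex g) p = 0" "Jac (ex f) (ex g) (cst v) p = 0" if "v \<in> \<gg>" "f \<in> C" "g \<in> C" for v f g
      using cee[OF that(1,3,2), of p] cee[OF that, of p] Jac_cycle[of "ex f" "cst v" "ex g" p] Jac_cycle[of "cst v" "ex f" "ex g" p]
      by (simp_all only:)
    have cec: "Jac (cst u) (ex f) (cst v) p = 0" "Jac (ex f) (cst u) (cst v) p = 0" if "u \<in> \<gg>" "v \<in> \<gg>" "f \<in> C" for u v f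
      using Jac_cce[OF that(2,1,3), of p] Jac_cce[OF that, of p] Jac_cycle[of "cst v" "cst u" "ex f" p] Jac_cycle[of "ex f" "cst u" "cst v" p]
      by (simp_all only:)
    from a consider (ae) f where "f \<in> C" "\<xi> = ex f" | (ac) v where "v \<in> \<gg>" "\<xi> = cst v" unfolding gen_def by blast
    note A = this
    from b consider (be) f where "f \<in> C" "\<eta> = ex f" | (bc) v where "v \<in> \<gg>" "\<eta> = cst v" unfolding gen_def by blast
    note B = this
    from c consider (ce) f where "f \<in> C" "\<zeta> = ex f" | (cc) v where "v \<in> \<gg>" "\<zeta> = cst v" unfolding gen_def by blast
    note C = this
    show ?thesis
      by (rule A; rule B; rule C) (simp_all only: eee cee ece cec Jac_cce Jac_ccc)
  qed
  have gg: "Jac \<xi> \<eta> \<zeta> p = 0" if "gen \<xi>" "gen \<eta>" "\<zeta> \<in> \<Gamma>" for \<xi> \<eta> \<zeta> p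
    by (rule step[OF gen_sec[OF that(1)] gen_sec[OF that(2)] ggg[OF that(1,2)] that(3)])
  have g: "Jac \<xi> \<eta> \<zeta> p = 0" if "gen \<xi>" "\<eta> \<in> \<Gamma>" "\<zeta> \<in> \<Gamma>" for \<xi> \<eta> \<zeta> p
  proof -
    \<comment> \<open>\<open>step\<close> works on the last slot only, so the arguments are rotated
      cyclically to free another one.\<close>
    have "Jac \<zeta> \<xi> \<eta> p = 0"
    proof (rule step[OF that(3) gen_sec[OF that(1)] _ that(2)])
      fix \<eta> p assume "gen \<eta>"
      then show "Jac \<zeta> \<xi> \<eta> p = 0" using gg[OF that(1) _ that(3), of \<eta> p] Jac_cycle[of \<zeta> \<xi> \<eta> p] by (simp only:)
    qed
    then show ?thesis using Jac_cycle[of \<zeta> \<xi> \<eta> p] by (simp only:)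
  qed
  show ?thesis
  proof (rule step[OF x y _ z])
    fix \<zeta> p assume "gen \<zeta>"
    then show "Jac \<xi> \<eta> \<zeta> p = 0" using g[OF _ x y, of \<zeta> p] Jac_cycle[of \<zeta> \<xi> \<eta> p] by (simp only:)
  qed
qed

theorem anchor_iff_jacobi:
  "anchor_preserves_brackets A \<gg> B \<rho> \<pi> \<longleftrightarrow> jacobi_on \<Gamma> (section_bracket A \<gg> B \<rho> \<pi>)"
  unfolding anchor_preserves_iff jacobi_iff
proof
  assume "\<forall>\<xi>\<in>\<Gamma>. \<forall>\<eta>\<in>\<Gamma>. \<forall>p. defect \<xi> \<eta> p = 0"
  then have d: "defect \<xi> \<eta> p = 0" if "\<xi> \<in> \<Gamma>" "\<eta> \<in> \<Gamma>" for \<xi> \<eta> p using that by blast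
  show "\<forall>\<xi>\<in>\<Gamma>. \<forall>\<eta>\<in>\<Gamma>. \<forall>\<zeta>\<in>\<Gamma>. \<forall>p. Jac \<xi> \<eta> \<zeta> p = 0"
    by (intro ballI allI anchor_imp_jacobi d)
next
  assume "\<forall>\<xi>\<in>\<Gamma>. \<forall>\<eta>\<in>\<Gamma>. \<forall>\<zeta>\<in>\<Gamma>. \<forall>p. Jac \<xi> \<eta> \<zeta> p = 0"
  then have J: "Jac \<xi> \<eta> \<zeta> p = 0" if "\<xi> \<in> \<Gamma>" "\<eta> \<in> \<Gamma>" "\<zeta> \<in> \<Gamma>" for \<xi> \<eta> \<zeta> p using that by blast
  show "\<forall>\<xi>\<in>\<Gamma>. \<forall>\<eta>\<in>\<Gamma>. \<forall>p. defect \<xi> \<eta> p = 0"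
    by (intro ballI allI jacobi_imp_anchor J)
qed

section \<open>The vector bundle structure and the Lie algebroid\<close>

lemma subspace_fibre: "subspace (fibre A \<gg> p)"
  unfolding fibre_def by (rule subspace_Times[OF subspace_dual subspace_g])

text \<open>A local frame in the sense of \<open>local_frame\<close> is numbered by naturals, hence
  the enumeration \<open>h\<close> of \<open>bs\<close> and the index shift by
  \<open>card bs\<close> for the constants.\<close>

definition bundle_frame :: "(nat \<Rightarrow> 'e) \<Rightarrow> ('e \<Rightarrow> 'm \<Rightarrow> real) \<Rightarrow> nat \<Rightarrow> 'm \<Rightarrow> 'm covec \<times> 'g vfield"
  where "bundle_frame h x j q = (if j < card bs then (extd A (x (h j)) q, 0) else (0, us (j - card bs)))"

definition bundle_coframe :: "(nat \<Rightarrow> 'e) \<Rightarrow> ('e \<Rightarrow> 'm vfield) \<Rightarrow> nat \<Rightarrow> 'm \<Rightarrow> 'm covec \<times> 'g vfield \<Rightarrow> real"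
  where "bundle_coframe h E j q s = (if j < card bs then fst s (E (h j) q) else cs (j - card bs) (snd s))"

lemma bundle_frame_expand:
  assumes h: "bij_betw h {..<card bs} bs" and fr: "frame_on W x E" and q: "q \<in> W" and s: "s \<in> fibre A \<gg> q"
  shows "s = (\<Sum>j<card bs + n. bundle_coframe h E j q s *\<^sub>R bundle_frame h x j q)"
proof -
  obtain a v where av: "s = (a, v)" "a \<in> cotangent A q" "v \<in> \<gg>" using s unfolding fibre_def by blast
  have "(\<Sum>j<card bs + n. bundle_coframe h E j q s *\<^sub>R bundle_frame h x j q)
      = (\<Sum>j<card bs + n. if j < card bs then a (E (h j) q) *\<^sub>R (extd A (x (h j)) q, 0)
          else cs (j - card bs) v *\<^sub>R (0, us (j - card bs)))"
  proof (rule sum.cong[OF refl])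
    fix j
    show "bundle_coframe h E j q s *\<^sub>R bundle_frame h x j q = (if j < card bs then a (E (h j) q) *\<^sub>R (extd A (x (h j)) q, 0)
        else cs (j - card bs) v *\<^sub>R (0, us (j - card bs)))"
      by (cases "j < card bs") (simp_all only: bundle_coframe_def bundle_frame_def av(1) fst_conv snd_conv if_True if_False)
  qed
  also have "\<dots> = (\<Sum>j<card bs. a (E (h j) q) *\<^sub>R (extd A (x (h j)) q, 0)) + (\<Sum>i<n. cs i v *\<^sub>R (0, us i))"
    by (rule sum_split_less)
  also have "(\<Sum>j<card bs. a (E (h j) q) *\<^sub>R (extd A (x (h j)) q, 0 :: 'g vfield)) = (\<Sum>u\<in>bs. a (E u q) *\<^sub>R (extd A (x u) q, 0))"
    by (rule sum.reindex_bij_betw[OF h])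
  also have "\<dots> = (a, 0)"
    by (intro prod_eqI) (simp_all only: fst_sum snd_sum scaleR_Pair fst_conv snd_conv scaleR_zero_right sum.neutral_const
        dual_frame_expand_dual[OF frame_on_dual_frame[OF fr q] av(2)])
  also have "(\<Sum>i<n. cs i v *\<^sub>R (0 :: 'm covec, us i)) = (0, v)"
    by (intro prod_eqI) (simp_all only: fst_sum snd_sum scaleR_Pair fst_conv snd_conv scaleR_zero_right sum.neutral_const
        g_expand[OF av(3)])
  finally show ?thesis by (simp only: av(1) add_Pair add_0_left add_0_right)
qed

lemma bundle_frame_section:
  assumes "frame_on W x E" "j < card bs + n"
  shows "bundle_frame h x j \<in> \<Gamma>"
proof (cases "j < card bs")
  case True
  have "bundle_frame h x j = ex (x (h j))" by (rule ext) (simp only: bundle_frame_def True if_True)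
  then show ?thesis using ex_section[OF frame_onD(2)[OF assms(1)]] by (simp only:)
next
  case False
  then have "j - card bs < n" using assms(2) by linarith
  moreover have "bundle_frame h x j = cst (us (j - card bs))" by (rule ext) (simp only: bundle_frame_def False if_False)
  ultimately show ?thesis using const_sections[OF us_g] by (simp only:)
qed

lemma section_in_fibre: "\<xi> \<in> \<Gamma> \<Longrightarrow> \<xi> p \<in> fibre A \<gg> p"
  by (erule section_cases) (simp only: fibre_def mem_Sigma_iff OF1_cotangent GF_g simp_thms)

text \<open>Independence comes from the coframe: its functionals are linear on the fibre and
  biorthogonal to the frame, which replaces a dimension count.\<close>

lemma bundle_local_frame:
  assumes h: "bij_betw h {..<card bs} bs" and fr: "frame_on W x E"
  shows "local_frame (fibre A \<gg>) \<Gamma> (card bs + n) W (bundle_frame h x)"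
  unfolding local_frame_def
proof (intro conjI ballI allI impI)
  let ?k = "card bs + n" and ?e = "bundle_frame h x" and ?L = "bundle_coframe h E"
  show "open W" by (rule frame_onD(1)[OF fr])
  show sec: "?e j \<in> \<Gamma>" if "j < ?k" for j by (rule bundle_frame_section[OF fr that])
  fix q assume q: "q \<in> W"
  have hb: "h i \<in> bs" if "i < card bs" for i using bij_betwE[OF h] that by blast
  have hinj: "h i = h j \<longleftrightarrow> i = j" if "i < card bs" "j < card bs" for i j
    using bij_betw_imp_inj_on[OF h] that by (auto dest: inj_onD)
  have lin: "linear_on (fibre A \<gg> q) (?L j q)" if "j < ?k" for j
    unfolding linear_on_def
  proof (intro conjI ballI allI)
    fix s t c assume s: "s \<in> fibre A \<gg> q"
    have ds: "snd s \<in> \<gg>" using s unfolding fibre_def by auto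
    have cd: "cs (j - card bs) \<in> dual \<gg>" if "\<not> j < card bs" using that \<open>j < ?k\<close> cs_dual by simp
    show "?L j q (c *\<^sub>R s) = c *\<^sub>R ?L j q s"
      using dual_scale[OF cd ds] by (simp add: bundle_coframe_def)
    assume t: "t \<in> fibre A \<gg> q"
    have dt: "snd t \<in> \<gg>" using t unfolding fibre_def by auto
    show "?L j q (s + t) = ?L j q s + ?L j q t"
      using dual_add[OF cd ds dt] by (simp only: bundle_coframe_def fst_add snd_add plus_fun_apply split: if_splits) simp
  qed
  have LE: "?L i q (?e j q) = (if i = j then 1 else 0)" if i: "i < ?k" and j: "j < ?k" for i j
  proof -
    consider "i < card bs" "j < card bs" | "i < card bs" "\<not> j < card bs" | "\<not> i < card bs" "j < card bs"
      | "\<not> i < card bs" "\<not> j < card bs" by blast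
    then show ?thesis
    proof cases
      case 1
      then show ?thesis
        using frame_onD(5)[OF fr q hb[OF 1(1)] hb[OF 1(2)]] hinj[OF 1]
        by (simp add: bundle_coframe_def bundle_frame_def extd_apply[OF VF_T[OF frame_onD(3)[OF fr]]])
    next
      case 2
      then show ?thesis by (auto simp: bundle_coframe_def bundle_frame_def)
    next
      case 3
      then have "cs (i - card bs) 0 = 0" using i by (intro dual_0 cs_dual) linarith
      then show ?thesis using 3 by (auto simp: bundle_coframe_def bundle_frame_def simp del: zero_fun_apply)
    next
      case 4
      then have "i - card bs < n" "j - card bs < n" "i - card bs = j - card bs \<longleftrightarrow> i = j" using i j by linarith+
      then show ?thesis using 4 biorth by (simp add: bundle_coframe_def bundle_frame_def)
    qed
  qed
  note bf = biorthogonal_family[OF subspace_fibre, of "{..<?k}" "\<lambda>j. ?e j q" q "\<lambda>j. ?L j q"]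
  have e: "?e j q \<in> fibre A \<gg> q" if "j \<in> {..<?k}" for j using section_in_fibre[OF sec] that by simp
  show "inj_on (\<lambda>j. ?e j q) {..<?k}" by (rule bf(1)) (use e lin LE in simp_all)
  show "independent ((\<lambda>j. ?e j q) ` {..<?k})" by (rule bf(2)) (use e lin LE in simp_all)
  show "span ((\<lambda>j. ?e j q) ` {..<?k}) = fibre A \<gg> q"
  proof (rule subset_antisym)
    show "span ((\<lambda>j. ?e j q) ` {..<?k}) \<subseteq> fibre A \<gg> q"
      by (rule span_minimal[OF image_subsetI subspace_fibre]) (rule e)
    show "fibre A \<gg> q \<subseteq> span ((\<lambda>j. ?e j q) ` {..<?k})"
    proof
      fix s assume "s \<in> fibre A \<gg> q"
      then have "s = (\<Sum>j<?k. ?L j q s *\<^sub>R ?e j q)" by (rule bundle_frame_expand[OF h fr q])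
      moreover have "(\<Sum>j<?k. ?L j q s *\<^sub>R ?e j q) \<in> span ((\<lambda>j. ?e j q) ` {..<?k})"
        by (intro span_sum span_scale span_base imageI)
      ultimately show "s \<in> span ((\<lambda>j. ?e j q) ` {..<?k})" by (simp only:)
    qed
  qed
qed

lemma bundle_coframe_C:
  assumes fr: "frame_on W x E" and "\<xi> \<in> \<Gamma>" "j < card bs + n"
  shows "(\<lambda>q. bundle_coframe h E j q (\<xi> q)) \<in> C"
proof -
  obtain \<alpha> s where x: "\<xi> = (\<lambda>p. (\<alpha> p, s p))" "\<alpha> \<in> OF1" "s \<in> GF" using section_cases[OF assms(2)] .
  show ?thesis
  proof (cases "j < card bs")
    case True
    show ?thesis
      unfolding bundle_coframe_def x(1) fst_conv if_P[OF True] by (rule OF1_C[OF x(2) frame_onD(3)[OF fr]])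
  next
    case False
    then have "j - card bs < n" using assms(3) by linarith
    then show ?thesis
      unfolding bundle_coframe_def x(1) snd_conv if_not_P[OF False] by (rule GF_C[OF x(3) cs_dual])
  qed
qed

text \<open>Both components of a section are detected by fibrewise linear functionals that are
  smooth on members of \<open>\<Gamma>\<close>: evaluation on a vector field, and a coordinate of
  \<gg>. Applied to the frame expansion, such a functional gives a finite sum of products of smooth
  functions.\<close>

lemma section_localI:
  assumes fib: "\<And>p. s p \<in> fibre A \<gg> p"
    and loc: "\<And>p. \<exists>W x E c. p \<in> W \<and> frame_on W x E \<and> (\<forall>j<k. smooth_fun_on A W (c j)) \<and>
      (\<forall>q\<in>W. s q = (\<Sum>j<k. c j q *\<^sub>R bundle_frame h x j q))" and k: "k = card bs + n"
  shows "s \<in> \<Gamma>"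
proof -
  have local: "F \<in> C"
    if F: "\<And>q. F q = L q (s q)" and lin: "\<And>q. linear_on (fibre A \<gg> q) (L q)"
      and sm: "\<And>\<xi>. \<xi> \<in> \<Gamma> \<Longrightarrow> (\<lambda>q. L q (\<xi> q)) \<in> C" for F and L :: "'m \<Rightarrow> 'm covec \<times> 'g vfield \<Rightarrow> real"
  proof (rule C_localI)
    fix p
    obtain W x E c where p: "p \<in> W" and fr: "frame_on W x E" and c: "\<forall>j<k. smooth_fun_on A W (c j)"
      and s: "\<forall>q\<in>W. s q = (\<Sum>j<k. c j q *\<^sub>R bundle_frame h x j q)" using loc[of p] by blast
    note W = frame_onD(1)[OF fr]
    have sec: "bundle_frame h x j \<in> \<Gamma>" if "j < k" for j using bundle_frame_section[OF fr] that unfolding k .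
    have "smooth_fun_on A W (\<lambda>q. \<Sum>j<k. c j q * L q (bundle_frame h x j q))"
      by (rule smooth_fun_on_sum[OF W], rule smooth_fun_on_mult[OF W])
        (use c C_imp_smooth_fun_on[OF sm[OF sec]] in simp_all)
    moreover have "(\<Sum>j<k. c j q * L q (bundle_frame h x j q)) = F q" if q: "q \<in> W" for q
    proof -
      have "F q = L q (\<Sum>j<k. c j q *\<^sub>R bundle_frame h x j q)" unfolding F using s q by (simp only:)
      also have "\<dots> = (\<Sum>j<k. L q (c j q *\<^sub>R bundle_frame h x j q))"
        by (rule linear_on_sum[OF subspace_fibre lin]) (intro subspace_scale[OF subspace_fibre] section_in_fibre[OF sec], simp)
      also have "\<dots> = (\<Sum>j<k. c j q * L q (bundle_frame h x j q))"
        by (rule sum.cong) (simp_all only: linear_onD(2)[OF lin section_in_fibre[OF sec]] lessThan_iff real_scaleR_def)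
      finally show ?thesis by (rule sym)
    qed
    ultimately have "smooth_fun_on A W F" by (rule smooth_fun_on_cong[OF W])
    then show "\<exists>V. open V \<and> p \<in> V \<and> smooth_fun_on A V F" using W p by blast
  qed
  have s_eq: "s = (\<lambda>p. (fst (s p), snd (s p)))" by (simp only: prod.collapse)
  have fc: "fst (s p) \<in> cotangent A p" "snd (s p) \<in> \<gg>" for p using fib[of p] unfolding fibre_def by auto
  have "(\<lambda>p. fst (s p)) \<in> OF1"
  proof (rule OF1_I[OF fc(1)])
    fix X assume X: "X \<in> VF"
    show "(\<lambda>p. fst (s p) (X p)) \<in> C"
    proof (rule local[of _ "\<lambda>q t. fst t (X q)"])
      show "linear_on (fibre A \<gg> q) (\<lambda>t. fst t (X q))" for q
        unfolding linear_on_def by simp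
      show "(\<lambda>q. fst (\<xi> q) (X q)) \<in> C" if "\<xi> \<in> \<Gamma>" for \<xi>
        using that by (rule section_cases) (simp only: fst_conv OF1_C[OF _ X])
    qed (rule refl)
  qed
  moreover have "(\<lambda>p. snd (s p)) \<in> GF"
  proof (rule GF_I[OF fc(2)])
    fix i assume i: "i < n"
    show "(\<lambda>p. cs i (snd (s p))) \<in> C"
    proof (rule local[of _ "\<lambda>q t. cs i (snd t)"])
      have "snd t \<in> \<gg>" if "t \<in> fibre A \<gg> q" for t q using that unfolding fibre_def by auto
      then show "linear_on (fibre A \<gg> q) (\<lambda>t. cs i (snd t))" for q
        unfolding linear_on_def snd_add snd_scaleR real_scaleR_def
        by (intro conjI ballI allI dual_add[OF cs_dual[OF i]] dual_scale[OF cs_dual[OF i]])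
      show "(\<lambda>q. cs i (snd (\<xi> q))) \<in> C" if "\<xi> \<in> \<Gamma>" for \<xi>
        using that by (rule section_cases) (simp only: snd_conv GF_C[OF _ cs_dual[OF i]])
    qed (rule refl)
  qed
  ultimately show ?thesis by (subst s_eq) (simp only: section_iff simp_thms)
qed

lemma vector_bundle_sections: "vector_bundle A (fibre A \<gg>) \<Gamma>"
proof -
  obtain h where h: "bij_betw h {..<card bs} bs"
    using ex_bij_betw_nat_finite[OF onbD1[OF bs]] unfolding atLeast0LessThan by blast
  define F where "F = {(W, bundle_frame h x) | W x. \<exists>E. frame_on W x E}"
  let ?k = "card bs + n"
  let ?loc = "\<lambda>s. (\<forall>(U, e)\<in>F. \<exists>c. (\<forall>j<?k. smooth_fun_on A U (c j)) \<and> (\<forall>q\<in>U. s q = (\<Sum>j<?k. c j q *\<^sub>R e j q)))"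
  have "\<forall>(U, e)\<in>F. local_frame (fibre A \<gg>) \<Gamma> ?k U e"
    unfolding F_def using bundle_local_frame[OF h] by blast
  moreover have "\<Union>(fst ` F) = UNIV"
  proof -
    have "p \<in> \<Union>(fst ` F)" for p
    proof -
      obtain W x E where "p \<in> W" "frame_on W x E" using frame_on_exists by blast
      then have "(W, bundle_frame h x) \<in> F" unfolding F_def by blast
      then show ?thesis using \<open>p \<in> W\<close> by force
    qed
    then show ?thesis by blast
  qed
  moreover have "\<Gamma> = {s. (\<forall>p. s p \<in> fibre A \<gg> p) \<and> ?loc s}"
  proof (intro subset_antisym subsetI CollectI conjI allI)
    fix \<xi> p assume x: "\<xi> \<in> \<Gamma>"
    show "\<xi> p \<in> fibre A \<gg> p" by (rule section_in_fibre[OF x])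
    show "?loc \<xi>"
    proof clarify
      fix U e assume "(U, e) \<in> F"
      then obtain x E where e: "e = bundle_frame h x" and fr: "frame_on U x E" unfolding F_def by blast
      show "\<exists>c. (\<forall>j<?k. smooth_fun_on A U (c j)) \<and> (\<forall>q\<in>U. \<xi> q = (\<Sum>j<?k. c j q *\<^sub>R e j q))"
        unfolding e
        by (intro exI[of _ "\<lambda>j q. bundle_coframe h E j q (\<xi> q)"] conjI allI impI ballI
            C_imp_smooth_fun_on[OF bundle_coframe_C[OF fr x]] bundle_frame_expand[OF h fr] section_in_fibre[OF x])
    qed
  next
    fix s assume "s \<in> {s. (\<forall>p. s p \<in> fibre A \<gg> p) \<and> ?loc s}"
    then have fib: "\<And>p. s p \<in> fibre A \<gg> p" and l: "?loc s" by simp_all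
    show "s \<in> \<Gamma>"
    proof (rule section_localI[OF fib _ refl])
      fix p
      obtain W x E where p: "p \<in> W" and fr: "frame_on W x E" using frame_on_exists by blast
      have "(W, bundle_frame h x) \<in> F" using fr unfolding F_def by blast
      from bspec[OF l this]
      have "\<exists>c. (\<forall>j<?k. smooth_fun_on A W (c j)) \<and> (\<forall>q\<in>W. s q = (\<Sum>j<?k. c j q *\<^sub>R bundle_frame h x j q))"
        by (simp only: prod.case)
      then show "\<exists>W x E c. p \<in> W \<and> frame_on W x E \<and> (\<forall>j<?k. smooth_fun_on A W (c j)) \<and>
          (\<forall>q\<in>W. s q = (\<Sum>j<?k. c j q *\<^sub>R bundle_frame h x j q))" using p fr by blast
    qed
  qed
  ultimately show ?thesis
    unfolding vector_bundle_def by (intro conjI allI subspace_fibre exI[of _ ?k] exI[of _ F])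
qed

text \<open>Bundle structure, anchor, Leibniz rule, skew-symmetry and linearity hold by
  construction; the Jacobi identity is the one clause of a Lie algebroid left open.\<close>

theorem jacobi_iff_lie_algebroid:
  "jacobi_on \<Gamma> (section_bracket A \<gg> B \<rho> \<pi>) \<longleftrightarrow>
    lie_algebroid A (fibre A \<gg>) \<Gamma> r (section_bracket A \<gg> B \<rho> \<pi>)"
proof
  assume J: "jacobi_on \<Gamma> (section_bracket A \<gg> B \<rho> \<pi>)"
  note d = is_section_bracket_sbr[unfolded is_section_bracket_def]
  have "lie_bracket_on \<Gamma> sbr"
    unfolding lie_bracket_on_def
    using conjunct1[OF d] conjunct1[OF conjunct2[OF d]] J[unfolded section_bracket_eq] by (intro conjI)
  moreover have "bundle_map_to_tangent A (fibre A \<gg>) \<Gamma> r"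
    unfolding bundle_map_to_tangent_def
  proof (intro conjI allI ballI R_VF)
    fix p
    show "linear_on (fibre A \<gg> p) (r p)"
      unfolding linear_on_def fibre_def
    proof (intro conjI ballI allI)
      fix x y c assume x: "x \<in> cotangent A p \<times> \<gg>"
      then obtain a u where a: "x = (a, u)" "a \<in> cotangent A p" "u \<in> \<gg>" by blast
      show "r p (c *\<^sub>R x) = c *\<^sub>R r p x" unfolding a(1) scaleR_Pair by (rule r_scale[OF a(2,3)])
      assume "y \<in> cotangent A p \<times> \<gg>"
      then obtain b v where b: "y = (b, v)" "b \<in> cotangent A p" "v \<in> \<gg>" by blast
      show "r p (x + y) = r p x + r p y" unfolding a(1) b(1) add_Pair by (rule r_add[OF a(2) b(2) a(3) b(3)])
    qed
    show "r p ` fibre A \<gg> p \<subseteq> T p" unfolding fibre_def using r_T by blast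
  qed
  moreover have "leibniz_on A \<Gamma> r sbr" using d by (elim conjE)
  ultimately show "lie_algebroid A (fibre A \<gg>) \<Gamma> r (section_bracket A \<gg> B \<rho> \<pi>)"
    unfolding lie_algebroid_def section_bracket_eq by (intro conjI vector_bundle_sections)
next
  assume "lie_algebroid A (fibre A \<gg>) \<Gamma> r (section_bracket A \<gg> B \<rho> \<pi>)"
  then show "jacobi_on \<Gamma> (section_bracket A \<gg> B \<rho> \<pi>)"
    unfolding lie_algebroid_def lie_bracket_on_def by (elim conjE)
qed

end

text \<open>Charts of \<open>G \<times> G\<close> take values in the product of the model space with
  itself, and \<open>smooth_on_compose\<close> needs an orthonormal basis of the intermediate
  space.\<close>

lemma onb_prod:
  assumes b: "onb (b :: 'e::real_inner set)" and c: "onb (c :: 'f::real_inner set)"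
  shows "onb ((\<lambda>x. (x, 0 :: 'f)) ` b \<union> (\<lambda>y. (0 :: 'e, y)) ` c)"
  unfolding onb_def
proof (intro conjI ballI allI)
  note fin = onbD1[OF b] onbD1[OF c]
  show "finite ((\<lambda>x. (x, 0 :: 'f)) ` b \<union> (\<lambda>y. (0 :: 'e, y)) ` c)" using fin by simp
  have nz: "x \<noteq> 0" if "x \<in> b" for x using onbD3[OF b that that] by auto
  fix u v assume "u \<in> (\<lambda>x. (x, 0 :: 'f)) ` b \<union> (\<lambda>y. (0 :: 'e, y)) ` c" "v \<in> (\<lambda>x. (x, 0 :: 'f)) ` b \<union> (\<lambda>y. (0 :: 'e, y)) ` c"
  then show "u \<bullet> v = (if u = v then 1 else 0)"
    using onbD3[OF b] onbD3[OF c] nz by (elim UnE imageE) (auto simp: inner_prod_def)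
next
  fix x :: "'e \<times> 'f"
  note fin = onbD1[OF b] onbD1[OF c]
  have nz: "x \<noteq> 0" if "x \<in> b" for x using onbD3[OF b that that] by auto
  have disj: "(\<lambda>x. (x, 0 :: 'f)) ` b \<inter> (\<lambda>y. (0 :: 'e, y)) ` c = {}" using nz by auto
  have "(\<Sum>u\<in>(\<lambda>x. (x, 0 :: 'f)) ` b \<union> (\<lambda>y. (0 :: 'e, y)) ` c. (x \<bullet> u) *\<^sub>R u)
      = (\<Sum>u\<in>(\<lambda>x. (x, 0 :: 'f)) ` b. (x \<bullet> u) *\<^sub>R u) + (\<Sum>u\<in>(\<lambda>y. (0 :: 'e, y)) ` c. (x \<bullet> u) *\<^sub>R u)"
    by (rule sum.union_disjoint) (use fin disj in simp_all)
  also have "(\<Sum>u\<in>(\<lambda>x. (x, 0 :: 'f)) ` b. (x \<bullet> u) *\<^sub>R u) = (\<Sum>u\<in>b. (fst x \<bullet> u) *\<^sub>R (u, 0))"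
    by (subst sum.reindex) (simp_all add: inj_on_def inner_prod_def)
  also have "(\<Sum>u\<in>(\<lambda>y. (0 :: 'e, y)) ` c. (x \<bullet> u) *\<^sub>R u) = (\<Sum>u\<in>c. (snd x \<bullet> u) *\<^sub>R (0, u))"
    by (subst sum.reindex) (simp_all add: inj_on_def inner_prod_def)
  also have "(\<Sum>u\<in>b. (fst x \<bullet> u) *\<^sub>R (u, 0 :: 'f)) = (fst x, 0)"
    by (intro prod_eqI) (simp_all add: fst_sum snd_sum onbD2[OF b, symmetric])
  also have "(\<Sum>u\<in>c. (snd x \<bullet> u) *\<^sub>R (0 :: 'e, u)) = (0, snd x)"
    by (intro prod_eqI) (simp_all add: fst_sum snd_sum onbD2[OF c, symmetric])
  finally show "x = (\<Sum>u\<in>(\<lambda>x. (x, 0 :: 'f)) ` b \<union> (\<lambda>y. (0 :: 'e, y)) ` c. (x \<bullet> u) *\<^sub>R u)" by simp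
qed

lemma has_derivative_partial:
  assumes F: "smooth_on S F" and z: "(x, z) \<in> S"
  shows "((\<lambda>z. F (x, z)) has_derivative (\<lambda>b. frechet_derivative F (at (x, z)) (0, b))) (at z)"
    and "((\<lambda>x. F (x, z)) has_derivative (\<lambda>b. frechet_derivative F (at (x, z)) (b, 0))) (at x)"
proof -
  note d = smooth_on_has_derivative[OF F z]
  have "((\<lambda>z. (x, z)) has_derivative (\<lambda>b. (0, b))) (at z)" by (auto intro!: derivative_eq_intros)
  from diff_chain_at[OF this d] show "((\<lambda>z. F (x, z)) has_derivative (\<lambda>b. frechet_derivative F (at (x, z)) (0, b))) (at z)"
    by (simp add: o_def)
  have "((\<lambda>x. (x, z)) has_derivative (\<lambda>b. (b, 0))) (at x)" by (auto intro!: derivative_eq_intros)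
  from diff_chain_at[OF this d] show "((\<lambda>x. F (x, z)) has_derivative (\<lambda>b. frechet_derivative F (at (x, z)) (b, 0))) (at x)"
    by (simp add: o_def)
qed

context manifold
begin

lemma smooth_map_chart:
  assumes F: "smooth_map A A F" and U: "(U, \<phi>) \<in> A" and W: "(W, \<kappa>) \<in> A"
  shows "smooth_on (\<phi> ` (U \<inter> F -` W)) (\<lambda>x. \<kappa> (F (inv_into U \<phi> x)))"
proof -
  have "\<forall>(U, \<phi>)\<in>A. \<forall>(V, \<psi>)\<in>A. smooth_on (\<phi> ` (U \<inter> F -` V)) (\<psi> \<circ> F \<circ> inv_into U \<phi>)"
    using F unfolding smooth_map_def by (rule conjunct2)
  from bspec[OF this U] have "\<forall>(V, \<psi>)\<in>A. smooth_on (\<phi> ` (U \<inter> F -` V)) (\<psi> \<circ> F \<circ> inv_into U \<phi>)" by (simp only: prod.case)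
  from bspec[OF this W] show ?thesis by (simp only: prod.case o_def)
qed

lemma smooth_map_C:
  assumes F: "smooth_map A A F" and f: "f \<in> C"
  shows "(\<lambda>q. f (F q)) \<in> C"
  unfolding smooth_funs_def
proof (rule CollectI, rule smooth_fun_onI[OF open_UNIV])
  fix p
  obtain U \<phi> where U: "(U, \<phi>) \<in> A" "p \<in> U" by (rule chart_exists)
  obtain W \<kappa> where W: "(W, \<kappa>) \<in> A" "F p \<in> W" by (rule chart_exists)
  have cont: "continuous_on UNIV F" using F unfolding smooth_map_def by (rule conjunct1)
  have o: "open (F -` W)" using cont chart_open(1)[OF W(1)] by (simp add: open_vimage)
  let ?V = "U \<inter> F -` W"
  have V: "open ?V" using o chart_open(1)[OF U(1)] by (rule open_Int[rotated])
  note oV = chart_image_open[OF U(1) o]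
  have "smooth_on (\<phi> ` ?V) (\<lambda>x. (f \<circ> inv_into W \<kappa>) (\<kappa> (F (inv_into U \<phi> x))))"
    by (rule smooth_on_compose[OF bs oV chart_open(2)[OF W(1)] _ smooth_map_chart[OF F U(1) W(1)] smooth_funsD[OF f W(1) subset_refl]])
      (auto simp: chart_inv(1)[OF U(1)])
  then have "smooth_on (\<phi> ` ?V) ((\<lambda>q. f (F q)) \<circ> inv_into U \<phi>)"
    by (rule smooth_on_cong[OF _ oV]) (auto simp: chart_inv(1)[OF U(1)] chart_inv(1)[OF W(1)])
  then show "\<exists>U \<phi> V. (U, \<phi>) \<in> A \<and> p \<in> V \<and> open V \<and> V \<subseteq> U \<and> smooth_on (\<phi> ` V) ((\<lambda>q. f (F q)) \<circ> inv_into U \<phi>)"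
    using U W(2) V by (intro exI[of _ U] exI[of _ \<phi>] exI[of _ ?V] conjI) simp_all
qed

text \<open>Expanded on a smooth \<open>f\<close>, the cyclic sum contains each of the six threefold
  derivatives twice with opposite signs.\<close>

lemma vf_jacobi:
  assumes X: "X \<in> VF" and Y: "Y \<in> VF" and Z: "Z \<in> VF"
  shows "vf_bracket X (vf_bracket Y Z) + vf_bracket Y (vf_bracket Z X) + vf_bracket Z (vf_bracket X Y) = 0"
proof (intro ext)
  fix p f
  note br = vf_bracket_VF[OF X Y] vf_bracket_VF[OF Y Z] vf_bracket_VF[OF Z X]
  have "vf_bracket X (vf_bracket Y Z) p f + vf_bracket Y (vf_bracket Z X) p f + vf_bracket Z (vf_bracket X Y) p f = 0"
  proof (cases "f \<in> C")
    case f: True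
    have *: "vf_bracket X (vf_bracket Y Z) p f = X p (\<lambda>q. Y q (\<lambda>q. Z q f)) - X p (\<lambda>q. Z q (\<lambda>q. Y q f))
        - (Y p (\<lambda>q. Z q (\<lambda>q. X q f)) - Z p (\<lambda>q. Y q (\<lambda>q. X q f)))"
      if "X \<in> VF" "Y \<in> VF" "Z \<in> VF" for X Y Z
      using tangent_diff[OF VF_T[OF that(1)] VF_C[OF that(2) VF_C[OF that(3) f]] VF_C[OF that(3) VF_C[OF that(2) f]], of p]
      by (simp add: vf_bracket_def)
    show ?thesis unfolding *[OF X Y Z] *[OF Y Z X] *[OF Z X Y] by simp
  next
    case False
    show ?thesis
      unfolding tangentD(4)[OF VF_T[OF vf_bracket_VF[OF X br(2)]] False] tangentD(4)[OF VF_T[OF vf_bracket_VF[OF Y br(3)]] False]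
        tangentD(4)[OF VF_T[OF vf_bracket_VF[OF Z br(1)]] False] by simp
  qed
  then show "(vf_bracket X (vf_bracket Y Z) + vf_bracket Y (vf_bracket Z X) + vf_bracket Z (vf_bracket X Y)) p f = 0 p f"
    by (simp only: plus_fun_apply zero_fun_apply)
qed

end

section \<open>Invariant vector fields on a Lie group\<close>

locale lie_group_manifold = manifold A bs
  for A :: "('g::{t2_space,second_countable_topology}, 'd::real_inner) atlas" and bs :: "'d set" +
  fixes m :: "'g \<Rightarrow> 'g \<Rightarrow> 'g" and e :: 'g and i :: "'g \<Rightarrow> 'g"
  assumes lie_group: "lie_group A m e i"
begin

sublocale grp: group m e i
  using lie_group unfolding lie_group_def by (elim conjE)

lemma mult_smooth_map: "smooth_map (prod_atlas A A) A (\<lambda>(x, y). m x y)"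
  and inv_smooth_map: "smooth_map A A i"
  using lie_group unfolding lie_group_def by simp_all

lemma mult_continuous: "continuous_on UNIV (\<lambda>(x, y). m x y)"
  using mult_smooth_map unfolding smooth_map_def by (rule conjunct1)

text \<open>The function \<open>f (x y)\<close> in product coordinates. Its partial derivatives in
  the first and second slot differentiate \<open>f\<close> composed with right and with left
  translations.\<close>

definition mult_chart :: "'g set \<Rightarrow> ('g \<Rightarrow> 'd) \<Rightarrow> 'g set \<Rightarrow> ('g \<Rightarrow> 'd) \<Rightarrow> ('g \<Rightarrow> real) \<Rightarrow> 'd \<times> 'd \<Rightarrow> real"
  where "mult_chart U \<phi> V \<psi> f z = f (m (inv_into U \<phi> (fst z)) (inv_into V \<psi> (snd z)))"

text \<open>Multiplication may map a product of chart domains across several charts, so smoothness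
  is checked near each point with a chart \<open>W\<close> around the product there.\<close>

lemma mult_chart_smooth:
  assumes f: "f \<in> C" and U: "(U, \<phi>) \<in> A" and V: "(V, \<psi>) \<in> A"
  shows "smooth_on (\<phi> ` U \<times> \<psi> ` V) (mult_chart U \<phi> V \<psi> f)"
proof (rule smooth_on_local)
  fix z assume "z \<in> \<phi> ` U \<times> \<psi> ` V"
  then obtain p q where pq: "p \<in> U" "q \<in> V" "z = (\<phi> p, \<psi> q)" by auto
  obtain W \<kappa> where W: "(W, \<kappa>) \<in> A" "m p q \<in> W" by (rule chart_exists)
  let ?F = "\<lambda>(x, y). m x y" and ?I = "\<lambda>z. (inv_into U \<phi> (fst z), inv_into V \<psi> (snd z))"
  let ?S = "map_prod \<phi> \<psi> ` ((U \<times> V) \<inter> ?F -` W)"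
  have "((U \<times> V, map_prod \<phi> \<psi>)) \<in> prod_atlas A A"
    unfolding prod_atlas_def using U V by (intro image_eqI[of _ _ "((U, \<phi>), (V, \<psi>))"]) auto
  moreover have "\<forall>(U, \<phi>)\<in>prod_atlas A A. \<forall>(V, \<psi>)\<in>A. smooth_on (\<phi> ` (U \<inter> ?F -` V)) (\<psi> \<circ> ?F \<circ> inv_into U \<phi>)"
    using mult_smooth_map unfolding smooth_map_def by (rule conjunct2)
  ultimately have "\<forall>(W, \<kappa>)\<in>A. smooth_on (map_prod \<phi> \<psi> ` ((U \<times> V) \<inter> ?F -` W)) (\<kappa> \<circ> ?F \<circ> inv_into (U \<times> V) (map_prod \<phi> \<psi>))"
    by (auto dest: bspec)
  from bspec[OF this W(1)] have s: "smooth_on ?S (\<kappa> \<circ> ?F \<circ> inv_into (U \<times> V) (map_prod \<phi> \<psi>))"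
    by (simp only: prod.case)
  have S: "?S = (\<phi> ` U \<times> \<psi> ` V) \<inter> (\<lambda>z. ?F (?I z)) -` W"
    using chart_inv(1)[OF U] chart_inv(1)[OF V] by (auto simp: image_iff)
  have cI: "continuous_on (\<phi> ` U \<times> \<psi> ` V) ?I"
    by (intro continuous_on_Pair continuous_on_compose2[OF chart_inv(5)[OF U]] continuous_on_compose2[OF chart_inv(5)[OF V]]
        continuous_on_fst continuous_on_snd continuous_on_id) auto
  have c: "continuous_on (\<phi> ` U \<times> \<psi> ` V) (\<lambda>z. ?F (?I z))"
    by (rule continuous_on_compose2[OF mult_continuous cI]) simp
  have "open ((\<lambda>z. ?F (?I z)) -` W \<inter> (\<phi> ` U \<times> \<psi> ` V))"
    by (rule iffD1[OF continuous_on_open_vimage[OF open_Times[OF chart_open(2)[OF U] chart_open(2)[OF V]]] c,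
        rule_format, OF chart_open(1)[OF W(1)]])
  then have oS: "open ?S" unfolding S by (simp only: Int_commute)
  have inv: "inv_into (U \<times> V) (map_prod \<phi> \<psi>) z' = ?I z'" if z': "z' \<in> ?S" for z'
  proof -
    obtain xy' where xy': "xy' \<in> (U \<times> V) \<inter> ?F -` W" "z' = map_prod \<phi> \<psi> xy'" using z' by (rule imageE)
    obtain x y where e: "xy' = (x, y)" by (cases xy')
    have xy: "x \<in> U" "y \<in> V" "z' = map_prod \<phi> \<psi> (x, y)" using xy' unfolding e by simp_all
    have "inj_on (map_prod \<phi> \<psi>) (U \<times> V)"
      by (rule map_prod_inj_on[OF inj_on_inverseI inj_on_inverseI]) (erule chart_inv(1)[OF U], erule chart_inv(1)[OF V])
    from inv_into_f_f[OF this, of "(x, y)"] have "inv_into (U \<times> V) (map_prod \<phi> \<psi>) z' = (x, y)"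
      using xy by (simp only: mem_Sigma_iff simp_thms)
    then show ?thesis using xy chart_inv(1)[OF U xy(1)] chart_inv(1)[OF V xy(2)] by simp
  qed
  have "smooth_on ?S (\<lambda>z. (f \<circ> inv_into W \<kappa>) ((\<kappa> \<circ> ?F \<circ> inv_into (U \<times> V) (map_prod \<phi> \<psi>)) z))"
    by (rule smooth_on_compose[OF bs oS chart_open(2)[OF W(1)] _ s smooth_funsD[OF f W(1) subset_refl]])
      (use inv in \<open>auto simp: S\<close>)
  then have "smooth_on ?S (mult_chart U \<phi> V \<psi> f)"
  proof (rule smooth_on_cong[OF _ oS])
    fix z assume z: "z \<in> ?S"
    then have "?F (?I z) \<in> W" unfolding S by simp
    then show "(f \<circ> inv_into W \<kappa>) ((\<kappa> \<circ> ?F \<circ> inv_into (U \<times> V) (map_prod \<phi> \<psi>)) z) = mult_chart U \<phi> V \<psi> f z"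
      unfolding o_apply inv[OF z] chart_inv(1)[OF W(1) \<open>?F (?I z) \<in> W\<close>] by (simp add: mult_chart_def)
  qed
  moreover have "z \<in> ?S" using pq W(2) by (intro image_eqI[of _ _ "(p, q)"]) auto
  ultimately show "\<exists>T. open T \<and> z \<in> T \<and> smooth_on T (mult_chart U \<phi> V \<psi> f)" using oS by blast
qed

lemma mult_chart_eq:
  "(U, \<phi>) \<in> A \<Longrightarrow> (V, \<psi>) \<in> A \<Longrightarrow> p \<in> U \<Longrightarrow> q \<in> V \<Longrightarrow> mult_chart U \<phi> V \<psi> f (\<phi> p, \<psi> q) = f (m p q)"
  by (simp add: mult_chart_def chart_inv(1))

lemmas onb2 = onb_prod[OF bs bs]

lemma open_chart_prod: "(U, \<phi>) \<in> A \<Longrightarrow> (V, \<psi>) \<in> A \<Longrightarrow> open (\<phi> ` U \<times> \<psi> ` V)"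
  by (intro open_Times chart_open)

lemma mult_right_C:
  assumes f: "f \<in> C"
  shows "(\<lambda>q. f (m q h)) \<in> C"
  unfolding smooth_funs_def
proof (rule CollectI, rule smooth_fun_onI[OF open_UNIV])
  fix p
  obtain U \<phi> where U: "(U, \<phi>) \<in> A" "p \<in> U" by (rule chart_exists)
  obtain V \<psi> where V: "(V, \<psi>) \<in> A" "h \<in> V" by (rule chart_exists)
  note oU = chart_open(2)[OF U(1)]
  have "smooth_on (\<phi> ` U) (\<lambda>x. mult_chart U \<phi> V \<psi> f (x, \<psi> h))"
    by (rule smooth_on_compose[OF onb2 oU open_chart_prod[OF U(1) V(1)] _ smooth_on_Pair[OF oU smooth_on_ident[OF oU] smooth_on_const[OF oU]]
        mult_chart_smooth[OF f U(1) V(1)]]) (use V(2) in auto)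
  then have "smooth_on (\<phi> ` U) ((\<lambda>q. f (m q h)) \<circ> inv_into U \<phi>)"
    by (rule smooth_on_cong[OF _ oU]) (use mult_chart_eq[OF U(1) V(1) _ V(2)] chart_inv(1)[OF U(1)] in auto)
  then show "\<exists>U \<phi> V. (U, \<phi>) \<in> A \<and> p \<in> V \<and> open V \<and> V \<subseteq> U \<and> smooth_on (\<phi> ` V) ((\<lambda>q. f (m q h)) \<circ> inv_into U \<phi>)"
    using U chart_open(1)[OF U(1)] by (intro exI[of _ U] exI[of _ \<phi>] exI[of _ U] conjI) simp_all
qed

lemma mult_left_C:
  assumes f: "f \<in> C"
  shows "(\<lambda>q. f (m h q)) \<in> C"
  unfolding smooth_funs_def
proof (rule CollectI, rule smooth_fun_onI[OF open_UNIV])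
  fix p
  obtain U \<phi> where U: "(U, \<phi>) \<in> A" "p \<in> U" by (rule chart_exists)
  obtain V \<psi> where V: "(V, \<psi>) \<in> A" "h \<in> V" by (rule chart_exists)
  note oU = chart_open(2)[OF U(1)]
  have "smooth_on (\<phi> ` U) (\<lambda>x. mult_chart V \<psi> U \<phi> f (\<psi> h, x))"
    by (rule smooth_on_compose[OF onb2 oU open_chart_prod[OF V(1) U(1)] _ smooth_on_Pair[OF oU smooth_on_const[OF oU] smooth_on_ident[OF oU]]
        mult_chart_smooth[OF f V(1) U(1)]]) (use V(2) in auto)
  then have "smooth_on (\<phi> ` U) ((\<lambda>q. f (m h q)) \<circ> inv_into U \<phi>)"
    by (rule smooth_on_cong[OF _ oU]) (use mult_chart_eq[OF V(1) U(1) V(2)] chart_inv(1)[OF U(1)] in auto)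
  then show "\<exists>U \<phi> V. (U, \<phi>) \<in> A \<and> p \<in> V \<and> open V \<and> V \<subseteq> U \<and> smooth_on (\<phi> ` V) ((\<lambda>q. f (m h q)) \<circ> inv_into U \<phi>)"
    using U chart_open(1)[OF U(1)] by (intro exI[of _ U] exI[of _ \<phi>] exI[of _ U] conjI) simp_all
qed

lemma mult_cancel_simps: "m (i h) (m h q) = q" "m h (m (i h) q) = q" "m (m q h) (i h) = q" "m (m q (i h)) h = q"
  by (simp_all add: grp.assoc[symmetric]) (simp_all add: grp.assoc)

lemma right_cancel: "m x h = m y h \<longleftrightarrow> x = y"
  using mult_cancel_simps(3) by metis

text \<open>Tangent vectors vanish on non-smooth functions; this convention survives left
  translation only because non-smooth functions stay non-smooth.\<close>

lemma mult_left_C_iff: "(\<lambda>q. f (m h q)) \<in> C \<longleftrightarrow> f \<in> C"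
  using mult_left_C[of "\<lambda>q. f (m h q)" "i h"] mult_left_C[of f h] by (auto simp: mult_cancel_simps)

lemma the_inv_right: "the_inv (\<lambda>x. m x h) q = m q (i h)"
  by (rule the_inv_into_f_eq) (auto intro!: injI simp: mult_cancel_simps right_cancel)

lemma the_inv_left: "the_inv (m h) q = m (i h) q"
  by (rule the_inv_into_f_eq) (auto intro!: injI simp: mult_cancel_simps grp.left_cancel)

abbreviation "g \<equiv> lie_algebra A m"

text \<open>Evaluating the pushforward equation at translated points removes the inverse map.
  Translation is invertible, so the two conditions agree on all functions, smooth or not.\<close>

lemma g_iff: "u \<in> g \<longleftrightarrow> u \<in> VF \<and> (\<forall>q h f. u (m q h) f = u q (\<lambda>x. f (m x h)))"
proof -
  have "(\<forall>h. pushforward (\<lambda>x. m x h) u = u) \<longleftrightarrow> (\<forall>q h f. u (m q h) f = u q (\<lambda>x. f (m x h)))"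
    unfolding pushforward_def the_inv_right o_def fun_eq_iff
  proof (intro iffI allI)
    fix q h f assume *: "\<forall>h q f. u (m q (i h)) (\<lambda>x. f (m x h)) = u q f"
    show "u (m q h) f = u q (\<lambda>x. f (m x h))"
      using *[rule_format, of "m q h" h f] unfolding mult_cancel_simps by (rule sym)
  next
    fix q h f assume *: "\<forall>q h f. u (m q h) f = u q (\<lambda>x. f (m x h))"
    show "u (m q (i h)) (\<lambda>x. f (m x h)) = u q f"
      using *[rule_format, of q "i h" "\<lambda>x. f (m x h)"] unfolding mult_cancel_simps .
  qed
  then show ?thesis unfolding lie_algebra_def by simp
qed

lemma g_VF: "u \<in> g \<Longrightarrow> u \<in> VF" and g_right: "u \<in> g \<Longrightarrow> u (m q h) f = u q (\<lambda>x. f (m x h))"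
  unfolding g_iff by blast+

lemma g_at: "u \<in> g \<Longrightarrow> u q f = u e (\<lambda>x. f (m x q))"
  using g_right[of u e q f] by simp

lemma g_eqI:
  assumes "u \<in> g" "v \<in> g" "u e = v e"
  shows "u = v"
proof (intro ext)
  fix q f
  have "u q f = u e (\<lambda>x. f (m x q))" by (rule g_at[OF assms(1)])
  also have "\<dots> = v e (\<lambda>x. f (m x q))" by (simp only: assms(3))
  also have "\<dots> = v q f" by (rule g_at[OF assms(2), symmetric])
  finally show "u q f = v q f" .
qed

lemma subspace_lie_algebra: "subspace g"
  unfolding subspace_def
proof (intro conjI ballI allI)
  show "0 \<in> g" unfolding g_iff using VF_0 by (simp add: zero_fun_def)
  fix u v c assume u: "u \<in> g"
  show "c *\<^sub>R u \<in> g"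
    unfolding g_iff using VF_scale[OF C_const g_VF[OF u], of c] g_right[OF u] by (simp add: scaleR_fun_def)
  assume v: "v \<in> g"
  show "u + v \<in> g"
    unfolding g_iff using VF_add[OF g_VF[OF u] g_VF[OF v]] g_right[OF u] g_right[OF v] by (simp add: plus_fun_def)
qed

lemma g_bracket:
  assumes u: "u \<in> g" and v: "v \<in> g"
  shows "vf_bracket u v \<in> g"
  unfolding g_iff
proof (intro conjI allI vf_bracket_VF g_VF u v)
  fix q h f
  show "vf_bracket u v (m q h) f = vf_bracket u v q (\<lambda>x. f (m x h))"
    unfolding vf_bracket_def g_right[OF u, of q h] g_right[OF v, of q h] g_right[OF u, of _ h f] g_right[OF v, of _ h f]
    by (rule refl)
qed

lemma lie_bracket_on_g: "lie_bracket_on g vf_bracket"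
  unfolding lie_bracket_on_def jacobi_on_def
proof (intro conjI ballI)
  fix u v w assume u: "u \<in> g" and v: "v \<in> g" and w: "w \<in> g"
  show "vf_bracket u (vf_bracket v w) + vf_bracket v (vf_bracket w u) + vf_bracket w (vf_bracket u v) = 0"
    by (rule vf_jacobi[OF g_VF[OF u] g_VF[OF v] g_VF[OF w]])
next
  fix u v
  show "vf_bracket u v = - vf_bracket v u" unfolding fun_Compl_def[of "vf_bracket v u"] by (rule ext) (rule vf_bracket_skew)
next
  fix u assume u: "u \<in> g"
  show "vf_bracket u ` g \<subseteq> g" using g_bracket[OF u] by (rule image_subsetI)
  show "linear_on g (vf_bracket u)"
    unfolding linear_on_def
  proof (intro conjI ballI allI)
    fix v w c assume v: "v \<in> g"
    show "vf_bracket u (c *\<^sub>R v) = c *\<^sub>R vf_bracket u v"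
      using vf_bracket_scale[OF g_VF[OF u] g_VF[OF v] C_const, of c] tangent_const[OF VF_T[OF g_VF[OF u]]]
      unfolding scaleR_fun_def[of c v] scaleR_fun_def[of c "vf_bracket u v"] by (simp only: scaleR_zero_left add_0_right)
    assume w: "w \<in> g"
    show "vf_bracket u (v + w) = vf_bracket u v + vf_bracket u w"
      using vf_bracket_add[OF g_VF[OF u] g_VF[OF v] g_VF[OF w]]
      unfolding plus_fun_def[of v w] plus_fun_def[of "vf_bracket u v" "vf_bracket u w"] .
  qed
qed

text \<open>Evaluation at \<open>e\<close> embeds the right-invariant fields into the finite dimensional \<open>T e\<close>.\<close>

lemma lie_algebra_frame:
  obtains n us cs where "dual_frame g {..<n::nat} us cs"
    "\<And>i j. i < n \<Longrightarrow> j < n \<Longrightarrow> cs i (us j) = (if i = j then 1 else 0)"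
proof -
  obtain D where D: "D \<subseteq> g" "independent D" "g \<subseteq> span D"
    by (rule real_vector.maximal_independent_subset[of g])
  have span: "span D = g" using D(3) span_minimal[OF D(1) subspace_lie_algebra] by (rule subset_antisym[rotated])
  let ?ev = "\<lambda>u :: 'g vfield. u e"
  have lin: "linear ?ev" by (rule linearI) (simp_all only: plus_fun_apply scaleR_fun_apply)
  have inj: "inj_on ?ev (span D)" unfolding span by (rule inj_onI) (rule g_eqI)
  \<comment> \<open>Evaluation at \<open>e\<close> keeps \<open>D\<close> independent, and
    \<open>T e\<close> is spanned by finitely many frame vectors, which forces \<open>D\<close> to
    be finite.\<close>
  have ind: "independent (?ev ` D)" by (rule linear_independent_injective_image[OF lin D(2) inj])
  obtain W x E where p: "e \<in> W" and fr: "frame_on W x E" using frame_on_exists by blast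
  have "?ev ` D \<subseteq> span ((\<lambda>u. E u e) ` bs)"
  proof (rule image_subsetI)
    fix u assume "u \<in> D"
    then have "u e \<in> T e" using D(1) g_VF VF_T by blast
    then have "u e = (\<Sum>b\<in>bs. u e (x b) *\<^sub>R E b e)" by (rule frame_onD(4)[OF fr p])
    moreover have "(\<Sum>b\<in>bs. u e (x b) *\<^sub>R E b e) \<in> span ((\<lambda>u. E u e) ` bs)"
      by (intro span_sum span_scale span_base imageI)
    ultimately show "u e \<in> span ((\<lambda>u. E u e) ` bs)" by (simp only:)
  qed
  then have "finite (?ev ` D)" using independent_span_bound[OF finite_imageI[OF onbD1[OF bs]] ind] by blast
  then have fin: "finite D" using finite_imageD inj_on_subset[OF inj span_superset] by blast
  obtain us where us: "bij_betw us {..<card D} D"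
    using ex_bij_betw_nat_finite[OF fin] unfolding atLeast0LessThan by blast
  define cs where "cs k v = (if v \<in> g then representation D v (us k) else 0)" for k v
  have usD: "us k \<in> D" if "k < card D" for k using bij_betwE[OF us] that by blast
  show ?thesis
  proof (rule that[of "card D" us cs])
    show "cs k (us j) = (if k = j then 1 else 0)" if "k < card D" "j < card D" for k j
    proof -
      have "us k = us j \<longleftrightarrow> k = j" using bij_betw_imp_inj_on[OF us] that by (auto dest: inj_onD)
      then show ?thesis using usD[OF that(2)] D(1) by (auto simp: cs_def representation_basis[OF D(2)])
    qed
    show "dual_frame g {..<card D} us cs"
      unfolding dual_frame_def
    proof (intro conjI ballI subspace_lie_algebra finite_lessThan)
      fix k assume k: "k \<in> {..<card D}"
      show "us k \<in> g" using usD k D(1) by auto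
      show "cs k \<in> dual g"
      proof (rule dualI)
        fix u v c assume u: "u \<in> g"
        show "cs k (c *\<^sub>R u) = c * cs k u"
          using u subspace_scale[OF subspace_lie_algebra u, of c] by (simp add: cs_def representation_scale[OF D(2)] span)
        assume v: "v \<in> g"
        show "cs k (u + v) = cs k u + cs k v"
          using u v subspace_add[OF subspace_lie_algebra u v] by (simp add: cs_def representation_add[OF D(2)] span)
      qed (simp add: cs_def)
    next
      fix v assume v: "v \<in> g"
      have "(\<Sum>k<card D. cs k v *\<^sub>R us k) = (\<Sum>k<card D. representation D v (us k) *\<^sub>R us k)"
        using v by (simp add: cs_def)
      also have "\<dots> = (\<Sum>b\<in>D. representation D v b *\<^sub>R b)" by (rule sum.reindex_bij_betw[OF us])
      also have "\<dots> = v" by (rule sum_representation_eq[OF D(2) _ fin subset_refl]) (simp add: span v)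
      finally show "(\<Sum>k<card D. cs k v *\<^sub>R us k) = v" .
    qed
  qed
qed

section \<open>The adjoint action and its derivative at the identity\<close>

abbreviation Ad :: "'g \<Rightarrow> 'g vfield \<Rightarrow> 'g vfield"
  where "Ad h \<equiv> pushforward (m h)"

lemma Ad_apply: "Ad h u q f = u (m (i h) q) (\<lambda>x. f (m h x))"
  unfolding pushforward_def the_inv_left o_def by (rule refl)

text \<open>By associativity left translation by \<open>h\<close> commutes with all right
  translations and hence preserves right invariance.\<close>

lemma Ad_g:
  assumes u: "u \<in> g"
  shows "Ad h u \<in> g"
  unfolding g_iff
proof (intro conjI allI)
  show "Ad h u \<in> VF"
  proof (rule VF_I)
    fix q
    note t = tangentD[OF VF_T[OF g_VF[OF u], of "m (i h) q"]]
    show "Ad h u q \<in> T q"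
    proof (rule tangentI)
      fix f f' c assume f: "f \<in> C"
      show "Ad h u q (\<lambda>q. c * f q) = c * Ad h u q f" unfolding Ad_apply by (rule t(2)[OF mult_left_C[OF f]])
      assume f': "f' \<in> C"
      show "Ad h u q (\<lambda>q. f q + f' q) = Ad h u q f + Ad h u q f'"
        unfolding Ad_apply by (rule t(1)[OF mult_left_C[OF f] mult_left_C[OF f']])
      show "Ad h u q (\<lambda>q. f q * f' q) = Ad h u q f * f' q + f q * Ad h u q f'"
        unfolding Ad_apply t(3)[OF mult_left_C[OF f] mult_left_C[OF f']] mult_cancel_simps by (rule refl)
    next
      fix f assume "f \<notin> C"
      then have "(\<lambda>x. f (m h x)) \<notin> C" unfolding mult_left_C_iff .
      then show "Ad h u q f = 0" unfolding Ad_apply by (rule t(4))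
    qed
  next
    fix f assume "f \<in> C"
    then show "(\<lambda>q. Ad h u q f) \<in> C"
      unfolding Ad_apply by (rule mult_left_C[OF VF_C[OF g_VF[OF u] mult_left_C]])
  qed
  fix q k f
  show "Ad h u (m q k) f = Ad h u q (\<lambda>x. f (m x k))"
    unfolding Ad_apply grp.assoc[symmetric] g_right[OF u] by (simp only: grp.assoc)
qed

lemma Ad_e: "Ad e u = u"
  by (intro ext) (simp add: Ad_apply grp.inverse_neutral)

text \<open>The left-invariant field extending \<open>u e\<close>, expressed at \<open>q\<close>
  through a right-invariant field that varies with \<open>q\<close>.\<close>

lemma Ad_diag: "u \<in> g \<Longrightarrow> Ad q u q f = u e (\<lambda>x. f (m q x))"
  by (simp add: Ad_apply)

lemma chart_vec_partial:
  assumes f: "f \<in> C" and U: "(U, \<phi>) \<in> A" and V: "(V, \<psi>) \<in> A" and p: "p \<in> U" and q: "q \<in> V"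
  shows "chart_vec V \<psi> q b (\<lambda>x. f (m p x)) = frechet_derivative (mult_chart U \<phi> V \<psi> f) (at (\<phi> p, \<psi> q)) (0, b)"
    and "chart_vec U \<phi> p b (\<lambda>x. f (m x q)) = frechet_derivative (mult_chart U \<phi> V \<psi> f) (at (\<phi> p, \<psi> q)) (b, 0)"
proof -
  note d = has_derivative_partial[OF mult_chart_smooth[OF f U V], of "\<phi> p" "\<psi> q"]
  have mem: "(\<phi> p, \<psi> q) \<in> \<phi> ` U \<times> \<psi> ` V" using p q by simp
  have "((\<lambda>x. f (m p x)) \<circ> inv_into V \<psi> has_derivative (\<lambda>b. frechet_derivative (mult_chart U \<phi> V \<psi> f) (at (\<phi> p, \<psi> q)) (0, b))) (at (\<psi> q))"
    by (rule has_derivative_transform_within_open[OF d(1)[OF mem] chart_open(2)[OF V]])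
      (use q chart_inv(1)[OF U p] in \<open>auto simp: mult_chart_def\<close>)
  then show "chart_vec V \<psi> q b (\<lambda>x. f (m p x)) = frechet_derivative (mult_chart U \<phi> V \<psi> f) (at (\<phi> p, \<psi> q)) (0, b)"
    by (rule chart_vec_eqI[OF mult_left_C[OF f]])
  have "((\<lambda>x. f (m x q)) \<circ> inv_into U \<phi> has_derivative (\<lambda>b. frechet_derivative (mult_chart U \<phi> V \<psi> f) (at (\<phi> p, \<psi> q)) (b, 0))) (at (\<phi> p))"
    by (rule has_derivative_transform_within_open[OF d(2)[OF mem] chart_open(2)[OF U]])
      (use p chart_inv(1)[OF V q] in \<open>auto simp: mult_chart_def\<close>)
  then show "chart_vec U \<phi> p b (\<lambda>x. f (m x q)) = frechet_derivative (mult_chart U \<phi> V \<psi> f) (at (\<phi> p, \<psi> q)) (b, 0)"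
    by (rule chart_vec_eqI[OF mult_right_C[OF f]])
qed

text \<open>\<open>Ad h u e f\<close> is \<open>u\<close> at the inverse of \<open>h\<close> applied
  to \<open>f\<close> translated by \<open>h\<close>, so point and function both move. Expanding
  \<open>u\<close> in coordinate fields near the inverse of \<open>h0\<close> separates the two:
  smooth coefficients times partial derivatives of the multiplication.\<close>

lemma Ad_smooth:
  assumes u: "u \<in> g" and f: "f \<in> C"
  shows "(\<lambda>h. Ad h u e f) \<in> C"
proof (rule C_localI)
  fix h0
  obtain U \<phi> where U: "(U, \<phi>) \<in> A" "h0 \<in> U" by (rule chart_exists)
  obtain V \<psi> where V: "(V, \<psi>) \<in> A" "i h0 \<in> V" by (rule chart_exists)
  obtain W x E where W: "i h0 \<in> W" "W \<subseteq> V" and fr: "frame_on W x E" and E: "\<forall>q\<in>W. \<forall>b. E b q = chart_vec V \<psi> q b"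
    using chart_frame_exists[OF V] by blast
  let ?F = "frechet_derivative (mult_chart U \<phi> V \<psi> f)"
  have cont: "continuous_on UNIV i" using inv_smooth_map unfolding smooth_map_def by (rule conjunct1)
  have oV: "open (i -` V)" and oW: "open (i -` W)"
    using cont chart_open(1)[OF V(1)] frame_onD(1)[OF fr] by (simp_all add: open_vimage)
  have N: "open (U \<inter> i -` W)" by (rule open_Int[OF chart_open(1)[OF U(1)] oW])
  have eq: "Ad h u e f = (\<Sum>b\<in>bs. u (i h) (x b) * ?F (at (\<phi> h, \<psi> (i h))) (0, b))" if h: "h \<in> U \<inter> i -` W" for h
  proof -
    have iW: "i h \<in> W" and iV: "i h \<in> V" using h W(2) by auto
    have "Ad h u e f = u (i h) (\<lambda>x. f (m h x))" by (simp add: Ad_apply)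
    also have "u (i h) = (\<Sum>b\<in>bs. u (i h) (x b) *\<^sub>R E b (i h))" by (rule frame_onD(4)[OF fr iW VF_T[OF g_VF[OF u]]])
    also have "(\<Sum>b\<in>bs. u (i h) (x b) *\<^sub>R E b (i h)) (\<lambda>x. f (m h x))
        = (\<Sum>b\<in>bs. u (i h) (x b) * chart_vec V \<psi> (i h) b (\<lambda>x. f (m h x)))"
      using E iW by (simp add: sum_fun_apply)
    also have "\<dots> = (\<Sum>b\<in>bs. u (i h) (x b) * ?F (at (\<phi> h, \<psi> (i h))) (0, b))"
      using chart_vec_partial(1)[OF f U(1) V(1) _ iV] h by simp
    finally show ?thesis .
  qed
  have 1: "(\<lambda>h. u (i h) (x b)) \<in> C" for b by (rule smooth_map_C[OF inv_smooth_map VF_C[OF g_VF[OF u] frame_onD(2)[OF fr]]])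
  have 2: "smooth_fun_on A (U \<inter> i -` W) (\<lambda>h. ?F (at (\<phi> h, \<psi> (i h))) (0, b))" for b
  proof -
    let ?N = "U \<inter> i -` V"
    note oN = chart_image_open[OF U(1) oV]
    have pair: "smooth_on (\<phi> ` ?N) (\<lambda>x. (x, \<psi> (i (inv_into U \<phi> x))))"
      by (rule smooth_on_Pair[OF oN smooth_on_ident[OF oN] smooth_map_chart[OF inv_smooth_map U(1) V(1)]])
    have "smooth_on (\<phi> ` ?N) (\<lambda>x. ?F (at (x, \<psi> (i (inv_into U \<phi> x)))) (0, b))"
      by (rule smooth_on_compose[OF onb2 oN open_chart_prod[OF U(1) V(1)] _ pair
          smooth_on_derivative[OF mult_chart_smooth[OF f U(1) V(1)]]]) (auto simp: chart_inv(1)[OF U(1)])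
    then have s: "smooth_on (\<phi> ` ?N) ((\<lambda>h. ?F (at (\<phi> h, \<psi> (i h))) (0, b)) \<circ> inv_into U \<phi>)"
      by (rule smooth_on_cong[OF _ oN]) (auto simp: chart_inv(1)[OF U(1)])
    have "smooth_fun_on A ?N (\<lambda>h. ?F (at (\<phi> h, \<psi> (i h))) (0, b))"
      by (rule smooth_fun_onI[OF open_Int[OF chart_open(1)[OF U(1)] oV]], intro exI[of _ U] exI[of _ \<phi>] exI[of _ ?N] conjI)
        (use U(1) s open_Int[OF chart_open(1)[OF U(1)] oV] in simp_all)
    then show ?thesis by (rule smooth_fun_on_subset) (use W(2) in auto)
  qed
  have "smooth_fun_on A (U \<inter> i -` W) (\<lambda>h. \<Sum>b\<in>bs. u (i h) (x b) * ?F (at (\<phi> h, \<psi> (i h))) (0, b))"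
    by (rule smooth_fun_on_sum[OF N], rule smooth_fun_on_mult[OF N C_imp_smooth_fun_on[OF 1] 2])
  then have "smooth_fun_on A (U \<inter> i -` W) (\<lambda>h. Ad h u e f)"
    by (rule smooth_fun_on_cong[OF N]) (simp only: eq)
  then show "\<exists>V. open V \<and> h0 \<in> V \<and> smooth_fun_on A V (\<lambda>h. Ad h u e f)"
    using N U(2) W(1) by (intro exI[of _ "U \<inter> i -` W"] conjI) simp_all
qed

text \<open>\<open>\<lambda>q. u e (\<lambda>x. f (m q x))\<close> is the derivative of \<open>f\<close> along the left-invariant field extending \<open>u e\<close>.\<close>

lemma left_right_commute:
  assumes w: "w \<in> g" and u: "u \<in> g" and f: "f \<in> C" and uf: "(\<lambda>q. u e (\<lambda>x. f (m q x))) \<in> C"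
  shows "w e (\<lambda>q. u e (\<lambda>x. f (m q x))) = u e (\<lambda>q. w q f)"
proof -
  obtain U \<phi> where U: "(U, \<phi>) \<in> A" "e \<in> U" by (rule chart_exists)
  obtain a where a: "w e = chart_vec U \<phi> e a" using tangent_eq_chart_vec[OF VF_T[OF g_VF[OF w]] U] .
  obtain b where b: "u e = chart_vec U \<phi> e b" using tangent_eq_chart_vec[OF VF_T[OF g_VF[OF u]] U] .
  let ?G = "mult_chart U \<phi> U \<phi> f" and ?S = "\<phi> ` U \<times> \<phi> ` U"
  let ?F = "\<lambda>z. frechet_derivative ?G (at z)"
  have G: "smooth_on ?S ?G" by (rule mult_chart_smooth[OF f U(1) U(1)])
  have S: "open ?S" by (rule open_chart_prod[OF U(1) U(1)])
  have ee: "(\<phi> e, \<phi> e) \<in> ?S" using U(2) by simp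
  note oU = chart_open(2)[OF U(1)] and eU = imageI[OF U(2), of \<phi>]
  have "w e (\<lambda>q. u e (\<lambda>x. f (m q x))) = frechet_derivative (\<lambda>z. ?F z (0, b)) (at (\<phi> e, \<phi> e)) (a, 0)"
    unfolding a
  proof (rule chart_vec_eqI[OF uf])
    note d = has_derivative_partial(2)[OF smooth_on_derivative[OF G, of "(0, b)"] ee]
    show "((\<lambda>q. u e (\<lambda>x. f (m q x))) \<circ> inv_into U \<phi> has_derivative
        (\<lambda>a. frechet_derivative (\<lambda>z. ?F z (0, b)) (at (\<phi> e, \<phi> e)) (a, 0))) (at (\<phi> e))"
    proof (rule has_derivative_transform_within_open[OF d oU eU])
      fix y assume "y \<in> \<phi> ` U"
      then obtain q where q: "q \<in> U" "y = \<phi> q" by blast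
      show "?F (y, \<phi> e) (0, b) = ((\<lambda>q. u e (\<lambda>x. f (m q x))) \<circ> inv_into U \<phi>) y"
        unfolding o_apply q(2) chart_inv(1)[OF U(1) q(1)] b by (rule chart_vec_partial(1)[OF f U(1) U(1) q(1) U(2), symmetric])
    qed
  qed
  \<comment> \<open>Both sides of the claim are the mixed second derivative of
    \<open>f (x y)\<close> at \<open>(e, e)\<close>, with \<open>a\<close> in the first factor and
    \<open>b\<close> in the second; here the order of differentiation is exchanged.\<close>
  also have "\<dots> = frechet_derivative (\<lambda>z. ?F z (a, 0)) (at (\<phi> e, \<phi> e)) (0, b)"
    by (rule mixed_partials_commute[OF S G ee])
  also have "\<dots> = u e (\<lambda>q. w q f)"
    unfolding b
  proof (rule chart_vec_eqI[OF VF_C[OF g_VF[OF w] f], symmetric])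
    note d = has_derivative_partial(1)[OF smooth_on_derivative[OF G, of "(a, 0)"] ee]
    show "((\<lambda>q. w q f) \<circ> inv_into U \<phi> has_derivative
        (\<lambda>b. frechet_derivative (\<lambda>z. ?F z (a, 0)) (at (\<phi> e, \<phi> e)) (0, b))) (at (\<phi> e))"
    proof (rule has_derivative_transform_within_open[OF d oU eU])
      fix y assume "y \<in> \<phi> ` U"
      then obtain q where q: "q \<in> U" "y = \<phi> q" by blast
      show "?F (\<phi> e, y) (a, 0) = ((\<lambda>q. w q f) \<circ> inv_into U \<phi>) y"
        unfolding o_apply q(2) chart_inv(1)[OF U(1) q(1)] g_at[OF w, of q] a
        by (rule chart_vec_partial(2)[OF f U(1) U(1) U(2) q(1), symmetric])
    qed
  qed
  finally show ?thesis .
qed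

text \<open>Evaluation at \<open>e\<close> is injective on \<open>g\<close>, so a coordinate
  functional extends to a covector at \<open>e\<close>, and covectors are differentials. Coordinates
  of \<open>Ad h u\<close> thereby become values of the kind that \<open>Ad_smooth\<close>
  controls.\<close>

lemma dual_functions:
  assumes fr: "dual_frame g {..<n::nat} us cs" and bi: "\<forall>i<n. \<forall>j<n. cs i (us j) = (if i = j then 1 else 0)"
    and k: "k < n"
  shows "\<exists>f\<in>C. \<forall>v\<in>g. v e f = cs k v"
proof -
  note d = dual_frameD[OF fr]
  have us: "us j \<in> g" if "j < n" for j using d(3) that by simp
  have z: "a j = 0" if 0: "(\<Sum>j\<in>{..<n}. a j *\<^sub>R us j e) = 0" and j: "j \<in> {..<n}" for a j
  proof -
    have V: "(\<Sum>j\<in>{..<n}. a j *\<^sub>R us j) \<in> g" by (intro subspace_sum[OF d(1)] subspace_scale[OF d(1)] d(3))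
    have "(\<Sum>j\<in>{..<n}. a j *\<^sub>R us j) e = (\<Sum>j\<in>{..<n}. a j *\<^sub>R us j e)"
      by (simp only: sum_fun_apply scaleR_fun_apply)
    also have "\<dots> = 0" by (rule 0)
    finally have "(\<Sum>j\<in>{..<n}. a j *\<^sub>R us j) e = 0" .
    then have "(\<Sum>j\<in>{..<n}. a j *\<^sub>R us j) = 0"
      by (intro g_eqI[OF V subspace_0[OF d(1)]]) (simp only: zero_fun_apply)
    moreover have lin: "linear_on g (cs j)" by (rule dual_linear[OF d(4)[OF j]])
    ultimately have "0 = cs j (\<Sum>k\<in>{..<n}. a k *\<^sub>R us k)" using linear_on_0[OF lin subspace_0[OF d(1)]] by (simp only:)
    also have "\<dots> = (\<Sum>k\<in>{..<n}. cs j (a k *\<^sub>R us k))"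
      by (rule linear_on_sum[OF d(1) lin]) (intro subspace_scale[OF d(1)] d(3))
    also have "\<dots> = (\<Sum>k\<in>{..<n}. if k = j then a k else 0)"
      by (rule sum.cong) (use j in \<open>simp_all add: linear_onD(2)[OF lin us] bi[rule_format]\<close>)
    also have "\<dots> = a j" using j by simp
    finally show ?thesis by simp
  qed
  have inj: "inj_on (\<lambda>j. us j e) {..<n}" by (rule independent_family(1)[OF finite_lessThan]) (rule z)
  have ind: "independent ((\<lambda>j. us j e) ` {..<n})" by (rule independent_family(2)[OF finite_lessThan]) (rule z)
  \<comment> \<open>The functional is given on the independent vectors \<open>us j e\<close>,
    extended linearly to the ambient type, and then cut down to \<open>T e\<close>.\<close>
  obtain G where G: "linear G" "\<forall>x\<in>(\<lambda>j. us j e) ` {..<n}. G x = (if x = us k e then 1 else (0::real))"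
    using linear_independent_extend[OF ind, of "\<lambda>x. if x = us k e then 1 else 0"] by blast
  define a where "a D = (if D \<in> T e then G D else 0)" for D
  have "a \<in> cotangent A e"
  proof (rule dualI)
    fix x y c assume x: "x \<in> T e"
    show "a (c *\<^sub>R x) = c * a x" using x T_scale[OF x, of c] by (simp add: a_def linear_scale[OF G(1)])
    assume y: "y \<in> T e"
    show "a (x + y) = a x + a y" using x y T_add[OF x y] by (simp add: a_def linear_add[OF G(1)])
  qed (simp add: a_def)
  then obtain f where f: "f \<in> C" "extd A f e = a" by (rule covector_exact)
  have ue: "us j e f = (if j = k then 1 else 0)" if j: "j < n" for j
  proof -
    have t: "us j e \<in> T e" by (rule VF_T[OF g_VF[OF us[OF j]]])
    have "us j e f = extd A f e (us j e)" by (rule extd_apply[OF t, symmetric])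
    also have "\<dots> = G (us j e)" unfolding f(2) a_def using t by simp
    also have "\<dots> = (if us j e = us k e then 1 else 0)" using G(2) j by simp
    also have "us j e = us k e \<longleftrightarrow> j = k" using inj_onD[OF inj, of j k] j k by auto
    finally show ?thesis .
  qed
  have "v e f = cs k v" if v: "v \<in> g" for v
  proof -
    have "v e f = (\<Sum>j<n. cs j v *\<^sub>R us j) e f" by (simp only: d(5)[OF v])
    also have "\<dots> = (\<Sum>j<n. cs j v * us j e f)" by (simp only: sum_fun_apply scaleR_fun_apply real_scaleR_def)
    also have "\<dots> = (\<Sum>j<n. if j = k then cs j v else 0)" by (rule sum.cong) (simp_all add: ue)
    also have "\<dots> = cs k v" using k by simp
    finally show ?thesis .
  qed
  then show ?thesis using f(1) by (intro bexI[of _ f] ballI)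
qed

lemma Ad_coord_smooth:
  assumes fr: "dual_frame g {..<n::nat} us cs" and bi: "\<forall>i<n. \<forall>j<n. cs i (us j) = (if i = j then 1 else 0)"
    and k: "k < n" and u: "u \<in> g"
  shows "(\<lambda>h. cs k (Ad h u)) \<in> C"
proof -
  obtain f where f: "f \<in> C" "\<forall>v\<in>g. v e f = cs k v" using dual_functions[OF fr, OF bi, OF k] by (rule bexE)
  have "(\<lambda>h. Ad h u e f) = (\<lambda>h. cs k (Ad h u))" by (rule ext) (rule bspec[OF f(2) Ad_g[OF u]])
  then show ?thesis using Ad_smooth[OF u f(1)] by (simp only:)
qed

text \<open>The left-invariant field extending \<open>u e\<close> is \<open>\<Sum>j. cs j (Ad h u) us j\<close>. It commutes with the
  right-invariant \<open>w\<close>, and this computes the derivative of its coefficients.\<close>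

lemma Ad_derivative:
  assumes fr: "dual_frame g {..<n::nat} us cs" and bi: "\<forall>i<n. \<forall>j<n. cs i (us j) = (if i = j then 1 else 0)"
    and w: "w \<in> g" and u: "u \<in> g"
  shows "(\<Sum>j<n. w e (\<lambda>h. cs j (Ad h u)) *\<^sub>R us j) = - vf_bracket w u"
proof (rule g_eqI)
  note d = dual_frameD[OF fr]
  have us: "us j \<in> g" if "j < n" for j using d(3) that by simp
  note c = Ad_coord_smooth[OF fr, OF bi, OF _ u]
  let ?c = "\<lambda>j h. cs j (Ad h u)"
  have L: "(\<Sum>j<n. w e (?c j) *\<^sub>R us j) \<in> g" by (intro subspace_sum[OF d(1)] subspace_scale[OF d(1)] us) simp
  have R: "- vf_bracket w u \<in> g" by (rule subspace_neg[OF d(1) g_bracket[OF w u]])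
  show "(\<Sum>j<n. w e (?c j) *\<^sub>R us j) \<in> g" "- vf_bracket w u \<in> g" by (rule L, rule R)
  show "(\<Sum>j<n. w e (?c j) *\<^sub>R us j) e = (- vf_bracket w u) e"
  proof (rule T_eqI[OF VF_T[OF g_VF[OF L]] VF_T[OF g_VF[OF R]]])
    fix f assume f: "f \<in> C"
    have uf: "(\<lambda>q. us j q f) \<in> C" if "j < n" for j by (rule VF_C[OF g_VF[OF us[OF that]] f])
    have expand: "v q f = (\<Sum>j<n. cs j v * us j q f)" if "v \<in> g" for v q
    proof -
      have "v q f = (\<Sum>j<n. cs j v *\<^sub>R us j) q f" by (simp only: d(5)[OF that])
      then show ?thesis by (simp only: sum_fun_apply scaleR_fun_apply real_scaleR_def)
    qed
    have uL: "(\<lambda>q. u e (\<lambda>x. f (m q x))) = (\<lambda>q. \<Sum>j<n. ?c j q * us j q f)"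
      by (rule ext) (simp only: Ad_diag[OF u, symmetric] expand[OF Ad_g[OF u]])
    have uLC: "(\<lambda>q. \<Sum>j<n. ?c j q * us j q f) \<in> C" by (rule C_sum, rule C_mult[OF c uf]) simp_all
    note D = VF_T[OF g_VF[OF w], of e]
    \<comment> \<open>The derivative by \<open>w\<close> at \<open>e\<close> of the left-invariant
      derivative of \<open>f\<close> is computed in two ways: by commutation it is
      \<open>u e\<close> of \<open>w f\<close>; by the product rule it is the wanted sum plus
      \<open>w e\<close> of \<open>u f\<close>, since \<open>Ad e u = u\<close>.\<close>
    have "u e (\<lambda>q. w q f) = w e (\<lambda>q. \<Sum>j<n. ?c j q * us j q f)"
      using left_right_commute[OF w u f] uLC unfolding uL by simp
    also have "\<dots> = (\<Sum>j<n. w e (\<lambda>q. ?c j q * us j q f))"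
      by (rule tangent_sum[OF D], rule C_mult[OF c uf]) simp_all
    also have "\<dots> = (\<Sum>j<n. w e (?c j) * us j e f + ?c j e * w e (\<lambda>q. us j q f))"
      by (rule sum.cong[OF refl], rule tangentD(3)[OF D c uf]) simp_all
    also have "\<dots> = (\<Sum>j<n. w e (?c j) * us j e f) + (\<Sum>j<n. ?c j e * w e (\<lambda>q. us j q f))" by (rule sum.distrib)
    also have "(\<Sum>j<n. ?c j e * w e (\<lambda>q. us j q f)) = (\<Sum>j<n. w e (\<lambda>q. cs j u * us j q f))"
      unfolding Ad_e by (rule sum.cong[OF refl], rule tangentD(2)[OF D uf, symmetric]) simp
    also have "\<dots> = w e (\<lambda>q. \<Sum>j<n. cs j u * us j q f)"
      by (rule tangent_sum[OF D, symmetric], rule C_mult[OF C_const uf]) simp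
    also have "\<dots> = w e (\<lambda>q. u q f)" by (simp only: expand[OF u, symmetric])
    finally have "(\<Sum>j<n. w e (?c j) * us j e f) = u e (\<lambda>q. w q f) - w e (\<lambda>q. u q f)" by simp
    then show "(\<Sum>j<n. w e (?c j) *\<^sub>R us j) e f = (- vf_bracket w u) e f"
      by (simp only: sum_fun_apply scaleR_fun_apply real_scaleR_def uminus_apply vf_bracket_def minus_diff_eq)
  qed
qed

lemma biinvariant_ad_invariant:
  assumes B: "biinvariant_form A m B" and u: "u \<in> g" and v: "v \<in> g" and w: "w \<in> g"
  shows "B (vf_bracket u v) w = B u (vf_bracket v w)"
proof -
  obtain n us cs where fr: "dual_frame g {..<n::nat} us cs"
    and bi0: "\<And>i j. i < n \<Longrightarrow> j < n \<Longrightarrow> cs i (us j) = (if i = j then 1 else 0)"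
    using lie_algebra_frame by blast
  then have bi: "\<forall>i<n. \<forall>j<n. cs i (us j) = (if i = j then 1 else 0)" by (intro allI impI bi0)
  note d = dual_frameD[OF fr]
  have us: "us j \<in> g" if "j < n" for j using d(3) that by simp
  have Bl: "linear_on g (B x)" if "x \<in> g" for x using B that unfolding biinvariant_form_def by blast
  have Bs: "B x y = B y x" if "x \<in> g" "y \<in> g" for x y using B that unfolding biinvariant_form_def by blast
  have Binv: "B (Ad h x) (Ad h y) = B x y" if "x \<in> g" "y \<in> g" for h x y
    using B that unfolding biinvariant_form_def by blast
  have sV: "(\<Sum>j<n. a j *\<^sub>R us j) \<in> g" for a by (intro subspace_sum[OF d(1)] subspace_scale[OF d(1)] us) simp
  have ex1: "B x (\<Sum>j<n. a j *\<^sub>R us j) = (\<Sum>j<n. a j * B x (us j))" if x: "x \<in> g" for x a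
  proof -
    have "B x (\<Sum>j<n. a j *\<^sub>R us j) = (\<Sum>j<n. B x (a j *\<^sub>R us j))"
      by (rule linear_on_sum[OF d(1) Bl[OF x]]) (intro subspace_scale[OF d(1)] us, simp)
    also have "\<dots> = (\<Sum>j<n. a j * B x (us j))" by (rule sum.cong) (simp_all add: linear_onD(2)[OF Bl[OF x] us])
    finally show ?thesis .
  qed
  have ex: "B (\<Sum>j<n. a j *\<^sub>R us j) (\<Sum>k<n. b k *\<^sub>R us k) = (\<Sum>k<n. \<Sum>j<n. b k * (a j * B (us k) (us j)))" for a b
    unfolding ex1[OF sV]
  proof (rule sum.cong[OF refl])
    fix k assume "k \<in> {..<n}"
    then have k: "us k \<in> g" using us by simp
    show "b k * B (\<Sum>j<n. a j *\<^sub>R us j) (us k) = (\<Sum>j<n. b k * (a j * B (us k) (us j)))"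
      unfolding Bs[OF sV k] ex1[OF k] by (rule sum_distrib_left)
  qed
  \<comment> \<open>The identity \<open>B (Ad h x) (Ad h y) = B x y\<close> is differentiated at
    \<open>h = e\<close> in direction \<open>w\<close>. In coordinates the coefficients of
    \<open>Ad h x\<close> and \<open>Ad h y\<close> are smooth functions of \<open>h\<close>, while
    the values of \<open>B\<close> on the basis are constants.\<close>
  have main: "B (vf_bracket w x) y + B x (vf_bracket w y) = 0" if w: "w \<in> g" and x: "x \<in> g" and y: "y \<in> g" for w x y
  proof -
    let ?c = "\<lambda>j h. cs j (Ad h x)" and ?d = "\<lambda>j h. cs j (Ad h y)"
    let ?b = "\<lambda>j k. B (us k) (us j)"
    note c = Ad_coord_smooth[OF fr, OF bi, OF _ x] and dd = Ad_coord_smooth[OF fr, OF bi, OF _ y]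
    note D = VF_T[OF g_VF[OF w], of e]
    have "(\<lambda>h. \<Sum>k<n. \<Sum>j<n. ?d k h * (?c j h * ?b j k)) = (\<lambda>h. B x y)"
    proof
      fix h
      show "(\<Sum>k<n. \<Sum>j<n. ?d k h * (?c j h * ?b j k)) = B x y"
        unfolding ex[symmetric] d(5)[OF Ad_g[OF x]] d(5)[OF Ad_g[OF y]] by (rule Binv[OF x y])
    qed
    then have "0 = w e (\<lambda>h. \<Sum>k<n. \<Sum>j<n. ?d k h * (?c j h * ?b j k))"
      using tangent_const[OF D] by (simp only:)
    also have "\<dots> = (\<Sum>k<n. w e (\<lambda>h. \<Sum>j<n. ?d k h * (?c j h * ?b j k)))"
      by (rule tangent_sum[OF D], rule C_sum, rule C_mult[OF dd C_mult[OF c C_const]]) simp_all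
    also have "\<dots> = (\<Sum>k<n. \<Sum>j<n. w e (\<lambda>h. ?d k h * (?c j h * ?b j k)))"
      by (rule sum.cong[OF refl], rule tangent_sum[OF D], rule C_mult[OF dd C_mult[OF c C_const]]) simp_all
    also have "\<dots> = (\<Sum>k<n. \<Sum>j<n. w e (?d k) * (?c j e * ?b j k) + ?d k e * (w e (?c j) * ?b j k))"
    proof (rule sum.cong[OF refl], rule sum.cong[OF refl])
      fix k j assume "k \<in> {..<n}" "j \<in> {..<n}"
      then have k: "k < n" and j: "j < n" by simp_all
      have "w e (\<lambda>h. ?c j h * ?b j k) = w e (?c j) * ?b j k"
        using tangentD(3)[OF D c[OF j] C_const, of "?b j k"] tangent_const[OF D] by simp
      then show "w e (\<lambda>h. ?d k h * (?c j h * ?b j k)) = w e (?d k) * (?c j e * ?b j k) + ?d k e * (w e (?c j) * ?b j k)"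
        unfolding tangentD(3)[OF D dd[OF k] C_mult[OF c[OF j] C_const]] by simp
    qed
    also have "\<dots> = (\<Sum>k<n. \<Sum>j<n. w e (?d k) * (?c j e * ?b j k)) + (\<Sum>k<n. \<Sum>j<n. ?d k e * (w e (?c j) * ?b j k))"
      by (simp only: sum.distrib)
    also have "\<dots> = B x (- vf_bracket w y) + B (- vf_bracket w x) y"
      unfolding ex[symmetric] Ad_derivative[OF fr, OF bi, OF w x] Ad_derivative[OF fr, OF bi, OF w y] Ad_e d(5)[OF x] d(5)[OF y] by (rule refl)
    also have "B x (- vf_bracket w y) = - B x (vf_bracket w y)" by (rule linear_on_minus[OF Bl[OF x] g_bracket[OF w y]])
    also have "B (- vf_bracket w x) y = - B (vf_bracket w x) y"
      using linear_on_minus[OF Bl[OF y] g_bracket[OF w x]] Bs[OF y g_bracket[OF w x]]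
        Bs[OF y subspace_neg[OF d(1) g_bracket[OF w x]]] by simp
    finally show ?thesis by simp
  qed
  have "vf_bracket v u = - vf_bracket u v" unfolding fun_Compl_def[of "vf_bracket u v"] by (rule ext) (rule vf_bracket_skew)
  then have "B (vf_bracket v u) w = - B (vf_bracket u v) w"
    using linear_on_minus[OF Bl[OF w] g_bracket[OF u v]] Bs[OF w g_bracket[OF u v]] Bs[OF w g_bracket[OF v u]] by simp
  then show ?thesis using main[OF v u w] by simp
qed

end

theorem theorem2p5:
  fixes AG :: "('g::{t2_space,second_countable_topology}, 'd::real_inner) atlas"
    and AM :: "('m::{t2_space,second_countable_topology}, 'e::real_inner) atlas"
    and m :: "'g \<Rightarrow> 'g \<Rightarrow> 'g" and e :: 'g and i :: "'g \<Rightarrow> 'g"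
    and B :: "'g vfield \<Rightarrow> 'g vfield \<Rightarrow> real"
    and \<gg> :: "'g vfield set"
    and \<rho> :: "'g vfield \<Rightarrow> 'm vfield"
    and \<pi> :: "'m bivec"
  assumes "lie_group AG m e i"
    and "\<gg> = lie_algebra AG m"
    and "biinvariant_form AG m B"
    and "g_manifold AM \<gg> \<rho>"
    and "\<pi> \<in> bivector_fields AM"
  shows "(quasi_poisson AM \<gg> B \<rho> \<pi> \<longleftrightarrow> anchor_preserves_brackets AM \<gg> B \<rho> \<pi>) \<and>
    (anchor_preserves_brackets AM \<gg> B \<rho> \<pi> \<longleftrightarrow>
      jacobi_on (sections AM \<gg>) (section_bracket AM \<gg> B \<rho> \<pi>)) \<and>
    (jacobi_on (sections AM \<gg>) (section_bracket AM \<gg> B \<rho> \<pi>) \<longleftrightarrow>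
      lie_algebroid AM (fibre AM \<gg>) (sections AM \<gg>) (anchor AM \<rho> \<pi>) (section_bracket AM \<gg> B \<rho> \<pi>))"
proof -
  have G: "smooth_manifold AG" using assms(1) unfolding lie_group_def by (rule conjunct1)
  have M: "smooth_manifold AM" using assms(4) unfolding g_manifold_def by (rule conjunct1)
  obtain bG :: "'d set" where bG: "onb bG"
    using G onb_exists unfolding smooth_manifold_def by metis
  obtain bM :: "'e set" where bM: "onb bM"
    using M onb_exists unfolding smooth_manifold_def by metis
  interpret G: lie_group_manifold AG bG m e i
    by unfold_locales (rule G bG assms(1))+
  obtain n us cs where fr: "dual_frame \<gg> {..<n::nat} us cs"
    and bi: "\<And>i j. i < n \<Longrightarrow> j < n \<Longrightarrow> cs i (us j) = (if i = j then 1 else 0)"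
    using G.lie_algebra_frame unfolding assms(2) by blast
  note B = assms(3)[unfolded biinvariant_form_def, folded assms(2)]
  note gm = assms(4)[unfolded g_manifold_def]
  interpret bivector_g_manifold AM bM \<pi> \<gg> B n us cs \<rho>
  proof unfold_locales
    show "lie_bracket_on \<gg> vf_bracket" unfolding assms(2) by (rule G.lie_bracket_on_g)
    \<comment> \<open>Invariance under the translations of the group enters the argument here, in
      its infinitesimal form.\<close>
    show "B (vf_bracket u v) w = B u (vf_bracket v w)" if "u \<in> \<gg>" "v \<in> \<gg>" "w \<in> \<gg>" for u v w
      using G.biinvariant_ad_invariant[OF assms(3)] that unfolding assms(2) .
    show "linear_on \<gg> (B u)" if "u \<in> \<gg>" for u using B that by blast
    show "B u v = B v u" if "u \<in> \<gg>" "v \<in> \<gg>" for u v using B that by blast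
    show "u = 0" if "u \<in> \<gg>" "\<And>v. v \<in> \<gg> \<Longrightarrow> B u v = 0" for u using B that by blast
    show "linear_on \<gg> \<rho>" using gm by (elim conjE)
    show "\<rho> v \<in> vector_fields AM" if "v \<in> \<gg>" for v using gm that by blast
    show "\<rho> (vf_bracket u v) = vf_bracket (\<rho> u) (\<rho> v)" if "u \<in> \<gg>" "v \<in> \<gg>" for u v using gm that by blast
  qed (rule M bM assms(5) fr bi, assumption?)+
  show ?thesis
    by (intro conjI quasi_poisson_iff_anchor[OF assms(4)] anchor_iff_jacobi jacobi_iff_lie_algebroid)
qed

end
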